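(* Let $m\in\mathbb{N}$, let $f_1,\ldots,f_m,\sigma:[0,1]\to\mathbb{R}$ with $f_1',\ldots,f_m',\sigma'\in BV$, let $a:\mathbb{R}\to\mathbb{R}$ be integrable, and let $X_0:=F=F(I(f_1),\ldots,I(f_m))\in\mathrm{lin}(\mathcal{WA})$. Let $(X_t)_{t\in[0,1]}$ be the solution of the linear Skorohod SDE $$dX_t=a(t)X_t\,dt+\sigma(t)X_t\,dW_t,\quad t\in[0,1],$$ with initial value $X_0=F$. Then, with $\widehat{X_1}^n=\mathbb{E}[X_1\mid W_{1/n},W_{2/n},\ldots,W_1]$, $$\lim_{n\to\infty}n^2\,\mathbb{E}\big[(X_1-\widehat{X_1}^n)^2\big]=\frac{e^{2\int_0^1a(s)\,ds}}{12}\int_0^1\mathbb{E}\Big[\Big(\Big(\sum_{k=1}^mf_k'(s)F_{x_k}+\sigma'(s)F\Big)\diamond e^{\diamond I(\sigma)}\Big)^2\Big]\,ds .$$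
   Context: Setting: $(W_t)_{t\in[0,1]}$ is a Brownian motion on $(\Omega,\mathcal{F},P)$, where $\mathcal{F}$ is generated by $W$ and completed by null sets. $L^2=L^2([0,1];\mathbb{R})$ has norm $\|\cdot\|$ and inner product $\langle\cdot,\cdot\rangle$; $L^2(\Omega)=L^2(\Omega,\mathcal{F},P)$. For $f\in L^2$, $I(f)=\int_0^1 f(s)\,dW_s$ is the Wiener integral. "$f'\in BV$" means: $f\in L^2$ is differentiable on $[0,1]$ and $f':[0,1]\to\mathbb{R}$ is of bounded variation. Optimal approximation: for $X\in L^2(\Omega)$, $\widehat{X}^n:=\mathbb{E}[X\mid W_{1/n},W_{2/n},\ldots,W_1]$. Wick exponential: $e^{\diamond I(g)}:=\exp(I(g)-\|g\|^2/2)$, $g\in L^2$. A random variable $X\in L^2(\Omega)$ is determined by the values $\mathbb{E}[Xe^{\diamond I(g)}]$, $g\in L^2$. Wick product: $X\diamond Y$ is the element of $L^2(\Omega)$ (when it exists) with $\mathbb{E}[(X\diamond Y)e^{\diamond I(g)}]=\mathbb{E}[Xe^{\diamond I(g)}]\,\mathbb{E}[Ye^{\diamond I(g)}]$ for all $g\in L^2$. $X^{\diamond k}$ is the $k$-fold Wick power, $X^{\diamond 0}=1$. One has $I(f)^{\diamond k}=h^k_{\|f\|^2}(I(f))$ with $h^k_{\|f\|^2}$ the monic Hermite polynomial of degree $k$ with variance parameter $\|f\|^2$, and $e^{\diamond I(f)}=\sum_{k\ge0}\frac1{k!}I(f)^{\diamond k}$. Wick-analytic functionals: the class $\mathcal{WA}\subset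 L^2(\Omega)$ consists of all $F(I(f_1),\ldots,I(f_K))=\big(\sum_{k\ge0}a_{1,k}I(f_1)^{\diamond k}\big)\diamond\cdots\diamond\big(\sum_{k\ge0}a_{K,k}I(f_K)^{\diamond k}\big)$ with $K\in\mathbb{N}$, $f_1,\ldots,f_K\in L^2$, and real coefficients with $\sup\{\sqrt[k]{k!\,|a_{i,k}|}:i\le K,k\ge1\}<\infty$. $\mathrm{lin}(\mathcal{WA})$ is its linear span; $F(I(f_1),\ldots,I(f_m))\in\mathrm{lin}(\mathcal{WA})$ denotes a finite linear combination of such functionals of the same $I(f_1),\ldots,I(f_m)$. Derivatives: $F_{x_k}$ is the partial derivative $\frac{\partial}{\partial x_k}F$ with respect to the $k$-th argument, evaluated at $(I(f_1),\ldots,I(f_m))$. By the derivative rule for Hermite polynomials it is obtained by linearity and by replacing, in each Wick product defining $F$, the $k$-th factor $\sum_{l\ge0}a_{k,l}I(f_k)^{\diamond l}$ by $\sum_{l\ge0}(l+1)a_{k,l+1}I(f_k)^{\diamond l}$. It is again in $\mathrm{lin}(\mathcal{WA})$. Skorohod integral: for a (possibly nonadapted) square integrable process $u=(u_s)_{s\in[0,1]}$, $\int_0^1u_s\,dW_s=Y$ for $Y\in L^2(\Omega)$ if $\mathbb{E}[Ye^{\diamond I(g)}]=\int_0^1\mathbb{E}[u_se^{\diamond I(g)}]g(s)\,ds$ for all $g\in L^2$. Skorohod SDE: the equation $dX_t=a(t)X_t\,dt+\sigma(t)X_t\,dW_t$ with (possibly nonadapted) initial value $X_0$ means $X_t=X_0+\int_0^ta(s)X_s\,ds+\int_0^1\mathbf{1}_{[0,t]}(s)\sigma(s)X_s\,dW_s$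 with the stochastic integral in the Skorohod sense. Its unique solution in $L^2(\Omega\times[0,1])$ is $X_t=X_0\diamond\exp\big(\int_0^t\sigma(s)\,dW_s+\int_0^t(a(s)-\sigma^2(s)/2)\,ds\big)$, and $X_1$ denotes the value of this process at $t=1$. *)

theory Defs
  imports "HOL-Probability.Probability"
begin

abbreviation leb01 :: "real measure" where
  "leb01 \<equiv> lebesgue_on {0..1}"

definition square_integrable :: "'b measure \<Rightarrow> ('b \<Rightarrow> real) \<Rightarrow> bool" where
  "square_integrable M f \<longleftrightarrow> f \<in> borel_measurable M \<and> integrable M (\<lambda>x. (f x)\<^sup>2)"

definition L2_tendsto :: "'b measure \<Rightarrow> (nat \<Rightarrow> 'b \<Rightarrow> real) \<Rightarrow> ('b \<Rightarrow> real) \<Rightarrow> bool" where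
  "L2_tendsto M Y X \<longleftrightarrow>
     (\<forall>n. square_integrable M (Y n)) \<and> square_integrable M X \<and>
     (\<lambda>n. \<integral>x. (Y n x - X x)\<^sup>2 \<partial>M) \<longlonglongrightarrow> 0"

definition bounded_variation_on :: "real set \<Rightarrow> (real \<Rightarrow> real) \<Rightarrow> bool" where
  "bounded_variation_on S g \<longleftrightarrow>
     (\<exists>B. \<forall>n (t :: nat \<Rightarrow> real). mono_on {..n} t \<and> t ` {..n} \<subseteq> S \<longrightarrow>
        (\<Sum>i<n. \<bar>g (t (Suc i)) - g (t i)\<bar>) \<le> B)"

text \<open>At the end points of the unit interval the derivatives are one-sided.\<close>

definition has_BV_derivative :: "(real \<Rightarrow> real) \<Rightarrow> (real \<Rightarrow> real) \<Rightarrow> bool" where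
  "has_BV_derivative f f' \<longleftrightarrow>
     square_integrable leb01 f \<and>
     (\<forall>x\<in>{0..1}. (f has_real_derivative f' x) (at x within {0..1})) \<and>
     bounded_variation_on {0..1} f'"

definition generated_sigma :: "'w measure \<Rightarrow> (real \<Rightarrow> 'w \<Rightarrow> real) \<Rightarrow> real set \<Rightarrow> 'w measure" where
  "generated_sigma M W T =
     sigma (space M) {W t -` B \<inter> space M |t B. t \<in> T \<and> B \<in> sets borel}"

locale brownian_motion = prob_space M for M :: "'w measure" +
  fixes W :: "real \<Rightarrow> 'w \<Rightarrow> real"
  assumes measurable_W: "t \<in> {0..1} \<Longrightarrow> W t \<in> borel_measurable M"
    and start_zero: "AE \<omega> in M. W 0 \<omega> = 0"
    and continuous_paths: "AE \<omega> in M. continuous_on {0..1} (\<lambda>t. W t \<omega>)"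
    and normal_increments:
      "0 \<le> s \<Longrightarrow> s < t \<Longrightarrow> t \<le> 1 \<Longrightarrow>
        distributed M lborel (\<lambda>\<omega>. W t \<omega> - W s \<omega>) (normal_density 0 (sqrt (t - s)))"
    and indep_increments:
      "mono_on {..n} \<tau> \<Longrightarrow> \<tau> ` {..n} \<subseteq> {0..1} \<Longrightarrow>
        indep_vars (\<lambda>_. borel) (\<lambda>i \<omega>. W (\<tau> (Suc i)) \<omega> - W (\<tau> i) \<omega>) {..<n :: nat}"

text \<open>The sigma-algebra of the probability space is the one generated by the Brownian motion,
  completed by the null sets.\<close>

locale brownian_space = brownian_motion +
  assumes sets_generated:
    "sets M = sets (completion (restr_to_subalg M (generated_sigma M W {0..1})))"

text \<open>A list with entries \<open>(c, u, v)\<close> encodes the step function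
  \<open>\<Sum> c \<cdot> 1_(u,v]\<close> (the intervals may overlap).\<close>

type_synonym step = "(real \<times> real \<times> real) list"

definition step_on_unit :: "step \<Rightarrow> bool" where
  "step_on_unit p \<longleftrightarrow> (\<forall>(c, u, v)\<in>set p. 0 \<le> u \<and> u \<le> v \<and> v \<le> 1)"

definition step_fun :: "step \<Rightarrow> real \<Rightarrow> real" where
  "step_fun p s = (\<Sum>(c, u, v)\<leftarrow>p. c * indicator {u<..v} s)"

definition step_integral :: "(real \<Rightarrow> 'w \<Rightarrow> real) \<Rightarrow> step \<Rightarrow> 'w \<Rightarrow> real" where
  "step_integral W p \<omega> = (\<Sum>(c, u, v)\<leftarrow>p. c * (W v \<omega> - W u \<omega>))"

definition has_wiener_integral ::
    "'w measure \<Rightarrow> (real \<Rightarrow> 'w \<Rightarrow> real) \<Rightarrow> (real \<Rightarrow> real) \<Rightarrow> ('w \<Rightarrow> real) \<Rightarrow> bool" where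
  "has_wiener_integral M W f Y \<longleftrightarrow>
     (\<exists>p. (\<forall>n. step_on_unit (p n)) \<and>
          L2_tendsto leb01 (\<lambda>n. step_fun (p n)) f \<and>
          L2_tendsto M (\<lambda>n. step_integral W (p n)) Y)"

text \<open>This and the following random variables are determined only up to null sets;
  the choice operator fixes a version.\<close>

definition wiener_integral ::
    "'w measure \<Rightarrow> (real \<Rightarrow> 'w \<Rightarrow> real) \<Rightarrow> (real \<Rightarrow> real) \<Rightarrow> 'w \<Rightarrow> real" where
  "wiener_integral M W f = (SOME Y. has_wiener_integral M W f Y)"

definition wick_exp ::
    "'w measure \<Rightarrow> (real \<Rightarrow> 'w \<Rightarrow> real) \<Rightarrow> (real \<Rightarrow> real) \<Rightarrow> 'w \<Rightarrow> real" where
  "wick_exp M W g \<omega> = exp (wiener_integral M W g \<omega> - (\<integral>s. (g s)\<^sup>2 \<partial>leb01) / 2)"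

definition is_wick_product ::
    "'w measure \<Rightarrow> (real \<Rightarrow> 'w \<Rightarrow> real) \<Rightarrow> ('w \<Rightarrow> real) \<Rightarrow> ('w \<Rightarrow> real) \<Rightarrow> ('w \<Rightarrow> real) \<Rightarrow> bool" where
  "is_wick_product M W X Y Z \<longleftrightarrow>
     square_integrable M Z \<and>
     (\<forall>g. square_integrable leb01 g \<longrightarrow>
        (\<integral>\<omega>. Z \<omega> * wick_exp M W g \<omega> \<partial>M) =
        (\<integral>\<omega>. X \<omega> * wick_exp M W g \<omega> \<partial>M) * (\<integral>\<omega>. Y \<omega> * wick_exp M W g \<omega> \<partial>M))"

definition wick_product ::
    "'w measure \<Rightarrow> (real \<Rightarrow> 'w \<Rightarrow> real) \<Rightarrow> ('w \<Rightarrow> real) \<Rightarrow> ('w \<Rightarrow> real) \<Rightarrow> 'w \<Rightarrow> real" where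
  "wick_product M W X Y = (SOME Z. is_wick_product M W X Y Z)"

primrec wick_power ::
    "'w measure \<Rightarrow> (real \<Rightarrow> 'w \<Rightarrow> real) \<Rightarrow> ('w \<Rightarrow> real) \<Rightarrow> nat \<Rightarrow> 'w \<Rightarrow> real" where
  "wick_power M W X 0 = (\<lambda>_. 1)"
| "wick_power M W X (Suc k) = wick_product M W (wick_power M W X k) X"

primrec wick_prod_upto ::
    "'w measure \<Rightarrow> (real \<Rightarrow> 'w \<Rightarrow> real) \<Rightarrow> (nat \<Rightarrow> 'w \<Rightarrow> real) \<Rightarrow> nat \<Rightarrow> 'w \<Rightarrow> real" where
  "wick_prod_upto M W Y 0 = (\<lambda>_. 1)"
| "wick_prod_upto M W Y (Suc n) = wick_product M W (wick_prod_upto M W Y n) (Y (Suc n))"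

text \<open>The sum in \<open>L\<^sup>2\<close> of the series \<open>\<Sum>k. a k \<cdot> I(f)\<^sup>\<diamond>\<^sup>k\<close>; under the growth condition
  \<open>wick_analytic_coeffs\<close> below it converges for every square integrable \<open>f\<close>.\<close>

definition wick_series ::
    "'w measure \<Rightarrow> (real \<Rightarrow> 'w \<Rightarrow> real) \<Rightarrow> (nat \<Rightarrow> real) \<Rightarrow> (real \<Rightarrow> real) \<Rightarrow> 'w \<Rightarrow> real" where
  "wick_series M W a f =
     (SOME Y. L2_tendsto M
        (\<lambda>n \<omega>. \<Sum>k<n. a k * wick_power M W (wiener_integral M W f) k \<omega>) Y)"

text \<open>The entry \<open>a i k\<close> of a coefficient array belongs to the \<open>k\<close>-th Wick power of the \<open>i\<close>-th
  Wiener integral, where \<open>i\<close> ranges over \<open>1, \<dots>, m\<close>.\<close>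

definition wick_analytic_coeffs :: "nat \<Rightarrow> (nat \<Rightarrow> nat \<Rightarrow> real) \<Rightarrow> bool" where
  "wick_analytic_coeffs m a \<longleftrightarrow>
     bdd_above {root k (fact k * \<bar>a i k\<bar>) |i k. i \<in> {1..m} \<and> 1 \<le> k}"

definition wick_analytic ::
    "'w measure \<Rightarrow> (real \<Rightarrow> 'w \<Rightarrow> real) \<Rightarrow> nat \<Rightarrow> (nat \<Rightarrow> real \<Rightarrow> real) \<Rightarrow>
      (nat \<Rightarrow> nat \<Rightarrow> real) \<Rightarrow> 'w \<Rightarrow> real" where
  "wick_analytic M W m f a = wick_prod_upto M W (\<lambda>i. wick_series M W (a i) (f i)) m"

text \<open>A linear combination of Wick-analytic functionals is given by the list of its weights and
  coefficient arrays. The partial derivatives are operations on this formal expression \<open>F\<close> (they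
  are not determined by the random variable \<open>F(I(f\<^sub>1), \<dots>, I(f\<^sub>m))\<close> if the \<open>f\<^sub>i\<close> are linearly
  dependent).\<close>

type_synonym wick_functional = "(real \<times> (nat \<Rightarrow> nat \<Rightarrow> real)) list"

definition lin_WA :: "nat \<Rightarrow> wick_functional set" where
  "lin_WA m = {F. \<forall>(c, a)\<in>set F. wick_analytic_coeffs m a}"

definition wick_eval ::
    "'w measure \<Rightarrow> (real \<Rightarrow> 'w \<Rightarrow> real) \<Rightarrow> nat \<Rightarrow> (nat \<Rightarrow> real \<Rightarrow> real) \<Rightarrow>
      wick_functional \<Rightarrow> 'w \<Rightarrow> real" where
  "wick_eval M W m f F \<omega> = (\<Sum>(c, a)\<leftarrow>F. c * wick_analytic M W m f a \<omega>)"

definition wick_partial :: "nat \<Rightarrow> wick_functional \<Rightarrow> wick_functional" where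
  "wick_partial k F = map (\<lambda>(c, a). (c, a(k := (\<lambda>l. real (l + 1) * a k (l + 1))))) F"

definition square_integrable_process :: "'w measure \<Rightarrow> (real \<Rightarrow> 'w \<Rightarrow> real) \<Rightarrow> bool" where
  "square_integrable_process M u \<longleftrightarrow> square_integrable (M \<Otimes>\<^sub>M leb01) (\<lambda>(\<omega>, s). u s \<omega>)"

definition has_skorohod_integral ::
    "'w measure \<Rightarrow> (real \<Rightarrow> 'w \<Rightarrow> real) \<Rightarrow> (real \<Rightarrow> 'w \<Rightarrow> real) \<Rightarrow> ('w \<Rightarrow> real) \<Rightarrow> bool" where
  "has_skorohod_integral M W u Y \<longleftrightarrow>
     square_integrable_process M u \<and> square_integrable M Y \<and>
     (\<forall>g. square_integrable leb01 g \<longrightarrow>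
        (\<integral>\<omega>. Y \<omega> * wick_exp M W g \<omega> \<partial>M) =
        (\<integral>s. (\<integral>\<omega>. u s \<omega> * wick_exp M W g \<omega> \<partial>M) * g s \<partial>leb01))"

text \<open>The second and third conditions make the drift term \<open>\<integral>\<^sub>0\<^sup>t a(s) X\<^sub>s ds\<close> meaningful as an
  integral with values in \<open>L\<^sup>2(\<Omega>)\<close>, since \<open>a\<close> is only assumed to be integrable (for square
  integrable \<open>a\<close> the third one follows from the first).\<close>

definition solves_skorohod_sde ::
    "'w measure \<Rightarrow> (real \<Rightarrow> 'w \<Rightarrow> real) \<Rightarrow> (real \<Rightarrow> real) \<Rightarrow> (real \<Rightarrow> real) \<Rightarrow>
      ('w \<Rightarrow> real) \<Rightarrow> (real \<Rightarrow> 'w \<Rightarrow> real) \<Rightarrow> bool" where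
  "solves_skorohod_sde M W a \<sigma> X0 X \<longleftrightarrow>
     square_integrable_process M X \<and>
     (\<forall>t\<in>{0..1}. square_integrable M (X t)) \<and>
     integrable leb01 (\<lambda>s. a s * sqrt (\<integral>\<omega>. (X s \<omega>)\<^sup>2 \<partial>M)) \<and>
     (\<forall>t\<in>{0..1}. \<exists>Y. has_skorohod_integral M W (\<lambda>s \<omega>. indicator {0..t} s * \<sigma> s * X s \<omega>) Y \<and>
        (AE \<omega> in M. X t \<omega> = X0 \<omega> + (\<integral>s. a s * X s \<omega> \<partial>lebesgue_on {0..t}) + Y \<omega>))"

definition optimal_approx ::
    "'w measure \<Rightarrow> (real \<Rightarrow> 'w \<Rightarrow> real) \<Rightarrow> nat \<Rightarrow> ('w \<Rightarrow> real) \<Rightarrow> 'w \<Rightarrow> real" where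
  "optimal_approx M W n X =
     real_cond_exp M (generated_sigma M W ((\<lambda>i. real i / real n) ` {1..n})) X"

end

theory Submission
  imports Defs
begin

text \<open>The S-transform \<open>S X(g) = E[X \<cdot> exp\<^sup>\<diamond> I(g)]\<close> turns the Skorohod equation into a linear Volterra
  equation, so that \<open>S X\<^sub>1(g) = exp(\<integral> a) \<cdot> S F(g) \<cdot> exp \<langle>\<sigma>, g\<rangle>\<close>. For a Wick-analytic \<open>F\<close>, \<open>S F\<close> is a sum of
  products of entire functions of exponential type of the \<open>\<langle>f\<^sub>i, g\<rangle>\<close>, and by the Borel transform such a function
  is an integral of \<open>exp(z \<langle>f\<^sub>i, g\<rangle>)\<close> over a circle \<open>\<bar>z\<bar> = R\<close>. Since S-transforms determine random
  variables, \<open>X\<^sub>1\<close> is a mixture over a torus of complex Wick exponentials of \<open>\<sigma> + \<Sum>\<^sub>i z\<^sub>i f\<^sub>i\<close>.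
  Conditioning on the grid replaces \<open>\<sigma>\<close> and the \<open>f\<^sub>i\<close> by their averages over the grid cells. Hence the squared error
  is an integral over pairs of points of the torus of the difference between the exponentials of two Gram
  forms, and as \<open>n\<^sup>2 (\<langle>h, k\<rangle> - \<langle>h\<^sub>n, k\<^sub>n\<rangle>) \<longlonglongrightarrow> \<langle>h', k'\<rangle> / 12\<close> for the cell averages \<open>h\<^sub>n, k\<^sub>n\<close>, dominated
  convergence yields a bilinear expression in the derivatives. The right-hand side has the same expansion, because
  a partial derivative of \<open>F\<close> multiplies the density of the mixture by \<open>z\<^sub>i\<close>.\<close>

section \<open>Square integrable functions and step functions\<close>

text \<open>The random variables of the statement are choices among versions, and
  \<open>wick_product\<close> and \<open>wick_series\<close> say something only once a suitable
  element of L2 is known to exist. Mixtures supply these elements: \<open>mix_real_exists\<close>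
  realises every real S-transform that is given as an integral of exponentials. Complex parameters
  appear although all variables are real, because on a circle the powers of z are orthogonal: a
  bounded density can then be given any geometrically bounded sequence of moments. The growth
  condition on the coefficients is exactly what bounds the radius. For the same reason the Gram form
  is bilinear and not Hermitian. The volatility enters as coordinate 0 with constant parameter 1, so
  the factor \<open>exp \<langle>\<sigma>, g\<rangle>\<close> and the term
  \<open>\<sigma>' F\<close> are treated like the other coordinates. The constant 1/12 is the
  variance of the uniform law on an interval of length 1: passing to cell averages removes the
  covariance of h and k within each cell. Bounded variation makes the derivatives continuous, since
  a derivative has no jumps; uniform continuity then controls the cell estimates.\<close>

definition l2norm :: "'b measure \<Rightarrow> ('b \<Rightarrow> real) \<Rightarrow> real" where
  "l2norm M f = sqrt (\<integral>x. (f x)\<^sup>2 \<partial>M)"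

lemma l2norm_nonneg [simp]: "0 \<le> l2norm M f"
  by (simp add: l2norm_def)

lemma l2norm_power2: "(l2norm M f)\<^sup>2 = (\<integral>x. (f x)\<^sup>2 \<partial>M)"
  by (simp add: l2norm_def)

lemma square_integrable_measurable:
  "square_integrable M f \<Longrightarrow> f \<in> borel_measurable M"
  by (simp add: square_integrable_def)

lemma square_integrable_power2:
  "square_integrable M f \<Longrightarrow> integrable M (\<lambda>x. (f x)\<^sup>2)"
  by (simp add: square_integrable_def)

lemma square_integrable_mult:
  assumes "square_integrable M f" "square_integrable M g"
  shows "integrable M (\<lambda>x. f x * g x)"
proof (rule Bochner_Integration.integrable_bound)
  show "integrable M (\<lambda>x. (f x)\<^sup>2 + (g x)\<^sup>2)"
    using assms by (simp add: square_integrable_def)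
  show "(\<lambda>x. f x * g x) \<in> borel_measurable M"
    using assms by (intro borel_measurable_times square_integrable_measurable)
  show "AE x in M. norm (f x * g x) \<le> norm ((f x)\<^sup>2 + (g x)\<^sup>2)"
  proof (rule AE_I2)
    fix x
    have "0 \<le> (\<bar>f x\<bar> - \<bar>g x\<bar>)\<^sup>2" by simp
    then have "2 * (\<bar>f x\<bar> * \<bar>g x\<bar>) \<le> (f x)\<^sup>2 + (g x)\<^sup>2"
      by (simp add: power2_diff)
    moreover have "0 \<le> \<bar>f x\<bar> * \<bar>g x\<bar>" by simp
    ultimately have "\<bar>f x\<bar> * \<bar>g x\<bar> \<le> (f x)\<^sup>2 + (g x)\<^sup>2" by linarith
    then show "norm (f x * g x) \<le> norm ((f x)\<^sup>2 + (g x)\<^sup>2)"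
      by (simp add: abs_mult)
  qed
qed

lemma square_integrable_cmult:
  "square_integrable M f \<Longrightarrow> square_integrable M (\<lambda>x. c * f x)"
  unfolding square_integrable_def by (auto simp: power_mult_distrib)

lemma square_integrable_add:
  assumes "square_integrable M f" "square_integrable M g"
  shows "square_integrable M (\<lambda>x. f x + g x)"
proof -
  have "integrable M (\<lambda>x. (f x)\<^sup>2 + (g x)\<^sup>2 + 2 * (f x * g x))"
    using assms square_integrable_mult[OF assms] by (simp add: square_integrable_def)
  then have "integrable M (\<lambda>x. (f x + g x)\<^sup>2)"
    by (simp add: power2_sum algebra_simps)
  then show ?thesis using assms by (auto simp: square_integrable_def)
qed

lemma square_integrable_diff:
  assumes "square_integrable M f" "square_integrable M g"
  shows "square_integrable M (\<lambda>x. f x - g x)"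
  using square_integrable_add[OF assms(1) square_integrable_cmult[OF assms(2), of "-1"]] by simp

lemma square_integrable_zero: "square_integrable M (\<lambda>x. 0)"
  by (simp add: square_integrable_def)

lemma square_integrable_sum:
  "(\<And>i. i \<in> I \<Longrightarrow> square_integrable M (f i)) \<Longrightarrow> square_integrable M (\<lambda>x. \<Sum>i\<in>I. f i x)"
  by (induction I rule: infinite_finite_induct)
     (auto intro: square_integrable_zero square_integrable_add)

lemma square_integrable_AE_cong:
  assumes "square_integrable M f" "g \<in> borel_measurable M" "AE x in M. f x = g x"
  shows "square_integrable M g"
proof -
  have "integrable M (\<lambda>x. (f x)\<^sup>2) \<longleftrightarrow> integrable M (\<lambda>x. (g x)\<^sup>2)"
    using assms by (intro integrable_cong_AE) (auto simp: square_integrable_def)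
  then show ?thesis using assms by (simp add: square_integrable_def)
qed

lemma (in finite_measure) square_integrable_const: "square_integrable M (\<lambda>x. c)"
  by (simp add: square_integrable_def)

lemma (in finite_measure) square_integrable_bounded:
  assumes "f \<in> borel_measurable M" "\<And>x. x \<in> space M \<Longrightarrow> \<bar>f x\<bar> \<le> B"
  shows "square_integrable M f"
proof -
  have "integrable M (\<lambda>x. (f x)\<^sup>2)"
  proof (rule integrable_const_bound[of _ "B\<^sup>2"])
    show "AE x in M. norm ((f x)\<^sup>2) \<le> B\<^sup>2"
    proof (rule AE_I2)
      fix x assume "x \<in> space M"
      then have "\<bar>f x\<bar> \<le> \<bar>B\<bar>" using assms(2)[of x] by linarith
      then have "(f x)\<^sup>2 \<le> B\<^sup>2" by (simp add: abs_le_square_iff)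
      then show "norm ((f x)\<^sup>2) \<le> B\<^sup>2" by simp
    qed
  qed (use assms in simp)
  then show ?thesis using assms by (simp add: square_integrable_def)
qed

lemma (in finite_measure) square_integrable_integrable:
  "square_integrable M f \<Longrightarrow> integrable M f"
  using square_integrable_mult[OF _ square_integrable_const[of 1]] by simp

lemma l2norm_cmult: "l2norm M (\<lambda>x. c * f x) = \<bar>c\<bar> * l2norm M f"
  by (simp add: l2norm_def power_mult_distrib real_sqrt_mult)

lemma l2norm_eq_0_AE:
  assumes "square_integrable M f" "l2norm M f = 0"
  shows "AE x in M. f x = 0"
proof -
  have "(\<integral>x. (f x)\<^sup>2 \<partial>M) = 0" using assms(2) by (simp add: l2norm_def)
  then have "AE x in M. (f x)\<^sup>2 = 0"
    using assms(1) by (subst (asm) integral_nonneg_eq_0_iff_AE) (auto simp: square_integrable_def)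
  then show ?thesis by simp
qed

lemma l2_Cauchy_Schwarz:
  assumes f: "square_integrable M f" and g: "square_integrable M g"
  shows "\<bar>\<integral>x. f x * g x \<partial>M\<bar> \<le> l2norm M f * l2norm M g"
proof (cases "l2norm M g = 0")
  case True
  then have "AE x in M. g x = 0" using l2norm_eq_0_AE g by blast
  then have "AE x in M. f x * g x = 0" by auto
  then have "(\<integral>x. f x * g x \<partial>M) = 0" by (rule integral_eq_zero_AE)
  then show ?thesis by simp
next
  case False
  define G where "G = (\<integral>x. (g x)\<^sup>2 \<partial>M)"
  define P where "P = (\<integral>x. f x * g x \<partial>M)"
  \<comment> \<open>This \<open>t\<close> minimises the quadratic
    \<open>\<integral> (f - t g)\<^sup>2\<close>, whose nonnegativity is the claim.\<close>
  define t where "t = P / G"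
  have "0 \<le> G" "G \<noteq> 0" using False by (auto simp: G_def l2norm_def)
  then have Gpos: "G > 0" by simp
  have ig: "integrable M (\<lambda>x. (f x)\<^sup>2)" "integrable M (\<lambda>x. (g x)\<^sup>2)" "integrable M (\<lambda>x. f x * g x)"
    using f g square_integrable_mult[OF f g] by (auto simp: square_integrable_def)
  have "0 \<le> (\<integral>x. (f x - t * g x)\<^sup>2 \<partial>M)" by simp
  also have "(\<integral>x. (f x - t * g x)\<^sup>2 \<partial>M) = (\<integral>x. (f x)\<^sup>2 + t\<^sup>2 * (g x)\<^sup>2 - 2 * t * (f x * g x) \<partial>M)"
    by (intro Bochner_Integration.integral_cong) (auto simp: power2_eq_square algebra_simps)
  also have "\<dots> = (\<integral>x. (f x)\<^sup>2 \<partial>M) + t\<^sup>2 * G - 2 * t * P"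
    using ig by (simp add: G_def P_def)
  also have "\<dots> = (\<integral>x. (f x)\<^sup>2 \<partial>M) - P\<^sup>2 / G"
    using Gpos by (simp add: t_def power2_eq_square field_simps)
  finally have "P\<^sup>2 / G \<le> (\<integral>x. (f x)\<^sup>2 \<partial>M)"
    by linarith
  then have "P\<^sup>2 \<le> (l2norm M f)\<^sup>2 * (l2norm M g)\<^sup>2"
    using Gpos by (simp add: l2norm_power2 G_def[symmetric] pos_divide_le_eq)
  then have "P\<^sup>2 \<le> (l2norm M f * l2norm M g)\<^sup>2" by (simp add: power_mult_distrib)
  then have "\<bar>P\<bar> \<le> \<bar>l2norm M f * l2norm M g\<bar>" by (simp only: abs_le_square_iff)
  then show ?thesis by (simp add: P_def)
qed

lemma l2norm_triangle:
  assumes f: "square_integrable M f" and g: "square_integrable M g"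
  shows "l2norm M (\<lambda>x. f x + g x) \<le> l2norm M f + l2norm M g"
proof -
  have ig: "integrable M (\<lambda>x. (f x)\<^sup>2)" "integrable M (\<lambda>x. (g x)\<^sup>2)" "integrable M (\<lambda>x. f x * g x)"
    using f g square_integrable_mult[OF f g] by (auto simp: square_integrable_def)
  have "(\<integral>x. (f x + g x)\<^sup>2 \<partial>M) = (\<integral>x. (f x)\<^sup>2 + (g x)\<^sup>2 + 2 * (f x * g x) \<partial>M)"
    by (intro Bochner_Integration.integral_cong) (auto simp: power2_eq_square algebra_simps)
  also have "\<dots> = (l2norm M f)\<^sup>2 + (l2norm M g)\<^sup>2 + 2 * (\<integral>x. f x * g x \<partial>M)"
    using ig by (simp add: l2norm_power2)
  also have "\<dots> \<le> (l2norm M f)\<^sup>2 + (l2norm M g)\<^sup>2 + 2 * (l2norm M f * l2norm M g)"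
    using l2_Cauchy_Schwarz[OF f g] by linarith
  also have "\<dots> = (l2norm M f + l2norm M g)\<^sup>2" by (simp add: power2_sum)
  finally show ?thesis unfolding l2norm_def[of M "\<lambda>x. f x + g x"]
    by (intro real_le_lsqrt) auto
qed

lemma l2norm_triangle_diff:
  assumes "square_integrable M f" "square_integrable M g" "square_integrable M h"
  shows "l2norm M (\<lambda>x. f x - h x) \<le> l2norm M (\<lambda>x. f x - g x) + l2norm M (\<lambda>x. g x - h x)"
  using l2norm_triangle[OF square_integrable_diff[OF assms(1,2)] square_integrable_diff[OF assms(2,3)]]
  by simp

lemma l2norm_commute: "l2norm M (\<lambda>x. f x - g x) = l2norm M (\<lambda>x. g x - f x)"
  by (simp add: l2norm_def power2_commute)

lemma l2norm_cong_AE: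
  assumes "f \<in> borel_measurable M" "g \<in> borel_measurable M" "AE x in M. f x = g x"
  shows "l2norm M f = l2norm M g"
  unfolding l2norm_def using assms
  by (intro arg_cong[where f=sqrt] integral_cong_AE) auto

lemma L2_tendsto_iff:
  "L2_tendsto M Y X \<longleftrightarrow> (\<forall>n. square_integrable M (Y n)) \<and> square_integrable M X \<and>
     (\<lambda>n. l2norm M (\<lambda>x. Y n x - X x)) \<longlonglongrightarrow> 0"
proof -
  have "(\<lambda>n. l2norm M (\<lambda>x. Y n x - X x)) \<longlonglongrightarrow> 0 \<longleftrightarrow> (\<lambda>n. \<integral>x. (Y n x - X x)\<^sup>2 \<partial>M) \<longlonglongrightarrow> 0"
  proof
    assume "(\<lambda>n. l2norm M (\<lambda>x. Y n x - X x)) \<longlonglongrightarrow> 0"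
    from tendsto_power[OF this, of 2] show "(\<lambda>n. \<integral>x. (Y n x - X x)\<^sup>2 \<partial>M) \<longlonglongrightarrow> 0"
      by (simp add: l2norm_power2)
  next
    assume "(\<lambda>n. \<integral>x. (Y n x - X x)\<^sup>2 \<partial>M) \<longlonglongrightarrow> 0"
    from tendsto_real_sqrt[OF this] show "(\<lambda>n. l2norm M (\<lambda>x. Y n x - X x)) \<longlonglongrightarrow> 0"
      by (simp add: l2norm_def)
  qed
  then show ?thesis by (simp add: L2_tendsto_def)
qed

lemma L2_tendstoD:
  assumes "L2_tendsto M Y X"
  shows "square_integrable M (Y n)" "square_integrable M X"
    "(\<lambda>n. l2norm M (\<lambda>x. Y n x - X x)) \<longlonglongrightarrow> 0"
  using assms by (auto simp: L2_tendsto_iff)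

lemma L2_tendsto_const: "square_integrable M X \<Longrightarrow> L2_tendsto M (\<lambda>n. X) X"
  by (simp add: L2_tendsto_def)

lemma L2_tendsto_add:
  assumes "L2_tendsto M Y X" "L2_tendsto M Y' X'"
  shows "L2_tendsto M (\<lambda>n x. Y n x + Y' n x) (\<lambda>x. X x + X' x)"
proof -
  note D = L2_tendstoD[OF assms(1)] L2_tendstoD[OF assms(2)]
  have lim: "(\<lambda>n. l2norm M (\<lambda>x. Y n x - X x) + l2norm M (\<lambda>x. Y' n x - X' x)) \<longlonglongrightarrow> 0"
    using tendsto_add[OF D(3,6)] by simp
  have "(\<lambda>n. l2norm M (\<lambda>x. Y n x + Y' n x - (X x + X' x))) \<longlonglongrightarrow> 0"
  proof (rule tendsto_sandwich[OF _ _ tendsto_const lim])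
    show "\<forall>\<^sub>F n in sequentially. l2norm M (\<lambda>x. Y n x + Y' n x - (X x + X' x))
        \<le> l2norm M (\<lambda>x. Y n x - X x) + l2norm M (\<lambda>x. Y' n x - X' x)"
      using l2norm_triangle[OF square_integrable_diff[OF D(1,2)] square_integrable_diff[OF D(4,5)]]
      by (intro always_eventually allI) (simp add: algebra_simps)
  qed simp
  then show ?thesis using D by (auto simp: L2_tendsto_iff intro: square_integrable_add)
qed

lemma L2_tendsto_cmult:
  assumes "L2_tendsto M Y X"
  shows "L2_tendsto M (\<lambda>n x. c * Y n x) (\<lambda>x. c * X x)"
proof -
  note D = L2_tendstoD[OF assms(1)]
  have "(\<lambda>n. \<bar>c\<bar> * l2norm M (\<lambda>x. Y n x - X x)) \<longlonglongrightarrow> 0"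
    using tendsto_mult_left[OF D(3), of "\<bar>c\<bar>"] by simp
  then have "(\<lambda>n. l2norm M (\<lambda>x. c * Y n x - c * X x)) \<longlonglongrightarrow> 0"
    by (simp add: l2norm_cmult[symmetric] right_diff_distrib)
  then show ?thesis using D by (auto simp: L2_tendsto_iff intro: square_integrable_cmult)
qed

lemma L2_tendsto_unique:
  assumes "L2_tendsto M Y X" "L2_tendsto M Y X'"
  shows "AE x in M. X x = X' x"
proof -
  note D = L2_tendstoD[OF assms(1)] L2_tendstoD[OF assms(2)]
  have "l2norm M (\<lambda>x. X x - X' x) \<le> l2norm M (\<lambda>x. Y n x - X x) + l2norm M (\<lambda>x. Y n x - X' x)" for n
    using l2norm_triangle_diff[OF D(2,1,5)] by (simp add: l2norm_commute)
  moreover have "(\<lambda>n. l2norm M (\<lambda>x. Y n x - X x) + l2norm M (\<lambda>x. Y n x - X' x)) \<longlonglongrightarrow> 0"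
    using tendsto_add[OF D(3,6)] by simp
  ultimately have "l2norm M (\<lambda>x. X x - X' x) \<le> 0"
    by (intro LIMSEQ_le_const) auto
  then have "l2norm M (\<lambda>x. X x - X' x) = 0"
    using l2norm_nonneg[of M "\<lambda>x. X x - X' x"] by linarith
  from l2norm_eq_0_AE[OF square_integrable_diff[OF D(2,5)] this] show ?thesis by simp
qed

lemma L2_tendsto_AE_cong:
  assumes "L2_tendsto M Y X" "X' \<in> borel_measurable M" "AE x in M. X x = X' x"
  shows "L2_tendsto M Y X'"
proof -
  note D = L2_tendstoD[OF assms(1)]
  have sq: "square_integrable M X'" using square_integrable_AE_cong D(2) assms(2,3) by blast
  have "l2norm M (\<lambda>x. Y n x - X x) = l2norm M (\<lambda>x. Y n x - X' x)" for n
    using assms(2,3) D(1)[of n] D(2) by (intro l2norm_cong_AE) (auto simp: square_integrable_def)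
  then show ?thesis using D sq by (simp add: L2_tendsto_iff)
qed

lemma L2_tendsto_inner:
  assumes "L2_tendsto M Y X" "L2_tendsto M Y' X'"
  shows "(\<lambda>n. \<integral>x. Y n x * Y' n x \<partial>M) \<longlonglongrightarrow> (\<integral>x. X x * X' x \<partial>M)"
proof -
  note D = L2_tendstoD[OF assms(1)] L2_tendstoD[OF assms(2)]
  let ?d = "\<lambda>n. l2norm M (\<lambda>x. Y n x - X x)" and ?d' = "\<lambda>n. l2norm M (\<lambda>x. Y' n x - X' x)"
  have est: "norm ((\<integral>x. Y n x * Y' n x \<partial>M) - (\<integral>x. X x * X' x \<partial>M))
     \<le> ?d n * ?d' n + ?d n * l2norm M X' + l2norm M X * ?d' n" for n
  proof -
    have "(\<integral>x. Y n x * Y' n x \<partial>M) - (\<integral>x. X x * X' x \<partial>M)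
       = (\<integral>x. Y n x * Y' n x - X x * X' x \<partial>M)"
      using D by (intro Bochner_Integration.integral_diff[symmetric] square_integrable_mult)
    also have "\<dots> = (\<integral>x. ((Y n x - X x) * (Y' n x - X' x) + (Y n x - X x) * X' x)
        + X x * (Y' n x - X' x) \<partial>M)"
      by (intro Bochner_Integration.integral_cong) (auto simp: algebra_simps)
    also have "\<dots> = (\<integral>x. (Y n x - X x) * (Y' n x - X' x) \<partial>M) + (\<integral>x. (Y n x - X x) * X' x \<partial>M)
        + (\<integral>x. X x * (Y' n x - X' x) \<partial>M)"
    proof -
      have "integrable M (\<lambda>x. (Y n x - X x) * (Y' n x - X' x))" "integrable M (\<lambda>x. (Y n x - X x) * X' x)"
        "integrable M (\<lambda>x. X x * (Y' n x - X' x))"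
        using D by (auto intro!: square_integrable_mult square_integrable_diff)
      then show ?thesis by simp
    qed
    finally have eq: "(\<integral>x. Y n x * Y' n x \<partial>M) - (\<integral>x. X x * X' x \<partial>M) =
        (\<integral>x. (Y n x - X x) * (Y' n x - X' x) \<partial>M) + (\<integral>x. (Y n x - X x) * X' x \<partial>M)
        + (\<integral>x. X x * (Y' n x - X' x) \<partial>M)" .
    have "\<bar>\<integral>x. (Y n x - X x) * (Y' n x - X' x) \<partial>M\<bar> \<le> ?d n * ?d' n"
      "\<bar>\<integral>x. (Y n x - X x) * X' x \<partial>M\<bar> \<le> ?d n * l2norm M X'"
      "\<bar>\<integral>x. X x * (Y' n x - X' x) \<partial>M\<bar> \<le> l2norm M X * ?d' n"
      using D by (auto intro!: l2_Cauchy_Schwarz square_integrable_diff)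
    then show ?thesis unfolding eq by simp
  qed
  have "(\<lambda>n. ?d n * ?d' n + ?d n * l2norm M X' + l2norm M X * ?d' n) \<longlonglongrightarrow> 0 * 0 + 0 * l2norm M X' + l2norm M X * 0"
    using D(3,6) by (intro tendsto_intros)
  then have "(\<lambda>n. ?d n * ?d' n + ?d n * l2norm M X' + l2norm M X * ?d' n) \<longlonglongrightarrow> 0" by simp
  then have "(\<lambda>n. (\<integral>x. Y n x * Y' n x \<partial>M) - (\<integral>x. X x * X' x \<partial>M)) \<longlonglongrightarrow> 0"
    by (rule Lim_null_comparison[OF always_eventually[OF allI[OF est]]])
  then show ?thesis by (simp add: LIM_zero_iff)
qed

lemma l2norm_dominated_tendsto_0:
  assumes Y: "\<And>n. Y n \<in> borel_measurable M" and X: "square_integrable M X"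
    and G: "square_integrable M G"
    and lim: "AE x in M. (\<lambda>n. Y n x) \<longlonglongrightarrow> X x"
    and bd: "\<And>n. AE x in M. \<bar>Y n x\<bar> \<le> \<bar>G x\<bar>"
  shows "L2_tendsto M Y X"
proof -
  have sqY: "square_integrable M (Y n)" for n
  proof -
    have "integrable M (\<lambda>x. (Y n x)\<^sup>2)"
    proof (rule Bochner_Integration.integrable_bound[OF square_integrable_power2[OF G]])
      show "AE x in M. norm ((Y n x)\<^sup>2) \<le> norm ((G x)\<^sup>2)"
        using bd[of n] by eventually_elim (simp add: abs_le_square_iff)
    qed (use Y in simp)
    then show ?thesis using Y by (simp add: square_integrable_def)
  qed
  have "(\<lambda>n. \<integral>x. (Y n x - X x)\<^sup>2 \<partial>M) \<longlonglongrightarrow> (\<integral>x. 0 \<partial>M)"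
  proof (rule integral_dominated_convergence[where w="\<lambda>x. (\<bar>G x\<bar> + \<bar>X x\<bar>)\<^sup>2"])
    have abs: "square_integrable M (\<lambda>x. \<bar>G x\<bar>)" "square_integrable M (\<lambda>x. \<bar>X x\<bar>)"
      using G X by (auto simp: square_integrable_def)
    then show "integrable M (\<lambda>x. (\<bar>G x\<bar> + \<bar>X x\<bar>)\<^sup>2)"
      using square_integrable_add square_integrable_power2 by blast
    show "AE x in M. (\<lambda>n. (Y n x - X x)\<^sup>2) \<longlonglongrightarrow> 0"
      using lim
    proof eventually_elim
      case (elim x)
      have "(\<lambda>n. (Y n x - X x)\<^sup>2) \<longlonglongrightarrow> (X x - X x)\<^sup>2"
        by (intro tendsto_intros elim)
      then show ?case by simp
    qed
    show "AE x in M. norm ((Y n x - X x)\<^sup>2) \<le> (\<bar>G x\<bar> + \<bar>X x\<bar>)\<^sup>2" for n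
      using bd[of n]
    proof eventually_elim
      case (elim x)
      then have "\<bar>Y n x - X x\<bar> \<le> \<bar>\<bar>G x\<bar> + \<bar>X x\<bar>\<bar>" by linarith
      then show ?case by (simp only: abs_le_square_iff) simp
    qed
  qed (use Y X in \<open>auto simp: square_integrable_def\<close>)
  then show ?thesis using sqY X by (simp add: L2_tendsto_def)
qed

lemma (in finite_measure) integral_abs_le_l2norm:
  assumes "square_integrable M f"
  shows "(\<integral>x. \<bar>f x\<bar> \<partial>M) \<le> l2norm M f * sqrt (measure M (space M))"
proof -
  have "square_integrable M (\<lambda>x. \<bar>f x\<bar>)" using assms by (auto simp: square_integrable_def)
  from l2_Cauchy_Schwarz[OF this square_integrable_const[of 1]]
  show ?thesis by (simp add: l2norm_def)
qed

text \<open>On a finite measure space the L1 norms of the increments are controlled by their L2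
  norms, here by a geometric series; hence the increments are absolutely summable almost
  everywhere.\<close>

lemma (in finite_measure) L2_fast_Cauchy_AE_convergent:
  assumes sq: "\<And>n. square_integrable M (Y n)"
    and fast: "\<And>n. l2norm M (\<lambda>x. Y (Suc n) x - Y n x) \<le> (1/2)^n"
  shows "AE x in M. convergent (\<lambda>n. Y n x)"
proof -
  let ?d = "\<lambda>n x. \<bar>Y (Suc n) x - Y n x\<bar>"
  let ?c = "sqrt (measure M (space M))"
  have sqd: "square_integrable M (\<lambda>x. Y (Suc n) x - Y n x)" for n
    by (intro square_integrable_diff sq)
  have meas: "Y n \<in> borel_measurable M" for n using sq by (simp add: square_integrable_def)
  have intd: "integrable M (?d n)" for n
    using square_integrable_integrable[OF sqd] by (rule integrable_abs)
  have "(\<integral>\<^sup>+x. (\<Sum>n. ennreal (?d n x)) \<partial>M) = (\<Sum>n. \<integral>\<^sup>+x. ennreal (?d n x) \<partial>M)"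
    using meas by (intro nn_integral_suminf) auto
  also have "\<dots> \<le> (\<Sum>n. ennreal ((1/2)^n * ?c))"
  proof (intro suminf_le allI)
    fix n
    have "(\<integral>\<^sup>+x. ennreal (?d n x) \<partial>M) = ennreal (\<integral>x. ?d n x \<partial>M)"
      using intd by (intro nn_integral_eq_integral) auto
    also have "(\<integral>x. ?d n x \<partial>M) \<le> (1/2)^n * ?c"
      using integral_abs_le_l2norm[OF sqd[of n]] mult_right_mono[OF fast[of n], of ?c] by simp
    finally show "(\<integral>\<^sup>+x. ennreal (?d n x) \<partial>M) \<le> ennreal ((1/2)^n * ?c)"
      by (simp add: ennreal_leI)
  qed auto
  also have "\<dots> = ennreal (\<Sum>n. (1/2)^n * ?c)"
    by (intro suminf_ennreal2 summable_mult2 summable_geometric) auto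
  also have "\<dots> < \<infinity>" by simp
  finally have "(\<integral>\<^sup>+x. (\<Sum>n. ennreal (?d n x)) \<partial>M) \<noteq> \<infinity>" by simp
  then have "AE x in M. (\<Sum>n. ennreal (?d n x)) \<noteq> \<infinity>"
    using meas by (intro nn_integral_PInf_AE) auto
  then show ?thesis
  proof eventually_elim
    case (elim x)
    then have "summable (\<lambda>n. ?d n x)" by (intro summable_suminf_not_top) auto
    then have "summable (\<lambda>n. Y (Suc n) x - Y n x)" by (rule summable_rabs_cancel)
    then have "convergent (\<lambda>n. \<Sum>i<n. Y (Suc i) x - Y i x)"
      by (simp add: summable_iff_convergent)
    then have "convergent (\<lambda>n. Y n x - Y 0 x)"
      unfolding sum_lessThan_telescope[of "\<lambda>i. Y i x"] .
    from convergent_add[OF this convergent_const[of "Y 0 x"]] show ?case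
      unfolding diff_add_cancel .
  qed
qed

text \<open>Riesz-Fischer: a rapidly Cauchy subsequence converges almost everywhere, and Fatou's
  lemma makes its pointwise limit the L2 limit of the whole sequence.\<close>

lemma (in finite_measure) L2_complete:
  assumes sq: "\<And>n. square_integrable M (Y n)"
    and Cauchy: "\<And>e. e > 0 \<Longrightarrow> \<exists>N. \<forall>m\<ge>N. \<forall>n\<ge>N. l2norm M (\<lambda>x. Y m x - Y n x) < e"
  obtains X where "L2_tendsto M Y X"
proof -
  obtain N where N: "\<And>e m n. e > 0 \<Longrightarrow> m \<ge> N e \<Longrightarrow> n \<ge> N e \<Longrightarrow> l2norm M (\<lambda>x. Y m x - Y n x) < e"
    using Cauchy by metis
  \<comment> \<open>Summing the thresholds makes \<open>r\<close> monotone, while \<open>r k\<close>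
    is still at least the threshold for \<open>(1/2)^k\<close>.\<close>
  define r where "r k = (\<Sum>i\<le>k. N ((1/2)^i))" for k
  have rge: "r k \<ge> N ((1/2)^k)" for k unfolding r_def by (rule member_le_sum) auto
  have rmono: "r k \<le> r (Suc k)" for k by (simp add: r_def)
  have rmono': "k \<le> l \<Longrightarrow> r k \<le> r l" for k l using lift_Suc_mono_le[of r, OF rmono] .
  have AEc: "AE x in M. convergent (\<lambda>k. Y (r k) x)"
  proof (rule L2_fast_Cauchy_AE_convergent[OF sq])
    fix n show "l2norm M (\<lambda>x. Y (r (Suc n)) x - Y (r n) x) \<le> (1 / 2) ^ n"
      using N[of "(1/2)^n" "r (Suc n)" "r n"] rge[of n] rmono[of n] by force
  qed
  define X where "X x = lim (\<lambda>k. Y (r k) x)" for x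
  have measY: "Y n \<in> borel_measurable M" for n using sq by (simp add: square_integrable_def)
  have measX: "X \<in> borel_measurable M" unfolding X_def
    by (rule borel_measurable_lim_metric[OF measY])
  have AEl: "AE x in M. (\<lambda>k. Y (r k) x) \<longlonglongrightarrow> X x"
    using AEc by eventually_elim (simp add: X_def convergent_LIMSEQ_iff)
  have Fatou: "(\<integral>\<^sup>+x. ennreal ((Y n x - X x)\<^sup>2) \<partial>M) \<le> ennreal (((1/2)^k)\<^sup>2)" if "n \<ge> r k" for n k
  proof -
    have "(\<integral>\<^sup>+x. ennreal ((Y n x - X x)\<^sup>2) \<partial>M) = (\<integral>\<^sup>+x. liminf (\<lambda>l. ennreal ((Y n x - Y (r l) x)\<^sup>2)) \<partial>M)"
    proof (intro nn_integral_cong_AE)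
      show "AE x in M. ennreal ((Y n x - X x)\<^sup>2) = liminf (\<lambda>l. ennreal ((Y n x - Y (r l) x)\<^sup>2))"
        using AEl
      proof eventually_elim
        case (elim x)
        then have "(\<lambda>l. ennreal ((Y n x - Y (r l) x)\<^sup>2)) \<longlonglongrightarrow> ennreal ((Y n x - X x)\<^sup>2)"
          by (intro tendsto_ennrealI tendsto_intros)
        then show ?case by (intro lim_imp_Liminf[symmetric]) auto
      qed
    qed
    also have "\<dots> \<le> liminf (\<lambda>l. \<integral>\<^sup>+x. ennreal ((Y n x - Y (r l) x)\<^sup>2) \<partial>M)"
      using measY by (intro nn_integral_liminf) auto
    also have "\<dots> \<le> ennreal (((1/2)^k)\<^sup>2)"
    proof (rule Liminf_le)
      show "\<forall>\<^sub>F l in sequentially. (\<integral>\<^sup>+x. ennreal ((Y n x - Y (r l) x)\<^sup>2) \<partial>M) \<le> ennreal (((1/2)^k)\<^sup>2)"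
      proof (intro eventually_sequentiallyI[of k])
        fix l assume "l \<ge> k"
        have "(\<integral>\<^sup>+x. ennreal ((Y n x - Y (r l) x)\<^sup>2) \<partial>M) = ennreal ((l2norm M (\<lambda>x. Y n x - Y (r l) x))\<^sup>2)"
          unfolding l2norm_power2
          using square_integrable_power2[OF square_integrable_diff[OF sq sq]]
          by (intro nn_integral_eq_integral) auto
        also have "\<dots> \<le> ennreal (((1/2)^k)\<^sup>2)"
          using N[of "(1/2)^k" n "r l"] rge[of k] rmono'[OF \<open>l \<ge> k\<close>] that
          by (intro ennreal_leI power_mono) auto
        finally show "(\<integral>\<^sup>+x. ennreal ((Y n x - Y (r l) x)\<^sup>2) \<partial>M) \<le> ennreal (((1/2)^k)\<^sup>2)" .
      qed
    qed simp
    finally show ?thesis .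
  qed
  have sqd: "square_integrable M (\<lambda>x. Y n x - X x)" if "n \<ge> r k" for n k
    unfolding square_integrable_def using measY measX Fatou[OF that]
    by (auto intro!: integrableI_bounded simp: le_less_trans)
  have "square_integrable M (\<lambda>x. Y (r 0) x - (Y (r 0) x - X x))"
    by (intro square_integrable_diff sq sqd[of 0]) auto
  then have sqX: "square_integrable M X" by simp
  have small: "l2norm M (\<lambda>x. Y n x - X x) \<le> (1/2)^k" if "n \<ge> r k" for n k
  proof -
    have "ennreal (\<integral>x. (Y n x - X x)\<^sup>2 \<partial>M) \<le> ennreal (((1/2)^k)\<^sup>2)"
      using Fatou[OF that] square_integrable_power2[OF sqd[OF that]]
      by (subst nn_integral_eq_integral[symmetric]) auto
    then have "(\<integral>x. (Y n x - X x)\<^sup>2 \<partial>M) \<le> ((1/2)^k)\<^sup>2" by (simp add: ennreal_le_iff)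
    then show ?thesis unfolding l2norm_def by (intro real_le_lsqrt) auto
  qed
  have "(\<lambda>n. l2norm M (\<lambda>x. Y n x - X x)) \<longlonglongrightarrow> 0"
  proof (rule LIMSEQ_I)
    fix e :: real assume "e > 0"
    then obtain k where "(1/2)^k < e" using real_arch_pow_inv[of e "1/2"] by auto
    then show "\<exists>no. \<forall>n\<ge>no. norm (l2norm M (\<lambda>x. Y n x - X x) - 0) < e"
      using small[of k] by (intro exI[of _ "r k"]) force
  qed
  then have "L2_tendsto M Y X" using sq sqX by (simp add: L2_tendsto_iff)
  then show ?thesis by (rule that)
qed

section \<open>Density of step functions in L2 of the unit interval\<close>

interpretation leb01: prob_space leb01
proof
  show "emeasure leb01 (space leb01) = 1"
    by (simp add: emeasure_restrict_space)
qed

lemma step_fun_Nil [simp]: "step_fun [] s = 0"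
  and step_fun_Cons [simp]: "step_fun ((c, u, v) # p) s = c * indicator {u<..v} s + step_fun p s"
  and step_fun_append [simp]: "step_fun (p @ q) s = step_fun p s + step_fun q s"
  by (auto simp: step_fun_def)

lemma step_integral_Nil [simp]: "step_integral W [] \<omega> = 0"
  and step_integral_Cons [simp]:
    "step_integral W ((c, u, v) # p) \<omega> = c * (W v \<omega> - W u \<omega>) + step_integral W p \<omega>"
  and step_integral_append [simp]:
    "step_integral W (p @ q) \<omega> = step_integral W p \<omega> + step_integral W q \<omega>"
  by (auto simp: step_integral_def)

lemma step_on_unit_simps [simp]:
  "step_on_unit []"
  "step_on_unit ((c, u, v) # p) \<longleftrightarrow> 0 \<le> u \<and> u \<le> v \<and> v \<le> 1 \<and> step_on_unit p"
  "step_on_unit (p @ q) \<longleftrightarrow> step_on_unit p \<and> step_on_unit q"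
  by (simp_all add: step_on_unit_def ball_Un)

definition step_scale :: "real \<Rightarrow> step \<Rightarrow> step" where
  "step_scale a p = map (\<lambda>(c, u, v). (a * c, u, v)) p"

lemma step_scale_simps [simp]:
  "step_fun (step_scale a p) s = a * step_fun p s"
  "step_integral W (step_scale a p) \<omega> = a * step_integral W p \<omega>"
  "step_on_unit (step_scale a p) \<longleftrightarrow> step_on_unit p"
  unfolding step_scale_def
  by (induction p) (auto simp: algebra_simps step_on_unit_def)

lemma step_fun_eqs:
  "step_fun [] = (\<lambda>s. 0)"
  "step_fun (p @ q) = (\<lambda>s. step_fun p s + step_fun q s)"
  "step_fun (step_scale a p) = (\<lambda>s. a * step_fun p s)"
  by auto

lemma step_fun_measurable [measurable]: "step_fun p \<in> borel_measurable borel"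
proof (induction p)
  case (Cons x p)
  obtain c u v where x: "x = (c, u, v)" by (cases x)
  have "step_fun (x # p) = (\<lambda>s. c * indicator {u<..v} s + step_fun p s)" by (auto simp: x)
  moreover have "(\<lambda>s. c * indicator {u<..v} s + step_fun p s) \<in> borel_measurable borel"
    using Cons by (intro borel_measurable_add borel_measurable_times) auto
  ultimately show ?case by simp
qed (simp add: step_fun_eqs)

lemma step_fun_measurable_leb01: "step_fun p \<in> borel_measurable leb01"
  by (intro measurable_restrict_space1 measurable_completion) simp

lemma step_fun_bounded: "\<exists>B. \<forall>s. \<bar>step_fun p s\<bar> \<le> B"
proof (induction p)
  case (Cons x p)
  obtain c u v where x: "x = (c, u, v)" by (cases x)
  from Cons obtain B where "\<forall>s. \<bar>step_fun p s\<bar> \<le> B" by blast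
  then have "\<bar>step_fun (x # p) s\<bar> \<le> \<bar>c\<bar> + B" for s
    using abs_triangle_ineq[of "c * indicator {u<..v} s" "step_fun p s"]
    by (fastforce simp: x indicator_def intro: order_trans)
  then show ?case by blast
qed auto

lemma square_integrable_step_fun: "square_integrable leb01 (step_fun p)"
  using step_fun_bounded[of p] leb01.square_integrable_bounded[OF step_fun_measurable_leb01] by blast

text \<open>The sequential form is exactly what \<open>has_wiener_integral\<close> requires of an
  integrand.\<close>

definition step_approximable :: "(real \<Rightarrow> real) \<Rightarrow> bool" where
  "step_approximable f \<longleftrightarrow> (\<exists>p. (\<forall>n. step_on_unit (p n)) \<and> L2_tendsto leb01 (\<lambda>n. step_fun (p n)) f)"

text \<open>The epsilon form reduces closedness under L2 limits to one triangle inequality.\<close>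

lemma step_approximable_iff:
  assumes "square_integrable leb01 f"
  shows "step_approximable f \<longleftrightarrow>
    (\<forall>e>0. \<exists>p. step_on_unit p \<and> l2norm leb01 (\<lambda>s. step_fun p s - f s) < e)"
proof
  assume "step_approximable f"
  then obtain p where p: "\<And>n. step_on_unit (p n)" "L2_tendsto leb01 (\<lambda>n. step_fun (p n)) f"
    unfolding step_approximable_def by blast
  show "\<forall>e>0. \<exists>p. step_on_unit p \<and> l2norm leb01 (\<lambda>s. step_fun p s - f s) < e"
  proof (intro allI impI)
    fix e :: real assume "e > 0"
    from L2_tendstoD(3)[OF p(2)] obtain n where "l2norm leb01 (\<lambda>s. step_fun (p n) s - f s) < e"
      using order_tendstoD(2)[of _ 0 sequentially e] \<open>e > 0\<close> by (force simp: eventually_sequentially)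
    then show "\<exists>p. step_on_unit p \<and> l2norm leb01 (\<lambda>s. step_fun p s - f s) < e" using p(1) by blast
  qed
next
  assume H: "\<forall>e>0. \<exists>p. step_on_unit p \<and> l2norm leb01 (\<lambda>s. step_fun p s - f s) < e"
  then have "\<forall>n. \<exists>p. step_on_unit p \<and> l2norm leb01 (\<lambda>s. step_fun p s - f s) < inverse (real (Suc n))"
    by (metis inverse_positive_iff_positive of_nat_0_less_iff zero_less_Suc)
  then obtain p where p: "\<And>n. step_on_unit (p n)"
    "\<And>n. l2norm leb01 (\<lambda>s. step_fun (p n) s - f s) < inverse (real (Suc n))"
    by metis
  have "(\<lambda>n. l2norm leb01 (\<lambda>s. step_fun (p n) s - f s)) \<longlonglongrightarrow> 0"
    by (rule tendsto_sandwich[OF _ _ tendsto_const LIMSEQ_inverse_real_of_nat])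
       (use p(2) in \<open>auto intro!: always_eventually less_imp_le\<close>)
  then show "step_approximable f"
    unfolding step_approximable_def L2_tendsto_iff using p(1) assms square_integrable_step_fun by blast
qed

lemma step_approximable_closed:
  assumes "\<And>n. step_approximable (f n)" "L2_tendsto leb01 f g"
  shows "step_approximable g"
proof -
  note D = L2_tendstoD[OF assms(2)]
  show ?thesis
    unfolding step_approximable_iff[OF D(2)]
  proof (intro allI impI)
    fix e :: real assume "e > 0"
    then obtain n where n: "l2norm leb01 (\<lambda>s. f n s - g s) < e / 2"
      using order_tendstoD(2)[OF D(3), of "e/2"] by (force simp: eventually_sequentially)
    obtain p where p: "step_on_unit p" "l2norm leb01 (\<lambda>s. step_fun p s - f n s) < e / 2"
      using assms(1)[of n] step_approximable_iff[OF D(1)] \<open>e > 0\<close> half_gt_zero by blast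
    have "l2norm leb01 (\<lambda>s. step_fun p s - g s) < e"
      using l2norm_triangle_diff[OF square_integrable_step_fun D(1,2), of p n] n p(2) by linarith
    then show "\<exists>p. step_on_unit p \<and> l2norm leb01 (\<lambda>s. step_fun p s - g s) < e" using p(1) by blast
  qed
qed

lemma step_approximable_add:
  assumes "step_approximable f" "step_approximable g"
  shows "step_approximable (\<lambda>x. f x + g x)"
proof -
  obtain p q where "\<forall>n. step_on_unit (p n)" "L2_tendsto leb01 (\<lambda>n. step_fun (p n)) f"
    "\<forall>n. step_on_unit (q n)" "L2_tendsto leb01 (\<lambda>n. step_fun (q n)) g"
    using assms unfolding step_approximable_def by blast
  then show ?thesis unfolding step_approximable_def
    using L2_tendsto_add[of leb01 "\<lambda>n. step_fun (p n)" f "\<lambda>n. step_fun (q n)" g]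
    by (intro exI[of _ "\<lambda>n. p n @ q n"]) (simp add: step_fun_eqs)
qed

lemma step_approximable_cmult:
  assumes "step_approximable f"
  shows "step_approximable (\<lambda>x. c * f x)"
proof -
  obtain p where "\<forall>n. step_on_unit (p n)" "L2_tendsto leb01 (\<lambda>n. step_fun (p n)) f"
    using assms unfolding step_approximable_def by blast
  then show ?thesis unfolding step_approximable_def
    using L2_tendsto_cmult[of leb01 "\<lambda>n. step_fun (p n)" f c]
    by (intro exI[of _ "\<lambda>n. step_scale c (p n)"]) (simp add: step_fun_eqs)
qed

lemma step_approximable_step_fun: "step_on_unit p \<Longrightarrow> step_approximable (step_fun p)"
  unfolding step_approximable_def
  by (intro exI[of _ "\<lambda>_. p"]) (simp add: L2_tendsto_const square_integrable_step_fun)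

lemma step_approximable_AE_cong:
  "step_approximable f \<Longrightarrow> g \<in> borel_measurable leb01 \<Longrightarrow> AE x in leb01. f x = g x \<Longrightarrow> step_approximable g"
  unfolding step_approximable_def using L2_tendsto_AE_cong by blast

lemma step_approximable_sum:
  "(\<And>i. i \<in> I \<Longrightarrow> step_approximable (f i)) \<Longrightarrow> step_approximable (\<lambda>x. \<Sum>i\<in>I. f i x)"
proof (induction I rule: infinite_finite_induct)
  case empty
  then show ?case using step_approximable_step_fun[of "[]"] by (simp add: step_fun_eqs)
next
  case (infinite A)
  then show ?case using step_approximable_step_fun[of "[]"] by (simp add: step_fun_eqs)
qed (auto intro: step_approximable_add)

lemma AE_leb01_neq: "AE s in leb01. s \<noteq> c"
proof -
  have "AE s in lebesgue. s \<noteq> c"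
    by (intro AE_I'[of "{c}"]) (auto simp: null_sets_completionI)
  then show ?thesis by (intro AE_restrict_space_iff[THEN iffD2]) auto
qed

text \<open>Dynkin argument over the half-lines \<open>{..a}\<close>: complements and disjoint
  unions are linear combinations and dominated L2 limits of indicators.\<close>

lemma borel_set_step_approximable:
  assumes "S \<in> sets (borel :: real measure)"
  shows "step_approximable (indicator S)"
proof -
  have mind: "(indicator A :: real \<Rightarrow> real) \<in> borel_measurable leb01" if "A \<in> sets borel" for A
    using that by (intro measurable_restrict_space1 borel_measurable_indicator) (auto intro: sets_completionI_sets)
  have sqind: "square_integrable leb01 (indicator A :: real \<Rightarrow> real)" if "A \<in> sets borel" for A
    by (rule leb01.square_integrable_bounded[OF mind[OF that], of 1]) (auto simp: indicator_def)
  have one: "step_approximable (\<lambda>s. 1)"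
  proof (rule step_approximable_AE_cong[of "step_fun [(1, 0, 1)]"])
    show "step_approximable (step_fun [(1, 0, 1)])" by (rule step_approximable_step_fun) simp
    show "AE s in leb01. step_fun [(1, 0, 1)] s = 1"
      using AE_leb01_neq[of 0] AE_space by eventually_elim (auto simp: indicator_def)
  qed simp
  have S: "S \<in> sigma_sets UNIV (range (\<lambda>a::real. {..a}))"
    using assms by (subst (asm) borel_eq_atMost) (simp add: sets_measure_of)
  have "Int_stable (range (\<lambda>a::real. {..a}))"
    by (auto simp: Int_stable_def)
  moreover have "range (\<lambda>a::real. {..a}) \<subseteq> Pow UNIV" by simp
  ultimately show ?thesis using S
  proof (induction rule: sigma_sets_induct_disjoint)
    case (basic A)
    then obtain a where A: "A = {..a}" by auto
    \<comment> \<open>The end point is clipped to the unit interval, as \<open>step_on_unit\<close>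
      demands; the half-open step then misses at most the null set \<open>{0}\<close>.\<close>
    define b where "b = max 0 (min a 1)"
    show ?case
    proof (rule step_approximable_AE_cong[of "step_fun [(1, 0, b)]"])
      show "step_approximable (step_fun [(1, 0, b)])"
        by (rule step_approximable_step_fun) (simp add: b_def)
      show "AE s in leb01. step_fun [(1, 0, b)] s = indicator A s"
        using AE_leb01_neq[of 0] AE_leb01_neq[of b] AE_space
        by eventually_elim (auto simp: indicator_def A b_def max_def min_def split: if_splits)
    qed (simp add: mind A)
  next
    case empty
    then show ?case using step_approximable_step_fun[of "[]"] by (simp add: step_fun_eqs indicator_def)
  next
    case (compl A)
    have "step_approximable (\<lambda>s. 1 + (-1) * indicator A s)"
      by (intro step_approximable_add step_approximable_cmult one compl)
    moreover have "(\<lambda>s. 1 + (-1) * indicator A s :: real) = indicator (UNIV - A)"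
      by (auto simp: indicator_def)
    ultimately show ?case by simp
  next
    case (union A)
    have bor: "A i \<in> sets borel" for i
      using union(2) by (subst borel_eq_atMost) (auto simp: sets_measure_of)
    show ?case
    proof (rule step_approximable_closed[of "\<lambda>n s. \<Sum>i<n. indicator (A i) s"])
      show "step_approximable (\<lambda>s. \<Sum>i<n. indicator (A i) s)" for n
        by (intro step_approximable_sum union)
      have eq: "(\<Sum>i<n. indicator (A i) s :: real) = indicator (\<Union>i<n. A i) s" for n s
        using union(1) by (intro indicator_UN_disjoint[symmetric, of "{..<n}" A s])
          (auto simp: disjoint_family_on_def)
      show "L2_tendsto leb01 (\<lambda>n s. \<Sum>i<n. indicator (A i) s) (indicator (\<Union> (range A)))"
        unfolding eq
      proof (rule l2norm_dominated_tendsto_0[where G="\<lambda>_. 1"])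
        show "AE s in leb01. (\<lambda>n. indicator (\<Union>i<n. A i) s :: real) \<longlonglongrightarrow> indicator (\<Union> (range A)) s"
          using LIMSEQ_indicator_UN[of A] by (intro always_eventually allI) simp
        show "(indicator (\<Union>i<n. A i) :: real \<Rightarrow> real) \<in> borel_measurable leb01" for n
          by (intro mind sets.finite_UN bor) auto
        show "square_integrable leb01 (indicator (\<Union> (range A)) :: real \<Rightarrow> real)"
          by (intro sqind sets.countable_UN) (auto intro: bor)
      qed (auto intro!: leb01.square_integrable_const simp: indicator_def)
    qed
  qed
qed

text \<open>A Lebesgue set is a Borel set up to a null set, which settles indicators; simple
  functions dominated by \<open>2 * f\<close> then approximate \<open>f\<close>.\<close>

lemma step_approximable_leb01:
  assumes f: "square_integrable leb01 f"
  shows "step_approximable f"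
proof -
  have mind: "(indicator A :: real \<Rightarrow> real) \<in> borel_measurable leb01" if "A \<in> sets leb01" for A
    using that by (rule borel_measurable_indicator)
  have ind: "step_approximable (indicator A)" if A: "A \<in> sets leb01" for A
  proof -
    have "A \<in> sets lebesgue" using A by (auto simp: sets_restrict_space)
    then obtain S N N' where SN: "S \<union> N = A" "N \<subseteq> N'" "N' \<in> null_sets lborel" "S \<in> sets lborel"
      by (auto elim!: sets_completionE)
    show ?thesis
    proof (rule step_approximable_AE_cong[OF borel_set_step_approximable])
      show "S \<in> sets borel" using SN by simp
      have "AE s in lebesgue. s \<notin> N'" using SN(3) by (intro AE_not_in null_sets_completionI)
      then have "AE s in leb01. s \<notin> N'" by (intro AE_restrict_space_iff[THEN iffD2]) auto
      then show "AE s in leb01. indicator S s = (indicator A s :: real)"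
        by eventually_elim (use SN in \<open>auto simp: indicator_def\<close>)
    qed (rule mind[OF A])
  qed
  obtain F where F: "\<And>i. simple_function leb01 (F i)"
    "\<And>x. x \<in> space leb01 \<Longrightarrow> (\<lambda>i. F i x) \<longlonglongrightarrow> f x"
    "\<And>i x. x \<in> space leb01 \<Longrightarrow> dist (F i x) 0 \<le> 2 * dist (f x) 0"
    using borel_measurable_implies_sequence_metric[OF square_integrable_measurable[OF f], of 0] by metis
  show ?thesis
  proof (rule step_approximable_closed)
    show "L2_tendsto leb01 F f"
    proof (rule l2norm_dominated_tendsto_0[where G="\<lambda>x. 2 * f x"])
      show "F n \<in> borel_measurable leb01" for n using F(1) borel_measurable_simple_function by blast
      show "AE x in leb01. (\<lambda>n. F n x) \<longlonglongrightarrow> f x" using F(2) by (intro AE_I2)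
      show "AE x in leb01. \<bar>F n x\<bar> \<le> \<bar>2 * f x\<bar>" for n
      proof (rule AE_I2)
        fix x assume "x \<in> space leb01"
        from F(3)[OF this, of n] show "\<bar>F n x\<bar> \<le> \<bar>2 * f x\<bar>" by (simp add: dist_real_def abs_mult)
      qed
    qed (intro f square_integrable_cmult)+
    fix n
    have mF: "F n \<in> borel_measurable leb01" using F(1) borel_measurable_simple_function by blast
    define h where "h = (\<lambda>s. \<Sum>y\<in>F n ` space leb01. y * indicator (F n -` {y} \<inter> space leb01) s)"
    have "step_approximable h" unfolding h_def
    proof (intro step_approximable_sum step_approximable_cmult ind)
      fix y show "F n -` {y} \<inter> space leb01 \<in> sets leb01"
        by (rule simple_functionD(2)[OF F(1)])
    qed
    moreover have "h x = F n x" if "x \<in> space leb01" for x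
      using simple_function_indicator_representation_banach[OF F(1) that, of n]
      unfolding h_def by (simp only: real_scaleR_def mult.commute)
    ultimately show "step_approximable (F n)"
      by (rule step_approximable_AE_cong[OF _ mF AE_I2])
  qed
qed

section \<open>The Wiener integral\<close>

text \<open>A grid cell lies in an interval with grid end points as soon as its right end does, so
  testing the right end selects precisely the cells between \<open>a\<close> and
  \<open>b\<close>.\<close>

lemma telescope_indicator:
  fixes \<phi> :: "real \<Rightarrow> real"
  assumes \<tau>: "strict_mono_on {..n} \<tau>" and ab: "a \<le> b" "b \<le> n"
  shows "(\<Sum>i<n. indicator {\<tau> a<..\<tau> b} (\<tau> (Suc i)) * (\<phi> (\<tau> (Suc i)) - \<phi> (\<tau> i))) = \<phi> (\<tau> b) - \<phi> (\<tau> a)"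
proof -
  have lt: "\<tau> i < \<tau> j \<longleftrightarrow> i < j" if "i \<le> n" "j \<le> n" for i j
    using \<tau> that by (intro strict_mono_on_less) auto
  have "(\<Sum>i<n. indicator {\<tau> a<..\<tau> b} (\<tau> (Suc i)) * (\<phi> (\<tau> (Suc i)) - \<phi> (\<tau> i)))
      = (\<Sum>i\<in>{a..<b}. \<phi> (\<tau> (Suc i)) - \<phi> (\<tau> i))"
  proof (rule sum.mono_neutral_cong_right)
    show "\<forall>i\<in>{..<n} - {a..<b}. indicator {\<tau> a<..\<tau> b} (\<tau> (Suc i)) * (\<phi> (\<tau> (Suc i)) - \<phi> (\<tau> i)) = 0"
    proof
      fix i assume i: "i \<in> {..<n} - {a..<b}"
      then have "\<not> (a < Suc i \<and> \<not> b < Suc i)" by auto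
      moreover have "\<tau> a < \<tau> (Suc i) \<longleftrightarrow> a < Suc i" "\<tau> b < \<tau> (Suc i) \<longleftrightarrow> b < Suc i"
        using i ab by (auto intro!: lt)
      ultimately show "indicator {\<tau> a<..\<tau> b} (\<tau> (Suc i)) * (\<phi> (\<tau> (Suc i)) - \<phi> (\<tau> i)) = 0"
        by (auto simp: indicator_def)
    qed
    fix i assume i: "i \<in> {a..<b}"
    have "\<tau> a < \<tau> (Suc i) \<longleftrightarrow> a < Suc i" "\<tau> b < \<tau> (Suc i) \<longleftrightarrow> b < Suc i"
      using i ab by (intro lt; simp)+
    then show "indicator {\<tau> a<..\<tau> b} (\<tau> (Suc i)) * (\<phi> (\<tau> (Suc i)) - \<phi> (\<tau> i)) = \<phi> (\<tau> (Suc i)) - \<phi> (\<tau> i)"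
      using i by (auto simp: indicator_def)
  qed (use ab in auto)
  also have "\<dots> = \<phi> (\<tau> b) - \<phi> (\<tau> a)"
    using ab by (intro sum_Suc_diff') auto
  finally show ?thesis .
qed

definition step_times :: "step \<Rightarrow> real set" where
  "step_times p = (\<Union>(c, u, v)\<in>set p. {u, v})"

lemma step_times_simps [simp]:
  "step_times [] = {}" "step_times ((c, u, v) # p) = {u, v} \<union> step_times p"
  by (auto simp: step_times_def)

lemma finite_step_times [simp]: "finite (step_times p)"
  by (auto simp: step_times_def)

lemma step_times_subset: "step_on_unit p \<Longrightarrow> step_times p \<subseteq> {0..1}"
  by (fastforce simp: step_times_def step_on_unit_def)

text \<open>Kept general in \<open>\<phi>\<close>: a Brownian path as \<open>\<phi>\<close> rewrites
  the step integral over disjoint increments, and an indicator of a half-line rewrites the step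
  function itself.\<close>

lemma step_increments:
  fixes \<phi> :: "real \<Rightarrow> real"
  assumes \<tau>: "strict_mono_on {..n} \<tau>" and p: "step_on_unit p" "step_times p \<subseteq> \<tau> ` {..n}"
  shows "(\<Sum>(c, u, v)\<leftarrow>p. c * (\<phi> v - \<phi> u))
    = (\<Sum>i<n. step_fun p (\<tau> (Suc i)) * (\<phi> (\<tau> (Suc i)) - \<phi> (\<tau> i)))"
  using p
proof (induction p)
  case (Cons x p)
  obtain c u v where x: "x = (c, u, v)" by (cases x)
  from Cons.prems x have uv: "u \<le> v" "u \<in> \<tau> ` {..n}" "v \<in> \<tau> ` {..n}" by auto
  then obtain a b where ab: "u = \<tau> a" "v = \<tau> b" "a \<le> n" "b \<le> n" by auto
  have "\<tau> b < \<tau> a \<longleftrightarrow> b < a" using \<tau> ab by (intro strict_mono_on_less) auto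
  then have "a \<le> b" using uv ab by auto
  from telescope_indicator[OF \<tau> this ab(4), of \<phi>] Cons x ab show ?case
    by (simp add: distrib_right sum.distrib mult.assoc sum_distrib_left[symmetric])
qed simp

lemma step_fun_on_grid:
  assumes \<tau>: "strict_mono_on {..n} \<tau>" and p: "step_on_unit p" "step_times p \<subseteq> \<tau> ` {..n}"
  shows "step_fun p s = (\<Sum>i<n. step_fun p (\<tau> (Suc i)) * indicator {\<tau> i<..\<tau> (Suc i)} s)"
proof -
  \<comment> \<open>As a function of time this jumps at \<open>s\<close>, so its increment over
    \<open>{u<..v}\<close> is the indicator of that interval at \<open>s\<close>.\<close>
  let ?\<phi> = "\<lambda>t. indicator {s..} t :: real"
  have ind: "indicator {u<..v} s = ?\<phi> v - ?\<phi> u" if "u \<le> v" for u v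
    using that by (auto simp: indicator_def)
  have "step_fun p s = (\<Sum>(c, u, v)\<leftarrow>p. c * (?\<phi> v - ?\<phi> u))"
    using p(1) unfolding step_fun_def step_on_unit_def
    by (intro arg_cong[where f=sum_list] map_cong refl) (auto simp: ind)
  also have "\<dots> = (\<Sum>i<n. step_fun p (\<tau> (Suc i)) * (?\<phi> (\<tau> (Suc i)) - ?\<phi> (\<tau> i)))"
    by (rule step_increments[OF \<tau> p])
  also have "\<dots> = (\<Sum>i<n. step_fun p (\<tau> (Suc i)) * indicator {\<tau> i<..\<tau> (Suc i)} s)"
  proof (intro sum.cong refl)
    fix i assume "i \<in> {..<n}"
    then have "\<tau> i \<le> \<tau> (Suc i)" using \<tau> by (auto simp: strict_mono_on_def intro!: less_imp_le)
    then show "step_fun p (\<tau> (Suc i)) * (?\<phi> (\<tau> (Suc i)) - ?\<phi> (\<tau> i)) =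
      step_fun p (\<tau> (Suc i)) * indicator {\<tau> i<..\<tau> (Suc i)} s" by (simp only: ind)
  qed
  finally show ?thesis .
qed

lemma step_fun_mult_on_grid:
  assumes \<tau>: "strict_mono_on {..n} \<tau>" and p: "step_on_unit p" "step_times p \<subseteq> \<tau> ` {..n}"
    and q: "step_on_unit q" "step_times q \<subseteq> \<tau> ` {..n}"
  shows "step_fun p s * step_fun q s =
    (\<Sum>i<n. step_fun p (\<tau> (Suc i)) * step_fun q (\<tau> (Suc i)) * indicator {\<tau> i<..\<tau> (Suc i)} s)"
proof -
  have le: "\<tau> i \<le> \<tau> j" if "i \<le> j" "i \<le> n" "j \<le> n" for i j
    using that by (intro strict_mono_on_leD[OF \<tau>]) auto
  have disj: "indicator {\<tau> i<..\<tau> (Suc i)} s * indicator {\<tau> j<..\<tau> (Suc j)} s =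
     (if i = j then indicator {\<tau> i<..\<tau> (Suc i)} s else 0 :: real)" if "i < n" "j < n" for i j
  proof (cases i j rule: linorder_cases)
    case less
    then have "\<tau> (Suc i) \<le> \<tau> j" using le that by simp
    then show ?thesis using less by (auto simp: indicator_def)
  next
    case greater
    then have "\<tau> (Suc j) \<le> \<tau> i" using le that by simp
    then show ?thesis using greater by (auto simp: indicator_def)
  qed (auto simp: indicator_def)
  have "step_fun p s * step_fun q s = (\<Sum>i<n. \<Sum>j<n. (step_fun p (\<tau> (Suc i)) * step_fun q (\<tau> (Suc j)))
     * (indicator {\<tau> i<..\<tau> (Suc i)} s * indicator {\<tau> j<..\<tau> (Suc j)} s))"
    by (subst step_fun_on_grid[OF \<tau> p], subst step_fun_on_grid[OF \<tau> q]) (simp only: sum_product mult_ac)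
  also have "\<dots> = (\<Sum>i<n. \<Sum>j<n. if i = j then (step_fun p (\<tau> (Suc i)) * step_fun q (\<tau> (Suc j)))
     * indicator {\<tau> i<..\<tau> (Suc i)} s else 0)"
    by (intro sum.cong refl) (auto simp: disj)
  also have "\<dots> = (\<Sum>i<n. step_fun p (\<tau> (Suc i)) * step_fun q (\<tau> (Suc i)) * indicator {\<tau> i<..\<tau> (Suc i)} s)"
    by simp
  finally show ?thesis .
qed

lemma integral_indicator_leb01:
  assumes "0 \<le> u" "u \<le> v" "v \<le> 1"
  shows "(\<integral>s. indicator {u<..v} s \<partial>leb01) = v - u"
proof -
  have "(\<integral>s. indicator {u<..v} s \<partial>leb01) = (\<integral>s. (indicator {0..1} s * indicator {u<..v} s :: real) \<partial>lebesgue)"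
    using integral_restrict_space[of "{0..1}" lebesgue "indicator {u<..v} :: real \<Rightarrow> real"] by simp
  also have "(\<lambda>s. indicator {0..1} s * indicator {u<..v} s :: real) = indicator {u<..v}"
    using assms by (auto simp: indicator_def)
  finally show ?thesis using assms by simp
qed

lemma grid_increments:
  fixes \<tau> :: "nat \<Rightarrow> real"
  assumes \<tau>: "strict_mono_on {..n} \<tau>" "\<tau> ` {..n} \<subseteq> {0..1}" and "i < n"
  shows "0 \<le> \<tau> i" "\<tau> i < \<tau> (Suc i)" "\<tau> (Suc i) \<le> 1"
proof -
  have "\<tau> i \<in> {0..1}" "\<tau> (Suc i) \<in> {0..1}"
    using \<open>i < n\<close> by (auto intro!: subsetD[OF \<tau>(2)] imageI simp del: atLeastAtMost_iff)
  then show "0 \<le> \<tau> i" "\<tau> (Suc i) \<le> 1" by auto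
  show "\<tau> i < \<tau> (Suc i)" using \<tau>(1) \<open>i < n\<close> by (auto simp: strict_mono_on_def)
qed

lemma step_fun_inner_on_grid:
  assumes \<tau>: "strict_mono_on {..n} \<tau>" "\<tau> ` {..n} \<subseteq> {0..1}"
    and p: "step_on_unit p" "step_times p \<subseteq> \<tau> ` {..n}"
    and q: "step_on_unit q" "step_times q \<subseteq> \<tau> ` {..n}"
  shows "(\<integral>s. step_fun p s * step_fun q s \<partial>leb01) =
    (\<Sum>i<n. step_fun p (\<tau> (Suc i)) * step_fun q (\<tau> (Suc i)) * (\<tau> (Suc i) - \<tau> i))"
proof -
  have int: "integrable leb01 (indicator {u<..v} :: real \<Rightarrow> real)" for u v
  proof -
    have "step_fun [(1, u, v)] = indicator {u<..v}" by auto
    then show ?thesis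
      using leb01.square_integrable_integrable[OF square_integrable_step_fun[of "[(1, u, v)]"]] by simp
  qed
  have "(\<integral>s. step_fun p s * step_fun q s \<partial>leb01) =
    (\<Sum>i<n. (\<integral>s. step_fun p (\<tau> (Suc i)) * step_fun q (\<tau> (Suc i)) * indicator {\<tau> i<..\<tau> (Suc i)} s \<partial>leb01))"
    by (subst Bochner_Integration.integral_cong[OF refl step_fun_mult_on_grid[OF \<tau>(1) p q]])
       (intro Bochner_Integration.integral_sum integrable_mult_right int)
  also have "\<dots> =
    (\<Sum>i<n. step_fun p (\<tau> (Suc i)) * step_fun q (\<tau> (Suc i)) * (\<integral>s. indicator {\<tau> i<..\<tau> (Suc i)} s \<partial>leb01))"
    by (simp only: integral_mult_right_zero)
  also have "\<dots> = (\<Sum>i<n. step_fun p (\<tau> (Suc i)) * step_fun q (\<tau> (Suc i)) * (\<tau> (Suc i) - \<tau> i))"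
  proof (intro sum.cong refl)
    fix i assume i: "i \<in> {..<n}"
    then have "(\<integral>s. indicator {\<tau> i<..\<tau> (Suc i)} s \<partial>leb01) = \<tau> (Suc i) - \<tau> i"
      using grid_increments[OF \<tau>, of i] by (intro integral_indicator_leb01) auto
    then show "step_fun p (\<tau> (Suc i)) * step_fun q (\<tau> (Suc i)) * (\<integral>s. indicator {\<tau> i<..\<tau> (Suc i)} s \<partial>leb01)
       = step_fun p (\<tau> (Suc i)) * step_fun q (\<tau> (Suc i)) * (\<tau> (Suc i) - \<tau> i)"
      by (simp only:)
  qed
  finally show ?thesis .
qed

lemma finite_set_grid:
  assumes "finite T" "T \<noteq> {}"
  obtains n and \<tau> :: "nat \<Rightarrow> real" where "strict_mono_on {..n} \<tau>" "\<tau> ` {..n} = T"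
proof
  let ?l = "sorted_list_of_set T"
  have len: "length ?l = card T" using assms by simp
  have "card T > 0" using assms by (simp add: card_gt_0_iff)
  then have eq: "{..card T - 1} = {..<length ?l}" using len by auto
  show "strict_mono_on {..card T - 1} ((!) ?l)"
    unfolding eq strict_mono_on_def
    using strict_sorted_list_of_set[of T] by (auto simp: sorted_wrt_iff_nth_less)
  show "(!) ?l ` {..card T - 1} = T"
    unfolding eq using assms by (simp add: nth_image[of "length ?l" ?l, simplified] lessThan_atLeast0)
qed

lemma steps_grid:
  assumes "step_on_unit p" "step_on_unit q"
  obtains n and \<tau> :: "nat \<Rightarrow> real" where "strict_mono_on {..n} \<tau>" "\<tau> ` {..n} \<subseteq> {0..1}" "step_times p \<subseteq> \<tau> ` {..n}"
    "step_times q \<subseteq> \<tau> ` {..n}"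
proof -
  \<comment> \<open>The point 0 is added to keep the set nonempty when both steps are empty.\<close>
  obtain n and \<tau> :: "nat \<Rightarrow> real" where "strict_mono_on {..n} \<tau>" "\<tau> ` {..n} = {0} \<union> step_times p \<union> step_times q"
    by (rule finite_set_grid[of "{0} \<union> step_times p \<union> step_times q"]) auto
  then show ?thesis using step_times_subset[OF assms(1)] step_times_subset[OF assms(2)]
    by (intro that[of n \<tau>]) auto
qed

text \<open>Translating by the real part of \<open>w\<close> completes the square; what remains is
  the characteristic function of the standard normal law at \<open>Im w\<close>.\<close>

lemma std_normal_complex_mgf:
  fixes w :: complex
  shows "integrable lborel (\<lambda>x. std_normal_density x *\<^sub>R exp (w * of_real x))"
    and "(\<integral>x. std_normal_density x *\<^sub>R exp (w * of_real x) \<partial>lborel) = exp (w\<^sup>2 / 2)"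
proof -
  let ?a = "Re w" and ?b = "Im w"
  let ?f = "\<lambda>x. std_normal_density x *\<^sub>R exp (w * of_real x)"
  have shift: "?f (?a + 1 * x) = (exp (of_real (?a\<^sup>2 / 2) + \<i> * of_real (?a * ?b))) * (std_normal_density x *\<^sub>R iexp (?b * x))" for x
  proof -
    have e: "exp (w * of_real (?a + x)) = exp (of_real (?a * (?a + x)) + \<i> * of_real (?a * ?b) + \<i> * of_real (?b * x))"
      by (rule arg_cong[where f=exp]) (auto simp: complex_eq_iff algebra_simps)
    have "std_normal_density (?a + x) * exp (?a * (?a + x)) = std_normal_density x * exp (?a\<^sup>2 / 2)"
      unfolding std_normal_density_def
      by (simp add: exp_add[symmetric] mult.assoc) (simp add: field_simps power2_eq_square)
    then have "of_real (std_normal_density (?a + x)) * exp (of_real (?a * (?a + x))) =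
      complex_of_real (std_normal_density x) * exp (of_real (?a\<^sup>2 / 2))"
      by (simp only: exp_of_real of_real_mult[symmetric])
    then show ?thesis unfolding mult_1 e exp_add scaleR_conv_of_real
      by (simp add: mult_ac)
  qed
  have int_iexp: "integrable lborel (\<lambda>x. std_normal_density x *\<^sub>R iexp (?b * x))"
    by (rule Bochner_Integration.integrable_bound[OF integrable_normal_density[of 1 0]]) auto
  have "integrable lborel (\<lambda>x. ?f (?a + 1 * x))"
    unfolding shift by (rule integrable_mult_right[OF int_iexp])
  then show int: "integrable lborel ?f"
    using lborel_integrable_real_affine_iff[of 1 ?f ?a] by simp
  have "(\<integral>x. ?f x \<partial>lborel) = (\<integral>x. ?f (?a + 1 * x) \<partial>lborel)"
    by (subst lborel_integral_real_affine[of 1 _ ?a]) auto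
  also have "\<dots> = exp (of_real (?a\<^sup>2 / 2) + \<i> * of_real (?a * ?b)) * (\<integral>x. std_normal_density x *\<^sub>R iexp (?b * x) \<partial>lborel)"
    unfolding shift by (rule integral_mult_right_zero)
  also have "(\<integral>x. std_normal_density x *\<^sub>R iexp (?b * x) \<partial>lborel) = char std_normal_distribution ?b"
    unfolding char_def by (subst integral_density) (auto simp: scaleR_conv_of_real)
  also have "\<dots> = exp (of_real (- ?b\<^sup>2 / 2))"
    unfolding char_std_normal_distribution by (simp only: exp_of_real)
  also have "exp (of_real (?a\<^sup>2 / 2) + \<i> * of_real (?a * ?b)) * exp (of_real (- ?b\<^sup>2 / 2)) = exp (w\<^sup>2 / 2)"
    unfolding exp_add[symmetric]
    by (rule arg_cong[where f=exp]) (auto simp: complex_eq_iff power2_eq_square field_simps)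
  finally show "(\<integral>x. ?f x \<partial>lborel) = exp (w\<^sup>2 / 2)" .
qed

text \<open>Mean value estimate on a half-plane, which is convex and on which the derivative of exp
  is bounded. The sum of the two exponentials replaces their maximum because it can be estimated
  term by term in L2.\<close>

lemma norm_exp_diff_le:
  fixes z w :: complex
  shows "norm (exp z - exp w) \<le> (exp (Re z) + exp (Re w)) * norm (z - w)"
proof -
  let ?S = "{x. Re x \<le> max (Re z) (Re w)}"
  have "norm (exp z - exp w) \<le> exp (max (Re z) (Re w)) * norm (z - w)"
  proof (rule field_differentiable_bound[where S="?S" and f'=exp])
    show "convex ?S" using convex_halfspace_Re_le by simp
  qed (auto intro!: derivative_eq_intros)
  also have "exp (max (Re z) (Re w)) \<le> exp (Re z) + exp (Re w)"
    by (auto simp: max_def)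
  finally show ?thesis by (simp add: mult_right_mono)
qed

context brownian_motion
begin

lemma increment_complex_mgf:
  fixes w :: complex
  assumes "0 \<le> s" "s < t" "t \<le> 1"
  shows "integrable M (\<lambda>\<omega>. exp (w * of_real (W t \<omega> - W s \<omega>)))"
    and "(\<integral>\<omega>. exp (w * of_real (W t \<omega> - W s \<omega>)) \<partial>M) = exp (w\<^sup>2 * of_real (t - s) / 2)"
proof -
  let ?d = "sqrt (t - s)"
  have d: "?d > 0" using assms by simp
  have D: "distributed M lborel (\<lambda>\<omega>. (W t \<omega> - W s \<omega>) / ?d) std_normal_density"
    using normal_standard_normal_convert[OF d, of "\<lambda>\<omega>. W t \<omega> - W s \<omega>" 0] normal_increments[OF assms] by simp
  have eq: "exp (w * of_real (W t \<omega> - W s \<omega>)) = exp (w * of_real ?d * of_real ((W t \<omega> - W s \<omega>) / ?d))" for \<omega>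
    using d by (simp add: mult.assoc flip: of_real_mult)
  have dd: "complex_of_real ?d * complex_of_real ?d = of_real (t - s)"
    using assms unfolding of_real_mult[symmetric] by simp
  have g: "(\<lambda>x. exp (w * of_real ?d * of_real x)) \<in> borel_measurable lborel" by simp
  note mgf = std_normal_complex_mgf[of "w * of_real ?d"]
  have distr: "distr M lborel (\<lambda>\<omega>. (W t \<omega> - W s \<omega>) / ?d) = density lborel std_normal_density"
    using distributed_distr_eq_density[OF D] by simp
  have m: "(\<lambda>\<omega>. (W t \<omega> - W s \<omega>) / ?d) \<in> M \<rightarrow>\<^sub>M lborel" using distributed_measurable[OF D] .
  have "integrable (density lborel std_normal_density) (\<lambda>x. exp (w * of_real ?d * of_real x))"
    using mgf(1) by (subst integrable_density) auto
  then have "integrable (distr M lborel (\<lambda>\<omega>. (W t \<omega> - W s \<omega>) / ?d)) (\<lambda>x. exp (w * of_real ?d * of_real x))"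
    by (simp only: distr)
  from integrable_distr[OF m this] show "integrable M (\<lambda>\<omega>. exp (w * of_real (W t \<omega> - W s \<omega>)))"
    unfolding eq .
  have "(\<integral>\<omega>. exp (w * of_real (W t \<omega> - W s \<omega>)) \<partial>M) =
     (\<integral>x. exp (w * of_real ?d * of_real x) \<partial>distr M lborel (\<lambda>\<omega>. (W t \<omega> - W s \<omega>) / ?d))"
    unfolding eq by (rule integral_distr[OF m g, symmetric])
  also have "\<dots> = (\<integral>x. std_normal_density x *\<^sub>R exp (w * of_real ?d * of_real x) \<partial>lborel)"
    unfolding distr by (subst integral_density) auto
  also have "\<dots> = exp (w\<^sup>2 * of_real (t - s) / 2)"
  proof -
    have "(w * of_real ?d)\<^sup>2 = w\<^sup>2 * of_real (t - s)"
      unfolding power2_eq_square dd[symmetric] by (simp add: mult_ac)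
    then show ?thesis unfolding mgf(2) by simp
  qed
  finally show "(\<integral>\<omega>. exp (w * of_real (W t \<omega> - W s \<omega>)) \<partial>M) = exp (w\<^sup>2 * of_real (t - s) / 2)" .
qed

lemma step_integral_grid:
  assumes "strict_mono_on {..n} \<tau>" "step_on_unit p" "step_times p \<subseteq> \<tau> ` {..n}"
  shows "step_integral W p \<omega> = (\<Sum>i<n. step_fun p (\<tau> (Suc i)) * (W (\<tau> (Suc i)) \<omega> - W (\<tau> i) \<omega>))"
  using step_increments[OF assms, of "\<lambda>t. W t \<omega>"] by (simp add: step_integral_def)

lemma step_integral_measurable:
  "step_on_unit p \<Longrightarrow> step_integral W p \<in> borel_measurable M"
proof (induction p)
  case (Cons x p)
  obtain c u v where x: "x = (c, u, v)" by (cases x)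
  have "W u \<in> borel_measurable M" "W v \<in> borel_measurable M" "step_integral W p \<in> borel_measurable M"
    using Cons x by (auto intro!: measurable_W)
  then have "(\<lambda>\<omega>. c * (W v \<omega> - W u \<omega>) + step_integral W p \<omega>) \<in> borel_measurable M" by simp
  then show ?case by (simp add: x cong: measurable_cong)
qed (simp cong: measurable_cong)

text \<open>\<open>p\<close> and \<open>q\<close> are the real and imaginary parts of one complex
  step function. On a common grid its exponential is a product of independent factors, and the
  exponents on the right add up to half the integral of its square.\<close>

lemma step_integral_complex_mgf:
  assumes p: "step_on_unit p" and q: "step_on_unit q"
  shows "integrable M (\<lambda>\<omega>. exp (Complex (step_integral W p \<omega>) (step_integral W q \<omega>)))" (is ?int)
    and "(\<integral>\<omega>. exp (Complex (step_integral W p \<omega>) (step_integral W q \<omega>)) \<partial>M) =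
      exp (Complex (((\<integral>s. (step_fun p s)\<^sup>2 \<partial>leb01) - (\<integral>s. (step_fun q s)\<^sup>2 \<partial>leb01)) / 2)
        (\<integral>s. step_fun p s * step_fun q s \<partial>leb01))" (is ?eq)
proof -
  obtain n and \<tau> :: "nat \<Rightarrow> real" where \<tau>: "strict_mono_on {..n} \<tau>" "\<tau> ` {..n} \<subseteq> {0..1}"
    and pq: "step_times p \<subseteq> \<tau> ` {..n}" "step_times q \<subseteq> \<tau> ` {..n}"
    by (rule steps_grid[OF p q])
  define w where "w i = Complex (step_fun p (\<tau> (Suc i))) (step_fun q (\<tau> (Suc i)))" for i
  let ?D = "\<lambda>i \<omega>. W (\<tau> (Suc i)) \<omega> - W (\<tau> i) \<omega>"
  have mono: "mono_on {..n} \<tau>" using \<tau>(1) by (rule strict_mono_on_imp_mono_on)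
  note grid = grid_increments[OF \<tau>]
  have "Complex (step_integral W p \<omega>) (step_integral W q \<omega>) = (\<Sum>i<n. w i * of_real (?D i \<omega>))" for \<omega>
    unfolding step_integral_grid[OF \<tau>(1) p pq(1)] step_integral_grid[OF \<tau>(1) q pq(2)]
    by (simp add: complex_eq_iff w_def)
  then have prod: "exp (Complex (step_integral W p \<omega>) (step_integral W q \<omega>)) = (\<Prod>i<n. exp (w i * of_real (?D i \<omega>)))" for \<omega>
    by (simp add: exp_sum)
  have "indep_vars (\<lambda>_. borel) ?D {..<n}"
    using indep_increments[OF mono \<tau>(2)] .
  then have ind: "indep_vars (\<lambda>_. borel) (\<lambda>i \<omega>. exp (w i * of_real (?D i \<omega>))) {..<n}"
    by (rule indep_vars_compose2) simp
  have int: "integrable M (\<lambda>\<omega>. exp (w i * of_real (?D i \<omega>)))" if "i \<in> {..<n}" for i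
    using that grid[of i] by (intro increment_complex_mgf(1)) auto
  show ?int unfolding prod by (rule indep_vars_integrable[OF _ ind int]) auto
  have "(\<integral>\<omega>. exp (Complex (step_integral W p \<omega>) (step_integral W q \<omega>)) \<partial>M) =
     (\<Prod>i<n. (\<integral>\<omega>. exp (w i * of_real (?D i \<omega>)) \<partial>M))"
    unfolding prod by (rule indep_vars_lebesgue_integral[OF _ ind int]) auto
  also have "\<dots> = (\<Prod>i<n. exp ((w i)\<^sup>2 * of_real (\<tau> (Suc i) - \<tau> i) / 2))"
    using grid by (intro prod.cong refl increment_complex_mgf(2)) auto
  also have "\<dots> = exp (\<Sum>i<n. (w i)\<^sup>2 * of_real (\<tau> (Suc i) - \<tau> i) / 2)"
    by (simp add: exp_sum)
  also have "(\<Sum>i<n. (w i)\<^sup>2 * of_real (\<tau> (Suc i) - \<tau> i) / 2) =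
      Complex (((\<integral>s. (step_fun p s)\<^sup>2 \<partial>leb01) - (\<integral>s. (step_fun q s)\<^sup>2 \<partial>leb01)) / 2)
        (\<integral>s. step_fun p s * step_fun q s \<partial>leb01)"
    unfolding power2_eq_square step_fun_inner_on_grid[OF \<tau> p pq(1) p pq(1)]
      step_fun_inner_on_grid[OF \<tau> p pq(1) q pq(2)] step_fun_inner_on_grid[OF \<tau> q pq(2) q pq(2)]
    by (simp add: complex_eq_iff w_def sum_subtractf[symmetric] sum_divide_distrib algebra_simps diff_divide_distrib)
       (simp add: sum.distrib[symmetric] field_simps)
  finally show ?eq .
qed

lemma increment_moments:
  assumes "0 \<le> s" "s < t" "t \<le> 1"
  shows "square_integrable M (\<lambda>\<omega>. W t \<omega> - W s \<omega>)" "(\<integral>\<omega>. W t \<omega> - W s \<omega> \<partial>M) = 0"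
    "(\<integral>\<omega>. (W t \<omega> - W s \<omega>)\<^sup>2 \<partial>M) = t - s"
proof -
  have d: "sqrt (t - s) > 0" using assms by simp
  note D = normal_increments[OF assms]
  show E: "(\<integral>\<omega>. W t \<omega> - W s \<omega> \<partial>M) = 0" by (rule normal_distributed_expectation[OF d D])
  show "(\<integral>\<omega>. (W t \<omega> - W s \<omega>)\<^sup>2 \<partial>M) = t - s"
    using normal_distributed_variance[OF d D] assms unfolding E by simp
  have "integrable M (\<lambda>\<omega>. (W t \<omega> - W s \<omega>)\<^sup>2)"
    using integrable_normal_moment[OF d, of 0 2] distributed_integrable[OF D, of "\<lambda>x. x\<^sup>2"] by simp
  then show "square_integrable M (\<lambda>\<omega>. W t \<omega> - W s \<omega>)"
    using assms measurable_W[of s] measurable_W[of t] by (auto simp: square_integrable_def)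
qed

text \<open>Increments over disjoint cells are independent and centred, hence orthogonal; only the
  diagonal of the double sum survives.\<close>

lemma step_integral_isometry:
  assumes p: "step_on_unit p"
  shows "square_integrable M (step_integral W p)" (is ?sq)
    and "l2norm M (step_integral W p) = l2norm leb01 (step_fun p)" (is ?eq)
proof -
  obtain n and \<tau> :: "nat \<Rightarrow> real" where \<tau>: "strict_mono_on {..n} \<tau>" "\<tau> ` {..n} \<subseteq> {0..1}" and pq: "step_times p \<subseteq> \<tau> ` {..n}"
    by (rule steps_grid[OF p p])
  define c where "c i = step_fun p (\<tau> (Suc i))" for i
  let ?D = "\<lambda>i \<omega>. W (\<tau> (Suc i)) \<omega> - W (\<tau> i) \<omega>"
  have mono: "mono_on {..n} \<tau>" using \<tau>(1) by (rule strict_mono_on_imp_mono_on)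
  note grid = grid_increments[OF \<tau>]
  have eq: "step_integral W p = (\<lambda>\<omega>. \<Sum>i<n. c i * ?D i \<omega>)"
    using step_integral_grid[OF \<tau>(1) p pq(1)] by (auto simp: c_def)
  have sqD: "square_integrable M (?D i)" if "i < n" for i
    using grid[OF that] by (rule increment_moments)
  show ?sq unfolding eq by (intro square_integrable_sum square_integrable_cmult sqD) auto
  have ind: "indep_vars (\<lambda>_. borel) ?D {..<n}"
    using indep_increments[OF mono \<tau>(2)] .
  have intD: "integrable M (\<lambda>\<omega>. ?D i \<omega> * ?D j \<omega>)" if "i < n" "j < n" for i j
    using that by (intro square_integrable_mult sqD)
  have orth: "(\<integral>\<omega>. ?D i \<omega> * ?D j \<omega> \<partial>M) = (if i = j then \<tau> (Suc i) - \<tau> i else 0)" if "i < n" "j < n" for i j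
  proof (cases "i = j")
    case True
    then show ?thesis using increment_moments(3)[OF grid[OF that(1)]] by (simp add: power2_eq_square)
  next
    case False
    have "(\<integral>\<omega>. (\<Prod>k\<in>{i, j}. ?D k \<omega>) \<partial>M) = (\<Prod>k\<in>{i, j}. \<integral>\<omega>. ?D k \<omega> \<partial>M)"
      using that by (intro indep_vars_lebesgue_integral indep_vars_subset[OF ind] square_integrable_integrable sqD) auto
    then show ?thesis using False increment_moments(2)[OF grid[OF that(1)]] by simp
  qed
  have "(\<integral>\<omega>. (step_integral W p \<omega>)\<^sup>2 \<partial>M) = (\<integral>\<omega>. (\<Sum>i<n. \<Sum>j<n. c i * c j * (?D i \<omega> * ?D j \<omega>)) \<partial>M)"
    unfolding eq power2_eq_square sum_product by (simp add: mult_ac)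
  also have "\<dots> = (\<Sum>i<n. \<Sum>j<n. c i * c j * (\<integral>\<omega>. ?D i \<omega> * ?D j \<omega> \<partial>M))"
  proof -
    have int: "integrable M (\<lambda>\<omega>. c i * c j * (?D i \<omega> * ?D j \<omega>))" if "i \<in> {..<n}" "j \<in> {..<n}" for i j
      using that by (intro integrable_mult_right intD) auto
    have "(\<integral>\<omega>. (\<Sum>i<n. \<Sum>j<n. c i * c j * (?D i \<omega> * ?D j \<omega>)) \<partial>M) =
      (\<Sum>i<n. (\<integral>\<omega>. (\<Sum>j<n. c i * c j * (?D i \<omega> * ?D j \<omega>)) \<partial>M))"
      by (intro Bochner_Integration.integral_sum Bochner_Integration.integrable_sum int)
    also have "\<dots> = (\<Sum>i<n. \<Sum>j<n. (\<integral>\<omega>. c i * c j * (?D i \<omega> * ?D j \<omega>) \<partial>M))"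
      by (intro sum.cong refl Bochner_Integration.integral_sum int)
    finally show ?thesis by simp
  qed
  also have "\<dots> = (\<Sum>i<n. \<Sum>j<n. if i = j then c i * c j * (\<tau> (Suc i) - \<tau> i) else 0)"
    by (intro sum.cong refl) (auto simp: orth)
  also have "\<dots> = (\<integral>s. (step_fun p s)\<^sup>2 \<partial>leb01)"
    unfolding power2_eq_square step_fun_inner_on_grid[OF \<tau> p pq p pq] by (simp add: c_def)
  finally show ?eq by (simp add: l2norm_def)
qed

lemma step_integral_isometry_diff:
  assumes p: "step_on_unit p" "step_on_unit q"
  shows "l2norm M (\<lambda>\<omega>. step_integral W p \<omega> - step_integral W q \<omega>)
     = l2norm leb01 (\<lambda>s. step_fun p s - step_fun q s)"
  using step_integral_isometry(2)[of "p @ step_scale (-1) q"] assms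
  by (simp add: l2norm_def)

section \<open>The Wiener integral of a general square integrable function\<close>

lemma has_wiener_integral_exists:
  assumes f: "square_integrable leb01 f"
  shows "\<exists>Y. has_wiener_integral M W f Y"
proof -
  obtain p where p: "\<And>n. step_on_unit (p n)" "L2_tendsto leb01 (\<lambda>n. step_fun (p n)) f"
    using step_approximable_leb01[OF f] unfolding step_approximable_def by blast
  note D = L2_tendstoD[OF p(2)]
  have "\<exists>N. \<forall>m\<ge>N. \<forall>n\<ge>N. l2norm M (\<lambda>x. step_integral W (p m) x - step_integral W (p n) x) < e"
    if "e > 0" for e
  proof -
    from order_tendstoD(2)[OF D(3), of "e/2"] that
    obtain N where N: "\<And>n. n \<ge> N \<Longrightarrow> l2norm leb01 (\<lambda>x. step_fun (p n) x - f x) < e / 2"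
      by (auto simp: eventually_sequentially)
    have "l2norm leb01 (\<lambda>x. step_fun (p m) x - step_fun (p n) x) < e" if "m \<ge> N" "n \<ge> N" for m n
      using l2norm_triangle_diff[OF D(1,2,1), of m n] N[OF that(1)] N[OF that(2)]
      unfolding l2norm_commute[of leb01 f] by linarith
    then show ?thesis using p(1) by (auto simp: step_integral_isometry_diff intro!: exI[of _ N])
  qed
  then obtain Y where "L2_tendsto M (\<lambda>n. step_integral W (p n)) Y"
    using L2_complete[of "\<lambda>n. step_integral W (p n)"] step_integral_isometry(1) p(1) by blast
  then show ?thesis unfolding has_wiener_integral_def using p by blast
qed

lemma has_wiener_integral_wiener_integral:
  "square_integrable leb01 f \<Longrightarrow> has_wiener_integral M W f (wiener_integral M W f)"
  unfolding wiener_integral_def using has_wiener_integral_exists by (rule someI_ex)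

text \<open>By the isometry, step integrals are as close as their step functions, so the limit does
  not depend on the approximating sequence. Allowing equality almost everywhere lets integrands be
  replaced by other versions.\<close>

lemma has_wiener_integral_unique:
  assumes "has_wiener_integral M W f Y" "has_wiener_integral M W g Z" "AE s in leb01. f s = g s"
  shows "AE \<omega> in M. Y \<omega> = Z \<omega>"
proof -
  obtain p q where p: "\<And>n. step_on_unit (p n)" "L2_tendsto leb01 (\<lambda>n. step_fun (p n)) f"
      "L2_tendsto M (\<lambda>n. step_integral W (p n)) Y"
    and q: "\<And>n. step_on_unit (q n)" "L2_tendsto leb01 (\<lambda>n. step_fun (q n)) g"
      "L2_tendsto M (\<lambda>n. step_integral W (q n)) Z"
    using assms unfolding has_wiener_integral_def by blast
  have q2: "L2_tendsto leb01 (\<lambda>n. step_fun (q n)) f"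
    by (rule L2_tendsto_AE_cong[OF q(2)])
       (use p(2) assms(3) in \<open>auto simp: L2_tendsto_def square_integrable_def\<close>)
  note D = L2_tendstoD[OF p(2)] L2_tendstoD[OF q2] L2_tendstoD[OF p(3)]
  have "(\<lambda>n. l2norm M (\<lambda>x. step_integral W (q n) x - Y x)) \<longlonglongrightarrow> 0"
  proof (rule tendsto_sandwich[OF _ _ tendsto_const])
    show "(\<lambda>n. l2norm leb01 (\<lambda>s. step_fun (q n) s - f s) + l2norm leb01 (\<lambda>s. step_fun (p n) s - f s)
        + l2norm M (\<lambda>x. step_integral W (p n) x - Y x)) \<longlonglongrightarrow> 0"
      using tendsto_add[OF tendsto_add[OF D(6) D(3)] D(9)] by simp
    show "\<forall>\<^sub>F n in sequentially. l2norm M (\<lambda>x. step_integral W (q n) x - Y x) \<le>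
       l2norm leb01 (\<lambda>s. step_fun (q n) s - f s) + l2norm leb01 (\<lambda>s. step_fun (p n) s - f s)
        + l2norm M (\<lambda>x. step_integral W (p n) x - Y x)"
    proof (intro always_eventually allI)
      fix n
      have "l2norm M (\<lambda>x. step_integral W (q n) x - Y x) \<le>
         l2norm M (\<lambda>x. step_integral W (q n) x - step_integral W (p n) x) + l2norm M (\<lambda>x. step_integral W (p n) x - Y x)"
        using L2_tendstoD[OF q(3)] D by (intro l2norm_triangle_diff) auto
      also have "l2norm M (\<lambda>x. step_integral W (q n) x - step_integral W (p n) x) =
          l2norm leb01 (\<lambda>s. step_fun (q n) s - step_fun (p n) s)"
        using p q by (simp add: step_integral_isometry_diff)
      also have "\<dots> \<le> l2norm leb01 (\<lambda>s. step_fun (q n) s - f s) + l2norm leb01 (\<lambda>s. step_fun (p n) s - f s)"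
        using l2norm_triangle_diff[OF D(4,2,1), of n n] by (simp add: l2norm_commute[of leb01 f])
      finally show "l2norm M (\<lambda>x. step_integral W (q n) x - Y x) \<le>
       l2norm leb01 (\<lambda>s. step_fun (q n) s - f s) + l2norm leb01 (\<lambda>s. step_fun (p n) s - f s)
        + l2norm M (\<lambda>x. step_integral W (p n) x - Y x)" by simp
    qed
  qed auto
  then have "L2_tendsto M (\<lambda>n. step_integral W (q n)) Y"
    using D L2_tendstoD[OF q(3)] by (simp add: L2_tendsto_iff)
  from L2_tendsto_unique[OF this q(3)] show ?thesis .
qed

lemma has_wiener_integral_add:
  assumes "has_wiener_integral M W f Y" "has_wiener_integral M W g Z"
  shows "has_wiener_integral M W (\<lambda>s. f s + g s) (\<lambda>\<omega>. Y \<omega> + Z \<omega>)"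
proof -
  obtain p q where p: "\<And>n. step_on_unit (p n)" "L2_tendsto leb01 (\<lambda>n. step_fun (p n)) f"
      "L2_tendsto M (\<lambda>n. step_integral W (p n)) Y"
    and q: "\<And>n. step_on_unit (q n)" "L2_tendsto leb01 (\<lambda>n. step_fun (q n)) g"
      "L2_tendsto M (\<lambda>n. step_integral W (q n)) Z"
    using assms unfolding has_wiener_integral_def by blast
  have e: "step_integral W (p n @ q n) = (\<lambda>\<omega>. step_integral W (p n) \<omega> + step_integral W (q n) \<omega>)" for n
    by auto
  show ?thesis unfolding has_wiener_integral_def
    by (intro exI[of _ "\<lambda>n. p n @ q n"])
       (use L2_tendsto_add[OF p(2) q(2)] L2_tendsto_add[OF p(3) q(3)] p(1) q(1) in \<open>simp add: step_fun_eqs e\<close>)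
qed

lemma has_wiener_integral_cmult:
  assumes "has_wiener_integral M W f Y"
  shows "has_wiener_integral M W (\<lambda>s. c * f s) (\<lambda>\<omega>. c * Y \<omega>)"
proof -
  obtain p where p: "\<And>n. step_on_unit (p n)" "L2_tendsto leb01 (\<lambda>n. step_fun (p n)) f"
      "L2_tendsto M (\<lambda>n. step_integral W (p n)) Y"
    using assms unfolding has_wiener_integral_def by blast
  have e: "step_integral W (step_scale c (p n)) = (\<lambda>\<omega>. c * step_integral W (p n) \<omega>)" for n
    by auto
  show ?thesis unfolding has_wiener_integral_def
    by (intro exI[of _ "\<lambda>n. step_scale c (p n)"])
       (use L2_tendsto_cmult[OF p(2), of c] L2_tendsto_cmult[OF p(3), of c] p(1) in \<open>simp add: step_fun_eqs e\<close>)
qed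

lemma has_wiener_integral_step:
  "step_on_unit p \<Longrightarrow> has_wiener_integral M W (step_fun p) (step_integral W p)"
  unfolding has_wiener_integral_def
  by (intro exI[of _ "\<lambda>_. p"])
     (simp add: L2_tendsto_const square_integrable_step_fun step_integral_isometry(1))

lemma has_wiener_integral_square_integrable:
  assumes "has_wiener_integral M W f Y"
  shows "square_integrable leb01 f" "square_integrable M Y"
  using assms by (auto simp: has_wiener_integral_def L2_tendsto_def)

lemma wiener_integral_AE_eq:
  assumes "has_wiener_integral M W f Y" "AE s in leb01. f s = g s" "square_integrable leb01 g"
  shows "AE \<omega> in M. wiener_integral M W g \<omega> = Y \<omega>"
  using has_wiener_integral_unique[OF assms(1) has_wiener_integral_wiener_integral[OF assms(3)] assms(2)]
  by eventually_elim simp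

lemma wiener_integral_square_integrable:
  "square_integrable leb01 f \<Longrightarrow> square_integrable M (wiener_integral M W f)"
  by (rule has_wiener_integral_square_integrable(2)[OF has_wiener_integral_wiener_integral])

lemma wiener_integral_add:
  assumes "square_integrable leb01 f" "square_integrable leb01 g"
  shows "AE \<omega> in M. wiener_integral M W (\<lambda>s. f s + g s) \<omega> = wiener_integral M W f \<omega> + wiener_integral M W g \<omega>"
  by (rule wiener_integral_AE_eq[OF has_wiener_integral_add])
     (use assms in \<open>auto intro: has_wiener_integral_wiener_integral square_integrable_add\<close>)

lemma wiener_integral_cmult:
  assumes "square_integrable leb01 f"
  shows "AE \<omega> in M. wiener_integral M W (\<lambda>s. c * f s) \<omega> = c * wiener_integral M W f \<omega>"
  by (rule wiener_integral_AE_eq[OF has_wiener_integral_cmult])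
     (use assms in \<open>auto intro: has_wiener_integral_wiener_integral square_integrable_cmult\<close>)

lemma wiener_integral_zero: "AE \<omega> in M. wiener_integral M W (\<lambda>s. 0) \<omega> = 0"
proof -
  have e: "step_integral W [] = (\<lambda>\<omega>. 0)" by auto
  show ?thesis
    using wiener_integral_AE_eq[OF has_wiener_integral_step[of "[]"], of "\<lambda>s. 0"]
    by (simp add: e square_integrable_zero)
qed

lemma wiener_integral_sum:
  assumes "finite J" "\<And>j. j \<in> J \<Longrightarrow> square_integrable leb01 (f j)"
  shows "AE \<omega> in M. wiener_integral M W (\<lambda>s. \<Sum>j\<in>J. c j * f j s) \<omega> = (\<Sum>j\<in>J. c j * wiener_integral M W (f j) \<omega>)"
  using assms
proof (induction J rule: finite_induct)
  case empty
  then show ?case using wiener_integral_zero by simp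
next
  case (insert j J)
  have sq: "square_integrable leb01 (\<lambda>s. c j * f j s)" "square_integrable leb01 (\<lambda>s. \<Sum>j\<in>J. c j * f j s)"
    using insert by (auto intro!: square_integrable_cmult square_integrable_sum)
  have "AE \<omega> in M. wiener_integral M W (\<lambda>s. c j * f j s) \<omega> = c j * wiener_integral M W (f j) \<omega>"
    "AE \<omega> in M. wiener_integral M W (\<lambda>s. \<Sum>j\<in>J. c j * f j s) \<omega> = (\<Sum>j\<in>J. c j * wiener_integral M W (f j) \<omega>)"
    using insert by (auto intro!: wiener_integral_cmult)
  with wiener_integral_add[OF sq] show ?case
    by eventually_elim (use insert(1,2) in simp)
qed

section \<open>Exponential moments of Wiener integrals\<close>

lemma L2_tendsto_AE_subseq:
  assumes "L2_tendsto M Y X"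
  obtains r :: "nat \<Rightarrow> nat" where "strict_mono r" "AE \<omega> in M. (\<lambda>n. Y (r n) \<omega>) \<longlonglongrightarrow> X \<omega>"
proof -
  note D = L2_tendstoD[OF assms]
  have sqd: "square_integrable M (\<lambda>\<omega>. Y n \<omega> - X \<omega>)" for n using D by (intro square_integrable_diff)
  have lim: "(\<lambda>n. \<integral>\<omega>. norm (Y n \<omega> - X \<omega>) \<partial>M) \<longlonglongrightarrow> 0"
  proof (rule tendsto_sandwich[OF _ _ tendsto_const D(3)])
    show "\<forall>\<^sub>F n in sequentially. (\<integral>\<omega>. norm (Y n \<omega> - X \<omega>) \<partial>M) \<le> l2norm M (\<lambda>\<omega>. Y n \<omega> - X \<omega>)"
      using integral_abs_le_l2norm[OF sqd] by (intro always_eventually allI) (simp add: prob_space)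
  qed simp
  obtain r where r: "strict_mono r" "AE \<omega> in M. (\<lambda>n. Y (r n) \<omega> - X \<omega>) \<longlonglongrightarrow> 0"
    using tendsto_L1_AE_subseq[of M "\<lambda>n \<omega>. Y n \<omega> - X \<omega>", OF square_integrable_integrable[OF sqd] lim] by blast
  have "AE \<omega> in M. (\<lambda>n. Y (r n) \<omega>) \<longlonglongrightarrow> X \<omega>"
    using r(2) by eventually_elim (simp add: LIM_zero_iff)
  with r(1) show ?thesis by (rule that)
qed

lemma exp_step_integral_mgf:
  assumes p: "step_on_unit p"
  shows "integrable M (\<lambda>\<omega>. exp (step_integral W p \<omega>))"
    "(\<integral>\<omega>. exp (step_integral W p \<omega>) \<partial>M) = exp ((l2norm leb01 (step_fun p))\<^sup>2 / 2)"
proof -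
  note mgf = step_integral_complex_mgf[OF p, of "[]"]
  have e: "Complex x 0 = of_real x" for x by (simp add: complex_of_real_def)
  have "integrable M (\<lambda>\<omega>. complex_of_real (exp (step_integral W p \<omega>)))"
    using mgf(1) by (simp add: e exp_of_real)
  then show "integrable M (\<lambda>\<omega>. exp (step_integral W p \<omega>))" by (simp only: complex_of_real_integrable_eq)
  have "complex_of_real (\<integral>\<omega>. exp (step_integral W p \<omega>) \<partial>M) = (\<integral>\<omega>. complex_of_real (exp (step_integral W p \<omega>)) \<partial>M)"
    by simp
  also have "\<dots> = of_real (exp ((l2norm leb01 (step_fun p))\<^sup>2 / 2))"
    using mgf(2) by (simp add: e exp_of_real[symmetric] l2norm_power2)
  finally show "(\<integral>\<omega>. exp (step_integral W p \<omega>) \<partial>M) = exp ((l2norm leb01 (step_fun p))\<^sup>2 / 2)"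
    by (simp only: of_real_eq_iff)
qed

text \<open>Squaring the exponential doubles the integrand, which multiplies the variance by
  4.\<close>

lemma exp_step_integral_l2norm:
  assumes p: "step_on_unit p"
  shows "square_integrable M (\<lambda>\<omega>. exp (step_integral W p \<omega>))"
    "l2norm M (\<lambda>\<omega>. exp (step_integral W p \<omega>)) = exp ((l2norm leb01 (step_fun p))\<^sup>2)"
proof -
  have e: "(exp (step_integral W p \<omega>))\<^sup>2 = exp (step_integral W (step_scale 2 p) \<omega>)" for \<omega>
    by (simp add: exp_double)
  have p2: "step_on_unit (step_scale 2 p)" using p by simp
  note mgf = exp_step_integral_mgf[OF p2]
  show "square_integrable M (\<lambda>\<omega>. exp (step_integral W p \<omega>))"
    using mgf(1) step_integral_measurable[OF p] unfolding square_integrable_def e by auto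
  have "(\<integral>\<omega>. (exp (step_integral W p \<omega>))\<^sup>2 \<partial>M) = (exp ((l2norm leb01 (step_fun p))\<^sup>2))\<^sup>2"
    unfolding e mgf(2) step_fun_eqs l2norm_cmult by (simp add: power_mult_distrib exp_double[symmetric])
  then show "l2norm M (\<lambda>\<omega>. exp (step_integral W p \<omega>)) = exp ((l2norm leb01 (step_fun p))\<^sup>2)"
    by (simp add: l2norm_def)
qed

text \<open>Fatou along an almost everywhere convergent subsequence: the second moments of the
  approximations are exponentials of the norms of the step functions, and these stay bounded because
  they converge.\<close>

lemma square_integrable_exp_wiener:
  assumes f: "square_integrable leb01 f"
  shows "square_integrable M (\<lambda>\<omega>. exp (wiener_integral M W f \<omega>))"
proof -
  obtain p where p: "\<And>n. step_on_unit (p n)" "L2_tendsto leb01 (\<lambda>n. step_fun (p n)) f"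
      "L2_tendsto M (\<lambda>n. step_integral W (p n)) (wiener_integral M W f)"
    using has_wiener_integral_wiener_integral[OF f] unfolding has_wiener_integral_def by blast
  obtain r :: "nat \<Rightarrow> nat" where r: "strict_mono r"
    "AE \<omega> in M. (\<lambda>n. step_integral W (p (r n)) \<omega>) \<longlonglongrightarrow> wiener_integral M W f \<omega>"
    by (rule L2_tendsto_AE_subseq[OF p(3)])
  have "(\<lambda>n. \<integral>s. step_fun (p n) s * step_fun (p n) s \<partial>leb01) \<longlonglongrightarrow> (\<integral>s. f s * f s \<partial>leb01)"
    by (rule L2_tendsto_inner[OF p(2) p(2)])
  then have "Bseq (\<lambda>n. \<integral>s. step_fun (p n) s * step_fun (p n) s \<partial>leb01)"
    by (rule convergent_imp_Bseq[OF convergentI])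
  then obtain K where K: "\<And>n. norm (\<integral>s. step_fun (p n) s * step_fun (p n) s \<partial>leb01) \<le> K"
    by (auto simp: Bseq_def)
  have meas: "wiener_integral M W f \<in> borel_measurable M"
    using wiener_integral_square_integrable[OF f] by (rule square_integrable_measurable)
  have "(\<integral>\<^sup>+\<omega>. ennreal ((exp (wiener_integral M W f \<omega>))\<^sup>2) \<partial>M)
     = (\<integral>\<^sup>+\<omega>. liminf (\<lambda>n. ennreal ((exp (step_integral W (p (r n)) \<omega>))\<^sup>2)) \<partial>M)"
  proof (rule nn_integral_cong_AE)
    show "AE \<omega> in M. ennreal ((exp (wiener_integral M W f \<omega>))\<^sup>2) =
        liminf (\<lambda>n. ennreal ((exp (step_integral W (p (r n)) \<omega>))\<^sup>2))"
      using r(2)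
    proof eventually_elim
      case (elim \<omega>)
      then have "(\<lambda>n. ennreal ((exp (step_integral W (p (r n)) \<omega>))\<^sup>2)) \<longlonglongrightarrow>
          ennreal ((exp (wiener_integral M W f \<omega>))\<^sup>2)"
        by (intro tendsto_ennrealI tendsto_intros)
      then show ?case by (intro lim_imp_Liminf[symmetric]) auto
    qed
  qed
  also have "\<dots> \<le> liminf (\<lambda>n. \<integral>\<^sup>+\<omega>. ennreal ((exp (step_integral W (p (r n)) \<omega>))\<^sup>2) \<partial>M)"
    using step_integral_measurable[OF p(1)] by (intro nn_integral_liminf) auto
  also have "\<dots> \<le> ennreal (exp (2 * K))"
  proof (rule Liminf_le)
    show "\<forall>\<^sub>F n in sequentially. (\<integral>\<^sup>+\<omega>. ennreal ((exp (step_integral W (p (r n)) \<omega>))\<^sup>2) \<partial>M) \<le> ennreal (exp (2 * K))"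
    proof (intro always_eventually allI)
      fix n
      note sq = exp_step_integral_l2norm[OF p(1)[of "r n"]]
      have "(\<integral>\<^sup>+\<omega>. ennreal ((exp (step_integral W (p (r n)) \<omega>))\<^sup>2) \<partial>M) = ennreal ((l2norm M (\<lambda>\<omega>. exp (step_integral W (p (r n)) \<omega>)))\<^sup>2)"
        unfolding l2norm_power2 using square_integrable_power2[OF sq(1)]
        by (intro nn_integral_eq_integral) auto
      also have "\<dots> \<le> ennreal (exp (2 * K))"
        unfolding sq(2) using K[of "r n"]
        by (intro ennreal_leI) (simp add: l2norm_power2 power2_eq_square[of "step_fun _ _"] exp_double[symmetric])
      finally show "(\<integral>\<^sup>+\<omega>. ennreal ((exp (step_integral W (p (r n)) \<omega>))\<^sup>2) \<partial>M) \<le> ennreal (exp (2 * K))" .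
    qed
  qed simp
  also have "\<dots> < \<infinity>" by simp
  finally show ?thesis unfolding square_integrable_def using meas
    by (auto intro!: integrableI_bounded)
qed

text \<open>Limit of the formula for steps. The exponentials differ by at most the distance of the
  exponents times a sum of real exponentials; Cauchy-Schwarz separates the two factors, the first
  tending to 0 and the second bounded in L2.\<close>

lemma wiener_complex_mgf:
  assumes u: "square_integrable leb01 u" and v: "square_integrable leb01 v"
  shows "integrable M (\<lambda>\<omega>. exp (Complex (wiener_integral M W u \<omega>) (wiener_integral M W v \<omega>)))" (is ?int)
    and "(\<integral>\<omega>. exp (Complex (wiener_integral M W u \<omega>) (wiener_integral M W v \<omega>)) \<partial>M) =
      exp (Complex (((\<integral>s. (u s)\<^sup>2 \<partial>leb01) - (\<integral>s. (v s)\<^sup>2 \<partial>leb01)) / 2) (\<integral>s. u s * v s \<partial>leb01))" (is ?eq)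
proof -
  let ?U = "wiener_integral M W u" and ?V = "wiener_integral M W v"
  obtain p where p: "\<And>n. step_on_unit (p n)" "L2_tendsto leb01 (\<lambda>n. step_fun (p n)) u"
      "L2_tendsto M (\<lambda>n. step_integral W (p n)) ?U"
    using has_wiener_integral_wiener_integral[OF u] unfolding has_wiener_integral_def by blast
  obtain q where q: "\<And>n. step_on_unit (q n)" "L2_tendsto leb01 (\<lambda>n. step_fun (q n)) v"
      "L2_tendsto M (\<lambda>n. step_integral W (q n)) ?V"
    using has_wiener_integral_wiener_integral[OF v] unfolding has_wiener_integral_def by blast
  let ?P = "\<lambda>n. step_integral W (p n)" and ?Q = "\<lambda>n. step_integral W (q n)"
  define Z where "Z n \<omega> = Complex (?P n \<omega>) (?Q n \<omega>)" for n \<omega>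
  define Y where "Y \<omega> = Complex (?U \<omega>) (?V \<omega>)" for \<omega>
  note D = L2_tendstoD[OF p(3)] L2_tendstoD[OF q(3)]
  have expU: "square_integrable M (\<lambda>\<omega>. exp (?U \<omega>))" by (rule square_integrable_exp_wiener[OF u])
  have measUV [measurable]: "?U \<in> borel_measurable M" "?V \<in> borel_measurable M"
    using D by (auto simp: square_integrable_def)
  have Yeq: "Y \<omega> = of_real (?U \<omega>) + \<i> * of_real (?V \<omega>)" for \<omega> by (simp add: Y_def complex_eq_iff)
  have measY: "(\<lambda>\<omega>. exp (Y \<omega>)) \<in> borel_measurable M"
    unfolding Yeq by measurable
  have intY: "integrable M (\<lambda>\<omega>. exp (Y \<omega>))"
    by (rule Bochner_Integration.integrable_bound[OF square_integrable_integrable[OF expU] measY]) (simp add: Y_def norm_exp_eq_Re)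
  then show ?int by (simp add: Y_def)
  have intZ: "integrable M (\<lambda>\<omega>. exp (Z n \<omega>))" for n
    using step_integral_complex_mgf(1)[OF p(1) q(1)] by (simp add: Z_def)
  let ?e = "\<lambda>n. (l2norm M (\<lambda>\<omega>. ?P n \<omega> - ?U \<omega>) + l2norm M (\<lambda>\<omega>. ?Q n \<omega> - ?V \<omega>))
      * (l2norm M (\<lambda>\<omega>. exp (?P n \<omega>)) + l2norm M (\<lambda>\<omega>. exp (?U \<omega>)))"
  have est: "norm ((\<integral>\<omega>. exp (Z n \<omega>) \<partial>M) - (\<integral>\<omega>. exp (Y \<omega>) \<partial>M)) \<le> ?e n" for n
  proof -
    let ?A = "\<lambda>\<omega>. \<bar>?P n \<omega> - ?U \<omega>\<bar> + \<bar>?Q n \<omega> - ?V \<omega>\<bar>" and ?B = "\<lambda>\<omega>. exp (?P n \<omega>) + exp (?U \<omega>)"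
    have sqP: "square_integrable M (\<lambda>\<omega>. exp (?P n \<omega>))" by (rule exp_step_integral_l2norm(1)[OF p(1)])
    have abs: "square_integrable M (\<lambda>\<omega>. \<bar>f \<omega>\<bar>)" if "square_integrable M f" for f
      using that by (auto simp: square_integrable_def)
    have sqd: "square_integrable M (\<lambda>\<omega>. ?P n \<omega> - ?U \<omega>)" "square_integrable M (\<lambda>\<omega>. ?Q n \<omega> - ?V \<omega>)"
      using D by (auto intro: square_integrable_diff)
    have sqA: "square_integrable M ?A" and sqB: "square_integrable M ?B"
      using sqd sqP expU by (auto intro!: square_integrable_add abs)
    have "norm ((\<integral>\<omega>. exp (Z n \<omega>) \<partial>M) - (\<integral>\<omega>. exp (Y \<omega>) \<partial>M)) = norm (\<integral>\<omega>. exp (Z n \<omega>) - exp (Y \<omega>) \<partial>M)"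
      using intY intZ by (subst Bochner_Integration.integral_diff) auto
    also have "\<dots> \<le> (\<integral>\<omega>. norm (exp (Z n \<omega>) - exp (Y \<omega>)) \<partial>M)" by (rule integral_norm_bound)
    also have "\<dots> \<le> (\<integral>\<omega>. ?A \<omega> * ?B \<omega> \<partial>M)"
    proof (rule integral_mono)
      show "integrable M (\<lambda>\<omega>. norm (exp (Z n \<omega>) - exp (Y \<omega>)))" using intY intZ by auto
      show "integrable M (\<lambda>\<omega>. ?A \<omega> * ?B \<omega>)" by (rule square_integrable_mult[OF sqA sqB])
      fix \<omega>
      have "norm (exp (Z n \<omega>) - exp (Y \<omega>)) \<le> ?B \<omega> * norm (Z n \<omega> - Y \<omega>)"
        using norm_exp_diff_le[of "Z n \<omega>" "Y \<omega>"] by (simp add: Z_def Y_def)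
      also have "\<dots> \<le> ?B \<omega> * ?A \<omega>"
        using cmod_le[of "Z n \<omega> - Y \<omega>"] by (intro mult_left_mono) (auto simp: Z_def Y_def)
      finally show "norm (exp (Z n \<omega>) - exp (Y \<omega>)) \<le> ?A \<omega> * ?B \<omega>" by (simp add: mult.commute)
    qed
    also have "\<dots> \<le> l2norm M ?A * l2norm M ?B" using l2_Cauchy_Schwarz[OF sqA sqB] by linarith
    also have "\<dots> \<le> ?e n"
      using l2norm_triangle[OF abs[OF sqd(1)] abs[OF sqd(2)]] l2norm_triangle[OF sqP expU]
      by (intro mult_mono) (auto simp: l2norm_def)
    finally show ?thesis .
  qed
  have lim_sq: "(\<lambda>n. \<integral>s. (step_fun (p n) s)\<^sup>2 \<partial>leb01) \<longlonglongrightarrow> (\<integral>s. (u s)\<^sup>2 \<partial>leb01)"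
    "(\<lambda>n. \<integral>s. (step_fun (q n) s)\<^sup>2 \<partial>leb01) \<longlonglongrightarrow> (\<integral>s. (v s)\<^sup>2 \<partial>leb01)"
    "(\<lambda>n. \<integral>s. step_fun (p n) s * step_fun (q n) s \<partial>leb01) \<longlonglongrightarrow> (\<integral>s. u s * v s \<partial>leb01)"
    unfolding power2_eq_square by (intro L2_tendsto_inner p q)+
  have "?e \<longlonglongrightarrow> (0 + 0) * (exp (\<integral>s. (u s)\<^sup>2 \<partial>leb01) + l2norm M (\<lambda>\<omega>. exp (?U \<omega>)))"
    unfolding exp_step_integral_l2norm(2)[OF p(1)] l2norm_power2
    by (intro tendsto_intros D lim_sq)
  then have e0: "?e \<longlonglongrightarrow> 0" by simp
  have "(\<lambda>n. (\<integral>\<omega>. exp (Z n \<omega>) \<partial>M) - (\<integral>\<omega>. exp (Y \<omega>) \<partial>M)) \<longlonglongrightarrow> 0"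
    by (rule Lim_null_comparison[OF always_eventually[OF allI[OF est]] e0])
  then have lim1: "(\<lambda>n. \<integral>\<omega>. exp (Z n \<omega>) \<partial>M) \<longlonglongrightarrow> (\<integral>\<omega>. exp (Y \<omega>) \<partial>M)" by (simp add: LIM_zero_iff)
  have "(\<lambda>n. exp (Complex (((\<integral>s. (step_fun (p n) s)\<^sup>2 \<partial>leb01) - (\<integral>s. (step_fun (q n) s)\<^sup>2 \<partial>leb01)) / 2)
        (\<integral>s. step_fun (p n) s * step_fun (q n) s \<partial>leb01)))
      \<longlonglongrightarrow> exp (Complex (((\<integral>s. (u s)\<^sup>2 \<partial>leb01) - (\<integral>s. (v s)\<^sup>2 \<partial>leb01)) / 2) (\<integral>s. u s * v s \<partial>leb01))"
    by (intro tendsto_intros lim_sq) auto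
  then have lim2: "(\<lambda>n. \<integral>\<omega>. exp (Z n \<omega>) \<partial>M) \<longlonglongrightarrow>
     exp (Complex (((\<integral>s. (u s)\<^sup>2 \<partial>leb01) - (\<integral>s. (v s)\<^sup>2 \<partial>leb01)) / 2) (\<integral>s. u s * v s \<partial>leb01))"
    using step_integral_complex_mgf(2)[OF p(1) q(1)] by (simp add: Z_def)
  from LIMSEQ_unique[OF lim1 lim2] show ?eq by (simp add: Y_def)
qed

end

section \<open>Totality of the exponentials\<close>

text \<open>If the lower coefficients vanish, dividing by \<open>x ^ m\<close> leaves a series that
  is zero off the origin; its limit at 0 is \<open>a m\<close>.\<close>

lemma real_powser_zero_coeffs:
  fixes a :: "nat \<Rightarrow> real"
  assumes sm: "\<And>x. (\<lambda>n. a n * x ^ n) sums 0"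
  shows "a m = 0"
proof (induction m rule: less_induct)
  case (less m)
  have "(\<lambda>n. a (n + m) * x ^ n) sums 0" if "x \<noteq> 0" for x
  proof -
    have "(\<lambda>n. a (n + m) * x ^ (n + m)) sums (0 - (\<Sum>i<m. a i * x ^ i))"
      by (intro sums_split_initial_segment sm)
    then have "(\<lambda>n. a (n + m) * x ^ (n + m)) sums 0" using less by simp
    then have "(\<lambda>n. a (n + m) * x ^ (n + m) * inverse (x ^ m)) sums (0 * inverse (x ^ m))"
      by (rule sums_mult2)
    then show ?thesis using that by (simp add: power_add field_simps)
  qed
  then have "((\<lambda>x. 0) \<longlongrightarrow> a (0 + m)) (at (0::real))"
    by (intro powser_limit_0_strong[of 1]) auto
  moreover have "((\<lambda>x. 0::real) \<longlongrightarrow> 0) (at (0::real))" by simp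
  ultimately show ?case using LIM_unique[of "\<lambda>x. 0::real" 0] by auto
qed

lemma power_le_fact_exp:
  fixes x :: real
  assumes "0 \<le> x"
  shows "x ^ k / fact k \<le> exp x"
proof -
  have s: "(\<lambda>n. x ^ n / fact n) sums exp x"
    using exp_converges[of x] by (simp add: divide_inverse mult.commute scaleR_conv_of_real)
  have "(\<Sum>n\<in>{k}. x ^ n / fact n) \<le> (\<Sum>n. x ^ n / fact n)"
    using assms sums_summable[OF s] by (intro sum_le_suminf) auto
  then show ?thesis using sums_unique[OF s] by simp
qed

lemma sum_power_fact_le_exp:
  fixes x :: real
  assumes "0 \<le> x"
  shows "(\<Sum>k<n. x ^ k / fact k) \<le> exp x"
proof -
  have s: "(\<lambda>n. x ^ n / fact n) sums exp x"
    using exp_converges[of x] by (simp add: divide_inverse mult.commute scaleR_conv_of_real)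
  have "(\<Sum>k<n. x ^ k / fact k) \<le> (\<Sum>n. x ^ n / fact n)"
    using assms sums_summable[OF s] by (intro sum_le_suminf) auto
  then show ?thesis using sums_unique[OF s] by simp
qed

lemma integrable_exp_abs:
  fixes Z V :: "'a \<Rightarrow> real"
  assumes [measurable]: "Z \<in> borel_measurable M" "V \<in> borel_measurable M"
    and int: "\<And>t. integrable M (\<lambda>\<omega>. Z \<omega> * exp (t * V \<omega>))"
  shows "integrable M (\<lambda>\<omega>. \<bar>Z \<omega>\<bar> * exp (r * \<bar>V \<omega>\<bar>))"
proof (rule Bochner_Integration.integrable_bound)
  show "integrable M (\<lambda>\<omega>. \<bar>Z \<omega> * exp (r * V \<omega>)\<bar> + \<bar>Z \<omega> * exp (- r * V \<omega>)\<bar>)"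
    by (intro Bochner_Integration.integrable_add integrable_abs int)
  show "AE \<omega> in M. norm (\<bar>Z \<omega>\<bar> * exp (r * \<bar>V \<omega>\<bar>)) \<le> norm (\<bar>Z \<omega> * exp (r * V \<omega>)\<bar> + \<bar>Z \<omega> * exp (- r * V \<omega>)\<bar>)"
  proof (rule AE_I2)
    fix \<omega>
    have "exp (r * \<bar>V \<omega>\<bar>) \<le> exp (r * V \<omega>) + exp (- r * V \<omega>)"
      by (cases "V \<omega> \<ge> 0") auto
    then have "\<bar>Z \<omega>\<bar> * exp (r * \<bar>V \<omega>\<bar>) \<le> \<bar>Z \<omega>\<bar> * (exp (r * V \<omega>) + exp (- r * V \<omega>))"
      by (intro mult_left_mono) auto
    also have "\<dots> = \<bar>Z \<omega> * exp (r * V \<omega>)\<bar> + \<bar>Z \<omega> * exp (- r * V \<omega>)\<bar>"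
      by (simp add: abs_mult distrib_left)
    finally show "norm (\<bar>Z \<omega>\<bar> * exp (r * \<bar>V \<omega>\<bar>)) \<le> norm (\<bar>Z \<omega> * exp (r * V \<omega>)\<bar> + \<bar>Z \<omega> * exp (- r * V \<omega>)\<bar>)"
      by (simp add: abs_mult)
  qed
qed measurable

text \<open>The moments determine the weighted transform for every complex \<open>w\<close>; the
  envelope \<open>|Z| exp (|w| |V|)\<close> justifies integrating term by term.\<close>

lemma mgf_series:
  fixes Z V :: "'a \<Rightarrow> real" and w :: complex
  assumes [measurable]: "Z \<in> borel_measurable M" "V \<in> borel_measurable M"
    and int: "\<And>t. integrable M (\<lambda>\<omega>. Z \<omega> * exp (t * V \<omega>))"
  shows "(\<lambda>k. w ^ k / fact k * of_real (\<integral>\<omega>. Z \<omega> * V \<omega> ^ k \<partial>M)) sums (\<integral>\<omega>. of_real (Z \<omega>) * exp (w * of_real (V \<omega>)) \<partial>M)"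
proof -
  define g where "g k \<omega> = w ^ k / fact k * of_real (Z \<omega> * V \<omega> ^ k)" for k \<omega>
  let ?r = "norm w"
  have norm_g: "norm (g k \<omega>) = \<bar>Z \<omega>\<bar> * ((?r * \<bar>V \<omega>\<bar>) ^ k / fact k)" for k \<omega>
    by (simp add: g_def norm_mult norm_divide norm_power power_mult_distrib abs_mult power_abs)
  have dom: "integrable M (\<lambda>\<omega>. \<bar>Z \<omega>\<bar> * exp (?r * \<bar>V \<omega>\<bar>))"
    by (rule integrable_exp_abs[OF assms])
  have meas_g: "g k \<in> borel_measurable M" for k unfolding g_def by measurable
  have int1: "integrable M (\<lambda>\<omega>. Z \<omega> * V \<omega> ^ k)" for k
  proof (rule Bochner_Integration.integrable_bound)
    show "integrable M (\<lambda>\<omega>. fact k * (\<bar>Z \<omega>\<bar> * exp (1 * \<bar>V \<omega>\<bar>)))"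
      by (intro integrable_mult_right integrable_exp_abs assms)
    show "AE \<omega> in M. norm (Z \<omega> * V \<omega> ^ k) \<le> norm (fact k * (\<bar>Z \<omega>\<bar> * exp (1 * \<bar>V \<omega>\<bar>)))"
    proof (rule AE_I2)
      fix \<omega>
      have "\<bar>V \<omega>\<bar> ^ k \<le> fact k * exp \<bar>V \<omega>\<bar>"
        using power_le_fact_exp[of "\<bar>V \<omega>\<bar>" k] by (simp add: field_simps)
      then have "\<bar>Z \<omega>\<bar> * \<bar>V \<omega>\<bar> ^ k \<le> \<bar>Z \<omega>\<bar> * (fact k * exp \<bar>V \<omega>\<bar>)" by (intro mult_left_mono) auto
      then show "norm (Z \<omega> * V \<omega> ^ k) \<le> norm (fact k * (\<bar>Z \<omega>\<bar> * exp (1 * \<bar>V \<omega>\<bar>)))"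
        by (simp add: abs_mult power_abs mult_ac)
    qed
  qed measurable
  have int_g: "integrable M (g k)" for k
    unfolding g_def by (intro integrable_mult_right integrable_of_real int1)
  have sum_g: "summable (\<lambda>k. norm (g k \<omega>))" for \<omega>
    unfolding norm_g by (intro summable_mult) (use summable_exp[of "?r * \<bar>V \<omega>\<bar>"] in \<open>simp add: field_simps\<close>)
  have exp_sums: "(\<lambda>k. g k \<omega>) sums (of_real (Z \<omega>) * exp (w * of_real (V \<omega>)))" for \<omega>
  proof -
    have "(\<lambda>k. of_real (Z \<omega>) * ((w * of_real (V \<omega>)) ^ k /\<^sub>R fact k)) sums (of_real (Z \<omega>) * exp (w * of_real (V \<omega>)))"
      by (intro sums_mult exp_converges)
    then show ?thesis
      by (simp add: g_def scaleR_conv_of_real power_mult_distrib field_simps)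
  qed
  have part: "norm (\<Sum>k<n. g k \<omega>) \<le> \<bar>Z \<omega>\<bar> * exp (?r * \<bar>V \<omega>\<bar>)" for n \<omega>
  proof -
    have "norm (\<Sum>k<n. g k \<omega>) \<le> (\<Sum>k<n. norm (g k \<omega>))" by (rule norm_sum)
    also have "\<dots> = \<bar>Z \<omega>\<bar> * (\<Sum>k<n. (?r * \<bar>V \<omega>\<bar>) ^ k / fact k)" by (simp add: norm_g sum_distrib_left)
    also have "\<dots> \<le> \<bar>Z \<omega>\<bar> * exp (?r * \<bar>V \<omega>\<bar>)"
      by (intro mult_left_mono sum_power_fact_le_exp) auto
    finally show ?thesis .
  qed
  have "(\<lambda>n. \<integral>\<omega>. (\<Sum>k<n. g k \<omega>) \<partial>M) \<longlonglongrightarrow> (\<integral>\<omega>. of_real (Z \<omega>) * exp (w * of_real (V \<omega>)) \<partial>M)"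
  proof (rule integral_dominated_convergence[OF _ _ dom])
    show "AE \<omega> in M. (\<lambda>n. \<Sum>k<n. g k \<omega>) \<longlonglongrightarrow> of_real (Z \<omega>) * exp (w * of_real (V \<omega>))"
      using exp_sums by (intro AE_I2) (simp add: sums_def)
    show "AE \<omega> in M. norm (\<Sum>k<n. g k \<omega>) \<le> \<bar>Z \<omega>\<bar> * exp (?r * \<bar>V \<omega>\<bar>)" for n
      using part by (intro AE_I2)
    show "(\<lambda>\<omega>. of_real (Z \<omega>) * exp (w * of_real (V \<omega>))) \<in> borel_measurable M" by measurable
    show "(\<lambda>\<omega>. \<Sum>k<n. g k \<omega>) \<in> borel_measurable M" for n
      by (intro borel_measurable_sum meas_g)
  qed
  moreover have "(\<integral>\<omega>. (\<Sum>k<n. g k \<omega>) \<partial>M) = (\<Sum>k<n. w ^ k / fact k * of_real (\<integral>\<omega>. Z \<omega> * V \<omega> ^ k \<partial>M))" for n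
  proof -
    have "(\<integral>\<omega>. (\<Sum>k<n. g k \<omega>) \<partial>M) = (\<Sum>k<n. (\<integral>\<omega>. g k \<omega> \<partial>M))"
      by (intro Bochner_Integration.integral_sum int_g)
    then show ?thesis unfolding g_def by (simp only: integral_mult_right_zero integral_complex_of_real)
  qed
  ultimately show ?thesis by (simp add: sums_def)
qed

text \<open>Analytic continuation in disguise: vanishing for real arguments kills all moments, hence
  also the values at imaginary arguments, where characteristic functions live.\<close>

lemma mgf_zero_imp_char_zero:
  fixes Z V :: "'a \<Rightarrow> real"
  assumes meas: "Z \<in> borel_measurable M" "V \<in> borel_measurable M"
    and int: "\<And>t. integrable M (\<lambda>\<omega>. Z \<omega> * exp (t * V \<omega>))"
    and zero: "\<And>t. (\<integral>\<omega>. Z \<omega> * exp (t * V \<omega>) \<partial>M) = 0"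
  shows "(\<integral>\<omega>. of_real (Z \<omega>) * exp (w * of_real (V \<omega>)) \<partial>M) = (0::complex)"
proof -
  define c where "c k = (\<integral>\<omega>. Z \<omega> * V \<omega> ^ k \<partial>M) / fact k" for k
  have "(\<lambda>k. c k * x ^ k) sums 0" for x
  proof -
    have "(\<lambda>k. of_real x ^ k / fact k * of_real (\<integral>\<omega>. Z \<omega> * V \<omega> ^ k \<partial>M)) sums
       (\<integral>\<omega>. of_real (Z \<omega>) * exp (of_real x * of_real (V \<omega>)) \<partial>M :: complex)"
      by (rule mgf_series[OF meas int])
    also have "(\<integral>\<omega>. of_real (Z \<omega>) * exp (of_real x * of_real (V \<omega>)) \<partial>M :: complex) = of_real (\<integral>\<omega>. Z \<omega> * exp (x * V \<omega>) \<partial>M)"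
      unfolding integral_complex_of_real[symmetric]
      by (simp only: of_real_mult exp_of_real[symmetric])
    also have "\<dots> = of_real 0" by (simp only: zero)
    also have "(\<lambda>k. of_real x ^ k / fact k * of_real (\<integral>\<omega>. Z \<omega> * V \<omega> ^ k \<partial>M)) = (\<lambda>k. complex_of_real (c k * x ^ k))"
      by (auto simp: c_def)
    finally show ?thesis by (simp only: sums_of_real_iff)
  qed
  then have "c k = 0" for k by (rule real_powser_zero_coeffs)
  then have "(\<integral>\<omega>. Z \<omega> * V \<omega> ^ k \<partial>M) = 0" for k by (simp add: c_def)
  then have "(\<lambda>k. 0) sums (\<integral>\<omega>. of_real (Z \<omega>) * exp (w * of_real (V \<omega>)) \<partial>M)"
    using mgf_series[OF meas int, of w] by simp
  then show ?thesis using sums_unique2[OF _ sums_zero] by blast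
qed

text \<open>The positive and negative parts of \<open>Z\<close> have the same mass \<open>c\<close>.
  If \<open>c\<close> is positive, both normalised parts induce laws of \<open>V\<close> with equal
  characteristic functions, so these laws agree by Levy's uniqueness theorem.\<close>

lemma mgf_zero_imp_indicator_zero:
  fixes Z V :: "'a \<Rightarrow> real"
  assumes meas [measurable]: "Z \<in> borel_measurable M" "V \<in> borel_measurable M"
    and int: "\<And>t. integrable M (\<lambda>\<omega>. Z \<omega> * exp (t * V \<omega>))"
    and zero: "\<And>t. (\<integral>\<omega>. Z \<omega> * exp (t * V \<omega>) \<partial>M) = 0"
    and B [measurable]: "B \<in> sets borel"
  shows "(\<integral>\<omega>. Z \<omega> * indicator B (V \<omega>) \<partial>M) = 0"
proof -
  have intZ: "integrable M Z" using int[of 0] by simp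
  define zp where "zp \<omega> = max 0 (Z \<omega>)" for \<omega>
  define zn where "zn \<omega> = max 0 (- Z \<omega>)" for \<omega>
  have [measurable]: "zp \<in> borel_measurable M" "zn \<in> borel_measurable M" unfolding zp_def zn_def by measurable
  have ipn: "integrable M zp" "integrable M zn"
    unfolding zp_def zn_def using intZ by auto
  have Zeq: "Z \<omega> = zp \<omega> - zn \<omega>" for \<omega> by (auto simp: zp_def zn_def)
  have nn: "zp \<omega> \<ge> 0" "zn \<omega> \<ge> 0" for \<omega> by (auto simp: zp_def zn_def)
  define c where "c = (\<integral>\<omega>. zp \<omega> \<partial>M)"
  have "(\<integral>\<omega>. zp \<omega> \<partial>M) - (\<integral>\<omega>. zn \<omega> \<partial>M) = 0"
    using zero[of 0] ipn by (subst Bochner_Integration.integral_diff[symmetric]) (auto simp: Zeq[symmetric])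
  then have cn: "c = (\<integral>\<omega>. zn \<omega> \<partial>M)" by (simp add: c_def)
  have "c \<ge> 0" unfolding c_def using nn by simp
  show ?thesis
  proof (cases "c = 0")
    case True
    have "(\<integral>\<omega>. zp \<omega> \<partial>M) = 0" "(\<integral>\<omega>. zn \<omega> \<partial>M) = 0" using True cn by (auto simp: c_def)
    then have "AE \<omega> in M. zp \<omega> = 0" "AE \<omega> in M. zn \<omega> = 0"
      using integral_nonneg_eq_0_iff_AE[OF ipn(1)] integral_nonneg_eq_0_iff_AE[OF ipn(2)] nn by auto
    then have "AE \<omega> in M. Z \<omega> * indicator B (V \<omega>) = 0"
      by eventually_elim (simp add: Zeq)
    then show ?thesis by (rule integral_eq_zero_AE)
  next
    case False
    then have c: "c > 0" using \<open>c \<ge> 0\<close> by simp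
    define \<mu> where "\<mu> z = distr (density M (\<lambda>\<omega>. ennreal (z \<omega> / c))) borel V" for z
    have \<mu>: "real_distribution (\<mu> z)" "char (\<mu> z) t = (\<integral>\<omega>. of_real (z \<omega>) * iexp (t * V \<omega>) \<partial>M) / of_real c"
       "measure (\<mu> z) B = (\<integral>\<omega>. z \<omega> * indicator B (V \<omega>) \<partial>M) / c"
      if z: "integrable M z" "(\<integral>\<omega>. z \<omega> \<partial>M) = c" "\<And>\<omega>. z \<omega> \<ge> 0" for z t
    proof -
      have [measurable]: "z \<in> borel_measurable M" using z by auto
      have e1: "emeasure (density M (\<lambda>\<omega>. ennreal (z \<omega> / c))) (space M) = 1"
      proof -
        have "emeasure (density M (\<lambda>\<omega>. ennreal (z \<omega> / c))) (space M) = (\<integral>\<^sup>+\<omega>. ennreal (z \<omega> / c) \<partial>M)"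
          by (subst emeasure_density) (auto intro!: nn_integral_cong)
        also have "\<dots> = ennreal (\<integral>\<omega>. z \<omega> / c \<partial>M)"
          using z c by (intro nn_integral_eq_integral) auto
        also have "\<dots> = 1" using z c by simp
        finally show ?thesis .
      qed
      interpret D: prob_space "density M (\<lambda>\<omega>. ennreal (z \<omega> / c))"
        by (rule prob_spaceI) (use e1 in simp)
      have V: "V \<in> density M (\<lambda>\<omega>. ennreal (z \<omega> / c)) \<rightarrow>\<^sub>M borel" by simp
      interpret R: prob_space "\<mu> z" unfolding \<mu>_def by (rule D.prob_space_distr[OF V])
      show "real_distribution (\<mu> z)"
        by unfold_locales (auto simp: \<mu>_def)
      have "char (\<mu> z) t = (\<integral>\<omega>. iexp (t * V \<omega>) \<partial>density M (\<lambda>\<omega>. ennreal (z \<omega> / c)))"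
        unfolding char_def \<mu>_def by (rule integral_distr[OF V]) simp
      also have "\<dots> = (\<integral>\<omega>. (z \<omega> / c) *\<^sub>R iexp (t * V \<omega>) \<partial>M)"
        using z c by (intro integral_density) auto
      also have "\<dots> = (\<integral>\<omega>. of_real (z \<omega>) * iexp (t * V \<omega>) / of_real c \<partial>M)"
        by (simp add: scaleR_conv_of_real)
      finally show "char (\<mu> z) t = (\<integral>\<omega>. of_real (z \<omega>) * iexp (t * V \<omega>) \<partial>M) / of_real c"
        by simp
      have "measure (\<mu> z) B = (\<integral>x. indicator B x \<partial>\<mu> z)"
        by (simp add: \<mu>_def)
      also have "\<dots> = (\<integral>\<omega>. indicator B (V \<omega>) \<partial>density M (\<lambda>\<omega>. ennreal (z \<omega> / c)))"
        unfolding \<mu>_def by (rule integral_distr[OF V]) simp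
      also have "\<dots> = (\<integral>\<omega>. (z \<omega> / c) *\<^sub>R indicator B (V \<omega>) \<partial>M)"
        using z c by (intro integral_density) auto
      also have "\<dots> = (\<integral>\<omega>. z \<omega> * indicator B (V \<omega>) / c \<partial>M)" by simp
      finally show "measure (\<mu> z) B = (\<integral>\<omega>. z \<omega> * indicator B (V \<omega>) \<partial>M) / c" by simp
    qed
    have "char (\<mu> zp) = char (\<mu> zn)"
    proof
      fix t
      have "(\<integral>\<omega>. of_real (Z \<omega>) * exp (\<i> * of_real t * of_real (V \<omega>)) \<partial>M) = 0"
        by (rule mgf_zero_imp_char_zero[OF meas int zero])
      then have "(\<integral>\<omega>. of_real (zp \<omega>) * iexp (t * V \<omega>) - of_real (zn \<omega>) * iexp (t * V \<omega>) \<partial>M) = 0"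
        by (simp add: Zeq left_diff_distrib mult.assoc)
      moreover have i: "integrable M (\<lambda>\<omega>. of_real (z \<omega>) * iexp (t * V \<omega>))" if "integrable M z" for z
        using that by (intro Bochner_Integration.integrable_bound[OF that]) (auto simp: norm_mult)
      ultimately have "(\<integral>\<omega>. of_real (zp \<omega>) * iexp (t * V \<omega>) \<partial>M) = (\<integral>\<omega>. of_real (zn \<omega>) * iexp (t * V \<omega>) \<partial>M)"
        using i[OF ipn(1)] i[OF ipn(2)] by simp
      then show "char (\<mu> zp) t = char (\<mu> zn) t"
        using \<mu>(2)[OF ipn(1)] \<mu>(2)[OF ipn(2)] c_def cn nn by simp
    qed
    then have "\<mu> zp = \<mu> zn"
      using \<mu>(1)[OF ipn(1)] \<mu>(1)[OF ipn(2)] c_def cn nn by (intro Levy_uniqueness) auto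
    then have "(\<integral>\<omega>. zp \<omega> * indicator B (V \<omega>) \<partial>M) / c = (\<integral>\<omega>. zn \<omega> * indicator B (V \<omega>) \<partial>M) / c"
      unfolding \<mu>(3)[OF ipn(1) c_def[symmetric] nn(1), symmetric] \<mu>(3)[OF ipn(2) cn[symmetric] nn(2), symmetric]
      by simp
    then have eq: "(\<integral>\<omega>. zp \<omega> * indicator B (V \<omega>) \<partial>M) = (\<integral>\<omega>. zn \<omega> * indicator B (V \<omega>) \<partial>M)"
      using c by simp
    have i: "integrable M (\<lambda>\<omega>. z \<omega> * indicator B (V \<omega>))" if "integrable M z" for z :: "'a \<Rightarrow> real"
      using that by (intro Bochner_Integration.integrable_bound[OF that]) (auto simp: indicator_def)
    show ?thesis unfolding Zeq left_diff_distrib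
      using eq i[OF ipn(1)] i[OF ipn(2)] by simp
  qed
qed

text \<open>Starting every interval at 0 makes the step integral depend, up to
  \<open>W 0 = 0\<close> almost everywhere, only on the values of \<open>W\<close> at times in
  \<open>T\<close>.\<close>

definition times_step :: "real set \<Rightarrow> step \<Rightarrow> bool" where
  "times_step T p \<longleftrightarrow> (\<forall>(c, u, v)\<in>set p. u = 0 \<and> v \<in> T)"

lemma times_step_simps [simp]:
  "times_step T []" "times_step T ((c, u, v) # p) \<longleftrightarrow> u = 0 \<and> v \<in> T \<and> times_step T p"
  by (auto simp: times_step_def)

lemma times_step_on_unit: "T \<subseteq> {0..1} \<Longrightarrow> times_step T p \<Longrightarrow> step_on_unit p"
  by (fastforce simp: times_step_def step_on_unit_def)

context brownian_motion
begin

lemma space_generated_sigma: "space (generated_sigma M W T) = space M"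
  and sets_generated_sigma: "sets (generated_sigma M W T) =
    sigma_sets (space M) {W t -` B \<inter> space M |t B. t \<in> T \<and> B \<in> sets borel}"
  unfolding generated_sigma_def by (rule space_measure_of sets_measure_of; blast)+

lemma subalgebra_generated_sigma:
  assumes "T \<subseteq> {0..1}"
  shows "subalgebra M (generated_sigma M W T)"
  unfolding subalgebra_def space_generated_sigma sets_generated_sigma
proof (intro conjI refl sets.sigma_sets_subset subsetI)
  fix A assume "A \<in> {W t -` B \<inter> space M |t B. t \<in> T \<and> B \<in> sets borel}"
  then obtain t B where A: "A = W t -` B \<inter> space M" "t \<in> T" "B \<in> sets borel" by blast
  then have "W t \<in> borel_measurable M" using assms by (intro measurable_W) auto
  then show "A \<in> sets M" unfolding A(1) using A(3) by (rule measurable_sets)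
qed

lemma measurable_W_generated:
  assumes "t \<in> T"
  shows "W t \<in> borel_measurable (generated_sigma M W T)"
proof (rule measurableI)
  fix B :: "real set" assume "B \<in> sets borel"
  then show "W t -` B \<inter> space (generated_sigma M W T) \<in> sets (generated_sigma M W T)"
    unfolding space_generated_sigma sets_generated_sigma using assms by (intro sigma_sets.Basic) blast
qed simp

text \<open>Exponentials are traded for indicators one time at a time. The remaining exponent
  \<open>p\<close> stays arbitrary so that the induction hypothesis covers
  \<open>(r, 0, t) # p\<close> for all \<open>r\<close>, which is the moment generating function in
  the next variable.\<close>

lemma exponential_zero_imp_cylinder_zero:
  assumes T: "T \<subseteq> {0..1}" and Z: "square_integrable M Z"
    and zero: "\<And>p. times_step T p \<Longrightarrow> (\<integral>\<omega>. Z \<omega> * exp (step_integral W p \<omega>) \<partial>M) = 0"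
    and S: "finite S" "S \<subseteq> T" and B: "\<And>t. B t \<in> sets borel" and p: "times_step T p"
  shows "(\<integral>\<omega>. Z \<omega> * (\<Prod>t\<in>S. indicator (B t) (W t \<omega>)) * exp (step_integral W p \<omega>) \<partial>M) = 0"
  using S p
proof (induction S arbitrary: p rule: finite_induct)
  case empty
  then show ?case using zero by simp
next
  case (insert t S)
  have [measurable]: "Z \<in> borel_measurable M" using Z by (rule square_integrable_measurable)
  have Wm: "W s \<in> borel_measurable M" if "s \<in> T" for s using that T by (intro measurable_W) auto
  have [measurable]: "W t \<in> borel_measurable M" "W 0 \<in> borel_measurable M"
    using insert Wm by (auto intro: measurable_W)
  have [measurable]: "B t \<in> sets borel" by (rule B)
  have unit: "step_on_unit q" if "times_step T q" for q using times_step_on_unit[OF T that] .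
  have m2 [measurable]: "(\<lambda>\<omega>. \<Prod>s\<in>S. indicator (B s) (W s \<omega>) :: real) \<in> borel_measurable M"
  proof (intro borel_measurable_prod)
    fix s assume "s \<in> S"
    then have [measurable]: "W s \<in> borel_measurable M" "B s \<in> sets borel" using insert Wm B by auto
    show "(\<lambda>\<omega>. indicator (B s) (W s \<omega>) :: real) \<in> borel_measurable M" by measurable
  qed
  define Z' where "Z' \<omega> = Z \<omega> * (\<Prod>s\<in>S. indicator (B s) (W s \<omega>)) * exp (step_integral W p \<omega>)" for \<omega>
  \<comment> \<open>Step integrals see only increments, hence \<open>W t - W 0\<close>; the initial
    value is removed at the end by \<open>start_zero\<close>.\<close>
  define V where "V \<omega> = W t \<omega> - W 0 \<omega>" for \<omega>
  have [measurable]: "step_integral W p \<in> borel_measurable M"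
    using insert unit by (intro step_integral_measurable) auto
  have [measurable]: "Z' \<in> borel_measurable M" unfolding Z'_def by measurable
  have [measurable]: "V \<in> borel_measurable M" unfolding V_def by measurable
  have eq: "Z' \<omega> * exp (r * V \<omega>) = Z \<omega> * (\<Prod>s\<in>S. indicator (B s) (W s \<omega>)) * exp (step_integral W ((r, 0, t) # p) \<omega>)" for r \<omega>
    by (simp add: Z'_def V_def exp_add mult_ac)
  have ts: "times_step T ((r, 0, t) # p)" for r using insert by auto
  have int: "integrable M (\<lambda>\<omega>. Z' \<omega> * exp (r * V \<omega>))" for r
    unfolding eq
  proof (rule Bochner_Integration.integrable_bound)
    show "integrable M (\<lambda>\<omega>. Z \<omega> * exp (step_integral W ((r, 0, t) # p) \<omega>))"
      by (intro square_integrable_mult Z exp_step_integral_l2norm unit ts)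
    show "AE \<omega> in M. norm (Z \<omega> * (\<Prod>s\<in>S. indicator (B s) (W s \<omega>)) * exp (step_integral W ((r, 0, t) # p) \<omega>))
       \<le> norm (Z \<omega> * exp (step_integral W ((r, 0, t) # p) \<omega>))"
    proof (rule AE_I2)
      fix \<omega>
      have "\<bar>\<Prod>s\<in>S. indicator (B s) (W s \<omega>) :: real\<bar> \<le> 1"
        unfolding abs_prod by (intro prod_le_1) (auto simp: indicator_def)
      then have "\<bar>\<Prod>s\<in>S. indicator (B s) (W s \<omega>) :: real\<bar> * (\<bar>Z \<omega>\<bar> * exp (step_integral W ((r, 0, t) # p) \<omega>))
         \<le> 1 * (\<bar>Z \<omega>\<bar> * exp (step_integral W ((r, 0, t) # p) \<omega>))"
        by (intro mult_right_mono) auto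
      then show "norm (Z \<omega> * (\<Prod>s\<in>S. indicator (B s) (W s \<omega>)) * exp (step_integral W ((r, 0, t) # p) \<omega>))
       \<le> norm (Z \<omega> * exp (step_integral W ((r, 0, t) # p) \<omega>))" by (simp only: real_norm_def abs_mult mult_ac abs_exp_cancel mult_1)
    qed
    have [measurable]: "step_integral W ((r, 0, t) # p) \<in> borel_measurable M"
      by (intro step_integral_measurable unit ts)
    show "(\<lambda>\<omega>. Z \<omega> * (\<Prod>s\<in>S. indicator (B s) (W s \<omega>)) * exp (step_integral W ((r, 0, t) # p) \<omega>)) \<in> borel_measurable M"
      by (intro borel_measurable_times m2) measurable
  qed
  have zero': "(\<integral>\<omega>. Z' \<omega> * exp (r * V \<omega>) \<partial>M) = 0" for r
    unfolding eq using insert ts by (intro insert.IH) auto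
  have "(\<integral>\<omega>. Z' \<omega> * indicator (B t) (V \<omega>) \<partial>M) = 0"
    by (rule mgf_zero_imp_indicator_zero[OF _ _ int zero' B]) measurable
  moreover have "(\<integral>\<omega>. Z' \<omega> * indicator (B t) (V \<omega>) \<partial>M) =
     (\<integral>\<omega>. Z \<omega> * (\<Prod>t\<in>insert t S. indicator (B t) (W t \<omega>)) * exp (step_integral W p \<omega>) \<partial>M)"
  proof (rule integral_cong_AE)
    show "AE \<omega> in M. Z' \<omega> * indicator (B t) (V \<omega>) = Z \<omega> * (\<Prod>t\<in>insert t S. indicator (B t) (W t \<omega>)) * exp (step_integral W p \<omega>)"
      using start_zero by eventually_elim (use insert in \<open>simp add: Z'_def V_def mult_ac\<close>)
    have "(\<lambda>\<omega>. Z \<omega> * (indicator (B t) (W t \<omega>) * (\<Prod>t\<in>S. indicator (B t) (W t \<omega>))) * exp (step_integral W p \<omega>)) \<in> borel_measurable M"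
      by (intro borel_measurable_times m2) measurable
    then show "(\<lambda>\<omega>. Z \<omega> * (\<Prod>t\<in>insert t S. indicator (B t) (W t \<omega>)) * exp (step_integral W p \<omega>)) \<in> borel_measurable M"
      using insert(1,2) by simp
  qed measurable
  ultimately show ?case by simp
qed

text \<open>The finite-dimensional cylinders over \<open>T\<close> form an intersection-stable
  generator of the generated sigma-algebra, and the sets with vanishing integral form a Dynkin
  system.\<close>

lemma exponential_zero_imp_set_integral_zero:
  assumes T: "T \<subseteq> {0..1}" and Z: "square_integrable M Z"
    and zero: "\<And>p. times_step T p \<Longrightarrow> (\<integral>\<omega>. Z \<omega> * exp (step_integral W p \<omega>) \<partial>M) = 0"
    and A: "A \<in> sets (generated_sigma M W T)"
  shows "(LINT \<omega>:A|M. Z \<omega>) = 0"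
proof -
  let ?cyl = "\<lambda>S B. {\<omega> \<in> space M. \<forall>t\<in>S. W t \<omega> \<in> B t}"
  define P where "P = {?cyl S B |S B. finite S \<and> S \<subseteq> T \<and> (\<forall>t. B t \<in> sets borel)}"
  have intZ: "integrable M Z" using Z by (rule square_integrable_integrable)
  have sub: "P \<subseteq> sets M"
  proof
    fix C assume "C \<in> P"
    then obtain S B where C: "C = ?cyl S B" "finite S" "S \<subseteq> T" "\<forall>t. B t \<in> sets borel" unfolding P_def by blast
    show "C \<in> sets M" unfolding C(1)
    proof (intro sets.sets_Collect_finite_All)
      fix t assume "t \<in> S"
      then have [measurable]: "W t \<in> borel_measurable M" "B t \<in> sets borel" using C T by (auto intro!: measurable_W)
      show "{\<omega> \<in> space M. W t \<omega> \<in> B t} \<in> sets M" by measurable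
    qed (use C in auto)
  qed
  have cylZ: "(LINT \<omega>:C|M. Z \<omega>) = 0" if CP: "C \<in> P" for C
  proof -
    obtain S B where C: "C = ?cyl S B" "finite S" "S \<subseteq> T" "\<forall>t. B t \<in> sets borel" using CP unfolding P_def by blast
    have "(LINT \<omega>:C|M. Z \<omega>) = (\<integral>\<omega>. Z \<omega> * (\<Prod>t\<in>S. indicator (B t) (W t \<omega>)) * exp (step_integral W [] \<omega>) \<partial>M)"
      unfolding set_lebesgue_integral_def
    proof (rule Bochner_Integration.integral_cong[OF refl])
      fix \<omega> assume "\<omega> \<in> space M"
      show "indicator C \<omega> *\<^sub>R Z \<omega> = Z \<omega> * (\<Prod>t\<in>S. indicator (B t) (W t \<omega>)) * exp (step_integral W [] \<omega>)"
      proof (cases "\<forall>t\<in>S. W t \<omega> \<in> B t")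
        case True
        then show ?thesis using \<open>\<omega> \<in> space M\<close> by (simp add: C(1))
      next
        case False
        then obtain t where "t \<in> S" "W t \<omega> \<notin> B t" by auto
        then have "(\<Prod>t\<in>S. indicator (B t) (W t \<omega>) :: real) = 0"
          using C(2) by (intro prod_zero) (auto intro!: bexI[of _ t])
        then show ?thesis using False by (simp add: C(1))
      qed
    qed
    also have "\<dots> = 0" by (rule exponential_zero_imp_cylinder_zero[OF T Z zero C(2,3) C(4)[rule_format]]) auto
    finally show ?thesis .
  qed
  have stable: "Int_stable P"
  proof (rule Int_stableI)
    fix C D assume "C \<in> P" "D \<in> P"
    then obtain S B S' B' where C: "C = ?cyl S B" "finite S" "S \<subseteq> T" "\<forall>t. B t \<in> sets borel"
      and D: "D = ?cyl S' B'" "finite S'" "S' \<subseteq> T" "\<forall>t. B' t \<in> sets borel" unfolding P_def by blast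
    define B'' where "B'' t = (if t \<in> S then B t else UNIV) \<inter> (if t \<in> S' then B' t else UNIV)" for t
    have "C \<inter> D = ?cyl (S \<union> S') B''" by (auto simp: C(1) D(1) B''_def)
    moreover have "B'' t \<in> sets borel" for t
      unfolding B''_def by (rule sets.Int) (simp_all add: C(4) D(4))
    moreover have "finite (S \<union> S')" "S \<union> S' \<subseteq> T" using C D by auto
    ultimately show "C \<inter> D \<in> P" unfolding P_def mem_Collect_eq
      by (intro exI[of _ "S \<union> S'"] exI[of _ B'']) (intro conjI allI)
  qed
  have "A \<in> sigma_sets (space M) P"
  proof -
    have "{W t -` B \<inter> space M |t B. t \<in> T \<and> B \<in> sets borel} \<subseteq> P"
    proof
      fix C assume "C \<in> {W t -` B \<inter> space M |t B. t \<in> T \<and> B \<in> sets borel}"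
      then obtain t B where "C = W t -` B \<inter> space M" "t \<in> T" "B \<in> sets borel" by blast
      then have "C = ?cyl {t} (\<lambda>_. B)" by auto
      then show "C \<in> P" unfolding P_def mem_Collect_eq
        using \<open>t \<in> T\<close> \<open>B \<in> sets borel\<close>
        by (intro exI[of _ "{t}"] exI[of _ "\<lambda>_. B"]) simp
    qed
    moreover have "A \<in> sigma_sets (space M) {W t -` B \<inter> space M |t B. t \<in> T \<and> B \<in> sets borel}"
      using A unfolding sets_generated_sigma .
    ultimately show ?thesis by (rule subsetD[OF sigma_sets_mono'])
  qed
  moreover have "P \<subseteq> Pow (space M)" by (auto simp: P_def)
  ultimately have "Int_stable P" "P \<subseteq> Pow (space M)" "A \<in> sigma_sets (space M) P" using stable by auto
  then show ?thesis
  proof (induction rule: sigma_sets_induct_disjoint)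
    case (basic A)
    then show ?case by (rule cylZ)
  next
    case empty
    show ?case by (simp add: set_lebesgue_integral_def)
  next
    case (compl A)
    have AM: "A \<in> sets M" by (rule subsetD[OF sets.sigma_sets_subset[OF sub] compl(1)])
    have "space M \<in> P" unfolding P_def mem_Collect_eq
      by (intro exI[of _ "{}"] exI[of _ "\<lambda>_. UNIV"]) simp
    then have "(\<integral>\<omega>. Z \<omega> \<partial>M) = 0" using cylZ[of "space M"] set_integral_space[OF intZ] by simp
    moreover have "(LINT \<omega>:space M - A|M. Z \<omega>) = (\<integral>\<omega>. Z \<omega> \<partial>M) - (LINT \<omega>:A|M. Z \<omega>)"
    proof -
      have "(LINT \<omega>:space M - A|M. Z \<omega>) = (\<integral>\<omega>. Z \<omega> - indicator A \<omega> *\<^sub>R Z \<omega> \<partial>M)"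
        unfolding set_lebesgue_integral_def
        by (intro Bochner_Integration.integral_cong) (auto simp: indicator_def)
      also have "\<dots> = (\<integral>\<omega>. Z \<omega> \<partial>M) - (LINT \<omega>:A|M. Z \<omega>)"
        unfolding set_lebesgue_integral_def
        using intZ integrable_mult_indicator[OF AM intZ] by simp
      finally show ?thesis .
    qed
    ultimately show ?case using compl(2) by simp
  next
    case (union A)
    have AM: "A i \<in> sets M" for i using union(2) sets.sigma_sets_subset[OF sub] by auto
    have "(LINT \<omega>:(\<Union>i. A i)|M. Z \<omega>) = (\<Sum>i. (LINT \<omega>:A i|M. Z \<omega>))"
    proof (rule lebesgue_integral_countable_add[OF AM])
      show "A i \<inter> A j = {}" if "i \<noteq> j" for i j using union(1) that by (auto simp: disjoint_family_on_def)
      show "set_integrable M (\<Union>i. A i) Z" unfolding set_integrable_def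
        using AM by (intro integrable_mult_indicator intZ) auto
    qed
    then show ?case using union(3) by simp
  qed
qed

text \<open>Translates between the pathwise exponential of a step and \<open>wick_exp\<close>, which
  uses a chosen version of the integral and a normalising constant.\<close>

lemma integral_mult_exp_step:
  assumes p: "step_on_unit p" and Z: "Z \<in> borel_measurable M"
  shows "(\<integral>\<omega>. Z \<omega> * exp (step_integral W p \<omega>) \<partial>M) =
    (\<integral>\<omega>. Z \<omega> * wick_exp M W (step_fun p) \<omega> \<partial>M) * exp ((\<integral>s. (step_fun p s)\<^sup>2 \<partial>leb01) / 2)"
proof -
  let ?c = "(\<integral>s. (step_fun p s)\<^sup>2 \<partial>leb01) / 2"
  have meas: "Z \<in> borel_measurable M" "wiener_integral M W (step_fun p) \<in> borel_measurable M" "step_integral W p \<in> borel_measurable M"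
    using Z p by (auto intro!: square_integrable_measurable wiener_integral_square_integrable square_integrable_step_fun step_integral_measurable)
  have "AE \<omega> in M. wiener_integral M W (step_fun p) \<omega> = step_integral W p \<omega>"
    by (rule wiener_integral_AE_eq[OF has_wiener_integral_step[OF p]]) (auto simp: square_integrable_step_fun)
  then have ae: "AE \<omega> in M. Z \<omega> * exp (step_integral W p \<omega>) = Z \<omega> * wick_exp M W (step_fun p) \<omega> * exp ?c"
    by eventually_elim (simp add: wick_exp_def mult_exp_exp mult.assoc)
  have "(\<integral>\<omega>. Z \<omega> * exp (step_integral W p \<omega>) \<partial>M) = (\<integral>\<omega>. Z \<omega> * wick_exp M W (step_fun p) \<omega> * exp ?c \<partial>M)"
    by (rule integral_cong_AE[OF _ _ ae]) (use meas in \<open>simp_all add: wick_exp_def[abs_def]\<close>)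
  then show ?thesis by (simp only: integral_mult_left_zero)
qed

end

context brownian_space
begin

text \<open>Step functions already suffice as test functions \<open>g\<close>. Every measurable set
  is a set of the sigma-algebra of the Brownian motion up to a null set, so all set integrals of
  \<open>Z\<close> vanish.\<close>

lemma wick_exp_total:
  assumes Z: "square_integrable M Z"
    and zero: "\<And>g. square_integrable leb01 g \<Longrightarrow> (\<integral>\<omega>. Z \<omega> * wick_exp M W g \<omega> \<partial>M) = 0"
  shows "AE \<omega> in M. Z \<omega> = 0"
proof (rule density_unique_real)
  show intZ: "integrable M Z" using Z by (rule square_integrable_integrable)
  show "integrable M (\<lambda>\<omega>. 0::real)" by simp
  let ?G = "generated_sigma M W {0..1}"
  have zero': "(\<integral>\<omega>. Z \<omega> * exp (step_integral W p \<omega>) \<partial>M) = 0" if "times_step {0..1} p" for p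
    using times_step_on_unit[OF _ that] zero[OF square_integrable_step_fun[of p]] Z
    by (simp add: integral_mult_exp_step square_integrable_measurable)
  fix A assume "A \<in> sets M"
  then have "A \<in> sets (completion (restr_to_subalg M ?G))" using sets_generated by simp
  then obtain S N N' where SN: "A = S \<union> N" "N \<subseteq> N'" "N' \<in> null_sets (restr_to_subalg M ?G)" "S \<in> sets (restr_to_subalg M ?G)"
    by (rule sets_completionE)
  have sa: "subalgebra M ?G" by (rule subalgebra_generated_sigma) simp
  have N': "N' \<in> null_sets M" using SN(3) null_sets_restr_to_subalg[OF sa] by auto
  have S: "S \<in> sets ?G" using SN(4) sets_restr_to_subalg[OF sa] by auto
  then have SM: "S \<in> sets M" using sa by (auto simp: subalgebra_def)
  have "(LINT \<omega>:A|M. Z \<omega>) = (LINT \<omega>:S|M. Z \<omega>)"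
    unfolding set_lebesgue_integral_def
  proof (rule integral_cong_AE)
    show "AE \<omega> in M. indicator A \<omega> *\<^sub>R Z \<omega> = indicator S \<omega> *\<^sub>R Z \<omega>"
      using AE_not_in[OF N'] by eventually_elim (use SN in \<open>auto simp: indicator_def\<close>)
  qed (use \<open>A \<in> sets M\<close> SM intZ in auto)
  also have "\<dots> = 0"
    by (rule exponential_zero_imp_set_integral_zero[OF _ Z zero' S]) auto
  finally show "(LINT \<omega>:A|M. Z \<omega>) = (LINT \<omega>:A|M. 0)" by simp
qed

end

section \<open>Mixtures of complex Wick exponentials\<close>

abbreviation inner01 :: "(real \<Rightarrow> real) \<Rightarrow> (real \<Rightarrow> real) \<Rightarrow> real" where
  "inner01 f g \<equiv> (\<integral>s. f s * g s \<partial>leb01)"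

lemma inner01_sum_left:
  assumes "\<And>j. j \<in> J \<Longrightarrow> square_integrable leb01 (f j)" "square_integrable leb01 g"
  shows "inner01 (\<lambda>s. \<Sum>j\<in>J. c j * f j s) g = (\<Sum>j\<in>J. c j * inner01 (f j) g)"
proof -
  have int: "integrable leb01 (\<lambda>s. c j * (f j s * g s))" if "j \<in> J" for j
    using that by (intro integrable_mult_right square_integrable_mult assms)
  have "inner01 (\<lambda>s. \<Sum>j\<in>J. c j * f j s) g = (\<integral>s. (\<Sum>j\<in>J. c j * (f j s * g s)) \<partial>leb01)"
    by (simp add: sum_distrib_right mult.assoc)
  also have "\<dots> = (\<Sum>j\<in>J. (\<integral>s. c j * (f j s * g s) \<partial>leb01))"
    by (intro Bochner_Integration.integral_sum int)
  finally show ?thesis by simp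
qed

lemma inner01_commute: "inner01 f g = inner01 g f"
  by (simp add: mult.commute)

lemma inner01_sum_both:
  assumes "\<And>j. j \<in> J \<Longrightarrow> square_integrable leb01 (f j)" "\<And>k. k \<in> K \<Longrightarrow> square_integrable leb01 (g k)"
  shows "inner01 (\<lambda>s. \<Sum>j\<in>J. c j * f j s) (\<lambda>s. \<Sum>k\<in>K. d k * g k s) = (\<Sum>j\<in>J. \<Sum>k\<in>K. c j * d k * inner01 (f j) (g k))"
proof -
  have "inner01 (\<lambda>s. \<Sum>j\<in>J. c j * f j s) (\<lambda>s. \<Sum>k\<in>K. d k * g k s)
      = (\<Sum>j\<in>J. c j * inner01 (f j) (\<lambda>s. \<Sum>k\<in>K. d k * g k s))"
    using assms by (intro inner01_sum_left square_integrable_sum square_integrable_cmult)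
  also have "\<dots> = (\<Sum>j\<in>J. c j * (\<Sum>k\<in>K. d k * inner01 (g k) (f j)))"
  proof (intro sum.cong refl)
    fix j assume "j \<in> J"
    then have "inner01 (\<lambda>s. \<Sum>k\<in>K. d k * g k s) (f j) = (\<Sum>k\<in>K. d k * inner01 (g k) (f j))"
      using assms by (intro inner01_sum_left)
    then show "c j * inner01 (f j) (\<lambda>s. \<Sum>k\<in>K. d k * g k s) = c j * (\<Sum>k\<in>K. d k * inner01 (g k) (f j))"
      by (simp only: inner01_commute)
  qed
  finally show ?thesis by (simp add: sum_distrib_left mult.assoc inner01_commute[of "f _"])
qed

context brownian_motion
begin

text \<open>Separating the coefficients into real and imaginary parts reduces this to one pair
  \<open>u\<close>, \<open>v\<close>. The exponent is half of the bilinear square of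
  \<open>u + i v\<close>, without conjugation.\<close>

lemma linear_complex_mgf:
  fixes w :: "'i \<Rightarrow> complex"
  assumes J: "finite J" and h: "\<And>j. j \<in> J \<Longrightarrow> square_integrable leb01 (h j)"
  shows "(\<integral>\<omega>. exp (\<Sum>j\<in>J. w j * of_real (wiener_integral M W (h j) \<omega>)) \<partial>M) =
    exp ((\<Sum>j\<in>J. \<Sum>k\<in>J. w j * w k * of_real (inner01 (h j) (h k))) / 2)"
proof -
  define u where "u s = (\<Sum>j\<in>J. Re (w j) * h j s)" for s
  define v where "v s = (\<Sum>j\<in>J. Im (w j) * h j s)" for s
  have sq: "square_integrable leb01 u" "square_integrable leb01 v"
    unfolding u_def[abs_def] v_def[abs_def] using h by (auto intro!: square_integrable_sum square_integrable_cmult)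
  have "AE \<omega> in M. wiener_integral M W u \<omega> = (\<Sum>j\<in>J. Re (w j) * wiener_integral M W (h j) \<omega>)"
    "AE \<omega> in M. wiener_integral M W v \<omega> = (\<Sum>j\<in>J. Im (w j) * wiener_integral M W (h j) \<omega>)"
    unfolding u_def[abs_def] v_def[abs_def] by (intro wiener_integral_sum J h; assumption)+
  then have ae: "AE \<omega> in M. exp (\<Sum>j\<in>J. w j * of_real (wiener_integral M W (h j) \<omega>)) =
     exp (Complex (wiener_integral M W u \<omega>) (wiener_integral M W v \<omega>))"
  proof eventually_elim
    case (elim \<omega>)
    have "(\<Sum>j\<in>J. w j * of_real (wiener_integral M W (h j) \<omega>)) = Complex (wiener_integral M W u \<omega>) (wiener_integral M W v \<omega>)"
      using elim by (simp add: complex_eq_iff)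
    then show ?case by simp
  qed
  have meas: "wiener_integral M W (h j) \<in> borel_measurable M" if "j \<in> J" for j
    using that by (intro square_integrable_measurable wiener_integral_square_integrable h)
  have m1: "(\<lambda>\<omega>. exp (\<Sum>j\<in>J. w j * of_real (wiener_integral M W (h j) \<omega>))) \<in> borel_measurable M"
  proof -
    note [measurable] = meas
    show ?thesis by measurable
  qed
  have "(\<integral>\<omega>. exp (\<Sum>j\<in>J. w j * of_real (wiener_integral M W (h j) \<omega>)) \<partial>M) =
     (\<integral>\<omega>. exp (Complex (wiener_integral M W u \<omega>) (wiener_integral M W v \<omega>)) \<partial>M)"
    by (rule integral_cong_AE[OF m1 _ ae]) (rule borel_measurable_integrable[OF wiener_complex_mgf(1)[OF sq]])
  also have "\<dots> = exp (Complex ((inner01 u u - inner01 v v) / 2) (inner01 u v))"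
    using wiener_complex_mgf(2)[OF sq] by (simp add: power2_eq_square)
  also have "Complex ((inner01 u u - inner01 v v) / 2) (inner01 u v) =
     (\<Sum>j\<in>J. \<Sum>k\<in>J. w j * w k * of_real (inner01 (h j) (h k))) / 2"
  proof -
    have uu: "inner01 u u = (\<Sum>j\<in>J. \<Sum>k\<in>J. Re (w j) * Re (w k) * inner01 (h j) (h k))"
      and vv: "inner01 v v = (\<Sum>j\<in>J. \<Sum>k\<in>J. Im (w j) * Im (w k) * inner01 (h j) (h k))"
      and uv: "inner01 u v = (\<Sum>j\<in>J. \<Sum>k\<in>J. Re (w j) * Im (w k) * inner01 (h j) (h k))"
      and vu: "inner01 v u = (\<Sum>j\<in>J. \<Sum>k\<in>J. Im (w j) * Re (w k) * inner01 (h j) (h k))"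
      unfolding u_def v_def by (intro inner01_sum_both h; assumption)+
    have "Re (\<Sum>j\<in>J. \<Sum>k\<in>J. w j * w k * of_real (inner01 (h j) (h k))) = inner01 u u - inner01 v v"
      unfolding uu vv by (simp add: sum_subtractf[symmetric] left_diff_distrib)
    moreover have "Im (\<Sum>j\<in>J. \<Sum>k\<in>J. w j * w k * of_real (inner01 (h j) (h k))) = inner01 u v + inner01 v u"
      unfolding uv vu by (simp add: sum.distrib[symmetric] distrib_right)
    moreover have "inner01 v u = inner01 u v" by (rule inner01_commute)
    ultimately show ?thesis by (simp add: complex_eq_iff)
  qed
  finally show ?thesis .
qed

text \<open>Each absolute value costs a sum of two exponentials with opposite signs, and either sign
  is absorbed into \<open>u\<close>; hence \<open>u\<close> is arbitrary in the induction.\<close>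

lemma square_integrable_exp_abs_wiener:
  assumes "finite J" "\<And>j. j \<in> J \<Longrightarrow> square_integrable leb01 (h j)" "square_integrable leb01 u"
  shows "square_integrable M (\<lambda>\<omega>. exp (wiener_integral M W u \<omega> + (\<Sum>j\<in>J. a * \<bar>wiener_integral M W (h j) \<omega>\<bar>)))"
  using assms
proof (induction J arbitrary: u rule: finite_induct)
  case empty
  then show ?case using square_integrable_exp_wiener by simp
next
  case (insert j J)
  let ?I = "wiener_integral M W"
  let ?S = "\<lambda>\<omega>. \<Sum>j\<in>J. a * \<bar>?I (h j) \<omega>\<bar>"
  define u1 where "u1 s = u s + a * h j s" for s
  define u2 where "u2 s = u s + (- a) * h j s" for s
  have sqh: "square_integrable leb01 (h j)" using insert by auto
  have sq: "square_integrable leb01 u1" "square_integrable leb01 u2"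
    unfolding u1_def[abs_def] u2_def[abs_def] by (intro square_integrable_add square_integrable_cmult insert.prems(2) sqh)+
  have IH: "square_integrable M (\<lambda>\<omega>. exp (?I u1 \<omega> + ?S \<omega>) + exp (?I u2 \<omega> + ?S \<omega>))"
    using insert.prems by (intro square_integrable_add insert.IH sq) auto
  have meas: "?I f \<in> borel_measurable M" if "square_integrable leb01 f" for f
    using that by (intro square_integrable_measurable wiener_integral_square_integrable)
  have mS: "?S \<in> borel_measurable M"
    using insert.prems by (intro borel_measurable_sum borel_measurable_times borel_measurable_abs meas) auto
  have m: "(\<lambda>\<omega>. exp (?I u \<omega> + (\<Sum>j\<in>insert j J. a * \<bar>?I (h j) \<omega>\<bar>))) \<in> borel_measurable M"
    using mS meas[OF sqh] meas[OF insert.prems(2)] insert(1,2) by simp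
  have "AE \<omega> in M. ?I u1 \<omega> = ?I u \<omega> + ?I (\<lambda>s. a * h j s) \<omega>" "AE \<omega> in M. ?I u2 \<omega> = ?I u \<omega> + ?I (\<lambda>s. (- a) * h j s) \<omega>"
    "AE \<omega> in M. ?I (\<lambda>s. a * h j s) \<omega> = a * ?I (h j) \<omega>" "AE \<omega> in M. ?I (\<lambda>s. (- a) * h j s) \<omega> = (- a) * ?I (h j) \<omega>"
    unfolding u1_def[abs_def] u2_def[abs_def]
    by (intro wiener_integral_add wiener_integral_cmult insert.prems(2) sqh square_integrable_cmult)+
  then have bd: "AE \<omega> in M. norm ((exp (?I u \<omega> + (\<Sum>j\<in>insert j J. a * \<bar>?I (h j) \<omega>\<bar>)))\<^sup>2) \<le>
      norm ((exp (?I u1 \<omega> + ?S \<omega>) + exp (?I u2 \<omega> + ?S \<omega>))\<^sup>2)"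
  proof eventually_elim
    case (elim \<omega>)
    let ?x = "?I (h j) \<omega>"
    have e: "a * \<bar>?x\<bar> = a * ?x \<or> a * \<bar>?x\<bar> = (- a) * ?x" by (auto simp: abs_if)
    have "exp (?I u \<omega> + (a * \<bar>?x\<bar> + ?S \<omega>)) \<le> exp (?I u \<omega> + a * ?x + ?S \<omega>) + exp (?I u \<omega> + (- a) * ?x + ?S \<omega>)"
    proof -
      have gen: "exp (p + (y + q)) \<le> exp (p + x + q) + exp (p + x' + q)" if "y = x \<or> y = x'" for p q x x' y :: real
        using that by (auto simp: add.assoc)
      show ?thesis by (rule gen[OF e])
    qed
    then have "exp (?I u \<omega> + (\<Sum>j\<in>insert j J. a * \<bar>?I (h j) \<omega>\<bar>)) \<le> exp (?I u1 \<omega> + ?S \<omega>) + exp (?I u2 \<omega> + ?S \<omega>)"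
      by (simp only: sum.insert[OF insert(1,2)] elim)
    then show ?case by (simp add: power_mono)
  qed
  have "integrable M (\<lambda>\<omega>. (exp (?I u \<omega> + (\<Sum>j\<in>insert j J. a * \<bar>?I (h j) \<omega>\<bar>)))\<^sup>2)"
    by (rule Bochner_Integration.integrable_bound[OF square_integrable_power2[OF IH] borel_measurable_power[OF m] bd])
  then show ?case unfolding square_integrable_def using m by simp
qed

end

text \<open>The point \<open>\<theta>\<close> selects the coefficients of a complex linear
  combination of integrands. Their uniform bound \<open>R\<close> gives one square integrable
  envelope for all \<open>\<theta>\<close>, on which every exchange of expectation and mixing
  rests.\<close>

locale wick_mixture = brownian_space M W + N: finite_measure N
  for M :: "'w measure" and W :: "real \<Rightarrow> 'w \<Rightarrow> real" and N :: "'z measure" +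
  fixes J :: "nat set" and z :: "'z \<Rightarrow> nat \<Rightarrow> complex" and R :: real
  assumes finite_J: "finite J"
    and z_measurable: "j \<in> J \<Longrightarrow> (\<lambda>\<theta>. z \<theta> j) \<in> borel_measurable N"
    and z_bounded: "j \<in> J \<Longrightarrow> norm (z \<theta> j) \<le> R"
begin

abbreviation "WI \<equiv> wiener_integral M W"

text \<open>Bilinear, not Hermitian: the mixtures represent real variables, so their inner products
  are expectations of plain products.\<close>

definition gram :: "(nat \<Rightarrow> real \<Rightarrow> real) \<Rightarrow> (nat \<Rightarrow> real \<Rightarrow> real) \<Rightarrow> 'z \<Rightarrow> 'z \<Rightarrow> complex" where
  "gram h h' \<theta> \<theta>' = (\<Sum>j\<in>J. \<Sum>k\<in>J. z \<theta> j * z \<theta>' k * of_real (inner01 (h j) (h' k)))"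

text \<open>The complex Wick exponential of \<open>\<Sum>j. z \<theta> j \<cdot> I (h j)\<close>, where \<open>x\<close> is a version of
  the family \<open>I (h j)\<close>.\<close>

definition cexp :: "(nat \<Rightarrow> real \<Rightarrow> real) \<Rightarrow> (nat \<Rightarrow> real) \<Rightarrow> 'z \<Rightarrow> complex" where
  "cexp h x \<theta> = exp ((\<Sum>j\<in>J. z \<theta> j * of_real (x j)) - gram h h \<theta> \<theta> / 2)"

definition mixture :: "(nat \<Rightarrow> real \<Rightarrow> real) \<Rightarrow> ('z \<Rightarrow> complex) \<Rightarrow> (nat \<Rightarrow> real) \<Rightarrow> complex" where
  "mixture h \<rho> x = (\<integral>\<theta>. \<rho> \<theta> * cexp h x \<theta> \<partial>N)"

abbreviation "L2fam h \<equiv> \<forall>j\<in>J. square_integrable leb01 (h j)"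

definition density_ok :: "('z \<Rightarrow> complex) \<Rightarrow> bool" where
  "density_ok \<rho> \<longleftrightarrow> \<rho> \<in> borel_measurable N \<and> (\<exists>B. \<forall>\<theta>. norm (\<rho> \<theta>) \<le> B)"

lemma density_okD: "density_ok \<rho> \<Longrightarrow> \<rho> \<in> borel_measurable N"
  "density_ok \<rho> \<Longrightarrow> \<exists>B\<ge>0. \<forall>\<theta>. norm (\<rho> \<theta>) \<le> B"
proof -
  assume "density_ok \<rho>"
  then show "\<rho> \<in> borel_measurable N" by (simp add: density_ok_def)
  from \<open>density_ok \<rho>\<close> obtain B where B: "\<forall>\<theta>. norm (\<rho> \<theta>) \<le> B" by (auto simp: density_ok_def)
  then have "\<forall>\<theta>. norm (\<rho> \<theta>) \<le> max 0 B" by (auto simp: le_max_iff_disj)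
  then show "\<exists>B\<ge>0. \<forall>\<theta>. norm (\<rho> \<theta>) \<le> B" by (intro exI[of _ "max 0 B"]) simp
qed

lemma WI_measurable: "square_integrable leb01 f \<Longrightarrow> WI f \<in> borel_measurable M"
  by (intro square_integrable_measurable wiener_integral_square_integrable)

lemma gram_measurable [measurable]:
  "(\<lambda>\<theta>. gram h h' \<theta> \<theta>) \<in> borel_measurable N" "(\<lambda>(\<theta>, \<theta>'). gram h h' \<theta> \<theta>') \<in> borel_measurable (N \<Otimes>\<^sub>M N)"
  "(\<lambda>\<theta>'. gram h h' \<theta> \<theta>') \<in> borel_measurable N"
proof -
  note [measurable] = z_measurable
  show "(\<lambda>\<theta>. gram h h' \<theta> \<theta>) \<in> borel_measurable N" unfolding gram_def by measurable
  show "(\<lambda>(\<theta>, \<theta>'). gram h h' \<theta> \<theta>') \<in> borel_measurable (N \<Otimes>\<^sub>M N)" unfolding gram_def by measurable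
  show "(\<lambda>\<theta>'. gram h h' \<theta> \<theta>') \<in> borel_measurable N" unfolding gram_def by measurable
qed

lemma gram_bounded: "norm (gram h h' \<theta> \<theta>') \<le> (\<Sum>j\<in>J. \<Sum>k\<in>J. R\<^sup>2 * \<bar>inner01 (h j) (h' k)\<bar>)"
  unfolding gram_def
proof (intro order_trans[OF norm_sum] sum_mono)
  fix j k assume jk: "j \<in> J" "k \<in> J"
  have "norm (z \<theta> j) * norm (z \<theta>' k) \<le> R * R"
    using z_bounded[OF jk(1), of \<theta>] z_bounded[OF jk(2), of \<theta>'] norm_ge_zero[of "z \<theta> j"]
    by (intro mult_mono) (auto intro: order_trans[OF norm_ge_zero])
  then show "norm (z \<theta> j * z \<theta>' k * of_real (inner01 (h j) (h' k))) \<le> R\<^sup>2 * \<bar>inner01 (h j) (h' k)\<bar>"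
    by (simp add: norm_mult power2_eq_square mult_right_mono del: integral_mult_right_zero integral_mult_left_zero)
qed

text \<open>Dominates \<open>cexp h x \<theta>\<close> for all \<open>\<theta>\<close> at
  once.\<close>

definition env :: "(nat \<Rightarrow> real \<Rightarrow> real) \<Rightarrow> (nat \<Rightarrow> real) \<Rightarrow> real" where
  "env h x = exp ((\<Sum>j\<in>J. R * \<bar>x j\<bar>) + (\<Sum>j\<in>J. \<Sum>k\<in>J. R\<^sup>2 * \<bar>inner01 (h j) (h k)\<bar>))"

lemma cexp_le_env: "norm (cexp h x \<theta>) \<le> env h x"
proof -
  have "Re ((\<Sum>j\<in>J. z \<theta> j * of_real (x j)) - gram h h \<theta> \<theta> / 2) \<le>
     norm ((\<Sum>j\<in>J. z \<theta> j * of_real (x j)) - gram h h \<theta> \<theta> / 2)"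
    by (rule complex_Re_le_cmod)
  also have "\<dots> \<le> norm (\<Sum>j\<in>J. z \<theta> j * of_real (x j)) + norm (gram h h \<theta> \<theta>) / 2"
    by (rule order_trans[OF norm_triangle_ineq4]) (simp add: norm_divide)
  also have "norm (\<Sum>j\<in>J. z \<theta> j * of_real (x j)) \<le> (\<Sum>j\<in>J. R * \<bar>x j\<bar>)"
    using z_bounded by (intro order_trans[OF norm_sum] sum_mono) (auto simp: norm_mult intro!: mult_right_mono)
  also have "norm (gram h h \<theta> \<theta>) / 2 \<le> (\<Sum>j\<in>J. \<Sum>k\<in>J. R\<^sup>2 * \<bar>inner01 (h j) (h k)\<bar>)"
    using gram_bounded[of h h \<theta> \<theta>] norm_ge_zero[of "gram h h \<theta> \<theta>"] by linarith
  finally show ?thesis unfolding cexp_def env_def norm_exp_eq_Re by simp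
qed

lemma env_square_integrable:
  assumes "L2fam h"
  shows "square_integrable M (\<lambda>\<omega>. env h (\<lambda>j. WI (h j) \<omega>))"
proof -
  let ?S = "\<lambda>\<omega>. \<Sum>j\<in>J. R * \<bar>WI (h j) \<omega>\<bar>"
  have "square_integrable M (\<lambda>\<omega>. exp (WI (\<lambda>s. 0) \<omega> + ?S \<omega>))"
    using assms by (intro square_integrable_exp_abs_wiener finite_J square_integrable_zero) auto
  moreover have "(\<lambda>\<omega>. exp (?S \<omega>)) \<in> borel_measurable M"
  proof -
    have [measurable]: "WI (h j) \<in> borel_measurable M" if "j \<in> J" for j
      using that assms by (intro WI_measurable) auto
    show ?thesis by measurable
  qed
  moreover have "AE \<omega> in M. exp (WI (\<lambda>s. 0) \<omega> + ?S \<omega>) = exp (?S \<omega>)"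
    using wiener_integral_zero by eventually_elim simp
  ultimately have "square_integrable M (\<lambda>\<omega>. exp (?S \<omega>))" by (rule square_integrable_AE_cong)
  from square_integrable_cmult[OF this, of "exp (\<Sum>j\<in>J. \<Sum>k\<in>J. R\<^sup>2 * \<bar>inner01 (h j) (h k)\<bar>)"]
  show ?thesis unfolding env_def exp_add by (simp add: mult.commute)
qed

lemma cexp_measurable:
  assumes "\<And>j. j \<in> J \<Longrightarrow> X j \<in> borel_measurable S"
  shows "(\<lambda>(\<omega>, \<theta>). cexp h (\<lambda>j. X j \<omega>) \<theta>) \<in> borel_measurable (S \<Otimes>\<^sub>M N)"
proof -
  note [measurable] = z_measurable assms
  show ?thesis unfolding cexp_def by measurable
qed

lemma cexp_measurable1:
  assumes "\<And>j. j \<in> J \<Longrightarrow> X j \<in> borel_measurable S"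
  shows "(\<lambda>\<omega>. cexp h (\<lambda>j. X j \<omega>) \<theta>) \<in> borel_measurable S" "(\<lambda>\<theta>. cexp h x \<theta>) \<in> borel_measurable N"
proof -
  note [measurable] = z_measurable assms
  show "(\<lambda>\<omega>. cexp h (\<lambda>j. X j \<omega>) \<theta>) \<in> borel_measurable S" unfolding cexp_def by measurable
  show "(\<lambda>\<theta>. cexp h x \<theta>) \<in> borel_measurable N" unfolding cexp_def by measurable
qed

text \<open>Stated for any family \<open>X\<close> on any space \<open>S\<close>, because the
  conditional expectation needs measurability with respect to the sigma-algebra of the grid
  values.\<close>

lemma mixture_measurable:
  assumes "density_ok \<rho>" "\<And>j. j \<in> J \<Longrightarrow> X j \<in> borel_measurable S"
  shows "(\<lambda>\<omega>. mixture h \<rho> (\<lambda>j. X j \<omega>)) \<in> borel_measurable S"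
  unfolding mixture_def
proof (rule N.borel_measurable_lebesgue_integral)
  have [measurable]: "\<rho> \<in> borel_measurable N" "(\<lambda>(\<omega>, \<theta>). cexp h (\<lambda>j. X j \<omega>) \<theta>) \<in> borel_measurable (S \<Otimes>\<^sub>M N)"
    using assms by (auto intro: density_okD cexp_measurable)
  show "(\<lambda>(\<omega>, \<theta>). \<rho> \<theta> * cexp h (\<lambda>j. X j \<omega>) \<theta>) \<in> borel_measurable (S \<Otimes>\<^sub>M N)" by measurable
qed

abbreviation "mix h \<rho> \<omega> \<equiv> mixture h \<rho> (\<lambda>j. WI (h j) \<omega>)"
abbreviation "cx h \<theta> \<omega> \<equiv> cexp h (\<lambda>j. WI (h j) \<omega>) \<theta>"

lemma mix_measurable: "density_ok \<rho> \<Longrightarrow> L2fam h \<Longrightarrow> (\<lambda>\<omega>. mix h \<rho> \<omega>) \<in> borel_measurable M"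
  by (intro mixture_measurable WI_measurable) auto

lemma mixture_le_env:
  assumes "density_ok \<rho>" "\<And>\<theta>. norm (\<rho> \<theta>) \<le> B"
  shows "norm (mixture h \<rho> x) \<le> B * measure N (space N) * env h x"
proof -
  have "B \<ge> 0" using assms(2) norm_ge_zero order_trans by blast
  have [measurable]: "\<rho> \<in> borel_measurable N" using assms by (intro density_okD)
  have "norm (mixture h \<rho> x) \<le> (\<integral>\<theta>. norm (\<rho> \<theta> * cexp h x \<theta>) \<partial>N)"
    unfolding mixture_def by (rule integral_norm_bound)
  also have "\<dots> \<le> (\<integral>\<theta>. B * env h x \<partial>N)"
  proof (rule integral_mono')
    show "norm (\<rho> \<theta> * cexp h x \<theta>) \<le> B * env h x" for \<theta>
      unfolding norm_mult using assms(2)[of \<theta>] cexp_le_env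
      by (intro mult_mono) (auto intro: order_trans[OF norm_ge_zero])
  qed (use \<open>B \<ge> 0\<close> in \<open>auto simp: env_def\<close>)
  also have "\<dots> = B * measure N (space N) * env h x" by simp
  finally show ?thesis .
qed

lemma norm_mix_square_integrable:
  assumes "density_ok \<rho>" "L2fam h"
  shows "square_integrable M (\<lambda>\<omega>. norm (mix h \<rho> \<omega>))"
proof -
  obtain B where B: "\<And>\<theta>. norm (\<rho> \<theta>) \<le> B" using density_okD(2)[OF assms(1)] by blast
  let ?D = "\<lambda>\<omega>. (B * measure N (space N)) * env h (\<lambda>j. WI (h j) \<omega>)"
  have D: "square_integrable M ?D" by (intro square_integrable_cmult env_square_integrable assms)
  have [measurable]: "(\<lambda>\<omega>. mix h \<rho> \<omega>) \<in> borel_measurable M" by (rule mix_measurable[OF assms])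
  have "integrable M (\<lambda>\<omega>. (norm (mix h \<rho> \<omega>))\<^sup>2)"
  proof (rule Bochner_Integration.integrable_bound[OF square_integrable_power2[OF D]])
    show "AE \<omega> in M. norm ((norm (mix h \<rho> \<omega>))\<^sup>2) \<le> norm ((?D \<omega>)\<^sup>2)"
    proof (rule AE_I2)
      fix \<omega>
      have "norm (mix h \<rho> \<omega>) \<le> ?D \<omega>"
        by (rule mixture_le_env[OF assms(1) B])
      then have "\<bar>norm (mix h \<rho> \<omega>)\<bar> \<le> \<bar>?D \<omega>\<bar>" by simp
      then have "(norm (mix h \<rho> \<omega>))\<^sup>2 \<le> (?D \<omega>)\<^sup>2" by (simp only: abs_le_square_iff)
      then show "norm ((norm (mix h \<rho> \<omega>))\<^sup>2) \<le> norm ((?D \<omega>)\<^sup>2)" by simp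
    qed
  qed measurable
  then show ?thesis unfolding square_integrable_def by simp
qed

lemma cx_norm_square_integrable:
  assumes "L2fam h"
  shows "square_integrable M (\<lambda>\<omega>. norm (cx h \<theta> \<omega>))"
proof -
  note D = env_square_integrable[OF assms]
  have [measurable]: "(\<lambda>\<omega>. cx h \<theta> \<omega>) \<in> borel_measurable M"
    using assms by (intro cexp_measurable1 WI_measurable) auto
  have "integrable M (\<lambda>\<omega>. (norm (cx h \<theta> \<omega>))\<^sup>2)"
  proof (rule Bochner_Integration.integrable_bound[OF square_integrable_power2[OF D]])
    show "AE \<omega> in M. norm ((norm (cx h \<theta> \<omega>))\<^sup>2) \<le> norm ((env h (\<lambda>j. WI (h j) \<omega>))\<^sup>2)"
      using cexp_le_env by (intro AE_I2) (simp add: power_mono)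
  qed measurable
  then show ?thesis unfolding square_integrable_def by simp
qed

text \<open>Fubini; the dominating function is \<open>norm (G \<omega>)\<close> times the envelope
  times a bound of \<open>\<rho>\<close>.\<close>

lemma expectation_mult_mix:
  fixes G :: "'w \<Rightarrow> complex"
  assumes \<rho>: "density_ok \<rho>" and h: "L2fam h" and G: "G \<in> borel_measurable M" "square_integrable M (\<lambda>\<omega>. norm (G \<omega>))"
  shows "(\<integral>\<omega>. G \<omega> * mix h \<rho> \<omega> \<partial>M) = (\<integral>\<theta>. \<rho> \<theta> * (\<integral>\<omega>. G \<omega> * cx h \<theta> \<omega> \<partial>M) \<partial>N)"
proof -
  interpret P: pair_sigma_finite M N ..
  obtain B where B: "B \<ge> 0" "\<And>\<theta>. norm (\<rho> \<theta>) \<le> B" using density_okD(2)[OF \<rho>] by blast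
  let ?E = "\<lambda>\<omega>. env h (\<lambda>j. WI (h j) \<omega>)"
  have cm [measurable]: "(\<lambda>(\<omega>, \<theta>). cx h \<theta> \<omega>) \<in> borel_measurable (M \<Otimes>\<^sub>M N)"
    using h by (intro cexp_measurable WI_measurable) auto
  have [measurable]: "G \<in> borel_measurable M" "\<rho> \<in> borel_measurable N" "?E \<in> borel_measurable M"
    using \<rho> G h by (auto intro: density_okD square_integrable_measurable env_square_integrable)
  have GE: "integrable M (\<lambda>\<omega>. norm (G \<omega>) * ?E \<omega>)"
    by (intro square_integrable_mult G env_square_integrable h)
  have "integrable (M \<Otimes>\<^sub>M N) (\<lambda>(\<omega>, \<theta>). norm (G \<omega>) * ?E \<omega> * B)"
  proof (rule P.Fubini_integrable)
    show "integrable M (\<lambda>\<omega>. \<integral>\<theta>. norm (case (\<omega>, \<theta>) of (\<omega>, \<theta>) \<Rightarrow> norm (G \<omega>) * ?E \<omega> * B) \<partial>N)"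
    proof -
      have "norm (norm (G \<omega>) * ?E \<omega> * B) = norm (G \<omega>) * ?E \<omega> * B" for \<omega>
        using B(1) by (simp add: env_def abs_mult)
      then have "(\<integral>\<theta>. norm (norm (G \<omega>) * ?E \<omega> * B) \<partial>N) = (norm (G \<omega>) * ?E \<omega>) * (B * measure N (space N))" for \<omega>
        by (simp only: lebesgue_integral_const real_scaleR_def mult_ac)
      then show ?thesis unfolding prod.case using integrable_mult_left[OF GE] by (simp only:)
    qed
  qed auto
  then have int: "integrable (M \<Otimes>\<^sub>M N) (\<lambda>(\<omega>, \<theta>). G \<omega> * (\<rho> \<theta> * cx h \<theta> \<omega>))"
  proof (rule Bochner_Integration.integrable_bound)
    show "AE x in M \<Otimes>\<^sub>M N. norm (case x of (\<omega>, \<theta>) \<Rightarrow> G \<omega> * (\<rho> \<theta> * cx h \<theta> \<omega>)) \<le>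
       norm (case x of (\<omega>, \<theta>) \<Rightarrow> norm (G \<omega>) * ?E \<omega> * B)"
    proof (rule AE_I2, clarify)
      fix \<omega> \<theta>
      have "norm (\<rho> \<theta>) * norm (cx h \<theta> \<omega>) \<le> B * ?E \<omega>"
        using B cexp_le_env by (intro mult_mono) auto
      then have "norm (G \<omega>) * (norm (\<rho> \<theta>) * norm (cx h \<theta> \<omega>)) \<le> norm (G \<omega>) * (B * ?E \<omega>)"
        by (intro mult_left_mono) auto
      then show "norm (G \<omega> * (\<rho> \<theta> * cx h \<theta> \<omega>)) \<le> norm (norm (G \<omega>) * ?E \<omega> * B)"
        using B(1) by (simp add: norm_mult env_def mult_ac)
    qed
  qed measurable
  have "(\<integral>\<omega>. G \<omega> * mix h \<rho> \<omega> \<partial>M) = (\<integral>\<omega>. \<integral>\<theta>. G \<omega> * (\<rho> \<theta> * cx h \<theta> \<omega>) \<partial>N \<partial>M)"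
    unfolding mixture_def by simp
  also have "\<dots> = (\<integral>\<theta>. \<integral>\<omega>. G \<omega> * (\<rho> \<theta> * cx h \<theta> \<omega>) \<partial>M \<partial>N)"
    using P.Fubini_integral[OF int] by simp
  also have "\<dots> = (\<integral>\<theta>. \<rho> \<theta> * (\<integral>\<omega>. G \<omega> * cx h \<theta> \<omega> \<partial>M) \<partial>N)"
    by (simp only: mult.left_commute[of "G _"] integral_mult_right_zero)
  finally show ?thesis .
qed

text \<open>Both linear combinations are read as one, indexed by the disjoint sum
  \<open>J <+> J\<close>. The diagonal Gram terms cancel against the normalisations and the two
  equal cross terms remain, each with factor one half.\<close>

lemma cx_inner:
  assumes h: "L2fam h" "L2fam h'"
  shows "(\<integral>\<omega>. cx h \<theta> \<omega> * cx h' \<theta>' \<omega> \<partial>M) = exp (gram h h' \<theta> \<theta>')"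
proof -
  let ?J = "J <+> J"
  let ?h = "case_sum h h'" and ?w = "case_sum (z \<theta>) (z \<theta>')"
  have J: "finite ?J" using finite_J by simp
  have sum: "(\<Sum>j\<in>?J. f j) = (\<Sum>j\<in>J. f (Inl j)) + (\<Sum>j\<in>J. f (Inr j))" for f :: "nat + nat \<Rightarrow> complex"
    using finite_J by (simp add: sum.Plus)
  have sq: "square_integrable leb01 (?h j)" if "j \<in> ?J" for j using that h by auto
  let ?c = "exp (- gram h h \<theta> \<theta> / 2 - gram h' h' \<theta>' \<theta>' / 2)"
  have "(\<integral>\<omega>. cx h \<theta> \<omega> * cx h' \<theta>' \<omega> \<partial>M) = (\<integral>\<omega>. ?c * exp (\<Sum>j\<in>?J. ?w j * of_real (WI (?h j) \<omega>)) \<partial>M)"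
  proof (rule Bochner_Integration.integral_cong[OF refl])
    fix \<omega>
    show "cx h \<theta> \<omega> * cx h' \<theta>' \<omega> = ?c * exp (\<Sum>j\<in>?J. ?w j * of_real (WI (?h j) \<omega>))"
      unfolding cexp_def sum mult_exp_exp by (simp add: algebra_simps)
  qed
  also have "\<dots> = ?c * exp ((\<Sum>j\<in>?J. \<Sum>k\<in>?J. ?w j * ?w k * of_real (inner01 (?h j) (?h k))) / 2)"
    by (simp only: integral_mult_right_zero linear_complex_mgf[OF J sq])
  also have "(\<Sum>j\<in>?J. \<Sum>k\<in>?J. ?w j * ?w k * of_real (inner01 (?h j) (?h k))) =
     gram h h \<theta> \<theta> + gram h h' \<theta> \<theta>' + (gram h' h \<theta>' \<theta> + gram h' h' \<theta>' \<theta>')"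
    unfolding gram_def by (simp add: sum sum.distrib)
  also have "gram h' h \<theta>' \<theta> = gram h h' \<theta> \<theta>'"
    unfolding gram_def by (subst sum.swap) (simp add: mult_ac)
  also have "?c * exp ((gram h h \<theta> \<theta> + gram h h' \<theta> \<theta>' + (gram h h' \<theta> \<theta>' + gram h' h' \<theta>' \<theta>')) / 2) = exp (gram h h' \<theta> \<theta>')"
    unfolding mult_exp_exp by (rule arg_cong[where f=exp]) (simp add: field_simps)
  finally show ?thesis .
qed

lemma mix_inner:
  assumes \<rho>: "density_ok \<rho>" "density_ok \<rho>'" and h: "L2fam h" "L2fam h'"
  shows "(\<integral>\<omega>. mix h \<rho> \<omega> * mix h' \<rho>' \<omega> \<partial>M) = (\<integral>\<theta>'. \<rho>' \<theta>' * (\<integral>\<theta>. \<rho> \<theta> * exp (gram h h' \<theta> \<theta>') \<partial>N) \<partial>N)"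
proof -
  have m: "(\<lambda>\<omega>. cx h' \<theta>' \<omega>) \<in> borel_measurable M" for \<theta>'
    using h by (intro cexp_measurable1 WI_measurable) auto
  have "(\<integral>\<omega>. mix h \<rho> \<omega> * mix h' \<rho>' \<omega> \<partial>M) = (\<integral>\<theta>'. \<rho>' \<theta>' * (\<integral>\<omega>. mix h \<rho> \<omega> * cx h' \<theta>' \<omega> \<partial>M) \<partial>N)"
    by (rule expectation_mult_mix[OF \<rho>(2) h(2) mix_measurable[OF \<rho>(1) h(1)] norm_mix_square_integrable[OF \<rho>(1) h(1)]])
  moreover have "(\<integral>\<omega>. mix h \<rho> \<omega> * cx h' \<theta>' \<omega> \<partial>M) = (\<integral>\<theta>. \<rho> \<theta> * exp (gram h h' \<theta> \<theta>') \<partial>N)" for \<theta>'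
  proof -
    have "(\<integral>\<omega>. mix h \<rho> \<omega> * cx h' \<theta>' \<omega> \<partial>M) = (\<integral>\<omega>. cx h' \<theta>' \<omega> * mix h \<rho> \<omega> \<partial>M)" by (simp only: mult.commute)
    moreover have "\<dots> = (\<integral>\<theta>. \<rho> \<theta> * (\<integral>\<omega>. cx h' \<theta>' \<omega> * cx h \<theta> \<omega> \<partial>M) \<partial>N)"
      by (rule expectation_mult_mix[OF \<rho>(1) h(1) m cx_norm_square_integrable[OF h(2)]])
    moreover have "(\<integral>\<omega>. cx h' \<theta>' \<omega> * cx h \<theta> \<omega> \<partial>M) = exp (gram h h' \<theta> \<theta>')" for \<theta>
      using cx_inner[OF h, of \<theta> \<theta>'] by (simp only: mult.commute)
    ultimately show ?thesis by (simp only:)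
  qed
  ultimately show ?thesis by (simp only:)
qed

text \<open>As for two complex exponentials, with \<open>g\<close> adjoined as one extra index of
  coefficient 1.\<close>

lemma cx_wick_exp:
  assumes h: "L2fam h" and g: "square_integrable leb01 g"
  shows "(\<integral>\<omega>. of_real (wick_exp M W g \<omega>) * cx h \<theta> \<omega> \<partial>M) = exp (\<Sum>j\<in>J. z \<theta> j * of_real (inner01 (h j) g))"
proof -
  let ?J = "J <+> {()}"
  let ?h = "case_sum h (\<lambda>_. g)" and ?w = "case_sum (z \<theta>) (\<lambda>_. 1)"
  have J: "finite ?J" using finite_J by simp
  have sum: "(\<Sum>j\<in>?J. f j) = (\<Sum>j\<in>J. f (Inl j)) + f (Inr ())" for f :: "nat + unit \<Rightarrow> complex"
    using finite_J by (simp add: sum.Plus)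
  have sq: "square_integrable leb01 (?h j)" if "j \<in> ?J" for j using that h g by auto
  let ?c = "exp (- gram h h \<theta> \<theta> / 2 - of_real (inner01 g g) / 2)"
  have "(\<integral>\<omega>. of_real (wick_exp M W g \<omega>) * cx h \<theta> \<omega> \<partial>M) = (\<integral>\<omega>. ?c * exp (\<Sum>j\<in>?J. ?w j * of_real (WI (?h j) \<omega>)) \<partial>M)"
  proof (rule Bochner_Integration.integral_cong[OF refl])
    fix \<omega>
    show "of_real (wick_exp M W g \<omega>) * cx h \<theta> \<omega> = ?c * exp (\<Sum>j\<in>?J. ?w j * of_real (WI (?h j) \<omega>))"
      unfolding wick_exp_def exp_of_real[symmetric] cexp_def sum mult_exp_exp
      by (rule arg_cong[where f=exp]) (simp add: power2_eq_square algebra_simps)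
  qed
  also have "\<dots> = ?c * exp ((\<Sum>j\<in>?J. \<Sum>k\<in>?J. ?w j * ?w k * of_real (inner01 (?h j) (?h k))) / 2)"
    by (simp only: integral_mult_right_zero linear_complex_mgf[OF J sq])
  also have "(\<Sum>j\<in>?J. \<Sum>k\<in>?J. ?w j * ?w k * of_real (inner01 (?h j) (?h k))) =
     gram h h \<theta> \<theta> + (\<Sum>j\<in>J. z \<theta> j * of_real (inner01 (h j) g)) + ((\<Sum>j\<in>J. z \<theta> j * of_real (inner01 (h j) g)) + of_real (inner01 g g))"
  proof -
    have comm: "inner01 g (h j) = inner01 (h j) g" for j by (rule inner01_commute)
    show ?thesis unfolding gram_def by (simp add: sum sum.distrib comm)
  qed
  also have "?c * exp ((gram h h \<theta> \<theta> + (\<Sum>j\<in>J. z \<theta> j * of_real (inner01 (h j) g)) + ((\<Sum>j\<in>J. z \<theta> j * of_real (inner01 (h j) g)) + of_real (inner01 g g))) / 2)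
     = exp (\<Sum>j\<in>J. z \<theta> j * of_real (inner01 (h j) g))"
    unfolding mult_exp_exp by (rule arg_cong[where f=exp]) (simp add: field_simps)
  finally show ?thesis .
qed

end

context brownian_motion
begin

lemma wick_exp_square_integrable:
  assumes "square_integrable leb01 g"
  shows "square_integrable M (wick_exp M W g)"
proof -
  have "wick_exp M W g = (\<lambda>\<omega>. exp (- (\<integral>s. (g s)\<^sup>2 \<partial>leb01) / 2) * exp (wiener_integral M W g \<omega>))"
    by (auto simp: wick_exp_def mult_exp_exp)
  then show ?thesis using square_integrable_cmult[OF square_integrable_exp_wiener[OF assms]] by simp
qed

end

section \<open>S-transforms of mixtures\<close>

context wick_mixture
begin

text \<open>The S-transform of the mixture. It sees the family \<open>h\<close> only through its
  inner products with \<open>g\<close>, which is what makes conditioning on the grid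
  computable.\<close>

definition S_mix :: "(nat \<Rightarrow> real \<Rightarrow> real) \<Rightarrow> ('z \<Rightarrow> complex) \<Rightarrow> (real \<Rightarrow> real) \<Rightarrow> complex" where
  "S_mix h \<rho> g = (\<integral>\<theta>. \<rho> \<theta> * exp (\<Sum>j\<in>J. z \<theta> j * of_real (inner01 (h j) g)) \<partial>N)"

lemma S_mix_integrable:
  assumes "density_ok \<rho>"
  shows "integrable N (\<lambda>\<theta>. \<rho> \<theta> * exp (\<Sum>j\<in>J. z \<theta> j * of_real (inner01 (h j) g)))"
proof -
  let ?e = "\<lambda>\<theta>. exp (\<Sum>j\<in>J. z \<theta> j * of_real (inner01 (h j) g))"
  have e: "norm (?e \<theta>) \<le> exp (\<Sum>j\<in>J. R * \<bar>inner01 (h j) g\<bar>)" for \<theta>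
  proof -
    have "Re (\<Sum>j\<in>J. z \<theta> j * of_real (inner01 (h j) g)) \<le> norm (\<Sum>j\<in>J. z \<theta> j * of_real (inner01 (h j) g))"
      by (rule complex_Re_le_cmod)
    also have "\<dots> \<le> (\<Sum>j\<in>J. R * \<bar>inner01 (h j) g\<bar>)"
    proof (intro order_trans[OF norm_sum] sum_mono)
      fix j assume "j \<in> J"
      then show "norm (z \<theta> j * of_real (inner01 (h j) g)) \<le> R * \<bar>inner01 (h j) g\<bar>"
        unfolding norm_mult norm_of_real by (intro mult_right_mono z_bounded) auto
    qed
    finally show ?thesis unfolding norm_exp_eq_Re by simp
  qed
  note [measurable] = z_measurable
  obtain B where B: "B \<ge> 0" "\<And>\<theta>. norm (\<rho> \<theta>) \<le> B" using density_okD(2)[OF assms] by blast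
  show ?thesis
  proof (rule N.integrable_const_bound[of _ "B * exp (\<Sum>j\<in>J. R * \<bar>inner01 (h j) g\<bar>)"])
    show "AE \<theta> in N. norm (\<rho> \<theta> * ?e \<theta>) \<le> B * exp (\<Sum>j\<in>J. R * \<bar>inner01 (h j) g\<bar>)"
      unfolding norm_mult using B e by (intro AE_I2 mult_mono) auto
    have "?e \<in> borel_measurable N" by measurable
    then show "(\<lambda>\<theta>. \<rho> \<theta> * ?e \<theta>) \<in> borel_measurable N"
      by (intro borel_measurable_times density_okD(1)[OF assms])
  qed
qed

lemma density_ok_times_coord:
  assumes "density_ok \<rho>" "k \<in> J"
  shows "density_ok (\<lambda>\<theta>. \<rho> \<theta> * z \<theta> k)"
proof -
  obtain B where B: "B \<ge> 0" "\<And>\<theta>. norm (\<rho> \<theta>) \<le> B" using density_okD(2)[OF assms(1)] by blast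
  have "norm (\<rho> \<theta> * z \<theta> k) \<le> B * R" for \<theta>
    unfolding norm_mult using B z_bounded[OF assms(2)] by (intro mult_mono) auto
  moreover have "(\<lambda>\<theta>. \<rho> \<theta> * z \<theta> k) \<in> borel_measurable N"
    by (intro borel_measurable_times density_okD(1)[OF assms(1)] z_measurable assms)
  ultimately show ?thesis unfolding density_ok_def by blast
qed

lemma density_ok_cmult:
  assumes "density_ok \<rho>"
  shows "density_ok (\<lambda>\<theta>. c * \<rho> \<theta>)"
proof -
  obtain B where B: "B \<ge> 0" "\<And>\<theta>. norm (\<rho> \<theta>) \<le> B" using density_okD(2)[OF assms] by blast
  have "norm (c * \<rho> \<theta>) \<le> norm c * B" for \<theta>
    unfolding norm_mult using B by (intro mult_left_mono) auto
  moreover have "(\<lambda>\<theta>. c * \<rho> \<theta>) \<in> borel_measurable N"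
    by (intro borel_measurable_times borel_measurable_const density_okD(1)[OF assms])
  ultimately show ?thesis unfolding density_ok_def by blast
qed

lemma S_mix_cmult: "S_mix h (\<lambda>\<theta>. c * \<rho> \<theta>) g = c * S_mix h \<rho> g"
  unfolding S_mix_def mult.assoc by (rule integral_mult_right_zero)

lemma density_ok_add:
  assumes "density_ok \<rho>" "density_ok \<rho>'"
  shows "density_ok (\<lambda>\<theta>. \<rho> \<theta> + \<rho>' \<theta>)"
proof -
  obtain B where B: "\<And>\<theta>. norm (\<rho> \<theta>) \<le> B" using density_okD(2)[OF assms(1)] by blast
  obtain B' where B': "\<And>\<theta>. norm (\<rho>' \<theta>) \<le> B'" using density_okD(2)[OF assms(2)] by blast
  have "norm (\<rho> \<theta> + \<rho>' \<theta>) \<le> B + B'" for \<theta>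
    using B B' by (intro order_trans[OF norm_triangle_ineq] add_mono)
  moreover have "(\<lambda>\<theta>. \<rho> \<theta> + \<rho>' \<theta>) \<in> borel_measurable N"
    by (intro borel_measurable_add density_okD(1) assms)
  ultimately show ?thesis unfolding density_ok_def by blast
qed

lemma S_mix_add:
  assumes "density_ok \<rho>" "density_ok \<rho>'"
  shows "S_mix h (\<lambda>\<theta>. \<rho> \<theta> + \<rho>' \<theta>) g = S_mix h \<rho> g + S_mix h \<rho>' g"
  unfolding S_mix_def distrib_right
  by (intro Bochner_Integration.integral_add S_mix_integrable assms)

lemma S_mix_derivative:
  assumes \<rho>: "density_ok \<rho>"
  shows "S_mix h (\<lambda>\<theta>. \<rho> \<theta> * (\<Sum>j\<in>J. z \<theta> j * of_real (c j))) g = (\<Sum>j\<in>J. of_real (c j) * S_mix h (\<lambda>\<theta>. \<rho> \<theta> * z \<theta> j) g)"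
proof -
  let ?e = "\<lambda>\<theta>. exp (\<Sum>j\<in>J. z \<theta> j * of_real (inner01 (h j) g))"
  have "S_mix h (\<lambda>\<theta>. \<rho> \<theta> * (\<Sum>j\<in>J. z \<theta> j * of_real (c j))) g =
      (\<integral>\<theta>. (\<Sum>j\<in>J. of_real (c j) * (\<rho> \<theta> * z \<theta> j * ?e \<theta>)) \<partial>N)"
    unfolding S_mix_def sum_distrib_left sum_distrib_right by (simp only: mult_ac)
  also have "\<dots> = (\<Sum>j\<in>J. (\<integral>\<theta>. of_real (c j) * (\<rho> \<theta> * z \<theta> j * ?e \<theta>) \<partial>N))"
    by (intro Bochner_Integration.integral_sum integrable_mult_right S_mix_integrable density_ok_times_coord \<rho>)
  finally show ?thesis unfolding S_mix_def by (simp only: integral_mult_right_zero)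
qed

lemma mix_wick_exp:
  assumes \<rho>: "density_ok \<rho>" and h: "L2fam h" and g: "square_integrable leb01 g"
  shows "(\<integral>\<omega>. mix h \<rho> \<omega> * of_real (wick_exp M W g \<omega>) \<partial>M) = S_mix h \<rho> g"
proof -
  have sq: "square_integrable M (wick_exp M W g)" by (rule wick_exp_square_integrable[OF g])
  have m: "(\<lambda>\<omega>. complex_of_real (wick_exp M W g \<omega>)) \<in> borel_measurable M"
    using square_integrable_measurable[OF sq] by simp
  have n: "square_integrable M (\<lambda>\<omega>. norm (complex_of_real (wick_exp M W g \<omega>)))"
  proof -
    have "norm (complex_of_real (wick_exp M W g \<omega>)) = wick_exp M W g \<omega>" for \<omega> by (simp add: wick_exp_def)
    then show ?thesis using sq by (simp only:)
  qed
  have "(\<integral>\<omega>. mix h \<rho> \<omega> * of_real (wick_exp M W g \<omega>) \<partial>M) = (\<integral>\<omega>. of_real (wick_exp M W g \<omega>) * mix h \<rho> \<omega> \<partial>M)"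
    by (simp add: mult.commute)
  also have "\<dots> = S_mix h \<rho> g"
    unfolding expectation_mult_mix[OF \<rho> h m n] S_mix_def cx_wick_exp[OF h g] ..
  finally show ?thesis .
qed

lemma mix_complex_square_integrable:
  assumes "density_ok \<rho>" "L2fam h"
  shows "square_integrable M (\<lambda>\<omega>. Re (mix h \<rho> \<omega>))" "square_integrable M (\<lambda>\<omega>. Im (mix h \<rho> \<omega>))"
proof -
  note sq = norm_mix_square_integrable[OF assms]
  have [measurable]: "(\<lambda>\<omega>. mix h \<rho> \<omega>) \<in> borel_measurable M" by (rule mix_measurable[OF assms])
  have "integrable M (\<lambda>\<omega>. (Re (mix h \<rho> \<omega>))\<^sup>2)"
    by (rule Bochner_Integration.integrable_bound[OF square_integrable_power2[OF sq]])
       (auto simp: abs_le_square_iff[symmetric] abs_Re_le_cmod)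
  then show "square_integrable M (\<lambda>\<omega>. Re (mix h \<rho> \<omega>))" by (simp add: square_integrable_def)
  have "integrable M (\<lambda>\<omega>. (Im (mix h \<rho> \<omega>))\<^sup>2)"
    by (rule Bochner_Integration.integrable_bound[OF square_integrable_power2[OF sq]])
       (auto simp: abs_le_square_iff[symmetric] abs_Im_le_cmod)
  then show "square_integrable M (\<lambda>\<omega>. Im (mix h \<rho> \<omega>))" by (simp add: square_integrable_def)
qed

text \<open>Totality of the Wick exponentials is applied separately to the real part minus
  \<open>X\<close> and to the imaginary part.\<close>

lemma mix_representation:
  assumes \<rho>: "density_ok \<rho>" and h: "L2fam h"
    and X: "square_integrable M X" and S: "\<And>g. square_integrable leb01 g \<Longrightarrow> S_mix h \<rho> g = of_real (\<integral>\<omega>. X \<omega> * wick_exp M W g \<omega> \<partial>M)"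
  shows "AE \<omega> in M. mix h \<rho> \<omega> = of_real (X \<omega>)"
proof -
  note sq = mix_complex_square_integrable[OF \<rho> h]
  have int: "integrable M (\<lambda>\<omega>. mix h \<rho> \<omega> * of_real (wick_exp M W g \<omega>))" if g: "square_integrable leb01 g" for g
  proof (rule Bochner_Integration.integrable_bound)
    show "integrable M (\<lambda>\<omega>. norm (mix h \<rho> \<omega>) * wick_exp M W g \<omega>)"
      by (intro square_integrable_mult norm_mix_square_integrable wick_exp_square_integrable \<rho> h g)
    have [measurable]: "(\<lambda>\<omega>. mix h \<rho> \<omega>) \<in> borel_measurable M" "wick_exp M W g \<in> borel_measurable M"
      using mix_measurable[OF \<rho> h] wick_exp_square_integrable[OF g] by (auto simp: square_integrable_def)
    show "(\<lambda>\<omega>. mix h \<rho> \<omega> * of_real (wick_exp M W g \<omega>)) \<in> borel_measurable M" by measurable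
  qed (simp add: norm_mult)
  have Re: "(\<integral>\<omega>. Re (mix h \<rho> \<omega>) * wick_exp M W g \<omega> \<partial>M) = (\<integral>\<omega>. X \<omega> * wick_exp M W g \<omega> \<partial>M)"
    and Im: "(\<integral>\<omega>. Im (mix h \<rho> \<omega>) * wick_exp M W g \<omega> \<partial>M) = 0" if g: "square_integrable leb01 g" for g
    using integral_Re[OF int[OF g]] integral_Im[OF int[OF g]] mix_wick_exp[OF \<rho> h g] S[OF g] by simp_all
  have "AE \<omega> in M. Re (mix h \<rho> \<omega>) - X \<omega> = 0"
  proof (rule wick_exp_total)
    show "square_integrable M (\<lambda>\<omega>. Re (mix h \<rho> \<omega>) - X \<omega>)" by (intro square_integrable_diff sq X)
    fix g assume g: "square_integrable leb01 g"
    have "integrable M (\<lambda>\<omega>. Re (mix h \<rho> \<omega>) * wick_exp M W g \<omega>)" "integrable M (\<lambda>\<omega>. X \<omega> * wick_exp M W g \<omega>)"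
      by (intro square_integrable_mult sq X wick_exp_square_integrable g)+
    then show "(\<integral>\<omega>. (Re (mix h \<rho> \<omega>) - X \<omega>) * wick_exp M W g \<omega> \<partial>M) = 0"
      using Re[OF g] by (simp add: left_diff_distrib)
  qed
  moreover have "AE \<omega> in M. Im (mix h \<rho> \<omega>) = 0"
    by (rule wick_exp_total[OF sq(2) Im])
  ultimately show ?thesis by eventually_elim (simp add: complex_eq_iff)
qed

text \<open>Source of all existence statements: a real functional of mixture form is the S-transform
  of the real part of the mixture. This supplies the witnesses for the choices in
  \<open>wick_product\<close> and \<open>wick_series\<close>.\<close>

lemma mix_real_exists:
  assumes \<rho>: "density_ok \<rho>" and h: "L2fam h"
    and S: "\<And>g. square_integrable leb01 g \<Longrightarrow> S_mix h \<rho> g = of_real (G g)"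
  obtains X where "square_integrable M X"
    "\<And>g. square_integrable leb01 g \<Longrightarrow> (\<integral>\<omega>. X \<omega> * wick_exp M W g \<omega> \<partial>M) = G g"
proof
  note sq = mix_complex_square_integrable[OF \<rho> h]
  show "square_integrable M (\<lambda>\<omega>. Re (mix h \<rho> \<omega>))" by (rule sq)
  fix g assume g: "square_integrable leb01 g"
  have int: "integrable M (\<lambda>\<omega>. mix h \<rho> \<omega> * of_real (wick_exp M W g \<omega>))"
  proof (rule Bochner_Integration.integrable_bound)
    show "integrable M (\<lambda>\<omega>. norm (mix h \<rho> \<omega>) * wick_exp M W g \<omega>)"
      by (intro square_integrable_mult norm_mix_square_integrable wick_exp_square_integrable \<rho> h g)
    have [measurable]: "(\<lambda>\<omega>. mix h \<rho> \<omega>) \<in> borel_measurable M" "wick_exp M W g \<in> borel_measurable M"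
      using mix_measurable[OF \<rho> h] wick_exp_square_integrable[OF g] by (auto simp: square_integrable_def)
    show "(\<lambda>\<omega>. mix h \<rho> \<omega> * of_real (wick_exp M W g \<omega>)) \<in> borel_measurable M" by measurable
  qed (simp add: norm_mult)
  show "(\<integral>\<omega>. Re (mix h \<rho> \<omega>) * wick_exp M W g \<omega> \<partial>M) = G g"
    using integral_Re[OF int] mix_wick_exp[OF \<rho> h g] S[OF g] by simp
qed

lemma real_mix_inner:
  assumes \<rho>: "density_ok \<rho>" "density_ok \<rho>'" and h: "L2fam h" "L2fam h'"
    and X: "X \<in> borel_measurable M" "X' \<in> borel_measurable M"
    and eq: "AE \<omega> in M. mix h \<rho> \<omega> = of_real (X \<omega>)" "AE \<omega> in M. mix h' \<rho>' \<omega> = of_real (X' \<omega>)"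
  shows "of_real (\<integral>\<omega>. X \<omega> * X' \<omega> \<partial>M) = (\<integral>\<theta>'. \<rho>' \<theta>' * (\<integral>\<theta>. \<rho> \<theta> * exp (gram h h' \<theta> \<theta>') \<partial>N) \<partial>N)"
proof -
  have "complex_of_real (\<integral>\<omega>. X \<omega> * X' \<omega> \<partial>M) = (\<integral>\<omega>. complex_of_real (X \<omega> * X' \<omega>) \<partial>M)"
    by (rule integral_complex_of_real[symmetric])
  also have "\<dots> = (\<integral>\<omega>. mix h \<rho> \<omega> * mix h' \<rho>' \<omega> \<partial>M)"
  proof (rule integral_cong_AE)
    show "AE \<omega> in M. complex_of_real (X \<omega> * X' \<omega>) = mix h \<rho> \<omega> * mix h' \<rho>' \<omega>"
      using eq by eventually_elim simp
    show "(\<lambda>\<omega>. complex_of_real (X \<omega> * X' \<omega>)) \<in> borel_measurable M" using X by simp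
    show "(\<lambda>\<omega>. mix h \<rho> \<omega> * mix h' \<rho>' \<omega>) \<in> borel_measurable M"
      by (intro borel_measurable_times mix_measurable \<rho> h)
  qed
  also have "\<dots> = (\<integral>\<theta>'. \<rho>' \<theta>' * (\<integral>\<theta>. \<rho> \<theta> * exp (gram h h' \<theta> \<theta>') \<partial>N) \<partial>N)" by (rule mix_inner[OF \<rho> h])
  finally show ?thesis .
qed

end

section \<open>Discretisation error of a mixture\<close>

text \<open>Caratheodory's form of the derivative avoids dividing by \<open>\<delta> n\<close>,
  which may vanish.\<close>

lemma scaled_exp_minus_1_limit:
  fixes \<delta> :: "nat \<Rightarrow> complex"
  assumes c: "(\<lambda>n. c n * \<delta> n) \<longlonglongrightarrow> d" and \<delta>: "\<delta> \<longlonglongrightarrow> 0"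
  shows "(\<lambda>n. c n * (exp (\<delta> n) - 1)) \<longlonglongrightarrow> d"
proof -
  have "DERIV exp (0::complex) :> 1" using DERIV_exp[of "0::complex"] by simp
  then obtain g where g: "\<And>z. exp z - exp 0 = g z * (z - (0::complex))" "isCont g 0" "g 0 = 1"
    unfolding CARAT_DERIV by blast
  have "(\<lambda>n. g (\<delta> n)) \<longlonglongrightarrow> g 0" using g(2) \<delta> by (rule isCont_tendsto_compose)
  then have "(\<lambda>n. c n * \<delta> n * g (\<delta> n)) \<longlonglongrightarrow> d * 1" unfolding g(3) by (intro tendsto_mult c)
  moreover have "exp z - 1 = g z * z" for z using g(1)[of z] by simp
  ultimately show ?thesis by (simp add: mult_ac)
qed

text \<open>\<open>step_integral\<close> without the values at the left end points. For
  \<open>times_step\<close> these are \<open>W 0\<close>, which is zero only almost everywhere and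
  need not be measurable with respect to the values at the times in \<open>T\<close>.\<close>

definition time_integral :: "(real \<Rightarrow> 'w \<Rightarrow> real) \<Rightarrow> step \<Rightarrow> 'w \<Rightarrow> real" where
  "time_integral W p \<omega> = (\<Sum>(c, u, v)\<leftarrow>p. c * W v \<omega>)"

lemma time_integral_simps [simp]:
  "time_integral W [] \<omega> = 0" "time_integral W ((c, u, v) # p) \<omega> = c * W v \<omega> + time_integral W p \<omega>"
  by (auto simp: time_integral_def)

lemma (in brownian_motion) time_integral_measurable:
  "times_step T p \<Longrightarrow> time_integral W p \<in> borel_measurable (generated_sigma M W T)"
proof (induction p)
  case Nil
  then show ?case by (simp cong: measurable_cong)
next
  case (Cons x p)
  obtain c u v where x: "x = (c, u, v)" by (cases x)
  have [measurable]: "W v \<in> borel_measurable (generated_sigma M W T)" "time_integral W p \<in> borel_measurable (generated_sigma M W T)"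
    using Cons x by (auto intro: measurable_W_generated)
  have "(\<lambda>\<omega>. c * W v \<omega> + time_integral W p \<omega>) \<in> borel_measurable (generated_sigma M W T)" by measurable
  then show ?case by (simp add: x cong: measurable_cong)
qed

lemma (in brownian_motion) time_integral_AE:
  assumes "times_step T p"
  shows "AE \<omega> in M. step_integral W p \<omega> = time_integral W p \<omega>"
  using start_zero
proof eventually_elim
  case (elim \<omega>)
  show ?case using assms
  proof (induction p)
    case (Cons x p)
    then show ?case using elim by (cases x) auto
  qed simp
qed

context wick_mixture
begin

definition pair_integral :: "('z \<Rightarrow> complex) \<Rightarrow> ('z \<Rightarrow> 'z \<Rightarrow> complex) \<Rightarrow> complex" where
  "pair_integral \<rho> E = (\<integral>x. \<rho> (fst x) * \<rho> (snd x) * E (fst x) (snd x) \<partial>(N \<Otimes>\<^sub>M N))"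

lemma density_mult_bounded:
  assumes \<rho>: "density_ok \<rho>" and b: "\<And>\<theta> \<theta>'. norm (E \<theta> \<theta>') \<le> C"
  shows "\<exists>B. \<forall>\<theta> \<theta>'. norm (\<rho> \<theta> * \<rho> \<theta>' * E \<theta> \<theta>') \<le> B"
proof -
  obtain B where B: "B \<ge> 0" "\<And>\<theta>. norm (\<rho> \<theta>) \<le> B" using density_okD(2)[OF \<rho>] by blast
  have "norm (\<rho> \<theta> * \<rho> \<theta>' * E \<theta> \<theta>') \<le> B * B * C" for \<theta> \<theta>'
    unfolding norm_mult using B b[of \<theta> \<theta>'] by (intro mult_mono) auto
  then show ?thesis by blast
qed

lemma pair_integrable:
  assumes \<rho>: "density_ok \<rho>" and E: "(\<lambda>x. E (fst x) (snd x)) \<in> borel_measurable (N \<Otimes>\<^sub>M N)"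
    and b: "\<And>\<theta> \<theta>'. norm (E \<theta> \<theta>') \<le> C"
  shows "integrable (N \<Otimes>\<^sub>M N) (\<lambda>x. \<rho> (fst x) * \<rho> (snd x) * E (fst x) (snd x))"
proof -
  interpret NN: finite_measure "N \<Otimes>\<^sub>M N" by (rule finite_measure_pair_measure) unfold_locales
  have [measurable]: "\<rho> \<in> borel_measurable N" using \<rho> by (rule density_okD)
  note [measurable] = E
  obtain B where B: "\<And>\<theta> \<theta>'. norm (\<rho> \<theta> * \<rho> \<theta>' * E \<theta> \<theta>') \<le> B"
    using density_mult_bounded[where E=E, OF \<rho> b] by blast
  show ?thesis
    by (rule NN.integrable_const_bound[of _ B]) (use B in \<open>auto intro!: AE_I2\<close>)
qed

lemma pair_integral_iterated:
  assumes \<rho>: "density_ok \<rho>" and E: "(\<lambda>x. E (fst x) (snd x)) \<in> borel_measurable (N \<Otimes>\<^sub>M N)"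
    and b: "\<And>\<theta> \<theta>'. norm (E \<theta> \<theta>') \<le> C"
  shows "(\<integral>\<theta>'. \<rho> \<theta>' * (\<integral>\<theta>. \<rho> \<theta> * E \<theta> \<theta>' \<partial>N) \<partial>N) = pair_integral \<rho> E"
proof -
  interpret P: pair_sigma_finite N N ..
  have int: "integrable (N \<Otimes>\<^sub>M N) (\<lambda>(\<theta>, \<theta>'). \<rho> \<theta> * \<rho> \<theta>' * E \<theta> \<theta>')"
    using pair_integrable[OF assms] by (simp add: case_prod_beta')
  have "(\<integral>\<theta>'. \<rho> \<theta>' * (\<integral>\<theta>. \<rho> \<theta> * E \<theta> \<theta>' \<partial>N) \<partial>N) = (\<integral>\<theta>'. (\<integral>\<theta>. \<rho> \<theta> * \<rho> \<theta>' * E \<theta> \<theta>' \<partial>N) \<partial>N)"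
    by (simp only: integral_mult_right_zero[symmetric] mult.assoc mult.left_commute)
  also have "\<dots> = pair_integral \<rho> E"
    unfolding P.integral_snd[OF int] pair_integral_def by (simp add: case_prod_beta')
  finally show ?thesis .
qed

lemma gram_pair_measurable:
  "(\<lambda>x. gram h h' (fst x) (snd x)) \<in> borel_measurable (N \<Otimes>\<^sub>M N)"
  using gram_measurable(2)[of h h'] by (simp add: case_prod_beta')

lemma exp_gram_bounded:
  "norm (exp (gram h h' \<theta> \<theta>')) \<le> exp (\<Sum>j\<in>J. \<Sum>k\<in>J. R\<^sup>2 * \<bar>inner01 (h j) (h' k)\<bar>)"
  using gram_bounded[of h h' \<theta> \<theta>'] complex_Re_le_cmod[of "gram h h' \<theta> \<theta>'"]
  unfolding norm_exp_eq_Re by simp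

lemma exp_gram_pair_measurable:
  "(\<lambda>x. exp (gram h h' (fst x) (snd x))) \<in> borel_measurable (N \<Otimes>\<^sub>M N)"
  using gram_pair_measurable[of h h'] by measurable

lemma real_mix_norm:
  assumes \<rho>: "density_ok \<rho>" and h: "L2fam h" and X: "X \<in> borel_measurable M"
    and eq: "AE \<omega> in M. mix h \<rho> \<omega> = of_real (X \<omega>)"
  shows "of_real (\<integral>\<omega>. (X \<omega>)\<^sup>2 \<partial>M) = pair_integral \<rho> (\<lambda>\<theta> \<theta>'. exp (gram h h \<theta> \<theta>'))"
  unfolding power2_eq_square real_mix_inner[OF \<rho> \<rho> h h X X eq eq]
  by (rule pair_integral_iterated[OF \<rho> exp_gram_pair_measurable exp_gram_bounded])

text \<open>\<open>h'\<close> consists of the projections of \<open>h\<close> onto the steps with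
  times in \<open>T\<close>, and the conditional expectation is the mixture with \<open>h'\<close>
  in place of \<open>h\<close>. The error is then a difference of two second moments by Pythagoras.
  Real S-transforms ensure that the projected mixture is real almost everywhere.\<close>

lemma cond_exp_mix:
  assumes T: "T \<subseteq> {0..1}" and \<rho>: "density_ok \<rho>" and h: "L2fam h"
    and p: "\<And>j. j \<in> J \<Longrightarrow> times_step T (p j)" and h': "\<And>j. j \<in> J \<Longrightarrow> h' j = step_fun (p j)"
    and proj: "\<And>j q. j \<in> J \<Longrightarrow> times_step T q \<Longrightarrow> inner01 (h j) (step_fun q) = inner01 (h' j) (step_fun q)"
    and real: "\<And>g. square_integrable leb01 g \<Longrightarrow> S_mix h' \<rho> g \<in> \<real>"
    and X: "square_integrable M X" and eq: "AE \<omega> in M. mix h \<rho> \<omega> = of_real (X \<omega>)"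
  shows "complex_of_real (\<integral>\<omega>. (X \<omega> - real_cond_exp M (generated_sigma M W T) X \<omega>)\<^sup>2 \<partial>M) =
    pair_integral \<rho> (\<lambda>\<theta> \<theta>'. exp (gram h h \<theta> \<theta>')) - pair_integral \<rho> (\<lambda>\<theta> \<theta>'. exp (gram h' h' \<theta> \<theta>'))"
proof -
  let ?F = "generated_sigma M W T"
  have sa: "subalgebra M ?F" by (rule subalgebra_generated_sigma[OF T])
  interpret sigma_finite_subalgebra M ?F
  proof
    show "subalgebra M ?F" by (rule sa)
    interpret F: prob_space "restr_to_subalg M ?F" by (rule prob_space_restr_to_subalg[OF sa prob_space_axioms])
    show "\<exists>A. countable A \<and> A \<subseteq> sets (restr_to_subalg M ?F) \<and> \<Union> A = space (restr_to_subalg M ?F)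
       \<and> (\<forall>a\<in>A. emeasure (restr_to_subalg M ?F) a \<noteq> \<infinity>)"
      by (rule F.sigma_finite_countable)
  qed
  have unit: "step_on_unit q" if "times_step T q" for q using times_step_on_unit[OF T that] .
  have hs: "L2fam h'" using h' square_integrable_step_fun by auto
  have "S_mix h' \<rho> g = of_real (Re (S_mix h' \<rho> g))" if "square_integrable leb01 g" for g
    using real[OF that] by (auto elim: Reals_cases)
  then obtain X' where X': "square_integrable M X'"
    "\<And>g. square_integrable leb01 g \<Longrightarrow> (\<integral>\<omega>. X' \<omega> * wick_exp M W g \<omega> \<partial>M) = Re (S_mix h' \<rho> g)"
    using mix_real_exists[OF \<rho> hs, of "\<lambda>g. Re (S_mix h' \<rho> g)"] by blast
  have eq': "AE \<omega> in M. mix h' \<rho> \<omega> = of_real (X' \<omega>)"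
    by (rule mix_representation[OF \<rho> hs X'(1)]) (use X'(2) real in \<open>auto elim: Reals_cases\<close>)
  \<comment> \<open>This version is built from the values of \<open>W\<close> at times in
    \<open>T\<close> and is therefore exactly measurable for the conditioning sigma-algebra, not
    just up to null sets.\<close>
  define Y where "Y \<omega> = Re (mixture h' \<rho> (\<lambda>j. time_integral W (p j) \<omega>))" for \<omega>
  have YF: "Y \<in> borel_measurable ?F"
    unfolding Y_def using mixture_measurable[OF \<rho> time_integral_measurable[OF p], of "\<lambda>j. j" h'] by measurable
  then have YM: "Y \<in> borel_measurable M" by (rule measurable_from_subalg[OF sa])
  have WIp: "AE \<omega> in M. \<forall>j\<in>J. WI (h' j) \<omega> = time_integral W (p j) \<omega>"
  proof (subst AE_ball_countable)
    show "countable J" using finite_J by (rule countable_finite)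
    show "\<forall>j\<in>J. AE \<omega> in M. WI (h' j) \<omega> = time_integral W (p j) \<omega>"
    proof
      fix j assume j: "j \<in> J"
      have "AE \<omega> in M. WI (h' j) \<omega> = step_integral W (p j) \<omega>"
        unfolding h'[OF j]
        by (rule wiener_integral_AE_eq[OF has_wiener_integral_step[OF unit[OF p[OF j]]]]) (auto simp: square_integrable_step_fun)
      with time_integral_AE[OF p[OF j]] show "AE \<omega> in M. WI (h' j) \<omega> = time_integral W (p j) \<omega>"
        by eventually_elim simp
    qed
  qed
  have YX': "AE \<omega> in M. Y \<omega> = X' \<omega>"
    using WIp eq'
  proof eventually_elim
    case (elim \<omega>)
    have "mixture h' \<rho> (\<lambda>j. time_integral W (p j) \<omega>) = mix h' \<rho> \<omega>"
      unfolding mixture_def cexp_def using elim(1) by (intro Bochner_Integration.integral_cong refl) simp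
    then show ?case using elim(2) by (simp add: Y_def)
  qed
  have sqY: "square_integrable M Y"
    by (rule square_integrable_AE_cong[OF X'(1) YM]) (use YX' in \<open>auto elim: eventually_mono\<close>)
  have eqY: "AE \<omega> in M. mix h' \<rho> \<omega> = of_real (Y \<omega>)"
    using eq' YX' by eventually_elim simp
  have XM: "X \<in> borel_measurable M" using X by (rule square_integrable_measurable)
  have "AE \<omega> in M. real_cond_exp M ?F X \<omega> = Y \<omega>"
  proof (rule real_cond_exp_charact[OF _ _ _ YF])
    show iX: "integrable M X" and iY: "integrable M Y" using X sqY by (auto intro: square_integrable_integrable)
    fix A assume A: "A \<in> sets ?F"
    have AM: "A \<in> sets M" using A sa by (auto simp: subalgebra_def)
    have sqd: "square_integrable M (\<lambda>\<omega>. X \<omega> - Y \<omega>)" by (rule square_integrable_diff[OF X sqY])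
    \<comment> \<open>It is enough to test with exponentials of steps over \<open>T\<close>; there
      the S-transforms of \<open>X\<close> and \<open>Y\<close> agree because \<open>h\<close> and
      \<open>h'\<close> have the same inner products with such steps.\<close>
    have "(LINT \<omega>:A|M. X \<omega> - Y \<omega>) = 0"
    proof (rule exponential_zero_imp_set_integral_zero[OF T sqd _ A])
      fix q assume q: "times_step T q"
      let ?g = "step_fun q"
      have g: "square_integrable leb01 ?g" by (rule square_integrable_step_fun)
      have SX: "of_real (\<integral>\<omega>. X \<omega> * wick_exp M W ?g \<omega> \<partial>M) = S_mix h \<rho> ?g"
        and SY: "of_real (\<integral>\<omega>. Y \<omega> * wick_exp M W ?g \<omega> \<partial>M) = S_mix h' \<rho> ?g"
      proof -
        have m: "wick_exp M W ?g \<in> borel_measurable M" using wick_exp_square_integrable[OF g] by (rule square_integrable_measurable)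
        have gen: "of_real (\<integral>\<omega>. V \<omega> * wick_exp M W ?g \<omega> \<partial>M) = S_mix k \<rho> ?g"
          if "V \<in> borel_measurable M" "AE \<omega> in M. mix k \<rho> \<omega> = of_real (V \<omega>)" "L2fam k" for V k
        proof -
          have "complex_of_real (\<integral>\<omega>. V \<omega> * wick_exp M W ?g \<omega> \<partial>M) = (\<integral>\<omega>. complex_of_real (V \<omega> * wick_exp M W ?g \<omega>) \<partial>M)"
            by (rule integral_complex_of_real[symmetric])
          also have "\<dots> = (\<integral>\<omega>. mix k \<rho> \<omega> * of_real (wick_exp M W ?g \<omega>) \<partial>M)"
          proof (rule integral_cong_AE)
            show "AE \<omega> in M. complex_of_real (V \<omega> * wick_exp M W ?g \<omega>) = mix k \<rho> \<omega> * of_real (wick_exp M W ?g \<omega>)"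
              using that(2) by eventually_elim simp
            show "(\<lambda>\<omega>. mix k \<rho> \<omega> * of_real (wick_exp M W ?g \<omega>)) \<in> borel_measurable M"
              using m by (intro borel_measurable_times mix_measurable \<rho> that(3)) simp
          qed (use that(1) m in simp)
          also have "\<dots> = S_mix k \<rho> ?g" by (rule mix_wick_exp[OF \<rho> that(3) g])
          finally show ?thesis .
        qed
        show "of_real (\<integral>\<omega>. X \<omega> * wick_exp M W ?g \<omega> \<partial>M) = S_mix h \<rho> ?g" by (rule gen[OF XM eq h])
        show "of_real (\<integral>\<omega>. Y \<omega> * wick_exp M W ?g \<omega> \<partial>M) = S_mix h' \<rho> ?g" by (rule gen[OF YM eqY hs])
      qed
      have "S_mix h \<rho> ?g = S_mix h' \<rho> ?g"
        unfolding S_mix_def using proj[OF _ q] by (simp cong: sum.cong)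
      then have "(\<integral>\<omega>. X \<omega> * wick_exp M W ?g \<omega> \<partial>M) = (\<integral>\<omega>. Y \<omega> * wick_exp M W ?g \<omega> \<partial>M)"
        unfolding SX[symmetric] SY[symmetric] of_real_eq_iff .
      moreover have "integrable M (\<lambda>\<omega>. X \<omega> * wick_exp M W ?g \<omega>)" "integrable M (\<lambda>\<omega>. Y \<omega> * wick_exp M W ?g \<omega>)"
        by (intro square_integrable_mult X sqY wick_exp_square_integrable g)+
      ultimately have "(\<integral>\<omega>. (X \<omega> - Y \<omega>) * wick_exp M W ?g \<omega> \<partial>M) = 0"
        by (simp add: left_diff_distrib)
      then show "(\<integral>\<omega>. (X \<omega> - Y \<omega>) * exp (step_integral W q \<omega>) \<partial>M) = 0"
        using integral_mult_exp_step[OF unit[OF q], of "\<lambda>\<omega>. X \<omega> - Y \<omega>"] XM YM by simp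
    qed
    then show "(LINT \<omega>:A|M. X \<omega>) = (LINT \<omega>:A|M. Y \<omega>)"
      using integrable_mult_indicator[OF AM iX] integrable_mult_indicator[OF AM iY]
      by (simp add: set_lebesgue_integral_def right_diff_distrib)
  qed
  then have "(\<integral>\<omega>. (X \<omega> - real_cond_exp M ?F X \<omega>)\<^sup>2 \<partial>M) = (\<integral>\<omega>. (X \<omega> - Y \<omega>)\<^sup>2 \<partial>M)"
    using XM YM by (intro integral_cong_AE) (auto elim: eventually_mono)
  also have "\<dots> = (\<integral>\<omega>. (X \<omega>)\<^sup>2 - 2 * (X \<omega> * Y \<omega>) + (Y \<omega>)\<^sup>2 \<partial>M)"
    by (intro Bochner_Integration.integral_cong) (auto simp: power2_diff)
  also have "\<dots> = (\<integral>\<omega>. (X \<omega>)\<^sup>2 \<partial>M) - 2 * (\<integral>\<omega>. X \<omega> * Y \<omega> \<partial>M) + (\<integral>\<omega>. (Y \<omega>)\<^sup>2 \<partial>M)"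
    using square_integrable_power2[OF X] square_integrable_power2[OF sqY] square_integrable_mult[OF X sqY] by simp
  also have "(\<integral>\<omega>. X \<omega> * Y \<omega> \<partial>M) = (\<integral>\<omega>. (Y \<omega>)\<^sup>2 \<partial>M)"
  proof -
    \<comment> \<open>\<open>h' k\<close> is itself a step over \<open>T\<close>, so
      \<open>proj\<close> applies to it: \<open>h - h'\<close> is orthogonal to
      \<open>h'\<close>.\<close>
    have "gram h h' \<theta> \<theta>' = gram h' h' \<theta> \<theta>'" for \<theta> \<theta>'
      unfolding gram_def
    proof (intro sum.cong refl)
      fix j k assume "j \<in> J" "k \<in> J"
      then have "inner01 (h j) (h' k) = inner01 (h' j) (h' k)"
        unfolding h'[OF \<open>k \<in> J\<close>] by (intro proj p)
      then show "z \<theta> j * z \<theta>' k * of_real (inner01 (h j) (h' k)) = z \<theta> j * z \<theta>' k * of_real (inner01 (h' j) (h' k))"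
        by (simp only:)
    qed
    then have "complex_of_real (\<integral>\<omega>. X \<omega> * Y \<omega> \<partial>M) = of_real (\<integral>\<omega>. Y \<omega> * Y \<omega> \<partial>M)"
      unfolding real_mix_inner[OF \<rho> \<rho> h hs XM YM eq eqY] real_mix_inner[OF \<rho> \<rho> hs hs YM YM eqY eqY] by simp
    then show ?thesis unfolding of_real_eq_iff by (simp add: power2_eq_square)
  qed
  finally have "(\<integral>\<omega>. (X \<omega> - real_cond_exp M ?F X \<omega>)\<^sup>2 \<partial>M) = (\<integral>\<omega>. (X \<omega>)\<^sup>2 \<partial>M) - (\<integral>\<omega>. (Y \<omega>)\<^sup>2 \<partial>M)" by simp
  then show ?thesis
    unfolding real_mix_norm[OF \<rho> h XM eq, symmetric] real_mix_norm[OF \<rho> hs YM eqY, symmetric] by simp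
qed

text \<open>Inner product of the mixtures with densities \<open>\<rho> z_j\<close> and
  \<open>\<rho> z_k\<close>, that is, of two formal partial derivatives.\<close>

definition moment :: "(nat \<Rightarrow> real \<Rightarrow> real) \<Rightarrow> ('z \<Rightarrow> complex) \<Rightarrow> nat \<Rightarrow> nat \<Rightarrow> complex" where
  "moment h \<rho> j k = pair_integral \<rho> (\<lambda>\<theta> \<theta>'. z \<theta> j * z \<theta>' k * exp (gram h h \<theta> \<theta>'))"

lemma moment_integrand:
  assumes "j \<in> J" "k \<in> J"
  shows "(\<lambda>x. z (fst x) j * z (snd x) k * exp (gram h h (fst x) (snd x))) \<in> borel_measurable (N \<Otimes>\<^sub>M N)"
    "norm (z \<theta> j * z \<theta>' k * exp (gram h h \<theta> \<theta>')) \<le> R * R * exp (\<Sum>j\<in>J. \<Sum>k\<in>J. R\<^sup>2 * \<bar>inner01 (h j) (h k)\<bar>)"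
proof -
  note [measurable] = z_measurable[OF assms(1)] z_measurable[OF assms(2)] exp_gram_pair_measurable[of h h]
  show "(\<lambda>x. z (fst x) j * z (snd x) k * exp (gram h h (fst x) (snd x))) \<in> borel_measurable (N \<Otimes>\<^sub>M N)"
    by measurable
  show "norm (z \<theta> j * z \<theta>' k * exp (gram h h \<theta> \<theta>')) \<le> R * R * exp (\<Sum>j\<in>J. \<Sum>k\<in>J. R\<^sup>2 * \<bar>inner01 (h j) (h k)\<bar>)"
    unfolding norm_mult
    using z_bounded[OF assms(1), of \<theta>] z_bounded[OF assms(2), of \<theta>'] exp_gram_bounded[of h h \<theta> \<theta>']
      norm_ge_zero[of "z \<theta> j"]
    by (intro mult_mono) (auto intro: order_trans[OF norm_ge_zero])
qed

lemma moment_cmult: "moment h (\<lambda>\<theta>. c * \<rho> \<theta>) j k = c\<^sup>2 * moment h \<rho> j k"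
proof -
  have "moment h (\<lambda>\<theta>. c * \<rho> \<theta>) j k = (\<integral>x. c\<^sup>2 * (\<rho> (fst x) * \<rho> (snd x) * (z (fst x) j * z (snd x) k * exp (gram h h (fst x) (snd x)))) \<partial>(N \<Otimes>\<^sub>M N))"
    unfolding moment_def pair_integral_def power2_eq_square by (simp only: mult_ac)
  also have "\<dots> = c\<^sup>2 * moment h \<rho> j k"
    unfolding moment_def pair_integral_def by (rule integral_mult_right_zero)
  finally show ?thesis .
qed

text \<open>Linearises exp at the limiting Gram form. The scaled difference of the Gram forms is
  bounded uniformly in both parameters, because the coefficients are bounded and finitely many
  convergent sequences enter.\<close>

lemma pair_integral_gram_limit:
  assumes \<rho>: "density_ok \<rho>"
    and lim: "\<And>j k. j \<in> J \<Longrightarrow> k \<in> J \<Longrightarrow>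
      (\<lambda>n. (real n)\<^sup>2 * (inner01 (h j) (h k) - inner01 (hn n j) (hn n k))) \<longlonglongrightarrow> d j k"
  shows "(\<lambda>n. of_real ((real n)\<^sup>2) * (pair_integral \<rho> (\<lambda>\<theta> \<theta>'. exp (gram h h \<theta> \<theta>')) -
      pair_integral \<rho> (\<lambda>\<theta> \<theta>'. exp (gram (hn n) (hn n) \<theta> \<theta>')))) \<longlonglongrightarrow>
    (\<Sum>j\<in>J. \<Sum>k\<in>J. of_real (d j k) * moment h \<rho> j k)"
proof -
  interpret NN: finite_measure "N \<Otimes>\<^sub>M N" by (rule finite_measure_pair_measure) unfold_locales
  let ?q = "\<lambda>x. gram h h (fst x) (snd x)" and ?qn = "\<lambda>n x. gram (hn n) (hn n) (fst x) (snd x)"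
  let ?r = "\<lambda>x. \<rho> (fst x) * \<rho> (snd x)"
  let ?e = "\<lambda>n j k. (real n)\<^sup>2 * (inner01 (h j) (h k) - inner01 (hn n j) (hn n k))"
  have [measurable]: "\<rho> \<in> borel_measurable N" using \<rho> by (rule density_okD)
  have mq [measurable]: "?q \<in> borel_measurable (N \<Otimes>\<^sub>M N)" "?qn n \<in> borel_measurable (N \<Otimes>\<^sub>M N)" for n
    by (rule gram_pair_measurable)+
  \<comment> \<open>Convergent sequences are bounded; \<open>C\<close> below collects these bounds
    with the factor \<open>R\<^sup>2\<close> from the coefficients.\<close>
  obtain K where K: "\<And>j k n. j \<in> J \<Longrightarrow> k \<in> J \<Longrightarrow> \<bar>?e n j k\<bar> \<le> K j k"
  proof -
    have "\<exists>K. \<forall>n. \<bar>?e n j k\<bar> \<le> K" if "j \<in> J" "k \<in> J" for j k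
    proof -
      have "Bseq (\<lambda>n. ?e n j k)" by (rule convergent_imp_Bseq[OF convergentI[OF lim[OF that]]])
      then show ?thesis by (auto simp: Bseq_def)
    qed
    then show ?thesis using that by metis
  qed
  define C where "C = (\<Sum>j\<in>J. \<Sum>k\<in>J. R\<^sup>2 * K j k)"
  define C1 where "C1 = (\<Sum>j\<in>J. \<Sum>k\<in>J. R\<^sup>2 * \<bar>inner01 (h j) (h k)\<bar>)"
  have scaled: "of_real ((real n)\<^sup>2) * (?q x - ?qn n x) = (\<Sum>j\<in>J. \<Sum>k\<in>J. z (fst x) j * z (snd x) k * of_real (?e n j k))" for n x
    unfolding gram_def sum_subtractf[symmetric] sum_distrib_left
    by (intro sum.cong refl) (simp only: of_real_mult of_real_diff right_diff_distrib mult_ac)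
  have bound: "norm (of_real ((real n)\<^sup>2) * (?q x - ?qn n x)) \<le> C" for n x
    unfolding scaled C_def
  proof (intro order_trans[OF norm_sum] sum_mono)
    fix j k assume jk: "j \<in> J" "k \<in> J"
    have "norm (z (fst x) j) * norm (z (snd x) k) * \<bar>?e n j k\<bar> \<le> R * R * K j k"
      using z_bounded[OF jk(1), of "fst x"] z_bounded[OF jk(2), of "snd x"] norm_ge_zero[of "z (fst x) j"] K[OF jk, of n]
      by (intro mult_mono) (auto intro: order_trans[OF norm_ge_zero])
    then show "norm (z (fst x) j * z (snd x) k * of_real (?e n j k)) \<le> R\<^sup>2 * K j k"
      unfolding norm_mult norm_of_real power2_eq_square[of R] .
  qed
  have C0: "C \<ge> 0" using bound[of 0 undefined] norm_ge_zero order_trans by blast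
  have lim_q: "(\<lambda>n. of_real ((real n)\<^sup>2) * (?q x - ?qn n x)) \<longlonglongrightarrow> (\<Sum>j\<in>J. \<Sum>k\<in>J. z (fst x) j * z (snd x) k * of_real (d j k))" for x
    unfolding scaled by (intro tendsto_sum tendsto_mult tendsto_const tendsto_of_real lim)
  have diff0: "(\<lambda>n. ?qn n x - ?q x) \<longlonglongrightarrow> 0" for x
  proof (rule Lim_null_comparison)
    have "(\<lambda>n. C * (inverse (real n))\<^sup>2) \<longlonglongrightarrow> C * 0\<^sup>2"
      by (intro tendsto_intros lim_inverse_n)
    show "(\<lambda>n. C * (inverse (real n))\<^sup>2) \<longlonglongrightarrow> 0" using \<open>(\<lambda>n. C * (inverse (real n))\<^sup>2) \<longlonglongrightarrow> C * 0\<^sup>2\<close> by simp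
    show "\<forall>\<^sub>F n in sequentially. norm (?qn n x - ?q x) \<le> C * (inverse (real n))\<^sup>2"
    proof (rule eventually_sequentiallyI[of 1])
      fix n :: nat assume "n \<ge> 1"
      then have "(real n)\<^sup>2 > 0" by simp
      moreover have "(real n)\<^sup>2 * norm (?qn n x - ?q x) \<le> C"
        using bound[of n x] by (simp add: norm_mult norm_minus_commute norm_power)
      ultimately show "norm (?qn n x - ?q x) \<le> C * (inverse (real n))\<^sup>2"
        by (simp add: field_simps)
    qed
  qed
  have main: "(\<lambda>n. \<integral>x. ?r x * (of_real ((real n)\<^sup>2) * (exp (?q x) - exp (?qn n x))) \<partial>(N \<Otimes>\<^sub>M N)) \<longlonglongrightarrow>
    (\<integral>x. ?r x * (exp (?q x) * (\<Sum>j\<in>J. \<Sum>k\<in>J. z (fst x) j * z (snd x) k * of_real (d j k))) \<partial>(N \<Otimes>\<^sub>M N))"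
  proof -
    obtain B where B: "B \<ge> 0" "\<And>\<theta>. norm (\<rho> \<theta>) \<le> B" using density_okD(2)[OF \<rho>] by blast
    have nz [measurable]: "(\<lambda>x. \<Sum>j\<in>J. \<Sum>k\<in>J. z (fst x) j * z (snd x) k * complex_of_real (d j k)) \<in> borel_measurable (N \<Otimes>\<^sub>M N)"
    proof -
      note [measurable] = z_measurable
      show ?thesis by measurable
    qed
    show ?thesis
    \<comment> \<open>\<open>C1\<close> bounds the limiting form and \<open>C\<close> the scaled
      difference, so \<open>C1 + C\<close> bounds the approximating form for
      \<open>n \<ge> 1\<close>. For \<open>n = 0\<close> the scaling factor is zero.\<close>
    proof (rule integral_dominated_convergence[where w="\<lambda>_. B * B * ((exp C1 + exp (C1 + C)) * C)"])
      show "AE x in N \<Otimes>\<^sub>M N. (\<lambda>n. ?r x * (of_real ((real n)\<^sup>2) * (exp (?q x) - exp (?qn n x)))) \<longlonglongrightarrow>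
        ?r x * (exp (?q x) * (\<Sum>j\<in>J. \<Sum>k\<in>J. z (fst x) j * z (snd x) k * of_real (d j k)))"
      proof (rule AE_I2)
        fix x
        let ?d = "\<Sum>j\<in>J. \<Sum>k\<in>J. z (fst x) j * z (snd x) k * of_real (d j k) :: complex"
        have "(\<lambda>n. - of_real ((real n)\<^sup>2) * (?qn n x - ?q x)) \<longlonglongrightarrow> ?d"
          using lim_q[of x] by (simp add: right_diff_distrib)
        from scaled_exp_minus_1_limit[OF this diff0]
        have "(\<lambda>n. ?r x * (exp (?q x) * (- of_real ((real n)\<^sup>2) * (exp (?qn n x - ?q x) - 1)))) \<longlonglongrightarrow> ?r x * (exp (?q x) * ?d)"
          by (intro tendsto_mult tendsto_const)
        moreover have "exp (?q x) * (- of_real ((real n)\<^sup>2) * (exp (?qn n x - ?q x) - 1)) = of_real ((real n)\<^sup>2) * (exp (?q x) - exp (?qn n x))" for n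
        proof -
          have "exp (?qn n x) = exp (?q x) * exp (?qn n x - ?q x)" by (simp add: mult_exp_exp)
          then show ?thesis by (simp only:) (simp add: algebra_simps)
        qed
        ultimately show "(\<lambda>n. ?r x * (of_real ((real n)\<^sup>2) * (exp (?q x) - exp (?qn n x)))) \<longlonglongrightarrow> ?r x * (exp (?q x) * ?d)"
          by (simp only:)
      qed
      show "AE x in N \<Otimes>\<^sub>M N. norm (?r x * (of_real ((real n)\<^sup>2) * (exp (?q x) - exp (?qn n x)))) \<le> B * B * ((exp C1 + exp (C1 + C)) * C)" for n
      proof (rule AE_I2)
        fix x
        have r: "norm (?r x) \<le> B * B" unfolding norm_mult using B by (intro mult_mono) auto
        have "norm (of_real ((real n)\<^sup>2) * (exp (?q x) - exp (?qn n x))) \<le> (exp C1 + exp (C1 + C)) * C"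
        proof (cases "n = 0")
          case True
          then show ?thesis using C0 by simp
        next
          case False
          have q1: "norm (?q x) \<le> C1" unfolding C1_def by (rule gram_bounded)
          have "1 * norm (?q x - ?qn n x) \<le> (real n)\<^sup>2 * norm (?q x - ?qn n x)"
            using False by (intro mult_right_mono) auto
          also have "\<dots> \<le> C" using bound[of n x] by (simp add: norm_mult norm_power)
          finally have dq: "norm (?q x - ?qn n x) \<le> C" by simp
          have "norm (?qn n x) \<le> norm (?q x) + norm (?q x - ?qn n x)"
            using norm_triangle_ineq4[of "?q x" "?q x - ?qn n x"] by simp
          then have qn: "Re (?qn n x) \<le> C1 + C" using q1 dq complex_Re_le_cmod[of "?qn n x"] by linarith
          have q: "Re (?q x) \<le> C1" using q1 complex_Re_le_cmod[of "?q x"] by linarith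
          have "norm (of_real ((real n)\<^sup>2) * (exp (?q x) - exp (?qn n x))) = (real n)\<^sup>2 * norm (exp (?q x) - exp (?qn n x))"
            by (simp add: norm_mult norm_power)
          also have "\<dots> \<le> (real n)\<^sup>2 * ((exp (Re (?q x)) + exp (Re (?qn n x))) * norm (?q x - ?qn n x))"
            by (intro mult_left_mono norm_exp_diff_le) auto
          also have "\<dots> = (exp (Re (?q x)) + exp (Re (?qn n x))) * norm (of_real ((real n)\<^sup>2) * (?q x - ?qn n x))"
            by (simp add: norm_mult norm_power)
          also have "\<dots> \<le> (exp C1 + exp (C1 + C)) * C"
            using q qn bound[of n x] by (intro mult_mono add_mono) auto
          finally show ?thesis .
        qed
        then show "norm (?r x * (of_real ((real n)\<^sup>2) * (exp (?q x) - exp (?qn n x)))) \<le> B * B * ((exp C1 + exp (C1 + C)) * C)"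
          using r B(1) unfolding norm_mult[of "?r x"] by (intro mult_mono) auto
      qed
    qed measurable
  qed
  have lhs: "of_real ((real n)\<^sup>2) * (pair_integral \<rho> (\<lambda>\<theta> \<theta>'. exp (gram h h \<theta> \<theta>')) - pair_integral \<rho> (\<lambda>\<theta> \<theta>'. exp (gram (hn n) (hn n) \<theta> \<theta>')))
     = (\<integral>x. ?r x * (of_real ((real n)\<^sup>2) * (exp (?q x) - exp (?qn n x))) \<partial>(N \<Otimes>\<^sub>M N))" for n
  proof -
    have i: "integrable (N \<Otimes>\<^sub>M N) (\<lambda>x. ?r x * exp (?q x))" "integrable (N \<Otimes>\<^sub>M N) (\<lambda>x. ?r x * exp (?qn n x))"
      by (rule pair_integrable[OF \<rho> exp_gram_pair_measurable exp_gram_bounded])+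
    have "(\<integral>x. ?r x * (of_real ((real n)\<^sup>2) * (exp (?q x) - exp (?qn n x))) \<partial>(N \<Otimes>\<^sub>M N)) =
       (\<integral>x. of_real ((real n)\<^sup>2) * (?r x * exp (?q x) - ?r x * exp (?qn n x)) \<partial>(N \<Otimes>\<^sub>M N))"
      by (simp only: right_diff_distrib mult.left_commute)
    also have "\<dots> = of_real ((real n)\<^sup>2) * ((\<integral>x. ?r x * exp (?q x) \<partial>(N \<Otimes>\<^sub>M N)) - (\<integral>x. ?r x * exp (?qn n x) \<partial>(N \<Otimes>\<^sub>M N)))"
      by (simp only: integral_mult_right_zero Bochner_Integration.integral_diff[OF i])
    finally show ?thesis unfolding pair_integral_def ..
  qed
  have rhs: "(\<integral>x. ?r x * (exp (?q x) * (\<Sum>j\<in>J. \<Sum>k\<in>J. z (fst x) j * z (snd x) k * of_real (d j k))) \<partial>(N \<Otimes>\<^sub>M N)) =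
     (\<Sum>j\<in>J. \<Sum>k\<in>J. of_real (d j k) * moment h \<rho> j k)"
  proof -
    have i: "integrable (N \<Otimes>\<^sub>M N) (\<lambda>x. of_real (d j k) * (?r x * (z (fst x) j * z (snd x) k * exp (?q x))))" if "j \<in> J" "k \<in> J" for j k
      by (rule integrable_mult_right[OF pair_integrable[OF \<rho> moment_integrand[OF that]]])
    have "(\<integral>x. ?r x * (exp (?q x) * (\<Sum>j\<in>J. \<Sum>k\<in>J. z (fst x) j * z (snd x) k * of_real (d j k))) \<partial>(N \<Otimes>\<^sub>M N)) =
       (\<integral>x. (\<Sum>j\<in>J. \<Sum>k\<in>J. of_real (d j k) * (?r x * (z (fst x) j * z (snd x) k * exp (?q x)))) \<partial>(N \<Otimes>\<^sub>M N))"
      by (simp only: sum_distrib_left mult_ac)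
    also have "\<dots> = (\<Sum>j\<in>J. (\<integral>x. (\<Sum>k\<in>J. of_real (d j k) * (?r x * (z (fst x) j * z (snd x) k * exp (?q x)))) \<partial>(N \<Otimes>\<^sub>M N)))"
      by (intro Bochner_Integration.integral_sum Bochner_Integration.integrable_sum i)
    also have "\<dots> = (\<Sum>j\<in>J. \<Sum>k\<in>J. (\<integral>x. of_real (d j k) * (?r x * (z (fst x) j * z (snd x) k * exp (?q x))) \<partial>(N \<Otimes>\<^sub>M N)))"
      by (intro sum.cong refl Bochner_Integration.integral_sum i)
    finally show ?thesis unfolding moment_def pair_integral_def by (simp only: integral_mult_right_zero)
  qed
  show ?thesis unfolding lhs rhs[symmetric] by (rule main)
qed

lemma derivative_density_ok:
  assumes "density_ok \<rho>"
  shows "density_ok (\<lambda>\<theta>. \<rho> \<theta> * (\<Sum>j\<in>J. z \<theta> j * of_real (c j)))"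
proof -
  obtain B where B: "B \<ge> 0" "\<And>\<theta>. norm (\<rho> \<theta>) \<le> B" using density_okD(2)[OF assms] by blast
  have [measurable]: "\<rho> \<in> borel_measurable N" using assms by (rule density_okD)
  note [measurable] = z_measurable
  have m: "(\<lambda>\<theta>. \<rho> \<theta> * (\<Sum>j\<in>J. z \<theta> j * of_real (c j))) \<in> borel_measurable N" by measurable
  have "norm (\<rho> \<theta> * (\<Sum>j\<in>J. z \<theta> j * of_real (c j))) \<le> B * (\<Sum>j\<in>J. R * \<bar>c j\<bar>)" for \<theta>
  proof -
    have "norm (\<Sum>j\<in>J. z \<theta> j * of_real (c j)) \<le> (\<Sum>j\<in>J. R * \<bar>c j\<bar>)"
      using z_bounded by (intro order_trans[OF norm_sum] sum_mono) (auto simp: norm_mult intro!: mult_right_mono)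
    then show ?thesis unfolding norm_mult[of "\<rho> \<theta>"] using B by (intro mult_mono) auto
  qed
  then show ?thesis using m unfolding density_ok_def by blast
qed

text \<open>The counterpart of the limit: the factor \<open>\<Sum>j. c j z_j\<close> in the density
  produces the same moments, now weighted with \<open>c j * c k\<close>.\<close>

lemma derivative_mix_norm:
  assumes \<rho>: "density_ok \<rho>" and h: "L2fam h" and X: "X \<in> borel_measurable M"
    and eq: "AE \<omega> in M. mix h (\<lambda>\<theta>. \<rho> \<theta> * (\<Sum>j\<in>J. z \<theta> j * of_real (c j))) \<omega> = of_real (X \<omega>)"
  shows "complex_of_real (\<integral>\<omega>. (X \<omega>)\<^sup>2 \<partial>M) = (\<Sum>j\<in>J. \<Sum>k\<in>J. of_real (c j * c k) * moment h \<rho> j k)"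
proof -
  let ?q = "\<lambda>x. gram h h (fst x) (snd x)" and ?r = "\<lambda>x. \<rho> (fst x) * \<rho> (snd x)"
  have i: "integrable (N \<Otimes>\<^sub>M N) (\<lambda>x. of_real (c j * c k) * (?r x * (z (fst x) j * z (snd x) k * exp (?q x))))" if "j \<in> J" "k \<in> J" for j k
    by (rule integrable_mult_right[OF pair_integrable[OF \<rho> moment_integrand[OF that]]])
  have "complex_of_real (\<integral>\<omega>. (X \<omega>)\<^sup>2 \<partial>M) =
     (\<integral>x. (\<rho> (fst x) * (\<Sum>j\<in>J. z (fst x) j * of_real (c j))) * (\<rho> (snd x) * (\<Sum>k\<in>J. z (snd x) k * of_real (c k))) * exp (?q x) \<partial>(N \<Otimes>\<^sub>M N))"
    using real_mix_norm[OF derivative_density_ok[OF \<rho>] h X eq] unfolding pair_integral_def .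
  also have "\<dots> = (\<integral>x. (\<Sum>j\<in>J. \<Sum>k\<in>J. of_real (c j * c k) * (?r x * (z (fst x) j * z (snd x) k * exp (?q x)))) \<partial>(N \<Otimes>\<^sub>M N))"
  proof (rule Bochner_Integration.integral_cong[OF refl])
    fix x
    have "(\<rho> (fst x) * (\<Sum>j\<in>J. z (fst x) j * of_real (c j))) * (\<rho> (snd x) * (\<Sum>k\<in>J. z (snd x) k * of_real (c k))) * exp (?q x) =
      ?r x * exp (?q x) * ((\<Sum>j\<in>J. z (fst x) j * of_real (c j)) * (\<Sum>k\<in>J. z (snd x) k * of_real (c k)))"
      by (simp only: mult_ac)
    also have "\<dots> = (\<Sum>j\<in>J. \<Sum>k\<in>J. of_real (c j * c k) * (?r x * (z (fst x) j * z (snd x) k * exp (?q x))))"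
    proof -
      have "(\<Sum>j\<in>J. z (fst x) j * of_real (c j)) * (\<Sum>k\<in>J. z (snd x) k * of_real (c k)) =
        (\<Sum>j\<in>J. \<Sum>k\<in>J. z (fst x) j * of_real (c j) * (z (snd x) k * of_real (c k)))"
        by (rule sum_product)
      then show ?thesis by (simp only: sum_distrib_left) (simp only: of_real_mult mult_ac)
    qed
    finally show "(\<rho> (fst x) * (\<Sum>j\<in>J. z (fst x) j * of_real (c j))) * (\<rho> (snd x) * (\<Sum>k\<in>J. z (snd x) k * of_real (c k))) * exp (?q x) =
      (\<Sum>j\<in>J. \<Sum>k\<in>J. of_real (c j * c k) * (?r x * (z (fst x) j * z (snd x) k * exp (?q x))))" .
  qed
  also have "\<dots> = (\<Sum>j\<in>J. (\<integral>x. (\<Sum>k\<in>J. of_real (c j * c k) * (?r x * (z (fst x) j * z (snd x) k * exp (?q x)))) \<partial>(N \<Otimes>\<^sub>M N)))"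
    by (intro Bochner_Integration.integral_sum Bochner_Integration.integrable_sum i)
  also have "\<dots> = (\<Sum>j\<in>J. \<Sum>k\<in>J. (\<integral>x. of_real (c j * c k) * (?r x * (z (fst x) j * z (snd x) k * exp (?q x))) \<partial>(N \<Otimes>\<^sub>M N)))"
    by (intro sum.cong refl Bochner_Integration.integral_sum i)
  finally show ?thesis unfolding moment_def pair_integral_def by (simp only: integral_mult_right_zero)
qed

end

section \<open>Contour densities\<close>

definition circ :: "real \<Rightarrow> real \<Rightarrow> complex" where
  "circ R t = of_real R * cis (2 * pi * t)"

text \<open>The density on the circle of radius \<open>R\<close> (parametrised by \<open>t \<in> [0, 1]\<close>) whose \<open>k\<close>-th
  moment is \<open>b k\<close>; it is the Borel transform of \<open>\<Sum>k. b k x^k / k!\<close>.\<close>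

definition circ_density :: "real \<Rightarrow> (nat \<Rightarrow> real) \<Rightarrow> real \<Rightarrow> complex" where
  "circ_density R b t = (\<Sum>k. of_real (b k / R ^ k) * cis (- (2 * pi * real k * t)))"

lemma norm_circ: "R \<ge> 0 \<Longrightarrow> norm (circ R t) = R"
  by (simp add: circ_def norm_mult)

lemma circ_measurable: "circ R \<in> borel_measurable leb01"
proof (intro measurable_restrict_space1 measurable_completion)
  have "continuous_on UNIV (circ R)" unfolding circ_def by (intro continuous_intros)
  then show "circ R \<in> borel_measurable lborel" by (simp add: borel_measurable_continuous_onI)
qed

lemma cis_measurable: "(\<lambda>t. cis (c * t)) \<in> borel_measurable leb01"
proof (intro measurable_restrict_space1 measurable_completion)
  have "continuous_on UNIV (\<lambda>t. cis (c * t))" by (intro continuous_intros)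
  then show "(\<lambda>t. cis (c * t)) \<in> borel_measurable lborel" by (simp add: borel_measurable_continuous_onI)
qed

lemma integral_cis_leb01:
  "(\<integral>t. cis (2 * pi * real_of_int k * t) \<partial>leb01) = (if k = 0 then 1 else 0)"
proof (cases "k = 0")
  case True
  then show ?thesis using leb01.prob_space by simp
next
  case False
  let ?a = "2 * pi * real_of_int k"
  have int: "integrable leb01 (\<lambda>t. cis (?a * t))"
    by (rule leb01.integrable_const_bound[of _ 1]) (auto intro: cis_measurable)
  have "((\<lambda>t. cis (?a * t)) has_integral
      (exp (\<i> * of_real ?a * of_real 1) / (\<i> * of_real ?a) - exp (\<i> * of_real ?a * of_real 0) / (\<i> * of_real ?a))) {0..1}"
  proof (rule fundamental_theorem_of_calculus)
    fix x :: real
    have "((\<lambda>z. exp (\<i> * of_real ?a * z) / (\<i> * of_real ?a)) has_field_derivative exp (\<i> * of_real ?a * of_real x)) (at (of_real x))"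
      using False by (auto intro!: derivative_eq_intros)
    then have "((\<lambda>t. exp (\<i> * of_real ?a * of_real t) / (\<i> * of_real ?a)) has_vector_derivative exp (\<i> * of_real ?a * of_real x)) (at x)"
      by (rule has_vector_derivative_real_field)
    moreover have "exp (\<i> * of_real ?a * of_real x) = cis (?a * x)" by (simp add: cis_conv_exp mult.assoc)
    ultimately show "((\<lambda>t. exp (\<i> * of_real ?a * of_real t) / (\<i> * of_real ?a)) has_vector_derivative cis (?a * x)) (at x within {0..1})"
      by (simp add: has_vector_derivative_at_within)
  qed simp
  moreover have "exp (\<i> * of_real ?a * of_real 1) = 1"
    using exp_integer_2pi[of "of_int k"] by (simp add: mult_ac)
  ultimately have "integral {0..1} (\<lambda>t. cis (?a * t)) = 0" by (simp add: integral_unique)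
  then show ?thesis using lebesgue_integral_eq_integral[OF int] False by simp
qed

text \<open>A growth rate of half the radius makes the Fourier series of the density converge
  geometrically, with total at most \<open>2 * K\<close>.\<close>

context
  fixes R K :: real and b :: "nat \<Rightarrow> real"
  assumes R: "R > 0" and bK: "\<And>k. \<bar>b k\<bar> \<le> K * (R / 2) ^ k"
begin

lemma circ_density_term: "norm (of_real (b k / R ^ k) * cis (- (2 * pi * real k * t))) \<le> K * (1 / 2) ^ k"
proof -
  have "\<bar>b k\<bar> / R ^ k \<le> K * (R / 2) ^ k / R ^ k" using bK[of k] R by (intro divide_right_mono) auto
  also have "\<dots> = K * (1 / 2) ^ k" using R by (simp add: power_divide)
  finally show ?thesis using R by (simp add: norm_mult norm_divide norm_power abs_div)
qed

lemma circ_density_summable: "summable (\<lambda>k. norm (of_real (b k / R ^ k) * cis (- (2 * pi * real k * t))))"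
  by (rule summable_comparison_test'[of "\<lambda>k. K * (1 / 2) ^ k" 0])
     (use circ_density_term in \<open>auto intro!: summable_mult summable_geometric\<close>)

lemma circ_density_bound: "norm (circ_density R b t) \<le> 2 * K"
proof -
  have g: "(\<lambda>k. K * (1 / 2) ^ k) sums (K * (1 / (1 - 1 / 2)))"
    by (intro sums_mult geometric_sums) simp
  have "norm (circ_density R b t) \<le> (\<Sum>k. norm (of_real (b k / R ^ k) * cis (- (2 * pi * real k * t))))"
    unfolding circ_density_def by (rule summable_norm[OF circ_density_summable])
  also have "\<dots> \<le> (\<Sum>k. K * (1 / 2) ^ k)"
    by (intro suminf_le circ_density_term circ_density_summable sums_summable[OF g])
  also have "\<dots> = 2 * K" using sums_unique[OF g] by simp
  finally show ?thesis .
qed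

lemma circ_density_measurable: "circ_density R b \<in> borel_measurable leb01"
proof -
  have "(\<lambda>t. \<Sum>k. of_real (b k / R ^ k) * cis (- (2 * pi * real k * t))) \<in> borel_measurable leb01"
  proof (rule borel_measurable_suminf)
    fix k
    show "(\<lambda>t. of_real (b k / R ^ k) * cis (- (2 * pi * real k * t))) \<in> borel_measurable leb01"
      using cis_measurable[of "- (2 * pi * real k)"] by simp
  qed
  then show ?thesis by (simp add: circ_density_def[abs_def])
qed

text \<open>Orthogonality of the characters: after termwise integration only the frequency
  \<open>k = l\<close> survives, and the powers of \<open>R\<close> cancel.\<close>

lemma circ_density_moment: "(\<integral>t. circ_density R b t * circ R t ^ l \<partial>leb01) = of_real (b l)"
proof -
  define g where "g k t = of_real (b k / R ^ k) * cis (- (2 * pi * real k * t)) * circ R t ^ l" for k t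
  have gm: "g k \<in> borel_measurable leb01" for k
    unfolding g_def using cis_measurable[of "- (2 * pi * real k)"] circ_measurable[of R] by simp
  have gn: "norm (g k t) \<le> K * (1 / 2) ^ k * R ^ l" for k t
    unfolding g_def norm_mult[of _ "circ R t ^ l"] norm_power norm_circ[OF less_imp_le[OF R]]
    using circ_density_term R by (intro mult_right_mono) auto
  have gi: "integrable leb01 (g k)" for k
    by (rule leb01.integrable_const_bound[of _ "K * (1 / 2) ^ k * R ^ l"]) (use gn gm in auto)
  have s: "summable (\<lambda>k. K * (1 / 2) ^ k * R ^ l)"
    by (intro summable_mult2 summable_mult summable_geometric) simp
  have sum1: "summable (\<lambda>k. norm (g k t))" for t
    by (rule summable_comparison_test'[OF s, of 0]) (use gn in auto)
  have nb: "(\<integral>t. norm (g k t) \<partial>leb01) \<le> K * (1 / 2) ^ k * R ^ l" for k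
  proof -
    have "(\<integral>t. norm (g k t) \<partial>leb01) \<le> (\<integral>t. K * (1 / 2) ^ k * R ^ l \<partial>leb01)"
      by (intro integral_mono integrable_norm gi gn) simp
    then show ?thesis using leb01.prob_space by simp
  qed
  have sum2: "summable (\<lambda>k. \<integral>t. norm (g k t) \<partial>leb01)"
    by (rule summable_comparison_test'[OF s, of 0]) (use nb in auto)
  have "(\<lambda>k. \<integral>t. g k t \<partial>leb01) sums (\<integral>t. (\<Sum>k. g k t) \<partial>leb01)"
    by (rule sums_integral[OF gi AE_I2[OF sum1] sum2])
  moreover have "(\<integral>t. g k t \<partial>leb01) = (if k = l then of_real (b l) else 0)" for k
  proof -
    have "g k t = of_real (b k / R ^ k * R ^ l) * cis (2 * pi * real_of_int (int l - int k) * t)" for t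
    proof -
      have "cis (- (2 * pi * real k * t)) * cis (2 * pi * t) ^ l = cis (2 * pi * real_of_int (int l - int k) * t)"
      proof -
        have "cis (2 * pi * t) ^ l = cis (real l * (2 * pi * t))" by (rule Complex.DeMoivre)
        then have "cis (- (2 * pi * real k * t)) * cis (2 * pi * t) ^ l = cis (- (2 * pi * real k * t) + real l * (2 * pi * t))"
          by (simp only: cis_mult)
        also have "- (2 * pi * real k * t) + real l * (2 * pi * t) = 2 * pi * real_of_int (int l - int k) * t"
          by (simp add: algebra_simps)
        finally show ?thesis .
      qed
      then show ?thesis unfolding g_def circ_def power_mult_distrib by (simp add: mult_ac)
    qed
    then have "(\<integral>t. g k t \<partial>leb01) = of_real (b k / R ^ k * R ^ l) * (if int l - int k = 0 then 1 else 0)"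
      by (simp only: integral_mult_right_zero integral_cis_leb01)
    then show ?thesis using R by simp
  qed
  ultimately have "(\<lambda>k. if k = l then of_real (b l) else 0) sums (\<integral>t. (\<Sum>k. g k t) \<partial>leb01)" by (simp only:)
  from sums_unique2[OF this sums_single] have "(\<integral>t. (\<Sum>k. g k t) \<partial>leb01) = of_real (b l)" by simp
  moreover have "(\<Sum>k. g k t) = circ_density R b t * circ R t ^ l" for t
    unfolding g_def circ_density_def
    by (rule suminf_mult2[symmetric]) (rule summable_norm_cancel[OF circ_density_summable])
  ultimately show ?thesis by simp
qed

text \<open>Expanding exp turns moments into Taylor coefficients. The extra power \<open>p\<close>
  of the coordinate shifts the moments by \<open>p\<close>, which is \<open>p\<close>-fold
  differentiation in \<open>x\<close>.\<close>

lemma circ_density_exp_integral: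
  "(\<lambda>l. of_real (b (l + p)) * x ^ l / fact l) sums (\<integral>t. circ_density R b t * circ R t ^ p * exp (circ R t * x) \<partial>leb01)"
proof -
  define g where "g l t = circ_density R b t * circ R t ^ (l + p) * (x ^ l / fact l)" for l t
  have gm: "g k \<in> borel_measurable leb01" for k
    unfolding g_def using circ_density_measurable circ_measurable[of R] by simp
  have gn: "norm (g l t) \<le> 2 * K * R ^ p * ((R * norm x) ^ l / fact l)" for l t
  proof -
    have "norm (g l t) = norm (circ_density R b t) * (R ^ p * ((R * norm x) ^ l / fact l))"
      unfolding g_def using R by (simp add: norm_mult norm_power norm_circ norm_divide power_add power_mult_distrib)
    also have "\<dots> \<le> 2 * K * (R ^ p * ((R * norm x) ^ l / fact l))"
      using R by (intro mult_right_mono circ_density_bound) auto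
    finally show ?thesis by (simp add: mult.assoc)
  qed
  have gi: "integrable leb01 (g k)" for k
    by (rule leb01.integrable_const_bound[of _ "2 * K * R ^ p * ((R * norm x) ^ k / fact k)"]) (use gn gm in auto)
  have s: "summable (\<lambda>l. 2 * K * R ^ p * ((R * norm x) ^ l / fact l))"
    by (intro summable_mult) (use summable_exp[of "R * norm x"] in \<open>simp add: field_simps\<close>)
  have sum1: "summable (\<lambda>k. norm (g k t))" for t
    by (rule summable_comparison_test'[OF s, of 0]) (use gn in auto)
  have nb: "(\<integral>t. norm (g k t) \<partial>leb01) \<le> 2 * K * R ^ p * ((R * norm x) ^ k / fact k)" for k
  proof -
    have "(\<integral>t. norm (g k t) \<partial>leb01) \<le> (\<integral>t. 2 * K * R ^ p * ((R * norm x) ^ k / fact k) \<partial>leb01)"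
      by (intro integral_mono integrable_norm gi gn) simp
    then show ?thesis using leb01.prob_space by simp
  qed
  have sum2: "summable (\<lambda>k. \<integral>t. norm (g k t) \<partial>leb01)"
    by (rule summable_comparison_test'[OF s, of 0]) (use nb in auto)
  have "(\<lambda>k. \<integral>t. g k t \<partial>leb01) sums (\<integral>t. (\<Sum>k. g k t) \<partial>leb01)"
    by (rule sums_integral[OF gi AE_I2[OF sum1] sum2])
  moreover have "(\<integral>t. g l t \<partial>leb01) = of_real (b (l + p)) * x ^ l / fact l" for l
    unfolding g_def integral_mult_left_zero circ_density_moment by simp
  moreover have "(\<Sum>l. g l t) = circ_density R b t * circ R t ^ p * exp (circ R t * x)" for t
  proof -
    have "(\<lambda>l. circ_density R b t * circ R t ^ p * ((circ R t * x) ^ l /\<^sub>R fact l)) sums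
        (circ_density R b t * circ R t ^ p * exp (circ R t * x))"
      by (intro sums_mult exp_converges)
    moreover have "circ_density R b t * circ R t ^ p * ((circ R t * x) ^ l /\<^sub>R fact l) = g l t" for l
      by (simp add: g_def scaleR_conv_of_real power_add power_mult_distrib field_simps)
    ultimately show ?thesis by (simp add: sums_iff)
  qed
  ultimately show ?thesis by (simp only:)
qed

end

text \<open>The density needs growth at most \<open>R / 2\<close>. The stricter \<open>R / 4\<close>
  leaves room: the coefficients from index \<open>n\<close> on, measured against
  \<open>R / 2\<close>, gain a factor \<open>(1 / 2) ^ n\<close>, which gives convergence of the
  Wick series.\<close>

definition coeff_growth :: "real \<Rightarrow> (nat \<Rightarrow> real) \<Rightarrow> bool" where
  "coeff_growth R a \<longleftrightarrow> (\<exists>K. \<forall>k. \<bar>fact k * a k\<bar> \<le> K * (R / 4) ^ k)"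

lemma coeff_growthD:
  assumes "coeff_growth R a" "R > 0"
  obtains K where "\<And>k. \<bar>fact k * a k\<bar> \<le> K * (R / 4) ^ k" "\<And>k. \<bar>fact k * a k\<bar> \<le> K * (R / 2) ^ k"
proof -
  obtain K where K: "\<And>k. \<bar>fact k * a k\<bar> \<le> K * (R / 4) ^ k" using assms(1) by (auto simp: coeff_growth_def)
  have K0: "K \<ge> 0" using K[of 0] by simp
  have "K * (R / 4) ^ k \<le> K * (R / 2) ^ k" for k
    using assms(2) K0 by (intro mult_left_mono power_mono) auto
  then show ?thesis using that[of K] K order_trans by blast
qed

lemma coeff_growth_mono:
  assumes "coeff_growth R a" "0 < R" "R \<le> R'"
  shows "coeff_growth R' a"
proof -
  obtain K where K: "\<And>k. \<bar>fact k * a k\<bar> \<le> K * (R / 4) ^ k" using assms(1) by (auto simp: coeff_growth_def)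
  have K0: "K \<ge> 0" using K[of 0] by simp
  have "K * (R / 4) ^ k \<le> K * (R' / 4) ^ k" for k
    using assms K0 by (intro mult_left_mono power_mono) auto
  then show ?thesis unfolding coeff_growth_def using K order_trans by blast
qed

definition coeff_shift :: "(nat \<Rightarrow> real) \<Rightarrow> nat \<Rightarrow> real" where
  "coeff_shift a l = real (l + 1) * a (l + 1)"

text \<open>For the normalised coefficients, from which the densities are built, differentiation is
  a mere shift of the index.\<close>

lemma fact_coeff_shift: "fact l * coeff_shift a l = fact (l + 1) * a (l + 1)"
  by (simp add: coeff_shift_def algebra_simps)

lemma coeff_growth_shift:
  assumes "coeff_growth R a" "R > 0"
  shows "coeff_growth R (coeff_shift a)"
proof -
  obtain K where K: "\<And>k. \<bar>fact k * a k\<bar> \<le> K * (R / 4) ^ k" using assms(1) by (auto simp: coeff_growth_def)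
  have "\<bar>fact k * coeff_shift a k\<bar> \<le> (K * (R / 4)) * (R / 4) ^ k" for k
    unfolding fact_coeff_shift using K[of "k + 1"] by (simp add: mult_ac)
  then show ?thesis unfolding coeff_growth_def by blast
qed

definition power_series :: "(nat \<Rightarrow> real) \<Rightarrow> real \<Rightarrow> real" where
  "power_series a x = (\<Sum>k. a k * x ^ k)"

text \<open>The second identity is the mechanism behind partial derivatives: a factor
  \<open>circ R t\<close> under the integral differentiates the represented function.\<close>

lemma circ_density_power_series:
  assumes "coeff_growth R a" "R > 0"
  shows "(\<integral>t. circ_density R (\<lambda>k. fact k * a k) t * exp (circ R t * of_real x) \<partial>leb01) = of_real (power_series a x)"
    and "(\<integral>t. circ_density R (\<lambda>k. fact k * a k) t * circ R t * exp (circ R t * of_real x) \<partial>leb01) = of_real (power_series (coeff_shift a) x)"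
proof -
  obtain K where K: "\<And>k. \<bar>fact k * a k\<bar> \<le> K * (R / 2) ^ k" using coeff_growthD[OF assms] by metis
  have gen: "(\<integral>t. circ_density R (\<lambda>k. fact k * a k) t * circ R t ^ p * exp (circ R t * of_real x) \<partial>leb01) = of_real (power_series c x)"
    if c: "\<And>l. fact (l + p) * a (l + p) / fact l = c l" for p c
  proof -
    have "(\<lambda>l. complex_of_real (c l * x ^ l)) sums (\<integral>t. circ_density R (\<lambda>k. fact k * a k) t * circ R t ^ p * exp (circ R t * of_real x) \<partial>leb01)"
    proof -
      have "complex_of_real (fact (l + p) * a (l + p)) * of_real x ^ l / fact l = complex_of_real (c l * x ^ l)" for l
        unfolding c[symmetric] by simp
      then show ?thesis using circ_density_exp_integral[OF assms(2) K, of p "of_real x"] by (simp only:)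
    qed
    then have "(\<Sum>l. complex_of_real (c l * x ^ l)) = (\<integral>t. circ_density R (\<lambda>k. fact k * a k) t * circ R t ^ p * exp (circ R t * of_real x) \<partial>leb01)"
      and sm: "summable (\<lambda>l. complex_of_real (c l * x ^ l))"
      by (simp_all add: sums_iff)
    moreover have "summable (\<lambda>l. c l * x ^ l)" using summable_Re[OF sm] by (simp only: Re_complex_of_real)
    ultimately show ?thesis unfolding power_series_def by (simp only: suminf_of_real)
  qed
  show "(\<integral>t. circ_density R (\<lambda>k. fact k * a k) t * exp (circ R t * of_real x) \<partial>leb01) = of_real (power_series a x)"
    using gen[of 0 a] by simp
  show "(\<integral>t. circ_density R (\<lambda>k. fact k * a k) t * circ R t * exp (circ R t * of_real x) \<partial>leb01) = of_real (power_series (coeff_shift a) x)"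
    using gen[of 1 "coeff_shift a"] fact_coeff_shift[of _ a] by (simp add: field_simps)
qed

section \<open>Product densities on the torus\<close>

abbreviation torus :: "nat \<Rightarrow> (nat \<Rightarrow> real) measure" where
  "torus m \<equiv> PiM {1..m} (\<lambda>_. leb01)"

text \<open>The index \<open>0\<close> is reserved for the volatility, whose Wick exponential is not mixed.\<close>

definition torus_coord :: "real \<Rightarrow> (nat \<Rightarrow> real) \<Rightarrow> nat \<Rightarrow> complex" where
  "torus_coord R \<theta> j = (if j = 0 then 1 else circ R (\<theta> j))"

text \<open>One circle per Wick factor: a Wick product has a product of S-transforms, so the density
  is a product too.\<close>

definition array_density :: "real \<Rightarrow> nat \<Rightarrow> (nat \<Rightarrow> nat \<Rightarrow> real) \<Rightarrow> (nat \<Rightarrow> real) \<Rightarrow> complex" where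
  "array_density R m a \<theta> = (\<Prod>j\<in>{1..m}. circ_density R (\<lambda>k. fact k * a j k) (\<theta> j))"

lemma torus_coord_measurable:
  assumes "j \<in> insert 0 {1..m}"
  shows "(\<lambda>\<theta>. torus_coord R \<theta> j) \<in> borel_measurable (torus m)"
proof (cases "j = 0")
  case True
  then show ?thesis by (simp add: torus_coord_def)
next
  case False
  then have "(\<lambda>\<theta>. \<theta> j) \<in> torus m \<rightarrow>\<^sub>M leb01" using assms by (intro measurable_component_singleton) auto
  from measurable_compose[OF this circ_measurable] show ?thesis using False by (simp add: torus_coord_def)
qed

lemma torus_prob_space: "prob_space (torus m)"
  by (rule prob_space_PiM) (rule leb01.prob_space_axioms)

lemma (in brownian_space) torus_mixture:
  assumes "R \<ge> 1"
  shows "wick_mixture M W (torus m) (insert 0 {1..m}) (torus_coord R) R"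
proof -
  interpret T: prob_space "torus m" by (rule torus_prob_space)
  show ?thesis
  proof unfold_locales
    show "norm (torus_coord R \<theta> j) \<le> R" for \<theta> j using assms by (simp add: torus_coord_def norm_circ)
    show "(\<lambda>\<theta>. torus_coord R \<theta> j) \<in> borel_measurable (torus m)" if "j \<in> insert 0 {1..m}" for j
      by (rule torus_coord_measurable[OF that])
  qed simp
qed

lemma torus_product_integral:
  fixes \<phi> :: "nat \<Rightarrow> real \<Rightarrow> complex"
  assumes "\<And>j. j \<in> {1..m} \<Longrightarrow> integrable leb01 (\<phi> j)"
  shows "(\<integral>\<theta>. (\<Prod>j\<in>{1..m}. \<phi> j (\<theta> j)) \<partial>torus m) = (\<Prod>j\<in>{1..m}. (\<integral>t. \<phi> j t \<partial>leb01))"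
proof -
  interpret P: product_sigma_finite "\<lambda>_::nat. leb01" by unfold_locales
  show ?thesis by (rule P.product_integral_prod[OF _ assms]) auto
qed

lemma array_density_ok:
  assumes R: "R > 0" and a: "\<And>j. j \<in> {1..m} \<Longrightarrow> coeff_growth R (a j)"
  shows "array_density R m a \<in> borel_measurable (torus m)" "\<exists>B. \<forall>\<theta>. norm (array_density R m a \<theta>) \<le> B"
proof -
  have ex: "\<exists>K. \<forall>k. \<bar>fact k * a j k\<bar> \<le> K * (R / 2) ^ k" if "j \<in> {1..m}" for j
    using coeff_growthD[OF a[OF that] R] by metis
  then obtain K where K: "\<And>j k. j \<in> {1..m} \<Longrightarrow> \<bar>fact k * a j k\<bar> \<le> K j * (R / 2) ^ k" by metis
  have "(\<lambda>\<theta>. \<Prod>j\<in>{1..m}. circ_density R (\<lambda>k. fact k * a j k) (\<theta> j)) \<in> borel_measurable (torus m)"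
  proof (rule borel_measurable_prod)
    fix j assume j: "j \<in> {1..m}"
    have "(\<lambda>\<theta>. \<theta> j) \<in> torus m \<rightarrow>\<^sub>M leb01" using j by (intro measurable_component_singleton) auto
    from measurable_compose[OF this circ_density_measurable[OF R K[OF j]]]
    show "(\<lambda>\<theta>. circ_density R (\<lambda>k. fact k * a j k) (\<theta> j)) \<in> borel_measurable (torus m)" .
  qed
  then show "array_density R m a \<in> borel_measurable (torus m)" by (simp add: array_density_def[abs_def])
  have "norm (array_density R m a \<theta>) \<le> (\<Prod>j\<in>{1..m}. 2 * K j)" for \<theta>
    unfolding array_density_def prod_norm[symmetric]
    by (intro prod_mono conjI norm_ge_zero circ_density_bound[OF R K])
  then show "\<exists>B. \<forall>\<theta>. norm (array_density R m a \<theta>) \<le> B" by blast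
qed

text \<open>Coordinate 0 contributes the constant factor \<open>exp (x 0)\<close>; the remaining
  integrand is a product over the circles and factorises by Fubini.\<close>

lemma array_density_integral:
  assumes R: "R > 0" and a: "\<And>j. j \<in> {1..m} \<Longrightarrow> coeff_growth R (a j)"
  shows "(\<integral>\<theta>. array_density R m a \<theta> * exp (\<Sum>j\<in>insert 0 {1..m}. torus_coord R \<theta> j * of_real (x j)) \<partial>torus m)
      = of_real (exp (x 0) * (\<Prod>j\<in>{1..m}. power_series (a j) (x j)))" (is ?A)
    and "k \<in> {1..m} \<Longrightarrow> (\<integral>\<theta>. array_density R m a \<theta> * torus_coord R \<theta> k * exp (\<Sum>j\<in>insert 0 {1..m}. torus_coord R \<theta> j * of_real (x j)) \<partial>torus m)
      = of_real (exp (x 0) * (\<Prod>j\<in>{1..m}. power_series ((a(k := coeff_shift (a k))) j) (x j)))" (is "_ \<Longrightarrow> ?B")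
proof -
  let ?d = "\<lambda>j. circ_density R (\<lambda>k. fact k * a j k)"
  have exps: "exp (\<Sum>j\<in>insert 0 {1..m}. torus_coord R \<theta> j * of_real (x j)) =
     exp (of_real (x 0)) * (\<Prod>j\<in>{1..m}. exp (circ R (\<theta> j) * of_real (x j)))" for \<theta>
  proof -
    have "(\<Sum>j\<in>{1..m}. torus_coord R \<theta> j * of_real (x j)) = (\<Sum>j\<in>{1..m}. circ R (\<theta> j) * of_real (x j))"
      by (intro sum.cong) (auto simp: torus_coord_def)
    then show ?thesis by (simp add: exp_add exp_sum torus_coord_def)
  qed
  have int: "integrable leb01 (\<lambda>t. ?d j t * circ R t ^ p * exp (circ R t * of_real y))" if j: "j \<in> {1..m}" for j p y
  proof -
    obtain K where K: "\<And>k. \<bar>fact k * a j k\<bar> \<le> K * (R / 2) ^ k" using coeff_growthD[OF a[OF j] R] by metis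
    show ?thesis
    proof (rule leb01.integrable_const_bound[of _ "2 * K * R ^ p * exp (R * \<bar>y\<bar>)"])
      show "(\<lambda>t. ?d j t * circ R t ^ p * exp (circ R t * of_real y)) \<in> borel_measurable leb01"
        using circ_density_measurable[OF R K] circ_measurable[of R] by measurable
      show "AE t in leb01. norm (?d j t * circ R t ^ p * exp (circ R t * of_real y)) \<le> 2 * K * R ^ p * exp (R * \<bar>y\<bar>)"
      proof (rule AE_I2)
        fix t
        have "Re (circ R t * of_real y) \<le> R * \<bar>y\<bar>"
          using complex_Re_le_cmod[of "circ R t * of_real y"] R by (simp add: norm_mult norm_circ)
        then have e: "norm (exp (circ R t * of_real y)) \<le> exp (R * \<bar>y\<bar>)" by (simp add: norm_exp_eq_Re)
        have c: "norm (circ R t ^ p) = R ^ p" using R by (simp add: norm_power norm_circ)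
        have d: "norm (?d j t) \<le> 2 * K" by (rule circ_density_bound[OF R K])
        then have "K \<ge> 0" using norm_ge_zero[of "?d j t"] by linarith
        then show "norm (?d j t * circ R t ^ p * exp (circ R t * of_real y)) \<le> 2 * K * R ^ p * exp (R * \<bar>y\<bar>)"
          unfolding norm_mult c using R d e by (intro mult_mono) auto
      qed
    qed
  qed
  have gen: "(\<integral>\<theta>. (\<Prod>j\<in>{1..m}. ?d j (\<theta> j) * circ R (\<theta> j) ^ p j * exp (circ R (\<theta> j) * of_real (x j))) \<partial>torus m) =
     (\<Prod>j\<in>{1..m}. (\<integral>t. ?d j t * circ R t ^ p j * exp (circ R t * of_real (x j)) \<partial>leb01))" for p
    by (rule torus_product_integral[OF int])
  have "(\<integral>\<theta>. array_density R m a \<theta> * exp (\<Sum>j\<in>insert 0 {1..m}. torus_coord R \<theta> j * of_real (x j)) \<partial>torus m) =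
      exp (of_real (x 0)) * (\<integral>\<theta>. (\<Prod>j\<in>{1..m}. ?d j (\<theta> j) * circ R (\<theta> j) ^ 0 * exp (circ R (\<theta> j) * of_real (x j))) \<partial>torus m)"
    unfolding exps array_density_def prod.distrib by (subst integral_mult_right_zero[symmetric]) (simp add: mult_ac)
  also have "\<dots> = exp (of_real (x 0)) * (\<Prod>j\<in>{1..m}. of_real (power_series (a j) (x j)))"
    unfolding gen[of "\<lambda>_. 0"] using circ_density_power_series(1)[OF a R] by simp
  finally show ?A by (simp add: exp_of_real)
  assume k: "k \<in> {1..m}"
  \<comment> \<open>The coordinate \<open>torus_coord R \<theta> k\<close> is written as a product
    over all circles with exponent 1 at \<open>k\<close> and 0 elsewhere, to keep the product
    form.\<close>
  let ?p = "\<lambda>j. if j = k then 1 else 0 :: nat"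
  have pk: "(\<Prod>j\<in>{1..m}. circ R (\<theta> j) ^ ?p j) = torus_coord R \<theta> k" for \<theta>
  proof -
    have "(\<Prod>j\<in>{1..m}. circ R (\<theta> j) ^ ?p j) = (\<Prod>j\<in>{1..m}. if j = k then circ R (\<theta> j) else 1)"
      by (intro prod.cong) auto
    then show ?thesis using k by (simp add: torus_coord_def)
  qed
  have "(\<integral>\<theta>. array_density R m a \<theta> * torus_coord R \<theta> k * exp (\<Sum>j\<in>insert 0 {1..m}. torus_coord R \<theta> j * of_real (x j)) \<partial>torus m) =
      exp (of_real (x 0)) * (\<integral>\<theta>. (\<Prod>j\<in>{1..m}. ?d j (\<theta> j) * circ R (\<theta> j) ^ ?p j * exp (circ R (\<theta> j) * of_real (x j))) \<partial>torus m)"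
    unfolding exps array_density_def prod.distrib pk
    by (subst integral_mult_right_zero[symmetric]) (simp add: mult_ac)
  also have "\<dots> = exp (of_real (x 0)) * (\<Prod>j\<in>{1..m}. of_real (power_series ((a(k := coeff_shift (a k))) j) (x j)))"
    unfolding gen[of ?p]
  proof (intro arg_cong2[where f="(*)"] prod.cong refl)
    fix j assume j: "j \<in> {1..m}"
    show "(\<integral>t. ?d j t * circ R t ^ ?p j * exp (circ R t * of_real (x j)) \<partial>leb01) = of_real (power_series ((a(k := coeff_shift (a k))) j) (x j))"
      using circ_density_power_series[OF a[OF j] R, of "x j"] by (cases "j = k") simp_all
  qed
  finally show ?B by (simp add: exp_of_real)
qed

section \<open>Wick calculus by S-transforms\<close>

text \<open>Bundles square integrability with the transform; on a \<open>brownian_space\<close> this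
  determines \<open>Y\<close> up to null sets.\<close>

definition has_S :: "'w measure \<Rightarrow> (real \<Rightarrow> 'w \<Rightarrow> real) \<Rightarrow> ('w \<Rightarrow> real) \<Rightarrow> ((real \<Rightarrow> real) \<Rightarrow> real) \<Rightarrow> bool" where
  "has_S M W Y G \<longleftrightarrow> square_integrable M Y \<and>
    (\<forall>g. square_integrable leb01 g \<longrightarrow> (\<integral>\<omega>. Y \<omega> * wick_exp M W g \<omega> \<partial>M) = G g)"

lemma has_SD:
  assumes "has_S M W Y G"
  shows "square_integrable M Y" "square_integrable leb01 g \<Longrightarrow> (\<integral>\<omega>. Y \<omega> * wick_exp M W g \<omega> \<partial>M) = G g"
  using assms by (auto simp: has_S_def)

context brownian_motion
begin

lemma has_S_add:
  assumes "has_S M W Y G" "has_S M W Y' G'"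
  shows "has_S M W (\<lambda>\<omega>. Y \<omega> + Y' \<omega>) (\<lambda>g. G g + G' g)"
  unfolding has_S_def
proof (intro conjI allI impI)
  show "square_integrable M (\<lambda>\<omega>. Y \<omega> + Y' \<omega>)" using assms by (auto intro: square_integrable_add has_SD)
  fix g assume g: "square_integrable leb01 g"
  have "integrable M (\<lambda>\<omega>. Y \<omega> * wick_exp M W g \<omega>)" "integrable M (\<lambda>\<omega>. Y' \<omega> * wick_exp M W g \<omega>)"
    by (intro square_integrable_mult wick_exp_square_integrable g has_SD(1)[OF assms(1)] has_SD(1)[OF assms(2)])+
  then show "(\<integral>\<omega>. (Y \<omega> + Y' \<omega>) * wick_exp M W g \<omega> \<partial>M) = G g + G' g"
    using has_SD(2)[OF assms(1) g] has_SD(2)[OF assms(2) g] by (simp add: distrib_right)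
qed

lemma has_S_cmult:
  assumes "has_S M W Y G"
  shows "has_S M W (\<lambda>\<omega>. c * Y \<omega>) (\<lambda>g. c * G g)"
  unfolding has_S_def
proof (intro conjI allI impI)
  show "square_integrable M (\<lambda>\<omega>. c * Y \<omega>)" using assms by (auto intro: square_integrable_cmult has_SD)
  fix g assume g: "square_integrable leb01 g"
  show "(\<integral>\<omega>. c * Y \<omega> * wick_exp M W g \<omega> \<partial>M) = c * G g"
    using has_SD(2)[OF assms(1) g] by (simp add: mult.assoc)
qed

lemma has_S_zero: "has_S M W (\<lambda>\<omega>. 0) (\<lambda>g. 0)"
  by (simp add: has_S_def square_integrable_zero)

lemma has_S_sum:
  "(\<And>i. i \<in> I \<Longrightarrow> has_S M W (Y i) (G i)) \<Longrightarrow> has_S M W (\<lambda>\<omega>. \<Sum>i\<in>I. Y i \<omega>) (\<lambda>g. \<Sum>i\<in>I. G i g)"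
  by (induction I rule: infinite_finite_induct) (auto intro: has_S_zero has_S_add)

lemma exp_wiener_expectation:
  assumes "square_integrable leb01 u"
  shows "(\<integral>\<omega>. exp (wiener_integral M W u \<omega>) \<partial>M) = exp (inner01 u u / 2)"
proof -
  have "complex_of_real (\<integral>\<omega>. exp (wiener_integral M W u \<omega>) \<partial>M) = (\<integral>\<omega>. complex_of_real (exp (wiener_integral M W u \<omega>)) \<partial>M)"
    by (rule integral_complex_of_real[symmetric])
  also have "\<dots> = (\<integral>\<omega>. exp (\<Sum>j\<in>{()}. 1 * of_real (wiener_integral M W u \<omega>)) \<partial>M)"
    by (simp add: exp_of_real)
  also have "\<dots> = of_real (exp (inner01 u u / 2))"
    using linear_complex_mgf[of "{()}" "\<lambda>_. u" "\<lambda>_. 1"] assms by (simp add: exp_of_real[symmetric])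
  finally show ?thesis by (simp only: of_real_eq_iff)
qed

lemma exp_wiener_wick_exp:
  assumes f: "square_integrable leb01 f" and g: "square_integrable leb01 g"
  shows "(\<integral>\<omega>. exp (t * wiener_integral M W f \<omega>) * wick_exp M W g \<omega> \<partial>M) = exp (t\<^sup>2 * inner01 f f / 2 + t * inner01 f g)"
proof -
  let ?u = "\<lambda>s. t * f s + g s"
  have tf: "square_integrable leb01 (\<lambda>s. t * f s)" by (rule square_integrable_cmult[OF f])
  have u: "square_integrable leb01 ?u" by (rule square_integrable_add[OF tf g])
  have meas: "wiener_integral M W k \<in> borel_measurable M" if "square_integrable leb01 k" for k
    using that by (intro square_integrable_measurable wiener_integral_square_integrable)
  have "AE \<omega> in M. exp (t * wiener_integral M W f \<omega>) * wick_exp M W g \<omega> = exp (wiener_integral M W ?u \<omega>) * exp (- inner01 g g / 2)"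
    using wiener_integral_add[OF tf g] wiener_integral_cmult[OF f, of t]
    by eventually_elim (simp add: wick_exp_def mult_exp_exp power2_eq_square)
  then have "(\<integral>\<omega>. exp (t * wiener_integral M W f \<omega>) * wick_exp M W g \<omega> \<partial>M) = (\<integral>\<omega>. exp (wiener_integral M W ?u \<omega>) * exp (- inner01 g g / 2) \<partial>M)"
    using meas[OF f] meas[OF g] meas[OF u] by (intro integral_cong_AE) (auto simp: wick_exp_def[abs_def])
  also have "\<dots> = exp (inner01 ?u ?u / 2) * exp (- inner01 g g / 2)"
    by (simp only: integral_mult_left_zero exp_wiener_expectation[OF u])
  also have "inner01 ?u ?u = t\<^sup>2 * inner01 f f + 2 * (t * inner01 f g) + inner01 g g"
  proof -
    have "inner01 ?u ?u = (\<integral>s. t\<^sup>2 * (f s * f s) + 2 * (t * (f s * g s)) + g s * g s \<partial>leb01)"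
      by (intro Bochner_Integration.integral_cong) (auto simp: algebra_simps power2_eq_square)
    then show ?thesis
      using square_integrable_mult[OF f f] square_integrable_mult[OF f g] square_integrable_mult[OF g g] by simp
  qed
  finally show ?thesis by (simp add: mult_exp_exp field_simps)
qed

lemma has_S_wick_exp:
  assumes f: "square_integrable leb01 f"
  shows "has_S M W (wick_exp M W f) (\<lambda>g. exp (inner01 f g))"
  unfolding has_S_def
proof (intro conjI allI impI)
  show "square_integrable M (wick_exp M W f)" by (rule wick_exp_square_integrable[OF f])
  fix g assume g: "square_integrable leb01 g"
  have "(\<integral>\<omega>. wick_exp M W f \<omega> * wick_exp M W g \<omega> \<partial>M) =
     (\<integral>\<omega>. exp (- inner01 f f / 2) * (exp (1 * wiener_integral M W f \<omega>) * wick_exp M W g \<omega>) \<partial>M)"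
    by (intro Bochner_Integration.integral_cong) (auto simp: wick_exp_def mult_exp_exp power2_eq_square algebra_simps)
  also have "\<dots> = exp (inner01 f g)"
    unfolding integral_mult_right_zero exp_wiener_wick_exp[OF f g] by (simp add: mult_exp_exp)
  finally show "(\<integral>\<omega>. wick_exp M W f \<omega> * wick_exp M W g \<omega> \<partial>M) = exp (inner01 f g)" .
qed

lemma has_S_one: "has_S M W (\<lambda>\<omega>. 1) (\<lambda>g. 1)"
proof -
  have "(\<integral>\<omega>. wick_exp M W g \<omega> \<partial>M) = 1" if g: "square_integrable leb01 g" for g
    using exp_wiener_wick_exp[OF g g, of 0] by simp
  then show ?thesis by (simp add: has_S_def square_integrable_const)
qed

text \<open>Compare the linear terms in \<open>t\<close> of the power series
  \<open>E (exp (t I(f)) \<cdot> wick_exp g) = exp (t\<^sup>2 \<langle>f, f\<rangle> / 2 + t \<langle>f, g\<rangle>)\<close>.\<close>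

lemma has_S_wiener_integral:
  assumes f: "square_integrable leb01 f"
  shows "has_S M W (wiener_integral M W f) (\<lambda>g. inner01 f g)"
  unfolding has_S_def
proof (intro conjI allI impI)
  show "square_integrable M (wiener_integral M W f)" by (rule wiener_integral_square_integrable[OF f])
  fix g assume g: "square_integrable leb01 g"
  let ?Z = "wick_exp M W g" and ?V = "wiener_integral M W f"
  define c where "c k = (\<integral>\<omega>. ?Z \<omega> * ?V \<omega> ^ k \<partial>M) / fact k" for k
  define F where "F t = exp (t\<^sup>2 * inner01 f f / 2 + t * inner01 f g)" for t
  have meas: "?Z \<in> borel_measurable M" "?V \<in> borel_measurable M"
    using wick_exp_square_integrable[OF g] wiener_integral_square_integrable[OF f] by (auto simp: square_integrable_def)
  have int: "integrable M (\<lambda>\<omega>. ?Z \<omega> * exp (t * ?V \<omega>))" for t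
  proof -
    have "square_integrable M (\<lambda>\<omega>. exp (wiener_integral M W (\<lambda>s. t * f s) \<omega>))"
      by (intro square_integrable_exp_wiener square_integrable_cmult f)
    then have "square_integrable M (\<lambda>\<omega>. exp (t * ?V \<omega>))"
      by (rule square_integrable_AE_cong) (use meas wiener_integral_cmult[OF f, of t] in \<open>auto elim: eventually_mono\<close>)
    then show ?thesis by (intro square_integrable_mult wick_exp_square_integrable g)
  qed
  have sums: "(\<lambda>k. c k * x ^ k) sums F x" for x
  proof -
    have "(\<lambda>k. of_real x ^ k / fact k * of_real (\<integral>\<omega>. ?Z \<omega> * ?V \<omega> ^ k \<partial>M)) sums
       (\<integral>\<omega>. of_real (?Z \<omega>) * exp (of_real x * of_real (?V \<omega>)) \<partial>M :: complex)"
      by (rule mgf_series[OF meas int])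
    also have "(\<integral>\<omega>. of_real (?Z \<omega>) * exp (of_real x * of_real (?V \<omega>)) \<partial>M :: complex) = (\<integral>\<omega>. complex_of_real (?Z \<omega> * exp (x * ?V \<omega>)) \<partial>M)"
      by (simp only: of_real_mult exp_of_real[symmetric])
    also have "\<dots> = of_real (\<integral>\<omega>. ?Z \<omega> * exp (x * ?V \<omega>) \<partial>M)" by (rule integral_complex_of_real)
    also have "(\<integral>\<omega>. ?Z \<omega> * exp (x * ?V \<omega>) \<partial>M) = F x"
      using exp_wiener_wick_exp[OF f g, of x] by (simp add: F_def mult.commute)
    also have "(\<lambda>k. of_real x ^ k / fact k * of_real (\<integral>\<omega>. ?Z \<omega> * ?V \<omega> ^ k \<partial>M)) = (\<lambda>k. complex_of_real (c k * x ^ k))"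
      by (auto simp: c_def)
    finally show ?thesis by (simp only: sums_of_real_iff)
  qed
  have "DERIV (\<lambda>x. \<Sum>n. c n * x ^ n) 0 :> (\<Sum>n. diffs c n * 0 ^ n)"
    by (rule termdiffs_strong[of c 1]) (use sums_summable[OF sums[of 1]] in auto)
  moreover have "(\<lambda>x. \<Sum>n. c n * x ^ n) = F" using sums by (auto simp: sums_iff)
  moreover have "(\<Sum>n. diffs c n * 0 ^ n) = c 1" by (simp add: diffs_def)
  ultimately have "DERIV F 0 :> c 1" by simp
  moreover have "DERIV F 0 :> inner01 f g"
    unfolding F_def by (auto intro!: derivative_eq_intros simp del: integral_mult_right_zero integral_mult_left_zero)
  ultimately have "c 1 = inner01 f g" by (rule DERIV_unique)
  then show "(\<integral>\<omega>. ?V \<omega> * wick_exp M W g \<omega> \<partial>M) = inner01 f g" by (simp add: c_def mult.commute)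
qed

text \<open>The witness \<open>Z\<close> is what makes the choice in \<open>wick_product\<close>
  meaningful; the chosen version then has the same S-transform.\<close>

lemma has_S_wick_product:
  assumes X: "has_S M W X G" and Y: "has_S M W Y H" and Z: "has_S M W Z (\<lambda>g. G g * H g)"
  shows "has_S M W (wick_product M W X Y) (\<lambda>g. G g * H g)"
proof -
  have "is_wick_product M W X Y Z"
    unfolding is_wick_product_def using has_SD[OF X] has_SD[OF Y] has_SD[OF Z] by simp
  then have "is_wick_product M W X Y (wick_product M W X Y)"
    unfolding wick_product_def by (rule someI[where P="is_wick_product M W X Y"])
  then show ?thesis
    unfolding is_wick_product_def has_S_def using has_SD[OF X] has_SD[OF Y] by simp
qed

end

definition array_growth :: "real \<Rightarrow> nat \<Rightarrow> (nat \<Rightarrow> nat \<Rightarrow> real) \<Rightarrow> bool" where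
  "array_growth R m a \<longleftrightarrow> (\<forall>j\<in>{1..m}. coeff_growth R (a j))"

definition S_array :: "nat \<Rightarrow> (nat \<Rightarrow> real \<Rightarrow> real) \<Rightarrow> (nat \<Rightarrow> nat \<Rightarrow> real) \<Rightarrow> (real \<Rightarrow> real) \<Rightarrow> real" where
  "S_array m f a g = (\<Prod>j\<in>{1..m}. power_series (a j) (inner01 (f j) g))"

section \<open>Existence and S-transforms of Wick-analytic functionals\<close>

context brownian_space
begin

lemma array_mixture:
  assumes R: "R \<ge> 1" and a: "array_growth R m a"
  shows "wick_mixture.density_ok (torus m) (array_density R m a)"
    and "wick_mixture.S_mix (torus m) (insert 0 {1..m}) (torus_coord R) h (array_density R m a) g
      = of_real (exp (inner01 (h 0) g) * S_array m h a g)"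
proof -
  interpret C: wick_mixture M W "torus m" "insert 0 {1..m}" "torus_coord R" R by (rule torus_mixture[OF R])
  have R0: "R > 0" using R by simp
  have a': "coeff_growth R (a j)" if "j \<in> {1..m}" for j using a that by (simp add: array_growth_def)
  show "C.density_ok (array_density R m a)"
    unfolding C.density_ok_def using array_density_ok[OF R0 a'] by simp
  show "C.S_mix h (array_density R m a) g = of_real (exp (inner01 (h 0) g) * S_array m h a g)"
    unfolding C.S_mix_def S_array_def by (rule array_density_integral(1)[OF R0 a'])
qed

text \<open>Provides the witnesses for all Wick products formed below, since their S-transforms are
  products of power series.\<close>

lemma has_S_array_exists:
  assumes R: "R \<ge> 1" and a: "array_growth R m a" and f: "\<And>j. j \<in> {1..m} \<Longrightarrow> square_integrable leb01 (f j)"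
  shows "\<exists>Y. has_S M W Y (S_array m f a)"
proof -
  interpret C: wick_mixture M W "torus m" "insert 0 {1..m}" "torus_coord R" R by (rule torus_mixture[OF R])
  \<comment> \<open>A zero volatility makes the factor belonging to coordinate 0 equal to 1.\<close>
  let ?h = "f(0 := \<lambda>s. 0)"
  have h: "C.L2fam ?h" using f by (auto simp: square_integrable_zero)
  have S: "C.S_mix ?h (array_density R m a) g = of_real (S_array m f a g)" for g
    unfolding array_mixture(2)[OF R a] by (simp add: S_array_def)
  obtain X where "square_integrable M X"
    "\<And>g. square_integrable leb01 g \<Longrightarrow> (\<integral>\<omega>. X \<omega> * wick_exp M W g \<omega> \<partial>M) = S_array m f a g"
    by (rule C.mix_real_exists[OF array_mixture(1)[OF R a] h S]) blast
  then show ?thesis unfolding has_S_def by blast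
qed

lemma power_series_monomial: "power_series (\<lambda>l. if l = k then 1 else 0) x = x ^ k"
proof -
  have "(\<lambda>l. if l = k then x ^ l else 0) sums x ^ k" by (rule sums_single)
  moreover have "(\<lambda>l. (if l = k then 1 else 0) * x ^ l) = (\<lambda>l. if l = k then x ^ l else 0)" by auto
  ultimately show ?thesis unfolding power_series_def by (simp add: sums_iff)
qed

lemma has_S_wick_power:
  assumes f: "square_integrable leb01 f"
  shows "has_S M W (wick_power M W (wiener_integral M W f) k) (\<lambda>g. inner01 f g ^ k)"
proof (induction k)
  case 0
  then show ?case using has_S_one by simp
next
  case (Suc k)
  \<comment> \<open>A single-variable array that represents the monomial of degree
    \<open>Suc k\<close>; with radius 4 its growth bound is the constant
    \<open>fact (Suc k)\<close>.\<close>
  let ?a = "\<lambda>_ l. if l = Suc k then 1 else 0 :: real"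
  have "array_growth 4 1 ?a"
    unfolding array_growth_def coeff_growth_def by (auto intro!: exI[of _ "fact (Suc k)"])
  then have "\<exists>Z. has_S M W Z (S_array 1 (\<lambda>_. f) ?a)"
    using f by (intro has_S_array_exists[of 4]) auto
  moreover have "S_array 1 (\<lambda>_. f) ?a = (\<lambda>g. inner01 f g ^ k * inner01 f g)"
    by (auto simp: S_array_def power_series_monomial)
  ultimately obtain Z where "has_S M W Z (\<lambda>g. inner01 f g ^ k * inner01 f g)" by auto
  from has_S_wick_product[OF Suc has_S_wiener_integral[OF f] this] show ?case by (simp add: mult.commute)
qed

text \<open>Partial sums and limit are all mixtures over the same circle. Their densities differ
  uniformly by a geometric error, and the envelope turns this into convergence in L2, so the choice
  in \<open>wick_series\<close> has a witness.\<close>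

lemma has_S_wick_series:
  assumes f: "square_integrable leb01 f" and R: "R \<ge> 1" and a: "coeff_growth R a"
  shows "has_S M W (wick_series M W a f) (\<lambda>g. power_series a (inner01 f g))"
proof -
  interpret C: wick_mixture M W "torus 1" "insert 0 {1..1}" "torus_coord R" R by (rule torus_mixture[OF R])
  have R0: "R > 0" using R by simp
  obtain K where K: "\<And>k. \<bar>fact k * a k\<bar> \<le> K * (R / 4) ^ k" "\<And>k. \<bar>fact k * a k\<bar> \<le> K * (R / 2) ^ k"
    by (rule coeff_growthD[OF a R0]) blast
  have K0: "K \<ge> 0" using K(1)[of 0] by simp
  define an where "an n k = (if k < n then a k else 0)" for n k :: nat
  have an: "coeff_growth R (an n)" for n
  proof -
    have "\<bar>fact k * an n k\<bar> \<le> K * (R / 4) ^ k" for k using K(1)[of k] K0 R by (auto simp: an_def)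
    then show ?thesis unfolding coeff_growth_def by blast
  qed
  let ?\<rho> = "array_density R 1 (\<lambda>_. a)" and ?\<rho>n = "\<lambda>n. array_density R 1 (\<lambda>_. an n)"
  let ?h = "\<lambda>j. if j = 0 then (\<lambda>s. 0) else f"
  let ?P = "\<lambda>n \<omega>. \<Sum>k<n. a k * wick_power M W (wiener_integral M W f) k \<omega>"
  have h: "C.L2fam ?h" using f by (auto simp: square_integrable_zero)
  have g1: "array_growth R 1 (\<lambda>_. a)" "array_growth R 1 (\<lambda>_. an n)" for n
    using a an by (auto simp: array_growth_def)
  note ok = array_mixture(1)[OF R g1(1)] array_mixture(1)[OF R g1(2)]
  have S: "C.S_mix ?h ?\<rho> g = of_real (power_series a (inner01 f g))"
    and Sn: "C.S_mix ?h (?\<rho>n n) g = of_real (power_series (an n) (inner01 f g))" for g n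
    unfolding array_mixture(2)[OF R g1(1)] array_mixture(2)[OF R g1(2)] by (simp_all add: S_array_def)
  obtain X where X: "square_integrable M X"
    "\<And>g. square_integrable leb01 g \<Longrightarrow> (\<integral>\<omega>. X \<omega> * wick_exp M W g \<omega> \<partial>M) = power_series a (inner01 f g)"
    by (rule C.mix_real_exists[OF ok(1) h S]) blast
  have SX: "has_S M W X (\<lambda>g. power_series a (inner01 f g))" using X by (simp add: has_S_def)
  have XE: "AE \<omega> in M. C.mix ?h ?\<rho> \<omega> = of_real (X \<omega>)"
    by (rule C.mix_representation[OF ok(1) h X(1)]) (simp only: S X(2))
  have SP: "has_S M W (?P n) (\<lambda>g. power_series (an n) (inner01 f g))" for n
  proof -
    have "has_S M W (?P n) (\<lambda>g. \<Sum>k<n. a k * inner01 f g ^ k)"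
      by (intro has_S_sum has_S_cmult has_S_wick_power f)
    moreover have "power_series (an n) x = (\<Sum>k<n. a k * x ^ k)" for x
    proof -
      have "power_series (an n) x = (\<Sum>k<n. an n k * x ^ k)"
        unfolding power_series_def by (rule suminf_finite) (auto simp: an_def)
      then show ?thesis by (simp add: an_def)
    qed
    ultimately show ?thesis by simp
  qed
  have PE: "AE \<omega> in M. C.mix ?h (?\<rho>n n) \<omega> = of_real (?P n \<omega>)" for n
    by (rule C.mix_representation[OF ok(2) h has_SD(1)[OF SP]]) (simp only: Sn has_SD(2)[OF SP])
  have rd: "norm (?\<rho>n n \<theta> - ?\<rho> \<theta>) \<le> 2 * (K * (1 / 2) ^ n)" for n \<theta>
  proof -
    let ?c = "\<lambda>b. circ_density R (\<lambda>k. fact k * b k) (\<theta> 1)"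
    \<comment> \<open>The tail of the coefficients; by linearity its density is the difference of
      the two densities.\<close>
    define tl where "tl k = (if k < n then 0 else a k)" for k
    have tlb: "\<bar>fact k * tl k\<bar> \<le> (K * (1 / 2) ^ n) * (R / 2) ^ k" for k
    proof (cases "k < n")
      case False
      have "\<bar>fact k * tl k\<bar> \<le> K * (R / 4) ^ k" using K(1)[of k] False by (simp add: tl_def)
      also have "(R / 4) ^ k = (1 / 2) ^ k * (R / 2) ^ k" by (simp add: power_mult_distrib[symmetric])
      also have "K * ((1 / 2) ^ k * (R / 2) ^ k) \<le> K * ((1 / 2) ^ n * (R / 2) ^ k)"
        using False K0 R by (intro mult_left_mono mult_right_mono power_decreasing) auto
      finally show ?thesis by (simp add: mult.assoc)
    qed (use K0 R in \<open>simp add: tl_def\<close>)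
    have anb: "\<bar>fact k * an n k\<bar> \<le> K * (R / 2) ^ k" for k using K(2)[of k] K0 R by (auto simp: an_def)
    have "?c a - ?c (an n) = ?c tl"
      unfolding circ_density_def
      by (subst suminf_diff[OF summable_norm_cancel[OF circ_density_summable[OF R0 K(2)]] summable_norm_cancel[OF circ_density_summable[OF R0 anb]]])
         (auto intro!: suminf_cong simp: tl_def an_def)
    moreover have "norm (?c tl) \<le> 2 * (K * (1 / 2) ^ n)" by (rule circ_density_bound[OF R0 tlb])
    moreover have "?\<rho> \<theta> = ?c a" "?\<rho>n n \<theta> = ?c (an n)" by (simp_all add: array_density_def)
    ultimately show ?thesis by (simp add: norm_minus_commute)
  qed
  have lim: "L2_tendsto M ?P X"
  proof -
    let ?E = "\<lambda>\<omega>. C.env ?h (\<lambda>j. wiener_integral M W (?h j) \<omega>)"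
    have E: "square_integrable M ?E" by (rule C.env_square_integrable[OF h])
    have sq: "square_integrable M (\<lambda>\<omega>. ?P n \<omega> - X \<omega>)" for n
      by (intro square_integrable_diff has_SD(1)[OF SP] X(1))
    have bd: "l2norm M (\<lambda>\<omega>. ?P n \<omega> - X \<omega>) \<le> 2 * (K * (1 / 2) ^ n) * l2norm M ?E" for n
    proof -
      let ?B = "2 * (K * (1 / 2) ^ n)"
      have okd: "C.density_ok (\<lambda>\<theta>. ?\<rho>n n \<theta> - ?\<rho> \<theta>)"
        unfolding C.density_ok_def using C.density_okD(1)[OF ok(1)] C.density_okD(1)[OF ok(2)[of n]] rd[of n] by (auto intro!: exI[of _ ?B])
      have T: "measure (torus 1) (space (torus 1)) = 1"
        using prob_space.prob_space[OF torus_prob_space] .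
      have diff: "C.mixture ?h (\<lambda>\<theta>. ?\<rho>n n \<theta> - ?\<rho> \<theta>) x = C.mixture ?h (?\<rho>n n) x - C.mixture ?h ?\<rho> x" for x
      proof -
        have i: "integrable (torus 1) (\<lambda>\<theta>. r \<theta> * C.cexp ?h x \<theta>)" if r: "C.density_ok r" for r
        proof -
          obtain B where B: "B \<ge> 0" "\<And>\<theta>. norm (r \<theta>) \<le> B" using C.density_okD(2)[OF r] by blast
          show ?thesis
          proof (rule C.N.integrable_const_bound[of _ "B * C.env ?h x"])
            show "AE \<theta> in torus 1. norm (r \<theta> * C.cexp ?h x \<theta>) \<le> B * C.env ?h x"
              unfolding norm_mult using B C.cexp_le_env by (intro AE_I2 mult_mono) auto
            show "(\<lambda>\<theta>. r \<theta> * C.cexp ?h x \<theta>) \<in> borel_measurable (torus 1)"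
              by (intro borel_measurable_times C.density_okD(1)[OF r] C.cexp_measurable1(2)[of "\<lambda>_ _. 0" "count_space UNIV"]) simp
          qed
        qed
        show ?thesis unfolding C.mixture_def left_diff_distrib
          by (rule Bochner_Integration.integral_diff[OF i[OF ok(2)] i[OF ok(1)]])
      qed
      \<comment> \<open>The difference of partial sum and limit is the mixture of the difference of
        the densities; as the torus has mass 1, it is at most \<open>?B\<close> times the
        envelope.\<close>
      have "AE \<omega> in M. norm ((?P n \<omega> - X \<omega>)\<^sup>2) \<le> norm ((?B * ?E \<omega>)\<^sup>2)"
        using XE PE[of n]
      proof eventually_elim
        case (elim \<omega>)
        have "norm (complex_of_real (?P n \<omega> - X \<omega>)) \<le> ?B * 1 * ?E \<omega>"
          using C.mixture_le_env[OF okd rd, of ?h "\<lambda>j. wiener_integral M W (?h j) \<omega>"] elim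
          unfolding diff T by simp
        then have "\<bar>?P n \<omega> - X \<omega>\<bar> \<le> \<bar>?B * ?E \<omega>\<bar>" unfolding norm_of_real by linarith
        then show ?case by (simp only: abs_le_square_iff real_norm_def abs_power2)
      qed
      then have "(\<integral>\<omega>. (?P n \<omega> - X \<omega>)\<^sup>2 \<partial>M) \<le> (\<integral>\<omega>. (?B * ?E \<omega>)\<^sup>2 \<partial>M)"
        by (intro integral_mono_AE square_integrable_power2 sq square_integrable_cmult E) auto
      then have "l2norm M (\<lambda>\<omega>. ?P n \<omega> - X \<omega>) \<le> l2norm M (\<lambda>\<omega>. ?B * ?E \<omega>)" unfolding l2norm_def by simp
      also have "\<dots> = ?B * l2norm M ?E" using K0 by (simp add: l2norm_cmult)
      finally show ?thesis .
    qed
    have "(\<lambda>n. 2 * (K * (1 / 2) ^ n) * l2norm M ?E) \<longlonglongrightarrow> 2 * (K * 0) * l2norm M ?E"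
      by (intro tendsto_intros LIMSEQ_realpow_zero) auto
    then have "(\<lambda>n. 2 * (K * (1 / 2) ^ n) * l2norm M ?E) \<longlonglongrightarrow> 0" by simp
    then have "(\<lambda>n. l2norm M (\<lambda>\<omega>. ?P n \<omega> - X \<omega>)) \<longlonglongrightarrow> 0"
    proof (rule Lim_null_comparison[rotated])
      show "\<forall>\<^sub>F n in sequentially. norm (l2norm M (\<lambda>\<omega>. ?P n \<omega> - X \<omega>)) \<le> 2 * (K * (1 / 2) ^ n) * l2norm M ?E"
        by (intro always_eventually allI) (simp only: real_norm_def abs_of_nonneg[OF l2norm_nonneg] bd)
    qed
    then show ?thesis unfolding L2_tendsto_iff using has_SD(1)[OF SP] X(1) by blast
  qed
  have "L2_tendsto M ?P (wick_series M W a f)"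
    unfolding wick_series_def using lim by (rule someI[where P="L2_tendsto M ?P"])
  then have "AE \<omega> in M. wick_series M W a f \<omega> = X \<omega>" "square_integrable M (wick_series M W a f)"
    using L2_tendsto_unique[OF _ lim] by (auto dest: L2_tendstoD)
  moreover have "(\<integral>\<omega>. wick_series M W a f \<omega> * wick_exp M W g \<omega> \<partial>M) = (\<integral>\<omega>. X \<omega> * wick_exp M W g \<omega> \<partial>M)"
    if "square_integrable leb01 g" for g
    using calculation X(1) wick_exp_square_integrable[OF that]
    by (intro integral_cong_AE borel_measurable_times square_integrable_measurable) (auto elim: eventually_mono)
  ultimately show ?thesis using X(2) by (simp add: has_S_def)
qed

text \<open>The first \<open>n\<close> factors again form an array, so every intermediate Wick
  product exists.\<close>

lemma has_S_wick_analytic: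
  assumes f: "\<And>j. j \<in> {1..m} \<Longrightarrow> square_integrable leb01 (f j)" and R: "R \<ge> 1" and a: "array_growth R m a"
  shows "has_S M W (wick_analytic M W m f a) (S_array m f a)"
proof -
  have "has_S M W (wick_prod_upto M W (\<lambda>i. wick_series M W (a i) (f i)) n) (S_array n f a)" if "n \<le> m" for n
    using that
  proof (induction n)
    case 0
    then show ?case using has_S_one by (simp add: S_array_def)
  next
    case (Suc n)
    have Sn: "S_array (Suc n) f a = (\<lambda>g. S_array n f a g * power_series (a (Suc n)) (inner01 (f (Suc n)) g))"
    proof
      fix g
      have "{1..Suc n} = insert (Suc n) {1..n}" by auto
      then show "S_array (Suc n) f a g = S_array n f a g * power_series (a (Suc n)) (inner01 (f (Suc n)) g)"
        unfolding S_array_def by (simp only: prod.insert[of "{1..n}" "Suc n"] finite_atLeastAtMost atLeastAtMost_iff) simp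
    qed
    have "\<exists>Z. has_S M W Z (S_array (Suc n) f a)"
      by (rule has_S_array_exists[OF R]) (use Suc.prems a f in \<open>auto simp: array_growth_def\<close>)
    then obtain Z where Z: "has_S M W Z (\<lambda>g. S_array n f a g * power_series (a (Suc n)) (inner01 (f (Suc n)) g))"
      unfolding Sn by blast
    have ser: "has_S M W (wick_series M W (a (Suc n)) (f (Suc n))) (\<lambda>g. power_series (a (Suc n)) (inner01 (f (Suc n)) g))"
      by (rule has_S_wick_series[OF f R]) (use Suc.prems a in \<open>auto simp: array_growth_def\<close>)
    have IH: "has_S M W (wick_prod_upto M W (\<lambda>i. wick_series M W (a i) (f i)) n) (S_array n f a)"
      using Suc by simp
    show ?case unfolding Sn wick_prod_upto.simps by (rule has_S_wick_product[OF IH ser Z])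
  qed
  then show ?thesis unfolding wick_analytic_def by simp
qed

end

section \<open>Linear combinations and their partial derivatives\<close>

definition functional_growth :: "real \<Rightarrow> nat \<Rightarrow> wick_functional \<Rightarrow> bool" where
  "functional_growth R m F \<longleftrightarrow> (\<forall>(c, a)\<in>set F. array_growth R m a)"

definition S_functional :: "nat \<Rightarrow> (nat \<Rightarrow> real \<Rightarrow> real) \<Rightarrow> wick_functional \<Rightarrow> (real \<Rightarrow> real) \<Rightarrow> real" where
  "S_functional m f F g = (\<Sum>(c, a)\<leftarrow>F. c * S_array m f a g)"

definition functional_density :: "real \<Rightarrow> nat \<Rightarrow> wick_functional \<Rightarrow> (nat \<Rightarrow> real) \<Rightarrow> complex" where
  "functional_density R m F \<theta> = (\<Sum>(c, a)\<leftarrow>F. of_real c * array_density R m a \<theta>)"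

lemma functional_growth_Cons [simp]:
  "functional_growth R m []" "functional_growth R m ((c, a) # F) \<longleftrightarrow> array_growth R m a \<and> functional_growth R m F"
  by (auto simp: functional_growth_def)

lemma S_functional_simps [simp]:
  "S_functional m f [] g = 0" "S_functional m f ((c, a) # F) g = c * S_array m f a g + S_functional m f F g"
  by (auto simp: S_functional_def)

lemma functional_density_simps [simp]:
  "functional_density R m [] \<theta> = 0"
  "functional_density R m ((c, a) # F) \<theta> = of_real c * array_density R m a \<theta> + functional_density R m F \<theta>"
  by (auto simp: functional_density_def)

lemma wick_partial_simps [simp]:
  "wick_partial k [] = []" "wick_partial k ((c, a) # F) = (c, a(k := coeff_shift (a k))) # wick_partial k F"
  by (auto simp: wick_partial_def coeff_shift_def[abs_def])

lemma wick_eval_simps: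
  "wick_eval M W m f [] = (\<lambda>\<omega>. 0)"
  "wick_eval M W m f ((c, a) # F) = (\<lambda>\<omega>. c * wick_analytic M W m f a \<omega> + wick_eval M W m f F \<omega>)"
  by (auto simp: wick_eval_def)

lemma functional_growth_partial:
  assumes "functional_growth R m F" "R > 0"
  shows "functional_growth R m (wick_partial k F)"
  using assms(1)
proof (induction F)
  case (Cons x F)
  obtain c a where x: "x = (c, a)" by (cases x)
  show ?case using Cons coeff_growth_shift[OF _ assms(2)] by (auto simp: x array_growth_def)
qed simp

text \<open>A bound \<open>C\<close> on the roots means \<open>k! |a k| \<le> C ^ k\<close>; the
  radius is \<open>4 * C\<close> because \<open>coeff_growth\<close> measures against a quarter of
  the radius.\<close>

lemma wick_analytic_coeffs_growth:
  assumes "wick_analytic_coeffs m a"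
  obtains R where "R \<ge> 1" "array_growth R m a"
proof -
  obtain C0 where C0: "\<And>i k. i \<in> {1..m} \<Longrightarrow> 1 \<le> k \<Longrightarrow> root k (fact k * \<bar>a i k\<bar>) \<le> C0"
    using assms unfolding wick_analytic_coeffs_def bdd_above_def by blast
  define C where "C = max 1 C0"
  have bound: "fact k * \<bar>a i k\<bar> \<le> C ^ k" if "i \<in> {1..m}" "1 \<le> k" for i k
  proof -
    have r: "root k (fact k * \<bar>a i k\<bar>) \<le> C" using C0[OF that] by (simp add: C_def)
    have "fact k * \<bar>a i k\<bar> = root k (fact k * \<bar>a i k\<bar>) ^ k" using that by (simp add: real_root_pow_pos2)
    also have "\<dots> \<le> C ^ k" using r that by (intro power_mono) auto
    finally show ?thesis .
  qed
  show ?thesis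
  proof (rule that[of "4 * C"])
    show "4 * C \<ge> 1" by (simp add: C_def)
    show "array_growth (4 * C) m a"
      unfolding array_growth_def coeff_growth_def
    proof
      fix j assume j: "j \<in> {1..m}"
      \<comment> \<open>The roots constrain only \<open>k \<ge> 1\<close>, so the constant
        coefficient has to enter the factor in front.\<close>
      have "\<bar>fact k * a j k\<bar> \<le> max 1 \<bar>a j 0\<bar> * (4 * C / 4) ^ k" for k
      proof (cases "k = 0")
        case False
        then have "\<bar>fact k * a j k\<bar> \<le> C ^ k" using bound[OF j, of k] by (simp add: abs_mult)
        also have "\<dots> \<le> max 1 \<bar>a j 0\<bar> * C ^ k" using mult_right_mono[of 1 "max 1 \<bar>a j 0\<bar>" "C ^ k"] by (simp add: C_def)
        finally show ?thesis by simp
      qed simp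
      then show "\<exists>K. \<forall>k. \<bar>fact k * a j k\<bar> \<le> K * (4 * C / 4) ^ k" by blast
    qed
  qed
qed

text \<open>A combination is a finite list, so the largest radius serves all its terms; a common
  torus is needed to add their densities.\<close>

lemma lin_WA_growth:
  assumes "F \<in> lin_WA m"
  obtains R where "R \<ge> 1" "functional_growth R m F"
  using assms
proof (induction F arbitrary: thesis)
  case Nil
  show ?case by (rule Nil(1)[of 1]) auto
next
  case (Cons x F)
  obtain c a where x: "x = (c, a)" by (cases x)
  have "F \<in> lin_WA m" using Cons(3) by (auto simp: lin_WA_def)
  then obtain R where R: "R \<ge> 1" "functional_growth R m F" using Cons(1) by blast
  have "wick_analytic_coeffs m a" using Cons(3) by (auto simp: lin_WA_def x)
  then obtain R' where R': "R' \<ge> 1" "array_growth R' m a" by (rule wick_analytic_coeffs_growth)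
  let ?R = "max R R'"
  have "array_growth ?R m a" using R' coeff_growth_mono[of R' _ ?R] by (auto simp: array_growth_def)
  moreover have "functional_growth ?R m F"
    unfolding functional_growth_def
  proof (clarify)
    fix c b assume "(c, b) \<in> set F"
    then have "array_growth R m b" using R(2) by (auto simp: functional_growth_def)
    then show "array_growth ?R m b" using R(1) coeff_growth_mono[of R _ ?R] by (auto simp: array_growth_def)
  qed
  ultimately show ?case using R(1) by (intro Cons(2)[of ?R]) (auto simp: x)
qed

context brownian_space
begin

lemma has_S_wick_eval:
  assumes f: "\<And>j. j \<in> {1..m} \<Longrightarrow> square_integrable leb01 (f j)" and R: "R \<ge> 1" and F: "functional_growth R m F"
  shows "has_S M W (wick_eval M W m f F) (S_functional m f F)"
  using F
proof (induction F)
  case Nil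
  then show ?case using has_S_zero unfolding wick_eval_simps by (simp add: S_functional_def[abs_def])
next
  case (Cons x F)
  obtain c a where x: "x = (c, a)" by (cases x)
  have e: "S_functional m f (x # F) = (\<lambda>g. c * S_array m f a g + S_functional m f F g)" by (auto simp: x)
  show ?case unfolding e unfolding x wick_eval_simps
    using Cons x by (intro has_S_add has_S_cmult has_S_wick_analytic[OF f R]) auto
qed

text \<open>All three facts are proved in one induction because linearity of \<open>S_mix\<close>
  needs admissibility of both densities. The third identifies multiplication by a coordinate with
  \<open>wick_partial\<close>.\<close>

lemma functional_mixture:
  assumes R: "R \<ge> 1" and F: "functional_growth R m F"
  shows "wick_mixture.density_ok (torus m) (functional_density R m F)"
    and "wick_mixture.S_mix (torus m) (insert 0 {1..m}) (torus_coord R) h (functional_density R m F) g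
      = of_real (exp (inner01 (h 0) g) * S_functional m h F g)"
    and "k \<in> {1..m} \<Longrightarrow> wick_mixture.S_mix (torus m) (insert 0 {1..m}) (torus_coord R) h
        (\<lambda>\<theta>. functional_density R m F \<theta> * torus_coord R \<theta> k) g
      = of_real (exp (inner01 (h 0) g) * S_functional m h (wick_partial k F) g)"
proof -
  interpret C: wick_mixture M W "torus m" "insert 0 {1..m}" "torus_coord R" R by (rule torus_mixture[OF R])
  have R0: "R > 0" using R by simp
  have okadd: "C.density_ok (\<lambda>\<theta>. c * r \<theta> + r' \<theta>)" if "C.density_ok r" "C.density_ok r'" for r r' c
    by (intro C.density_ok_add C.density_ok_cmult that)
  have okz: "C.density_ok (\<lambda>\<theta>. r \<theta> * torus_coord R \<theta> k)" if "C.density_ok r" "k \<in> {1..m}" for r k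
    using that by (intro C.density_ok_times_coord) auto
  have main: "C.density_ok (functional_density R m F) \<and>
      C.S_mix h (functional_density R m F) g = of_real (exp (inner01 (h 0) g) * S_functional m h F g) \<and>
      (k \<in> {1..m} \<longrightarrow> C.S_mix h (\<lambda>\<theta>. functional_density R m F \<theta> * torus_coord R \<theta> k) g
         = of_real (exp (inner01 (h 0) g) * S_functional m h (wick_partial k F) g))" for k
    using F
  proof (induction F)
    case Nil
    have "functional_density R m [] = (\<lambda>_. 0)" by auto
    moreover have "C.density_ok (\<lambda>_. 0)" unfolding C.density_ok_def by auto
    moreover have "C.S_mix h (\<lambda>_. 0) g = 0" unfolding C.S_mix_def by simp
    ultimately show ?case by (simp only: mult_zero_left mult_zero_right S_functional_simps wick_partial_simps of_real_0 simp_thms)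
  next
    case (Cons x F)
    obtain c a where x: "x = (c, a)" by (cases x)
    have a: "array_growth R m a" and F: "functional_growth R m F" using Cons.prems x by auto
    have a': "coeff_growth R (a j)" if "j \<in> {1..m}" for j using a that by (simp add: array_growth_def)
    note IH = Cons.IH[OF F]
    note oka = array_mixture(1)[OF R a]
    have okF: "C.density_ok (functional_density R m F)" using IH by blast
    have e: "functional_density R m (x # F) = (\<lambda>\<theta>. of_real c * array_density R m a \<theta> + functional_density R m F \<theta>)"
      by (auto simp: x)
    have lin: "C.S_mix h (\<lambda>\<theta>. of_real c * r \<theta> + r' \<theta>) g = of_real c * C.S_mix h r g + C.S_mix h r' g"
      if "C.density_ok r" "C.density_ok r'" for r r'
      by (simp only: C.S_mix_add[OF C.density_ok_cmult[OF that(1)] that(2)] C.S_mix_cmult)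
    have k: "C.S_mix h (\<lambda>\<theta>. functional_density R m (x # F) \<theta> * torus_coord R \<theta> k) g
         = of_real (exp (inner01 (h 0) g) * S_functional m h (wick_partial k (x # F)) g)" if k: "k \<in> {1..m}"
    proof -
      have "C.S_mix h (\<lambda>\<theta>. functional_density R m (x # F) \<theta> * torus_coord R \<theta> k) g =
         C.S_mix h (\<lambda>\<theta>. of_real c * (array_density R m a \<theta> * torus_coord R \<theta> k) + functional_density R m F \<theta> * torus_coord R \<theta> k) g"
        unfolding e by (simp only: distrib_right mult.assoc)
      also have "\<dots> = of_real c * C.S_mix h (\<lambda>\<theta>. array_density R m a \<theta> * torus_coord R \<theta> k) g
           + C.S_mix h (\<lambda>\<theta>. functional_density R m F \<theta> * torus_coord R \<theta> k) g"
        by (rule lin[OF okz[OF oka k] okz[OF okF k]])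
      also have "C.S_mix h (\<lambda>\<theta>. array_density R m a \<theta> * torus_coord R \<theta> k) g =
         of_real (exp (inner01 (h 0) g) * S_array m h (a(k := coeff_shift (a k))) g)"
        unfolding C.S_mix_def S_array_def by (rule array_density_integral(2)[OF R0 a' k])
      finally show ?thesis using IH k by (simp add: x algebra_simps)
    qed
    have "C.S_mix h (functional_density R m (x # F)) g = of_real (exp (inner01 (h 0) g) * S_functional m h (x # F) g)"
      unfolding e lin[OF oka okF] array_mixture(2)[OF R a] using IH by (simp add: x algebra_simps)
    then show ?case using k okadd[OF oka okF, of "of_real c"] unfolding e by blast
  qed
  show "C.density_ok (functional_density R m F)"
    "C.S_mix h (functional_density R m F) g = of_real (exp (inner01 (h 0) g) * S_functional m h F g)"
    "k \<in> {1..m} \<Longrightarrow> C.S_mix h (\<lambda>\<theta>. functional_density R m F \<theta> * torus_coord R \<theta> k) g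
      = of_real (exp (inner01 (h 0) g) * S_functional m h (wick_partial k F) g)"
    using main[of k] by blast+
qed

end

section \<open>The linear Skorohod equation\<close>

text \<open>Over a fine partition the squared increments sum to at most the largest increment of
  \<open>\<beta>\<close> times its total increase. This replaces a derivative criterion, as
  \<open>\<beta>\<close> is only continuous and monotone.\<close>

lemma const_if_quadratic_increments:
  fixes w \<beta> :: "real \<Rightarrow> real"
  assumes \<beta>: "continuous_on {0..1} \<beta>" "\<And>s t. 0 \<le> s \<Longrightarrow> s \<le> t \<Longrightarrow> t \<le> 1 \<Longrightarrow> \<beta> s \<le> \<beta> t"
    and w: "\<And>s t. 0 \<le> s \<Longrightarrow> s \<le> t \<Longrightarrow> t \<le> 1 \<Longrightarrow> \<bar>w t - w s\<bar> \<le> C * (\<beta> t - \<beta> s)\<^sup>2"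
    and C: "C \<ge> 0"
  shows "w 1 = w 0"
proof -
  have "\<bar>w 1 - w 0\<bar> \<le> 0 + e" if e: "e > 0" for e
  proof -
    \<comment> \<open>With increments of \<open>\<beta>\<close> below \<open>e / D\<close> the total
      is at most \<open>e\<close>; the summand 1 keeps \<open>D\<close> positive.\<close>
    define D where "D = C * (\<beta> 1 - \<beta> 0) + 1"
    have \<beta>01: "\<beta> 0 \<le> \<beta> 1" by (rule \<beta>(2)) auto
    have D: "D > 0" unfolding D_def using C \<beta>01 by (simp add: add_nonneg_pos)
    have "uniformly_continuous_on {0..1} \<beta>" by (rule compact_uniformly_continuous[OF \<beta>(1)]) simp
    then obtain d where d: "d > 0" "\<And>x y. x \<in> {0..1} \<Longrightarrow> y \<in> {0..1} \<Longrightarrow> dist y x < d \<Longrightarrow> dist (\<beta> y) (\<beta> x) < e / D"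
      unfolding uniformly_continuous_on_def using e D by (metis divide_pos_pos)
    obtain n :: nat where n: "n > 0" "1 / real n < d" using d(1) by (metis nat_approx_posE zero_less_Suc)
    let ?t = "\<lambda>i. real i / real n"
    have step: "\<bar>w (?t (Suc i)) - w (?t i)\<bar> \<le> C * (e / D) * (\<beta> (?t (Suc i)) - \<beta> (?t i))" if "i < n" for i
    proof -
      have t: "0 \<le> ?t i" "?t i \<le> ?t (Suc i)" "?t (Suc i) \<le> 1"
        using that n by (auto simp: divide_simps)
      have "dist (?t (Suc i)) (?t i) < d" using n by (simp add: dist_real_def diff_divide_distrib[symmetric])
      then have "dist (\<beta> (?t (Suc i))) (\<beta> (?t i)) < e / D" using t by (intro d(2)) auto
      then have small: "\<beta> (?t (Suc i)) - \<beta> (?t i) \<le> e / D" by (simp add: dist_real_def)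
      have pos: "0 \<le> \<beta> (?t (Suc i)) - \<beta> (?t i)" using \<beta>(2)[OF t] by simp
      have "\<bar>w (?t (Suc i)) - w (?t i)\<bar> \<le> C * ((\<beta> (?t (Suc i)) - \<beta> (?t i)) * (\<beta> (?t (Suc i)) - \<beta> (?t i)))"
        using w[OF t] by (simp add: power2_eq_square)
      also have "\<dots> \<le> C * (e / D * (\<beta> (?t (Suc i)) - \<beta> (?t i)))"
        using small pos C by (intro mult_left_mono mult_right_mono) auto
      finally show ?thesis by (simp add: mult.assoc)
    qed
    have "w 1 - w 0 = (\<Sum>i<n. w (?t (Suc i)) - w (?t i))"
      using sum_lessThan_telescope[of "\<lambda>i. w (?t i)" n] n by simp
    then have "\<bar>w 1 - w 0\<bar> \<le> (\<Sum>i<n. \<bar>w (?t (Suc i)) - w (?t i)\<bar>)" by (simp only: sum_abs)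
    also have "\<dots> \<le> (\<Sum>i<n. C * (e / D) * (\<beta> (?t (Suc i)) - \<beta> (?t i)))" using step by (intro sum_mono) auto
    also have "\<dots> = C * (e / D) * (\<beta> 1 - \<beta> 0)"
      unfolding sum_distrib_left[symmetric] sum_lessThan_telescope[of "\<lambda>i. \<beta> (?t i)" n] using n by simp
    also have "\<dots> = e * (C * (\<beta> 1 - \<beta> 0) / D)" by simp
    also have "\<dots> \<le> e * 1" using e D by (intro mult_left_mono) (auto simp: D_def divide_simps)
    finally show ?thesis by simp
  qed
  then have "\<bar>w 1 - w 0\<bar> \<le> 0" by (rule field_le_epsilon)
  then show ?thesis by simp
qed

lemma exp_minus_1_abs_le: "\<bar>exp x - 1\<bar> \<le> \<bar>x\<bar> * exp \<bar>x\<bar>" for x :: real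
proof (cases "x \<ge> 0")
  case True
  have "(1 - x) * exp x \<le> exp (- x) * exp x"
    using exp_ge_add_one_self[of "- x"] by (intro mult_right_mono) auto
  then have "exp x - 1 \<le> x * exp x" by (simp add: mult_exp_exp algebra_simps)
  then show ?thesis using True by simp
next
  case False
  have "1 - exp x \<le> - x" using exp_ge_add_one_self[of x] by linarith
  also have "\<dots> \<le> - x * exp \<bar>x\<bar>" using False mult_left_mono[of 1 "exp \<bar>x\<bar>" "- x"] by simp
  finally show ?thesis using False by simp
qed

lemma exp_taylor1_abs_le: "\<bar>exp x - 1 - x\<bar> \<le> x\<^sup>2 * exp \<bar>x\<bar>" for x :: real
proof -
  have "(1 - x) * exp x \<le> exp (- x) * exp x"
    using exp_ge_add_one_self[of "- x"] by (intro mult_right_mono) auto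
  then have "exp x - 1 - x \<le> x * (exp x - 1)" by (simp add: mult_exp_exp algebra_simps)
  also have "\<dots> \<le> \<bar>x\<bar> * \<bar>exp x - 1\<bar>" by (simp add: abs_mult[symmetric])
  also have "\<dots> \<le> \<bar>x\<bar> * (\<bar>x\<bar> * exp \<bar>x\<bar>)" by (intro mult_left_mono exp_minus_1_abs_le) auto
  finally have "exp x - 1 - x \<le> x\<^sup>2 * exp \<bar>x\<bar>" by (simp add: power2_eq_square mult.assoc[symmetric] abs_mult_self_eq)
  moreover have "0 \<le> exp x - 1 - x" using exp_ge_add_one_self[of x] by linarith
  ultimately show ?thesis by simp
qed

lemma integrable_indicator_leb01:
  fixes f :: "real \<Rightarrow> real"
  assumes "integrable leb01 f" "A \<in> sets borel"
  shows "integrable leb01 (\<lambda>s. indicator A s * f s)"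
proof (rule Bochner_Integration.integrable_bound[OF assms(1)])
  have "(indicator A :: real \<Rightarrow> real) \<in> borel_measurable leb01"
    using assms(2) by (intro measurable_restrict_space1 measurable_completion) simp
  then show "(\<lambda>s. indicator A s * f s) \<in> borel_measurable leb01"
    using assms(1) by (intro borel_measurable_times) auto
qed (auto simp: indicator_def)

lemma continuous_indefinite_leb01:
  fixes f :: "real \<Rightarrow> real"
  assumes f: "integrable leb01 f"
  shows "continuous_on {0..1} (\<lambda>t. \<integral>s. indicator {0..t} s * f s \<partial>leb01)"
  unfolding continuous_on_sequentially comp_def
proof (intro allI ballI impI)
  fix x :: "nat \<Rightarrow> real" and t assume x: "(\<forall>n. x n \<in> {0..1}) \<and> x \<longlonglongrightarrow> t"
  show "(\<lambda>n. \<integral>s. indicator {0..x n} s * f s \<partial>leb01) \<longlonglongrightarrow> (\<integral>s. indicator {0..t} s * f s \<partial>leb01)"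
  proof (rule integral_dominated_convergence[where w="\<lambda>s. \<bar>f s\<bar>"])
    show "AE s in leb01. (\<lambda>n. indicator {0..x n} s * f s) \<longlonglongrightarrow> indicator {0..t} s * f s"
      using AE_leb01_neq[of t]
    proof eventually_elim
      case (elim s)
      have "\<forall>\<^sub>F n in sequentially. indicator {0..x n} s * f s = indicator {0..t} s * f s"
      proof (cases "s < t")
        case True
        then have "\<forall>\<^sub>F n in sequentially. s < x n" using x order_tendstoD(1) by blast
        then show ?thesis by eventually_elim (use True in \<open>auto simp: indicator_def\<close>)
      next
        case False
        then have "t < s" using elim by simp
        then have "\<forall>\<^sub>F n in sequentially. x n < s" using x order_tendstoD(2) by blast
        then show ?thesis by eventually_elim (use False elim in \<open>auto simp: indicator_def\<close>)
      qed
      then show ?case by (rule tendsto_eventually)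
    qed
    show "AE s in leb01. norm (indicator {0..x n} s * f s) \<le> \<bar>f s\<bar>" for n
      by (intro AE_I2) (auto simp: indicator_def)
    show "(\<lambda>s. indicator {0..t} s * f s) \<in> borel_measurable leb01"
      "(\<lambda>s. indicator {0..x n} s * f s) \<in> borel_measurable leb01" for n
      by (intro borel_measurable_integrable integrable_indicator_leb01 f; simp)+
  qed (rule integrable_abs[OF f])
qed

text \<open>With \<open>B\<close> the primitive of \<open>b\<close>, the function
  \<open>u exp (- B)\<close> has increments quadratic in those of the primitive
  \<open>\<beta>\<close> of \<open>|b|\<close>. As \<open>b\<close> is only integrable, this avoids
  differentiating almost everywhere.\<close>

lemma linear_volterra_unique:
  fixes u b :: "real \<Rightarrow> real"
  assumes b: "integrable leb01 b" and bu: "integrable leb01 (\<lambda>s. b s * u s)"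
    and eq: "\<And>t. t \<in> {0..1} \<Longrightarrow> u t = u0 + (\<integral>s. indicator {0..t} s * (b s * u s) \<partial>leb01)"
  shows "u 1 = u0 * exp (\<integral>s. b s \<partial>leb01)"
proof -
  define \<beta> where "\<beta> t = (\<integral>s. indicator {0..t} s * \<bar>b s\<bar> \<partial>leb01)" for t :: real
  define B where "B t = (\<integral>s. indicator {0..t} s * b s \<partial>leb01)" for t :: real
  \<comment> \<open>An a priori bound for \<open>|u|\<close>, read off from the integral equation
    itself.\<close>
  define U where "U = \<bar>u0\<bar> + (\<integral>s. \<bar>b s * u s\<bar> \<partial>leb01)"
  have ab: "integrable leb01 (\<lambda>s. \<bar>b s\<bar>)" using b by (rule integrable_abs)
  note ind = integrable_indicator_leb01
  have U0: "U \<ge> 0" unfolding U_def by (intro add_nonneg_nonneg) auto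
  have u_le: "\<bar>u t\<bar> \<le> U" if "t \<in> {0..1}" for t
  proof -
    have "\<bar>\<integral>s. indicator {0..t} s * (b s * u s) \<partial>leb01\<bar> \<le> (\<integral>s. \<bar>indicator {0..t} s * (b s * u s)\<bar> \<partial>leb01)"
      by (rule integral_abs_bound)
    also have "\<dots> \<le> (\<integral>s. \<bar>b s * u s\<bar> \<partial>leb01)"
      by (intro integral_mono integrable_abs ind bu) (auto simp: indicator_def)
    finally show ?thesis unfolding eq[OF that] U_def by linarith
  qed
  have incr: "(\<integral>s. indicator {0..t} s * f s \<partial>leb01) - (\<integral>s. indicator {0..r} s * f s \<partial>leb01) = (\<integral>s. indicator {r<..t} s * f s \<partial>leb01)"
    if "0 \<le> r" "r \<le> t" "integrable leb01 f" for r t and f :: "real \<Rightarrow> real"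
  proof -
    have "(\<integral>s. indicator {0..t} s * f s \<partial>leb01) - (\<integral>s. indicator {0..r} s * f s \<partial>leb01) =
       (\<integral>s. indicator {0..t} s * f s - indicator {0..r} s * f s \<partial>leb01)"
      by (rule Bochner_Integration.integral_diff[symmetric]; intro ind that(3); simp)
    also have "\<dots> = (\<integral>s. indicator {r<..t} s * f s \<partial>leb01)"
      using that(1,2) by (intro Bochner_Integration.integral_cong) (auto simp: indicator_def)
    finally show ?thesis .
  qed
  have \<beta>incr: "\<beta> t - \<beta> r = (\<integral>s. indicator {r<..t} s * \<bar>b s\<bar> \<partial>leb01)" if "0 \<le> r" "r \<le> t" for r t
    unfolding \<beta>_def by (rule incr[OF that ab])
  have \<beta>mono: "\<beta> r \<le> \<beta> t" if "0 \<le> r" "r \<le> t" for r t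
  proof -
    have "0 \<le> (\<integral>s. indicator {r<..t} s * \<bar>b s\<bar> \<partial>leb01)" by (intro integral_nonneg_AE AE_I2) auto
    then show ?thesis using \<beta>incr[OF that] by linarith
  qed
  have est: "\<bar>\<integral>s. indicator {r<..t} s * (b s * v s) \<partial>leb01\<bar> \<le> V * (\<beta> t - \<beta> r)"
    if rt: "0 \<le> r" "r \<le> t" "t \<le> 1" and v: "\<And>s. s \<in> {r<..t} \<Longrightarrow> \<bar>v s\<bar> \<le> V" and i: "integrable leb01 (\<lambda>s. b s * v s)" for r t v V
  proof -
    have "\<bar>\<integral>s. indicator {r<..t} s * (b s * v s) \<partial>leb01\<bar> \<le> (\<integral>s. \<bar>indicator {r<..t} s * (b s * v s)\<bar> \<partial>leb01)"
      by (rule integral_abs_bound)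
    also have "\<dots> \<le> (\<integral>s. V * (indicator {r<..t} s * \<bar>b s\<bar>) \<partial>leb01)"
    proof (intro integral_mono integrable_abs integrable_mult_right ind i ab)
      fix s
      show "\<bar>indicator {r<..t} s * (b s * v s)\<bar> \<le> V * (indicator {r<..t} s * \<bar>b s\<bar>)"
      proof (cases "s \<in> {r<..t}")
        case True
        then have "\<bar>b s\<bar> * \<bar>v s\<bar> \<le> \<bar>b s\<bar> * V" using v by (intro mult_left_mono) auto
        then show ?thesis using True by (simp add: abs_mult mult.commute)
      qed simp
    qed (use b in auto)
    also have "\<dots> = V * (\<beta> t - \<beta> r)" using \<beta>incr rt by simp
    finally show ?thesis .
  qed
  have u_incr: "u t - u r = (\<integral>s. indicator {r<..t} s * (b s * u s) \<partial>leb01)" if "0 \<le> r" "r \<le> t" "t \<le> 1" for r t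
    using incr[OF that(1,2) bu] eq[of t] eq[of r] that by simp
  have B_incr: "B t - B r = (\<integral>s. indicator {r<..t} s * b s \<partial>leb01)" if "0 \<le> r" "r \<le> t" for r t
    unfolding B_def by (rule incr[OF that b])
  have B_le: "\<bar>B t - B r\<bar> \<le> \<beta> t - \<beta> r" if "0 \<le> r" "r \<le> t" "t \<le> 1" for r t
    using est[OF that, of "\<lambda>_. 1" 1] B_incr that b by simp
  have \<beta>0: "\<beta> 0 = 0" "B 0 = 0"
  proof -
    have ae: "AE s in leb01. indicator {0..0} s * f s = (0::real)" for f
      using AE_leb01_neq[of 0] by eventually_elim (auto simp: indicator_def)
    show "\<beta> 0 = 0" "B 0 = 0" unfolding \<beta>_def B_def by (rule integral_eq_zero_AE[OF ae])+
  qed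
  define C where "C = exp (\<beta> 1) * (U + U * exp (\<beta> 1))"
  have "u 1 * exp (- B 1) = u 0 * exp (- B 0)"
  proof (rule const_if_quadratic_increments[where \<beta>=\<beta> and C=C])
    show "continuous_on {0..1} \<beta>" unfolding \<beta>_def by (rule continuous_indefinite_leb01[OF ab])
    show "C \<ge> 0" using U0 by (simp add: C_def)
    fix r t :: real assume rt: "0 \<le> r" "r \<le> t" "t \<le> 1"
    show "\<beta> r \<le> \<beta> t" by (rule \<beta>mono[OF rt(1,2)])
    let ?d = "\<beta> t - \<beta> r" and ?D = "B t - B r"
    have d0: "?d \<ge> 0" using \<beta>mono rt by simp
    \<comment> \<open>First-order remainder: \<open>est\<close> bounds \<open>u s - u r\<close>
      linearly in the increment of \<open>\<beta>\<close>, and a second application gives the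
      square.\<close>
    have "u t - u r - u r * ?D = (\<integral>s. indicator {r<..t} s * (b s * (u s - u r)) \<partial>leb01)"
    proof -
      have "(\<integral>s. indicator {r<..t} s * (b s * (u s - u r)) \<partial>leb01) =
         (\<integral>s. indicator {r<..t} s * (b s * u s) - u r * (indicator {r<..t} s * b s) \<partial>leb01)"
        by (intro Bochner_Integration.integral_cong) (auto simp: algebra_simps)
      also have "\<dots> = (u t - u r) - u r * ?D"
        unfolding u_incr[OF rt] B_incr[OF rt(1,2)]
        by (subst Bochner_Integration.integral_diff) (auto intro!: ind bu b)
      finally show ?thesis by simp
    qed
    also have "\<bar>\<dots>\<bar> \<le> (U * ?d) * ?d"
    proof (rule est[OF rt])
      fix s assume s: "s \<in> {r<..t}"
      then have "\<bar>u s - u r\<bar> \<le> U * (\<beta> s - \<beta> r)"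
        unfolding u_incr[of r s, OF rt(1)] using s rt bu u_le by (subst u_incr) (auto intro!: est)
      also have "\<dots> \<le> U * ?d" using s rt \<beta>mono[of s t] U0 by (intro mult_left_mono) auto
      finally show "\<bar>u s - u r\<bar> \<le> U * ?d" .
    next
      show "integrable leb01 (\<lambda>s. b s * (u s - u r))"
        using bu b by (simp add: right_diff_distrib)
    qed
    finally have e1: "\<bar>u t - u r - u r * ?D\<bar> \<le> U * ?d\<^sup>2" by (simp add: power2_eq_square mult.assoc)
    have Dd: "\<bar>?D\<bar> \<le> ?d" by (rule B_le[OF rt])
    have d1: "?d \<le> \<beta> 1" using \<beta>mono[of 0 r] \<beta>mono[of t 1] \<beta>0 rt by simp
    have "\<bar>exp ?D - 1 - ?D\<bar> \<le> ?D\<^sup>2 * exp \<bar>?D\<bar>" by (rule exp_taylor1_abs_le)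
    also have "\<dots> \<le> ?d\<^sup>2 * exp (\<beta> 1)"
      using Dd d1 d0 by (intro mult_mono) (auto simp: abs_le_square_iff[symmetric])
    finally have e2: "\<bar>exp ?D - 1 - ?D\<bar> \<le> ?d\<^sup>2 * exp (\<beta> 1)" .
    have ur: "\<bar>u r\<bar> \<le> U" using u_le rt by auto
    have "\<bar>u t - u r * exp ?D\<bar> = \<bar>(u t - u r - u r * ?D) - u r * (exp ?D - 1 - ?D)\<bar>"
      by (simp add: algebra_simps)
    also have "\<dots> \<le> \<bar>u t - u r - u r * ?D\<bar> + \<bar>u r\<bar> * \<bar>exp ?D - 1 - ?D\<bar>"
      by (rule order_trans[OF abs_triangle_ineq4]) (simp add: abs_mult)
    also have "\<dots> \<le> U * ?d\<^sup>2 + U * (?d\<^sup>2 * exp (\<beta> 1))"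
      using e1 e2 ur U0 by (intro add_mono mult_mono) auto
    finally have e3: "\<bar>u t - u r * exp ?D\<bar> \<le> (U + U * exp (\<beta> 1)) * ?d\<^sup>2" by (simp add: algebra_simps)
    have "\<bar>B t\<bar> \<le> \<beta> 1" using B_le[of 0 t] \<beta>0 rt \<beta>mono[of t 1] by simp
    then have Bt: "exp (- B t) \<le> exp (\<beta> 1)" by simp
    have "u t * exp (- B t) - u r * exp (- B r) = exp (- B t) * (u t - u r * exp ?D)"
      by (simp add: right_diff_distrib mult_exp_exp algebra_simps)
    then have "\<bar>u t * exp (- B t) - u r * exp (- B r)\<bar> = exp (- B t) * \<bar>u t - u r * exp ?D\<bar>" by (simp add: abs_mult)
    also have "\<dots> \<le> exp (\<beta> 1) * ((U + U * exp (\<beta> 1)) * ?d\<^sup>2)" using Bt e3 by (intro mult_mono) auto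
    finally show "\<bar>u t * exp (- B t) - u r * exp (- B r)\<bar> \<le> C * ?d\<^sup>2" by (simp add: C_def mult.assoc)
  qed
  moreover have "u 0 = u0"
  proof -
    have ae: "AE s in leb01. indicator {0..0} s * (b s * u s) = (0::real)"
      using AE_leb01_neq[of 0] by eventually_elim (auto simp: indicator_def)
    show ?thesis using eq[of 0] integral_eq_zero_AE[OF ae] by simp
  qed
  moreover have "B 1 = (\<integral>s. b s \<partial>leb01)"
    unfolding B_def by (intro Bochner_Integration.integral_cong) (auto simp: indicator_def)
  ultimately show ?thesis using \<beta>0 by (simp add: exp_minus field_simps)
qed

context brownian_motion
begin

text \<open>For fixed \<open>g\<close>, testing the equation with the Wick exponential gives a
  Volterra equation with kernel \<open>a + \<sigma> g\<close>: the Skorohod term becomes an ordinary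
  integral by definition, and the drift term needs Fubini, justified by the third condition in
  \<open>solves_skorohod_sde\<close>.\<close>

lemma skorohod_sde_S_transform:
  assumes sde: "solves_skorohod_sde M W a \<sigma> X0 X" and X0: "has_S M W X0 G"
    and a: "integrable leb01 a" and \<sigma>: "\<sigma> \<in> borel_measurable leb01" "\<And>s. s \<in> {0..1} \<Longrightarrow> \<bar>\<sigma> s\<bar> \<le> B"
  shows "has_S M W (X 1) (\<lambda>g. exp (\<integral>s. a s \<partial>leb01) * (G g * exp (inner01 \<sigma> g)))"
  unfolding has_S_def
proof (intro conjI allI impI)
  have XS: "square_integrable_process M X" and Xt: "\<And>t. t \<in> {0..1} \<Longrightarrow> square_integrable M (X t)"
    and aX: "integrable leb01 (\<lambda>s. a s * sqrt (\<integral>\<omega>. (X s \<omega>)\<^sup>2 \<partial>M))"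
    using sde by (auto simp: solves_skorohod_sde_def)
  show "square_integrable M (X 1)" by (rule Xt) simp
  fix g assume g: "square_integrable leb01 g"
  define e where "e = wick_exp M W g"
  have e: "square_integrable M e" unfolding e_def by (rule wick_exp_square_integrable[OF g])
  have me [measurable]: "e \<in> borel_measurable M" using e by (rule square_integrable_measurable)
  have ma [measurable]: "a \<in> borel_measurable leb01" using a by simp
  have mg [measurable]: "g \<in> borel_measurable leb01" using g by (rule square_integrable_measurable)
  note [measurable] = \<sigma>(1)
  interpret Q: pair_sigma_finite leb01 M ..
  have mX': "(\<lambda>(\<omega>, s). X s \<omega>) \<in> borel_measurable (M \<Otimes>\<^sub>M leb01)"
    and iX': "integrable (M \<Otimes>\<^sub>M leb01) (\<lambda>(\<omega>, s). (X s \<omega>)\<^sup>2)"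
    using XS by (auto simp: square_integrable_process_def square_integrable_def case_prod_beta')
  have mX [measurable]: "(\<lambda>(s, \<omega>). X s \<omega>) \<in> borel_measurable (leb01 \<Otimes>\<^sub>M M)"
    using measurable_pair_swap[OF mX'] by (simp add: case_prod_beta')
  define u where "u t = (\<integral>\<omega>. X t \<omega> * e \<omega> \<partial>M)" for t
  have mu [measurable]: "u \<in> borel_measurable leb01" unfolding u_def by measurable
  have u_le: "\<bar>u s\<bar> \<le> l2norm M (X s) * l2norm M e" if "s \<in> {0..1}" for s
    unfolding u_def by (rule l2_Cauchy_Schwarz[OF Xt[OF that] e])
  have au: "integrable leb01 (\<lambda>s. a s * u s)"
  proof (rule Bochner_Integration.integrable_bound)
    show "integrable leb01 (\<lambda>s. (a s * sqrt (\<integral>\<omega>. (X s \<omega>)\<^sup>2 \<partial>M)) * l2norm M e)"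
      by (intro integrable_mult_left aX)
    show "AE s in leb01. norm (a s * u s) \<le> norm ((a s * sqrt (\<integral>\<omega>. (X s \<omega>)\<^sup>2 \<partial>M)) * l2norm M e)"
    proof (rule AE_I2)
      fix s assume "s \<in> space leb01"
      then have "\<bar>a s\<bar> * \<bar>u s\<bar> \<le> \<bar>a s\<bar> * (l2norm M (X s) * l2norm M e)"
        using u_le by (intro mult_left_mono) auto
      then show "norm (a s * u s) \<le> norm ((a s * sqrt (\<integral>\<omega>. (X s \<omega>)\<^sup>2 \<partial>M)) * l2norm M e)"
        by (simp add: abs_mult l2norm_def mult.assoc)
    qed
  qed measurable
  \<comment> \<open>Needed so that \<open>g s * u s\<close> is integrable; the values satisfy
    \<open>(u s)\<^sup>2 \<le> E (X s)\<^sup>2 E e\<^sup>2\<close>.\<close>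
  have squ: "square_integrable leb01 u"
  proof -
    have "integrable leb01 (\<lambda>s. (\<integral>\<omega>. (X s \<omega>)\<^sup>2 \<partial>M) * (l2norm M e)\<^sup>2)"
    proof (rule integrable_mult_left)
      interpret P: pair_sigma_finite M leb01 ..
      show "integrable leb01 (\<lambda>s. \<integral>\<omega>. (X s \<omega>)\<^sup>2 \<partial>M)" using P.integrable_snd[OF iX'] .
    qed
    then have "integrable leb01 (\<lambda>s. (u s)\<^sup>2)"
    proof (rule Bochner_Integration.integrable_bound)
      show "AE s in leb01. norm ((u s)\<^sup>2) \<le> norm ((\<integral>\<omega>. (X s \<omega>)\<^sup>2 \<partial>M) * (l2norm M e)\<^sup>2)"
      proof (rule AE_I2)
        fix s assume "s \<in> space leb01"
        then have "\<bar>u s\<bar>\<^sup>2 \<le> (l2norm M (X s) * l2norm M e)\<^sup>2" using u_le by (intro power_mono) auto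
        then show "norm ((u s)\<^sup>2) \<le> norm ((\<integral>\<omega>. (X s \<omega>)\<^sup>2 \<partial>M) * (l2norm M e)\<^sup>2)"
          by (simp add: power_mult_distrib l2norm_power2 abs_mult)
      qed
    qed measurable
    then show ?thesis by (simp add: square_integrable_def)
  qed
  have gs: "integrable leb01 (\<lambda>s. \<sigma> s * k s)" if k: "integrable leb01 k" for k :: "real \<Rightarrow> real"
  proof (rule Bochner_Integration.integrable_bound)
    show "integrable leb01 (\<lambda>s. B * k s)" using k by simp
    show "(\<lambda>s. \<sigma> s * k s) \<in> borel_measurable leb01" using k by measurable
    show "AE s in leb01. norm (\<sigma> s * k s) \<le> norm (B * k s)"
    proof (rule AE_I2)
      fix s assume "s \<in> space leb01"
      then have "\<bar>\<sigma> s\<bar> \<le> \<bar>B\<bar>" using \<sigma>(2)[of s] by simp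
      then show "norm (\<sigma> s * k s) \<le> norm (B * k s)" by (simp add: abs_mult mult_right_mono)
    qed
  qed
  have ig: "integrable leb01 g" using g by (rule leb01.square_integrable_integrable)
  define b where "b s = a s + \<sigma> s * g s" for s
  have ib: "integrable leb01 b" unfolding b_def by (intro Bochner_Integration.integrable_add a gs ig)
  have gu: "integrable leb01 (\<lambda>s. \<sigma> s * (g s * u s))" by (intro gs square_integrable_mult g squ)
  have ibu: "integrable leb01 (\<lambda>s. b s * u s)"
    unfolding b_def distrib_right mult.assoc by (intro Bochner_Integration.integrable_add au gu)
  have eq: "u t = G g + (\<integral>s. indicator {0..t} s * (b s * u s) \<partial>leb01)" if t: "t \<in> {0..1}" for t
  proof -
    obtain Y where Y: "has_skorohod_integral M W (\<lambda>s \<omega>. indicator {0..t} s * \<sigma> s * X s \<omega>) Y"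
      and XY: "AE \<omega> in M. X t \<omega> = X0 \<omega> + (\<integral>s. a s * X s \<omega> \<partial>lebesgue_on {0..t}) + Y \<omega>"
      using sde t unfolding solves_skorohod_sde_def by blast
    have sqY: "square_integrable M Y" using Y by (simp add: has_skorohod_integral_def)
    have sq0: "square_integrable M X0" by (rule has_SD(1)[OF X0])
    have EY: "(\<integral>\<omega>. Y \<omega> * e \<omega> \<partial>M) = (\<integral>s. indicator {0..t} s * (\<sigma> s * (g s * u s)) \<partial>leb01)"
    proof -
      have "(\<integral>\<omega>. Y \<omega> * e \<omega> \<partial>M) = (\<integral>s. (\<integral>\<omega>. indicator {0..t} s * \<sigma> s * X s \<omega> * e \<omega> \<partial>M) * g s \<partial>leb01)"
        using Y g unfolding has_skorohod_integral_def e_def by simp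
      also have "\<dots> = (\<integral>s. indicator {0..t} s * (\<sigma> s * (g s * u s)) \<partial>leb01)"
      proof (rule Bochner_Integration.integral_cong[OF refl])
        fix s
        have "(\<integral>\<omega>. indicator {0..t} s * \<sigma> s * X s \<omega> * e \<omega> \<partial>M) = indicator {0..t} s * \<sigma> s * u s"
          unfolding u_def by (simp only: mult.assoc integral_mult_right_zero)
        then show "(\<integral>\<omega>. indicator {0..t} s * \<sigma> s * X s \<omega> * e \<omega> \<partial>M) * g s = indicator {0..t} s * (\<sigma> s * (g s * u s))"
          by (simp only: mult_ac)
      qed
      finally show ?thesis .
    qed
    define D where "D \<omega> = (\<integral>s. indicator {0..t} s * (a s * X s \<omega>) \<partial>leb01)" for \<omega>
    have Deq: "(\<integral>s. a s * X s \<omega> \<partial>lebesgue_on {0..t}) = D \<omega>" for \<omega>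
    proof -
      have "(\<integral>s. a s * X s \<omega> \<partial>lebesgue_on {0..t}) = (\<integral>s. indicator {0..t} s *\<^sub>R (a s * X s \<omega>) \<partial>lebesgue)"
        by (rule integral_restrict_space) simp
      also have "\<dots> = (\<integral>s. indicator {0..1} s *\<^sub>R (indicator {0..t} s * (a s * X s \<omega>)) \<partial>lebesgue)"
        using t by (intro Bochner_Integration.integral_cong) (auto simp: indicator_def)
      also have "\<dots> = D \<omega>" unfolding D_def by (rule integral_restrict_space[symmetric]) simp
      finally show ?thesis .
    qed
    have mi [measurable]: "(indicator {0..t} :: real \<Rightarrow> real) \<in> borel_measurable leb01"
      by (intro measurable_restrict_space1 measurable_completion) simp
    have mD [measurable]: "D \<in> borel_measurable M" unfolding D_def
    proof (rule leb01.borel_measurable_lebesgue_integral)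
      note [measurable] = mX'
      show "(\<lambda>(\<omega>, s). indicator {0..t} s * (a s * X s \<omega>)) \<in> borel_measurable (M \<Otimes>\<^sub>M leb01)"
        by measurable
    qed
    let ?f = "\<lambda>s \<omega>. indicator {0..t} s * (a s * X s \<omega>) * e \<omega>"
    have Xe: "integrable M (\<lambda>\<omega>. X s \<omega> * e \<omega>)" if "s \<in> {0..1}" for s
      by (rule square_integrable_mult[OF Xt[OF that] e])
    have fint: "integrable (leb01 \<Otimes>\<^sub>M M) (case_prod ?f)"
    proof (rule Q.Fubini_integrable)
      show mf: "case_prod ?f \<in> borel_measurable (leb01 \<Otimes>\<^sub>M M)" by measurable
      have nf: "(\<integral>\<omega>. norm (case_prod ?f (s, \<omega>)) \<partial>M) = indicator {0..t} s * (\<bar>a s\<bar> * (\<integral>\<omega>. \<bar>X s \<omega>\<bar> * \<bar>e \<omega>\<bar> \<partial>M))" for s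
        by (simp add: abs_mult mult.assoc)
      show "integrable leb01 (\<lambda>s. \<integral>\<omega>. norm (case_prod ?f (s, \<omega>)) \<partial>M)"
      proof (rule Bochner_Integration.integrable_bound)
        show "integrable leb01 (\<lambda>s. (a s * sqrt (\<integral>\<omega>. (X s \<omega>)\<^sup>2 \<partial>M)) * l2norm M e)"
          by (intro integrable_mult_left aX)
        show "(\<lambda>s. \<integral>\<omega>. norm (case_prod ?f (s, \<omega>)) \<partial>M) \<in> borel_measurable leb01"
          using mf by measurable
        show "AE s in leb01. norm (\<integral>\<omega>. norm (case_prod ?f (s, \<omega>)) \<partial>M) \<le> norm ((a s * sqrt (\<integral>\<omega>. (X s \<omega>)\<^sup>2 \<partial>M)) * l2norm M e)"
        proof (rule AE_I2)
          fix s assume "s \<in> space leb01"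
          then have s: "s \<in> {0..1}" by simp
          have abs: "square_integrable M (\<lambda>\<omega>. \<bar>f \<omega>\<bar>)" if "square_integrable M f" for f
            using that by (auto simp: square_integrable_def)
          have cs: "(\<integral>\<omega>. \<bar>X s \<omega>\<bar> * \<bar>e \<omega>\<bar> \<partial>M) \<le> l2norm M (X s) * l2norm M e"
            using l2_Cauchy_Schwarz[OF abs[OF Xt[OF s]] abs[OF e]] by (simp add: l2norm_def)
          have nn: "0 \<le> (\<integral>\<omega>. \<bar>X s \<omega>\<bar> * \<bar>e \<omega>\<bar> \<partial>M)" by (intro integral_nonneg_AE AE_I2) auto
          have "indicator {0..t} s * (\<bar>a s\<bar> * (\<integral>\<omega>. \<bar>X s \<omega>\<bar> * \<bar>e \<omega>\<bar> \<partial>M)) \<le> 1 * (\<bar>a s\<bar> * (l2norm M (X s) * l2norm M e))"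
            using cs nn by (intro mult_mono) (auto simp: indicator_def)
          moreover have "0 \<le> indicator {0..t} s * (\<bar>a s\<bar> * (\<integral>\<omega>. \<bar>X s \<omega>\<bar> * \<bar>e \<omega>\<bar> \<partial>M))"
            using nn by simp
          ultimately show "norm (\<integral>\<omega>. norm (case_prod ?f (s, \<omega>)) \<partial>M) \<le> norm ((a s * sqrt (\<integral>\<omega>. (X s \<omega>)\<^sup>2 \<partial>M)) * l2norm M e)"
            unfolding nf by (simp add: abs_mult l2norm_def mult.assoc)
        qed
      qed
      show "AE s in leb01. integrable M (\<lambda>\<omega>. case_prod ?f (s, \<omega>))"
        using Xe by (intro AE_I2) (simp add: mult.assoc)
    qed
    have ED: "(\<integral>\<omega>. D \<omega> * e \<omega> \<partial>M) = (\<integral>s. indicator {0..t} s * (a s * u s) \<partial>leb01)"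
    proof -
      have "(\<integral>\<omega>. D \<omega> * e \<omega> \<partial>M) = (\<integral>\<omega>. (\<integral>s. ?f s \<omega> \<partial>leb01) \<partial>M)"
        unfolding D_def by (simp only: integral_mult_left_zero)
      also have "\<dots> = (\<integral>s. (\<integral>\<omega>. ?f s \<omega> \<partial>M) \<partial>leb01)" by (rule Q.Fubini_integral[OF fint])
      also have "\<dots> = (\<integral>s. indicator {0..t} s * (a s * u s) \<partial>leb01)"
        unfolding u_def by (simp only: mult.assoc integral_mult_right_zero)
      finally show ?thesis .
    qed
    \<comment> \<open>The equation expresses the drift term through three square integrable
      variables, so its expectation against \<open>e\<close> splits without a separate moment bound
      for \<open>D\<close>.\<close>
    define D' where "D' \<omega> = X t \<omega> - X0 \<omega> - Y \<omega>" for \<omega>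
    have sqD': "square_integrable M D'" unfolding D'_def[abs_def] by (intro square_integrable_diff Xt t sq0 sqY)
    have "AE \<omega> in M. D \<omega> * e \<omega> = D' \<omega> * e \<omega>"
      using XY by eventually_elim (simp add: D'_def Deq)
    then have "(\<integral>\<omega>. D \<omega> * e \<omega> \<partial>M) = (\<integral>\<omega>. D' \<omega> * e \<omega> \<partial>M)"
      using square_integrable_measurable[OF sqD'] by (intro integral_cong_AE) auto
    also have "\<dots> = u t - (\<integral>\<omega>. X0 \<omega> * e \<omega> \<partial>M) - (\<integral>\<omega>. Y \<omega> * e \<omega> \<partial>M)"
      unfolding D'_def u_def left_diff_distrib
      using square_integrable_mult[OF Xt[OF t] e] square_integrable_mult[OF sq0 e] square_integrable_mult[OF sqY e] by simp
    finally have "u t = (\<integral>\<omega>. X0 \<omega> * e \<omega> \<partial>M) + ((\<integral>s. indicator {0..t} s * (a s * u s) \<partial>leb01) + (\<integral>s. indicator {0..t} s * (\<sigma> s * (g s * u s)) \<partial>leb01))"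
      unfolding ED EY by simp
    also have "(\<integral>\<omega>. X0 \<omega> * e \<omega> \<partial>M) = G g" unfolding e_def by (rule has_SD(2)[OF X0 g])
    also have "(\<integral>s. indicator {0..t} s * (a s * u s) \<partial>leb01) + (\<integral>s. indicator {0..t} s * (\<sigma> s * (g s * u s)) \<partial>leb01) =
      (\<integral>s. indicator {0..t} s * (b s * u s) \<partial>leb01)"
      unfolding b_def distrib_right distrib_left mult.assoc
      by (rule Bochner_Integration.integral_add[symmetric]) (intro integrable_indicator_leb01 au gu; simp)+
    finally show ?thesis .
  qed
  have "u 1 = G g * exp (\<integral>s. b s \<partial>leb01)"
    by (rule linear_volterra_unique[OF ib ibu eq])
  also have "(\<integral>s. b s \<partial>leb01) = (\<integral>s. a s \<partial>leb01) + inner01 \<sigma> g"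
    unfolding b_def by (rule Bochner_Integration.integral_add[OF a gs[OF ig]])
  finally show "(\<integral>\<omega>. X 1 \<omega> * wick_exp M W g \<omega> \<partial>M) = exp (\<integral>s. a s \<partial>leb01) * (G g * exp (inner01 \<sigma> g))"
    by (simp add: u_def e_def exp_add mult_ac)
qed

end

section \<open>Averaging over a uniform grid\<close>

lemma bounded_variation_on_reflect:
  assumes "bounded_variation_on {0..1} g"
  shows "bounded_variation_on {0..1} (\<lambda>s. g (1 - s))"
proof -
  obtain B where B: "\<And>n t. mono_on {..n} t \<Longrightarrow> t ` {..n} \<subseteq> {0..1} \<Longrightarrow>
      (\<Sum>i<n. \<bar>g (t (Suc i)) - g (t i)\<bar>) \<le> B"
    using assms unfolding bounded_variation_on_def by blast
  have "(\<Sum>i<n. \<bar>g (1 - t (Suc i)) - g (1 - t i)\<bar>) \<le> B"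
    if t: "mono_on {..n} t" "t ` {..n} \<subseteq> {0..1}" for n and t :: "nat \<Rightarrow> real"
  proof -
    define r where "r i = 1 - t (n - i)" for i
    have "mono_on {..n} r"
    proof (rule mono_onI)
      fix i j assume "i \<in> {..n}" "j \<in> {..n}" "i \<le> j"
      then have "t (n - j) \<le> t (n - i)" by (intro mono_onD[OF t(1)]) auto
      then show "r i \<le> r j" by (simp add: r_def)
    qed
    moreover have "r ` {..n} \<subseteq> {0..1}"
    proof
      fix y assume "y \<in> r ` {..n}"
      then obtain i where "i \<le> n" "y = 1 - t (n - i)" by (auto simp: r_def)
      moreover have "t (n - i) \<in> {0..1}" using t(2) by (auto simp del: atLeastAtMost_iff)
      ultimately show "y \<in> {0..1}" by simp
    qed
    ultimately have "(\<Sum>i<n. \<bar>g (r (Suc i)) - g (r i)\<bar>) \<le> B" by (rule B)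
    also have "(\<Sum>i<n. \<bar>g (r (Suc i)) - g (r i)\<bar>) = (\<Sum>i<n. \<bar>g (1 - t (Suc i)) - g (1 - t i)\<bar>)"
    proof -
      have "(\<Sum>i<n. \<bar>g (r (Suc i)) - g (r i)\<bar>) = (\<Sum>i<n. \<bar>g (1 - t (Suc (n - Suc i))) - g (1 - t (n - Suc i))\<bar>)"
        by (intro sum.cong refl) (simp add: r_def Suc_diff_Suc abs_minus_commute)
      also have "\<dots> = (\<Sum>i<n. \<bar>g (1 - t (Suc i)) - g (1 - t i)\<bar>)"
        by (rule sum.nat_diff_reindex)
      finally show ?thesis .
    qed
    finally show ?thesis .
  qed
  then show ?thesis unfolding bounded_variation_on_def by blast
qed

lemma unit_interval_mvt:
  assumes der: "\<And>y. y \<in> {0..1} \<Longrightarrow> (f has_real_derivative f' y) (at y within {0..1})"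
    and st: "0 \<le> s" "s < t" "t \<le> 1"
  obtains q where "s < q" "q < t" "f t - f s = f' q * (t - s)"
proof -
  have "\<exists>q\<in>{s<..<t}. f t - f s = (\<lambda>h. f' q * h) (t - s)"
  proof (rule mvt_simple[OF st(2)])
    fix q assume "s \<le> q" "q \<le> t"
    then have "(f has_real_derivative f' q) (at q within {s..t})"
      using st by (intro has_field_derivative_subset[OF der[of q]]) auto
    then show "(f has_derivative (\<lambda>h. f' q * h)) (at q within {s..t})"
      by (simp add: has_field_derivative_def)
  qed
  then show ?thesis using that by auto
qed

text \<open>A derivative takes values close to \<open>f' x\<close> arbitrarily near \<open>x\<close> (mean value theorem), so a
  discontinuity at \<open>x\<close> would force infinitely many oscillations of a fixed size.\<close>

lemma bounded_variation_derivative_right_limit: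
  assumes der: "\<And>y. y \<in> {0..1} \<Longrightarrow> (f has_real_derivative f' y) (at y within {0..1})"
    and bv: "bounded_variation_on {0..1} f'" and x: "0 \<le> x" "x < 1" and e: "e > 0"
  shows "\<exists>d>0. \<forall>y. x < y \<and> y < x + d \<and> y \<le> 1 \<longrightarrow> \<bar>f' y - f' x\<bar> < e"
proof (rule ccontr)
  assume neg: "\<not> ?thesis"
  have bad: "\<exists>y. x < y \<and> y < x + d \<and> y \<le> 1 \<and> e \<le> \<bar>f' y - f' x\<bar>" if "d > 0" for d
    using neg that by (meson not_less)
  \<comment> \<open>A difference quotient at \<open>x\<close> is close to \<open>f' x\<close> and,
    by the mean value theorem, is a value of \<open>f'\<close> at a point still nearer to
    \<open>x\<close>.\<close>
  have good: "\<exists>q. x < q \<and> q < p \<and> \<bar>f' q - f' x\<bar> < e / 2" if p: "x < p" "p \<le> 1" for p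
  proof -
    have "((\<lambda>y. (f y - f x) / (y - x)) \<longlongrightarrow> f' x) (at x within {0..1})"
      using der[of x] x by (simp add: has_field_derivative_iff)
    moreover have "e / 2 > 0" using e by simp
    ultimately have "\<forall>\<^sub>F y in at x within {0..1}. dist ((f y - f x) / (y - x)) (f' x) < e / 2"
      by (rule tendstoD)
    then obtain d where d: "d > 0" "\<forall>y\<in>{0..1}. y \<noteq> x \<and> dist y x < d \<longrightarrow> dist ((f y - f x) / (y - x)) (f' x) < e / 2"
      unfolding eventually_at by blast
    define y where "y = x + min (d / 2) ((p - x) / 2)"
    have y: "x < y" "y < p" "y < x + d" using d(1) p by (auto simp: y_def min_def field_simps)
    obtain q where q: "x < q" "q < y" "f y - f x = f' q * (y - x)"
      by (rule unit_interval_mvt[OF der, of x y]) (use x y p in auto)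
    have "dist ((f y - f x) / (y - x)) (f' x) < e / 2"
      using d(2) y x p by (auto simp: dist_real_def)
    then have "\<bar>f' q - f' x\<bar> < e / 2" using q y by (simp add: dist_real_def)
    then show ?thesis using q y by (intro exI[of _ q]) auto
  qed
  \<comment> \<open>Partitions grow to the right: each round appends, to a partition lying nearer to
    \<open>x\<close>, a bad point \<open>y\<close> and a good point \<open>q\<close>, whose values
    differ by at least \<open>e / 2\<close>.\<close>
  have claim: "\<exists>N t. mono_on {..N} t \<and> t ` {..N} \<subseteq> {x<..<p} \<and> real n * (e / 2) \<le> (\<Sum>i<N. \<bar>f' (t (Suc i)) - f' (t i)\<bar>)"
    if "x < p" "p \<le> 1" for n :: nat and p
    using that
  proof (induction n arbitrary: p)
    case 0
    show ?case
      by (intro exI[of _ "0::nat"] exI[of _ "\<lambda>_. (x + p) / 2"]) (use 0 in \<open>auto intro: mono_onI\<close>)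
  next
    case (Suc n)
    obtain q where q: "x < q" "q < p" "\<bar>f' q - f' x\<bar> < e / 2" using good[OF Suc.prems] by blast
    obtain y where y: "x < y" "y < x + (q - x)" "y \<le> 1" "e \<le> \<bar>f' y - f' x\<bar>" using bad[of "q - x"] q by auto
    obtain N and t :: "nat \<Rightarrow> real" where t: "mono_on {..N} t" "t ` {..N} \<subseteq> {x<..<y}"
      "real n * (e / 2) \<le> (\<Sum>i<N. \<bar>f' (t (Suc i)) - f' (t i)\<bar>)"
      using Suc.IH[OF y(1,3)] by blast
    define t' where "t' i = (if i \<le> N then t i else if i = Suc N then y else q)" for i
    have tb: "x < t i" "t i < y" if "i \<le> N" for i using t(2) that by auto
    have "mono_on {..Suc (Suc N)} t'"
    proof (rule mono_onI)
      fix i j assume ij: "i \<in> {..Suc (Suc N)}" "j \<in> {..Suc (Suc N)}" "i \<le> j"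
      show "t' i \<le> t' j"
      proof (cases "j \<le> N")
        case True
        then have "t i \<le> t j" using ij by (intro mono_onD[OF t(1)]) auto
        then show ?thesis using True ij by (simp add: t'_def)
      next
        case False
        then show ?thesis using ij tb[of i] y q by (auto simp: t'_def)
      qed
    qed
    moreover have "t' ` {..Suc (Suc N)} \<subseteq> {x<..<p}"
    proof
      fix z assume "z \<in> t' ` {..Suc (Suc N)}"
      then obtain i where "z = t' i" "i \<le> Suc (Suc N)" by auto
      then show "z \<in> {x<..<p}" using tb[of i] y q by (auto simp: t'_def)
    qed
    moreover have "real (Suc n) * (e / 2) \<le> (\<Sum>i<Suc (Suc N). \<bar>f' (t' (Suc i)) - f' (t' i)\<bar>)"
    proof -
      have "(\<Sum>i<Suc (Suc N). \<bar>f' (t' (Suc i)) - f' (t' i)\<bar>) =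
        (\<Sum>i<N. \<bar>f' (t' (Suc i)) - f' (t' i)\<bar>) + \<bar>f' y - f' (t N)\<bar> + \<bar>f' q - f' y\<bar>"
        by (simp add: t'_def)
      also have "(\<Sum>i<N. \<bar>f' (t' (Suc i)) - f' (t' i)\<bar>) = (\<Sum>i<N. \<bar>f' (t (Suc i)) - f' (t i)\<bar>)"
        by (intro sum.cong) (auto simp: t'_def)
      finally have "(\<Sum>i<Suc (Suc N). \<bar>f' (t' (Suc i)) - f' (t' i)\<bar>) =
        (\<Sum>i<N. \<bar>f' (t (Suc i)) - f' (t i)\<bar>) + \<bar>f' y - f' (t N)\<bar> + \<bar>f' q - f' y\<bar>" .
      moreover have "e / 2 \<le> \<bar>f' q - f' y\<bar>" using q(3) y(4) by linarith
      moreover have "real (Suc n) * (e / 2) = real n * (e / 2) + e / 2" by (simp add: algebra_simps)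
      ultimately show ?thesis using t(3) abs_ge_zero[of "f' y - f' (t N)"] by linarith
    qed
    ultimately show ?case by blast
  qed
  obtain B where B: "\<And>n t. mono_on {..n} t \<Longrightarrow> t ` {..n} \<subseteq> {0..1} \<Longrightarrow>
      (\<Sum>i<n. \<bar>f' (t (Suc i)) - f' (t i)\<bar>) \<le> B"
    using bv unfolding bounded_variation_on_def by blast
  obtain n :: nat where n: "B / (e / 2) < real n" using reals_Archimedean2 by blast
  obtain N and t :: "nat \<Rightarrow> real" where t: "mono_on {..N} t" "t ` {..N} \<subseteq> {x<..<1}"
      "real n * (e / 2) \<le> (\<Sum>i<N. \<bar>f' (t (Suc i)) - f' (t i)\<bar>)"
    using claim[of 1 n] x by auto
  have "t ` {..N} \<subseteq> {0..1}" using t(2) x by (auto dest: subsetD)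
  from B[OF t(1) this] t(3) have "real n * (e / 2) \<le> B" by simp
  then show False using n e by (simp add: field_simps)
qed

text \<open>Right continuity is the previous lemma; left continuity follows from it by reflecting
  the interval.\<close>

lemma bounded_variation_derivative_continuous:
  assumes der: "\<And>y. y \<in> {0..1} \<Longrightarrow> (f has_real_derivative f' y) (at y within {0..1})"
    and bv: "bounded_variation_on {0..1} f'"
  shows "continuous_on {0..1} f'"
  unfolding continuous_on_iff
proof (intro ballI allI impI)
  fix x e :: real assume x: "x \<in> {0..1}" and e: "e > 0"
  have right: "\<exists>d>0. \<forall>y. x < y \<and> y < x + d \<and> y \<le> 1 \<longrightarrow> \<bar>f' y - f' x\<bar> < e"
  proof (cases "x < 1")
    case True
    then show ?thesis using bounded_variation_derivative_right_limit[OF der bv _ _ e] x by auto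
  next
    case False
    then show ?thesis using x by (intro exI[of _ 1]) auto
  qed
  have left: "\<exists>d>0. \<forall>y. y < x \<and> x - d < y \<and> 0 \<le> y \<longrightarrow> \<bar>f' y - f' x\<bar> < e"
  proof (cases "0 < x")
    case True
    \<comment> \<open>The sign in \<open>- f (1 - s)\<close> makes the derivative
      \<open>f' (1 - s)\<close>, the reflected function whose variation is bounded.\<close>
    have der': "((\<lambda>s. - f (1 - s)) has_real_derivative f' (1 - y)) (at y within {0..1})" if "y \<in> {0..1}" for y
    proof -
      have im: "(\<lambda>s. 1 - s) ` {0..1::real} = {0..1}"
        by (auto intro!: image_eqI[of _ "\<lambda>s. 1 - s" "1 - _"])
      have "(f has_real_derivative f' (1 - y)) (at (1 - y) within (\<lambda>s. 1 - s) ` {0..1})"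
        unfolding im using that by (intro der) auto
      moreover have "((\<lambda>s. 1 - s) has_real_derivative - 1) (at y within {0..1})"
        by (auto intro!: derivative_eq_intros)
      ultimately have "((\<lambda>s. f (1 - s)) has_real_derivative f' (1 - y) * - 1) (at y within {0..1})"
        using DERIV_image_chain[of f "f' (1 - y)" "\<lambda>s. 1 - s" y "{0..1}" "- 1"] by (simp add: comp_def)
      from DERIV_minus[OF this] show ?thesis by simp
    qed
    from bounded_variation_derivative_right_limit[OF der' bounded_variation_on_reflect[OF bv], of "1 - x" e] x e True
    obtain d where d: "d > 0" "\<And>y. 1 - x < y \<and> y < 1 - x + d \<and> y \<le> 1 \<Longrightarrow> \<bar>f' (1 - y) - f' (1 - (1 - x))\<bar> < e"
      by auto
    show ?thesis
    proof (intro exI[of _ d] conjI allI impI)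
      fix y assume "y < x \<and> x - d < y \<and> 0 \<le> y"
      then show "\<bar>f' y - f' x\<bar> < e" using d(2)[of "1 - y"] by auto
    qed (rule d(1))
  next
    case False
    then show ?thesis using x by (intro exI[of _ 1]) auto
  qed
  obtain d1 where d1: "d1 > 0" "\<And>y. x < y \<Longrightarrow> y < x + d1 \<Longrightarrow> y \<le> 1 \<Longrightarrow> \<bar>f' y - f' x\<bar> < e" using right by blast
  obtain d2 where d2: "d2 > 0" "\<And>y. y < x \<Longrightarrow> x - d2 < y \<Longrightarrow> 0 \<le> y \<Longrightarrow> \<bar>f' y - f' x\<bar> < e" using left by blast
  show "\<exists>d>0. \<forall>x'\<in>{0..1}. dist x' x < d \<longrightarrow> dist (f' x') (f' x) < e"
  proof (intro exI[of _ "min d1 d2"] conjI ballI impI)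
    fix y assume y: "y \<in> {0..1}" "dist y x < min d1 d2"
    show "dist (f' y) (f' x) < e"
      using d1(2)[of y] d2(2)[of y] y e by (cases y x rule: linorder_cases) (auto simp: dist_real_def)
  qed (use d1 d2 in auto)
qed

lemma continuous_square_integrable_leb01:
  assumes "continuous_on {0..1} f"
  shows "square_integrable leb01 f" "\<exists>B. \<forall>s\<in>{0..1}. \<bar>f s\<bar> \<le> B"
proof -
  have "bounded (f ` {0..1})" by (intro compact_imp_bounded compact_continuous_image assms) simp
  then show B: "\<exists>B. \<forall>s\<in>{0..1}. \<bar>f s\<bar> \<le> B" by (auto simp: bounded_iff)
  then obtain B where "\<forall>s\<in>{0..1}. \<bar>f s\<bar> \<le> B" by blast
  then show "square_integrable leb01 f"
    by (intro leb01.square_integrable_bounded[of f B] continuous_imp_measurable_on_sets_lebesgue assms) auto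
qed

section \<open>Cell averages as projections\<close>

abbreviation cell :: "nat \<Rightarrow> nat \<Rightarrow> real set" where
  "cell n i \<equiv> {real i / real n<..real (Suc i) / real n}"

definition cell_int :: "nat \<Rightarrow> nat \<Rightarrow> (real \<Rightarrow> real) \<Rightarrow> real" where
  "cell_int n i f = (\<integral>s. indicator (cell n i) s * f s \<partial>leb01)"

text \<open>The value 0 at index \<open>n\<close> closes the telescoping: summing the differences
  used in \<open>grid_step\<close> from a cell onwards leaves the average over that cell.\<close>

definition grid_coeff :: "nat \<Rightarrow> (real \<Rightarrow> real) \<Rightarrow> nat \<Rightarrow> real" where
  "grid_coeff n f i = (if i < n then real n * cell_int n i f else 0)"

text \<open>The average of \<open>f\<close> over the cells, written as a combination of the functions
  \<open>1_(0,i/n]\<close>.\<close>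

definition grid_step :: "nat \<Rightarrow> (real \<Rightarrow> real) \<Rightarrow> step" where
  "grid_step n f = map (\<lambda>i. (grid_coeff n f i - grid_coeff n f (Suc i), 0, real (Suc i) / real n)) [0..<n]"

abbreviation grid_times :: "nat \<Rightarrow> real set" where
  "grid_times n \<equiv> (\<lambda>i. real i / real n) ` {1..n}"

lemma times_step_grid_step: "times_step (grid_times n) (grid_step n f)"
  by (auto simp: times_step_def grid_step_def intro!: image_eqI[of _ _ "Suc _"])

lemma grid_point_less: "real i / real n < s \<Longrightarrow> 0 < s"
  by (rule le_less_trans[of 0 "real i / real n"]) simp_all

lemma cell_int_telescope:
  assumes f: "integrable leb01 f" and n: "n > 0" and j: "j \<le> n"
  shows "(\<integral>s. indicator {0<..real j / real n} s * f s \<partial>leb01) = (\<Sum>i<j. cell_int n i f)"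
  using j
proof (induction j)
  case 0
  then show ?case by simp
next
  case (Suc j)
  have "(\<integral>s. indicator {0<..real (Suc j) / real n} s * f s \<partial>leb01) =
     (\<integral>s. indicator {0<..real j / real n} s * f s + indicator (cell n j) s * f s \<partial>leb01)"
  proof (rule Bochner_Integration.integral_cong[OF refl])
    fix s
    have "real j / real n \<le> real (Suc j) / real n" using n by (auto simp: divide_right_mono)
    then show "indicator {0<..real (Suc j) / real n} s * f s = indicator {0<..real j / real n} s * f s + indicator (cell n j) s * f s"
      using grid_point_less[of j n s] by (auto simp: indicator_def)
  qed
  also have "\<dots> = (\<integral>s. indicator {0<..real j / real n} s * f s \<partial>leb01) + cell_int n j f"
    unfolding cell_int_def by (rule Bochner_Integration.integral_add) (intro integrable_indicator_leb01 f; simp)+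
  finally show ?case using Suc by simp
qed

lemma integral_cells:
  assumes f: "integrable leb01 f" and n: "n > 0"
  shows "(\<integral>s. f s \<partial>leb01) = (\<Sum>i<n. cell_int n i f)"
proof -
  have ae: "AE s in leb01. f s = indicator {0<..real n / real n} s * f s"
    using AE_leb01_neq[of 0] AE_space by eventually_elim (use n in \<open>auto simp: indicator_def\<close>)
  have "(\<integral>s. f s \<partial>leb01) = (\<integral>s. indicator {0<..real n / real n} s * f s \<partial>leb01)"
    by (rule integral_cong_AE[OF _ _ ae]) (use f in \<open>auto intro!: borel_measurable_integrable integrable_indicator_leb01 simp del: indicator_simps\<close>)
  then show ?thesis using cell_int_telescope[OF f n, of n] by simp
qed

text \<open>Summation by parts converts the steps starting at 0 back into sums over disjoint
  cells.\<close>

lemma inner01_grid_step: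
  assumes k: "square_integrable leb01 k" and n: "n > 0"
  shows "inner01 (step_fun (grid_step n f)) k = (\<Sum>i<n. real n * cell_int n i f * cell_int n i k)"
proof -
  let ?c = "grid_coeff n f"
  have ik: "integrable leb01 k" using k by (rule leb01.square_integrable_integrable)
  define \<Phi> where "\<Phi> j = (\<integral>s. indicator {0<..real j / real n} s * k s \<partial>leb01)" for j :: nat
  have sf: "step_fun (grid_step n f) s = (\<Sum>i<n. (?c i - ?c (Suc i)) * indicator {0<..real (Suc i) / real n} s)" for s
    unfolding step_fun_def grid_step_def
    by (simp add: comp_def interv_sum_list_conv_sum_set_nat lessThan_atLeast0 del: indicator_simps of_nat_Suc)
  have int: "integrable leb01 (\<lambda>s. (?c i - ?c (Suc i)) * (indicator {0<..real (Suc i) / real n} s * k s))" for i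
    by (intro integrable_mult_right integrable_indicator_leb01 ik) simp
  have "inner01 (step_fun (grid_step n f)) k = (\<integral>s. (\<Sum>i<n. (?c i - ?c (Suc i)) * (indicator {0<..real (Suc i) / real n} s * k s)) \<partial>leb01)"
    unfolding sf sum_distrib_right by (simp only: mult.assoc)
  also have "\<dots> = (\<Sum>i<n. (\<integral>s. (?c i - ?c (Suc i)) * (indicator {0<..real (Suc i) / real n} s * k s) \<partial>leb01))"
    by (rule Bochner_Integration.integral_sum[OF int])
  also have "\<dots> = (\<Sum>i<n. (?c i - ?c (Suc i)) * \<Phi> (Suc i))"
    unfolding \<Phi>_def by (simp only: integral_mult_right_zero)
  \<comment> \<open>Abel summation; both boundary terms vanish, as \<open>\<Phi> 0 = 0\<close> and
    \<open>?c n = 0\<close>.\<close>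
  also have "\<dots> = (\<Sum>i<n. ?c i * (\<Phi> (Suc i) - \<Phi> i)) - ?c n * \<Phi> n"
  proof -
    have "(\<Sum>i<l. (?c i - ?c (Suc i)) * \<Phi> (Suc i)) = (\<Sum>i<l. ?c i * (\<Phi> (Suc i) - \<Phi> i)) - ?c l * \<Phi> l" for l
    proof (induction l)
      case 0
      have "\<Phi> 0 = 0" by (simp add: \<Phi>_def)
      then show ?case by simp
    qed (simp add: algebra_simps)
    then show ?thesis .
  qed
  also have "?c n = 0" by (simp add: grid_coeff_def)
  also have "(\<Sum>i<n. ?c i * (\<Phi> (Suc i) - \<Phi> i)) = (\<Sum>i<n. real n * cell_int n i f * cell_int n i k)"
  proof (intro sum.cong refl)
    fix i assume i: "i \<in> {..<n}"
    have "\<Phi> (Suc i) - \<Phi> i = cell_int n i k"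
      using cell_int_telescope[OF ik n, of "Suc i"] cell_int_telescope[OF ik n, of i] i by (simp add: \<Phi>_def)
    then show "?c i * (\<Phi> (Suc i) - \<Phi> i) = real n * cell_int n i f * cell_int n i k"
      using i by (simp add: grid_coeff_def)
  qed
  finally show ?thesis by simp
qed

lemma cell_int_const:
  assumes "i < n"
  shows "cell_int n i (\<lambda>s. c) = c / real n"
proof -
  have "(\<integral>s. indicator (cell n i) s \<partial>leb01) = real (Suc i) / real n - real i / real n"
    using assms by (intro integral_indicator_leb01) (auto simp: divide_simps)
  also have "\<dots> = 1 / real n" by (simp add: diff_divide_distrib[symmetric])
  finally show ?thesis unfolding cell_int_def by (simp only: integral_mult_left_zero) simp
qed

lemma cell_int_indicator:
  assumes "i < n" "j \<le> n"
  shows "cell_int n i (indicator {0<..real j / real n}) = (if i < j then 1 / real n else 0)"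
proof (cases "i < j")
  case True
  have "real (Suc i) / real n \<le> real j / real n" using True by (auto intro!: divide_right_mono)
  then have "cell_int n i (indicator {0<..real j / real n}) = cell_int n i (\<lambda>s. 1)"
    unfolding cell_int_def
    by (intro Bochner_Integration.integral_cong refl) (auto simp: indicator_def dest: grid_point_less)
  then show ?thesis using True cell_int_const[OF assms(1)] by simp
next
  case False
  have "real j / real n \<le> real i / real n" using False by (auto intro!: divide_right_mono)
  then have "cell_int n i (indicator {0<..real j / real n}) = cell_int n i (\<lambda>s. 0)"
    unfolding cell_int_def by (intro Bochner_Integration.integral_cong refl) (auto simp: indicator_def)
  then show ?thesis using False cell_int_const[OF assms(1)] by simp
qed

text \<open>Averaging preserves the integrals over \<open>{0<..j / n}\<close>, and indicators of
  these intervals span the admissible steps. So \<open>grid_step\<close> represents the orthogonal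
  projection that \<open>cond_exp_mix\<close> requires.\<close>

lemma grid_step_projection:
  assumes h: "square_integrable leb01 h" and n: "n > 0" and q: "times_step (grid_times n) q"
  shows "inner01 h (step_fun q) = inner01 (step_fun (grid_step n h)) (step_fun q)"
  using q
proof (induction q)
  case Nil
  then show ?case by (simp add: step_fun_eqs)
next
  case (Cons x q)
  obtain c u v where x: "x = (c, u, v)" by (cases x)
  then have u: "u = 0" and v: "v \<in> grid_times n" and q: "times_step (grid_times n) q" using Cons.prems by auto
  then obtain j where j: "j \<le> n" "v = real j / real n" by auto
  let ?I = "indicator {0<..v} :: real \<Rightarrow> real"
  have sI: "square_integrable leb01 ?I"
  proof -
    have "step_fun [(1, 0, v)] = ?I" by auto
    then show ?thesis using square_integrable_step_fun[of "[(1, 0, v)]"] by simp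
  qed
  have split: "inner01 k (step_fun (x # q)) = c * inner01 k ?I + inner01 k (step_fun q)"
    if k: "square_integrable leb01 k" for k
  proof -
    have "inner01 k (step_fun (x # q)) = (\<integral>s. c * (k s * ?I s) + k s * step_fun q s \<partial>leb01)"
      unfolding x u step_fun_Cons by (intro Bochner_Integration.integral_cong refl) (simp only: distrib_left mult.left_commute)
    also have "\<dots> = (\<integral>s. c * (k s * ?I s) \<partial>leb01) + inner01 k (step_fun q)"
      by (rule Bochner_Integration.integral_add)
         (intro integrable_mult_right square_integrable_mult k sI square_integrable_step_fun)+
    finally show ?thesis by (simp only: integral_mult_right_zero)
  qed
  have "inner01 (step_fun (grid_step n h)) ?I = (\<Sum>i<n. real n * cell_int n i h * cell_int n i ?I)"
    by (rule inner01_grid_step[OF sI n])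
  also have "\<dots> = (\<Sum>i<n. if i < j then cell_int n i h else 0)"
    unfolding j(2) using n by (intro sum.cong refl) (simp add: cell_int_indicator[OF _ j(1)] del: indicator_simps)
  also have "\<dots> = (\<Sum>i<j. cell_int n i h)"
    using j(1) by (intro sum.mono_neutral_cong_right) auto
  also have "\<dots> = (\<integral>s. indicator {0<..real j / real n} s * h s \<partial>leb01)"
    by (rule cell_int_telescope[OF leb01.square_integrable_integrable[OF h] n j(1), symmetric])
  also have "\<dots> = inner01 h ?I" unfolding j(2) by (simp only: mult.commute)
  finally show ?case
    using Cons.IH[OF q] split[OF h] split[OF square_integrable_step_fun] by (simp only:)
qed

lemma inner01_grid_steps:
  assumes h: "square_integrable leb01 h" and k: "square_integrable leb01 k" and n: "n > 0"
  shows "inner01 (step_fun (grid_step n h)) (step_fun (grid_step n k)) = (\<Sum>i<n. real n * cell_int n i h * cell_int n i k)"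
proof -
  have "inner01 (step_fun (grid_step n h)) (step_fun (grid_step n k)) = inner01 h (step_fun (grid_step n k))"
    by (rule grid_step_projection[OF h n times_step_grid_step, symmetric])
  also have "\<dots> = inner01 (step_fun (grid_step n k)) h" by (rule inner01_commute)
  also have "\<dots> = (\<Sum>i<n. real n * cell_int n i k * cell_int n i h)" by (rule inner01_grid_step[OF h n])
  finally show ?thesis by (simp add: mult_ac)
qed

section \<open>Second-order asymptotics of the projection error\<close>

lemma cell_int_add:
  "integrable leb01 f \<Longrightarrow> integrable leb01 g \<Longrightarrow> cell_int n i (\<lambda>s. f s + g s) = cell_int n i f + cell_int n i g"
  unfolding cell_int_def distrib_left
  by (rule Bochner_Integration.integral_add) (intro integrable_indicator_leb01; simp)+

lemma cell_int_cmult: "cell_int n i (\<lambda>s. c * f s) = c * cell_int n i f"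
  unfolding cell_int_def by (simp only: mult.left_commute[of _ c] integral_mult_right_zero)

lemma cell_int_abs_le:
  assumes f: "integrable leb01 f" and i: "i < n" and B: "\<And>s. s \<in> cell n i \<Longrightarrow> \<bar>f s\<bar> \<le> B"
  shows "\<bar>cell_int n i f\<bar> \<le> B / real n"
proof -
  have "\<bar>cell_int n i f\<bar> \<le> (\<integral>s. \<bar>indicator (cell n i) s * f s\<bar> \<partial>leb01)"
    unfolding cell_int_def by (rule integral_abs_bound)
  also have "\<dots> \<le> (\<integral>s. indicator (cell n i) s * B \<partial>leb01)"
  proof (rule integral_mono)
    show "integrable leb01 (\<lambda>s. \<bar>indicator (cell n i) s * f s\<bar>)"
      by (intro integrable_abs integrable_indicator_leb01 f) simp
    show "integrable leb01 (\<lambda>s. indicator (cell n i) s * B)"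
      by (intro integrable_indicator_leb01) auto
    fix s show "\<bar>indicator (cell n i) s * f s\<bar> \<le> indicator (cell n i) s * B"
      using B[of s] by (cases "s \<in> cell n i") (auto simp: abs_mult)
  qed
  also have "\<dots> = B / real n" using cell_int_const[OF i] unfolding cell_int_def .
  finally show ?thesis .
qed

lemma cell_int_FTC:
  assumes i: "i < n" and F: "\<And>s. (F has_real_derivative f s) (at s)" and f: "continuous_on UNIV f"
  shows "cell_int n i f = F (real (Suc i) / real n) - F (real i / real n)"
proof -
  let ?c = "real i / real n" and ?d = "real (Suc i) / real n"
  have cd: "0 \<le> ?c" "?c \<le> ?d" "?d \<le> 1" using i by (auto simp: divide_simps)
  have mf: "f \<in> borel_measurable borel" using f by (rule borel_measurable_continuous_onI)
  have m: "(\<lambda>s. indicator {?c..?d} s *\<^sub>R f s) \<in> borel_measurable lborel"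
    "(\<lambda>s. indicator (cell n i) s *\<^sub>R f s) \<in> borel_measurable lborel"
    using mf by auto
  have "cell_int n i f = (\<integral>s. indicator {0..1} s *\<^sub>R (indicator (cell n i) s * f s) \<partial>lebesgue)"
    unfolding cell_int_def by (rule integral_restrict_space) simp
  also have "\<dots> = (\<integral>s. indicator (cell n i) s *\<^sub>R f s \<partial>lebesgue)"
    using cd by (intro Bochner_Integration.integral_cong refl) (auto simp: indicator_def dest: grid_point_less)
  also have "\<dots> = (\<integral>s. indicator (cell n i) s *\<^sub>R f s \<partial>lborel)" by (rule integral_completion[OF m(2)])
  also have "\<dots> = (\<integral>s. indicator {?c..?d} s *\<^sub>R f s \<partial>lborel)"
  proof (rule integral_cong_AE[OF m(2) m(1)])
    have "AE s in lborel. s \<noteq> ?c" by (rule AE_lborel_singleton)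
    then show "AE s in lborel. indicator (cell n i) s *\<^sub>R f s = indicator {?c..?d} s *\<^sub>R f s"
      by eventually_elim (auto simp: indicator_def)
  qed
  also have "\<dots> = F ?d - F ?c"
  proof (rule integral_FTC_Icc[OF cd(2)])
    show "(F has_vector_derivative f s) (at s within {?c..?d})" for s
      using F[of s] by (simp add: has_real_derivative_iff_has_vector_derivative has_vector_derivative_at_within)
    show "continuous_on {?c..?d} f" using f by (rule continuous_on_subset) simp
  qed
  finally show ?thesis .
qed

text \<open>Up to the cell length \<open>1 / n\<close>, the left side compares a covariance under
  the uniform law on the cell with that of two affine functions. The uniform law on length
  \<open>1 / n\<close> has variance \<open>1 / (12 n\<^sup>2)\<close>, hence
  \<open>1 / (12 n ^ 3)\<close>.\<close>

lemma cell_covariance: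
  assumes h: "square_integrable leb01 h" "square_integrable leb01 k" and i: "i < n"
    and r: "\<And>s. s \<in> cell n i \<Longrightarrow> \<bar>h s - \<alpha> - a * (s - real i / real n)\<bar> \<le> e / real n"
       "\<And>s. s \<in> cell n i \<Longrightarrow> \<bar>k s - \<beta> - b * (s - real i / real n)\<bar> \<le> e / real n"
    and K: "\<bar>a\<bar> \<le> K" "\<bar>b\<bar> \<le> K" "K \<ge> 0" "e \<ge> 0"
  shows "\<bar>cell_int n i (\<lambda>s. h s * k s) - real n * cell_int n i h * cell_int n i k - a * b / (12 * real n ^ 3)\<bar>
    \<le> (2 * K * e + 2 * e\<^sup>2) / real n ^ 3"
proof -
  let ?A = "cell_int n i" and ?c = "real i / real n"
  have n: "real n > 0" using i by simp
  \<comment> \<open>Centring the linear part at the midpoint makes its integral over the cell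
    vanish, so constants and slopes decouple.\<close>
  define mid where "mid = ?c + 1 / (2 * real n)"
  define L where "L s = s - mid" for s :: real
  define \<alpha>' where "\<alpha>' = \<alpha> + a * (mid - ?c)"
  define \<beta>' where "\<beta>' = \<beta> + b * (mid - ?c)"
  define p where "p s = h s - \<alpha> - a * (s - ?c)" for s
  define q where "q s = k s - \<beta> - b * (s - ?c)" for s
  have lin: "square_integrable leb01 (\<lambda>s. x + y * s)" for x y :: real
    by (rule continuous_square_integrable_leb01) (intro continuous_intros)
  have sqL: "square_integrable leb01 L" using lin[of "- mid" 1] by (simp add: L_def[abs_def])
  have sqp: "square_integrable leb01 p"
    using square_integrable_diff[OF h(1) lin[of "\<alpha> - a * ?c" a]] by (simp add: p_def[abs_def] algebra_simps)
  have sqq: "square_integrable leb01 q"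
    using square_integrable_diff[OF h(2) lin[of "\<beta> - b * ?c" b]] by (simp add: q_def[abs_def] algebra_simps)
  note I = leb01.square_integrable_integrable
  note IM = square_integrable_mult
  note ints = I[OF sqL] I[OF sqp] I[OF sqq] IM[OF sqL sqL] IM[OF sqL sqp] IM[OF sqL sqq] IM[OF sqp sqq]
  have hs: "h s = \<alpha>' + (a * L s + p s)" for s by (simp add: \<alpha>'_def L_def p_def algebra_simps)
  have ks: "k s = \<beta>' + (b * L s + q s)" for s by (simp add: \<beta>'_def L_def q_def algebra_simps)
  have AL: "?A L = 0"
  proof -
    have "?A L = (real (Suc i) / real n - mid)\<^sup>2 / 2 - (?c - mid)\<^sup>2 / 2"
      by (rule cell_int_FTC[OF i]) (auto intro!: derivative_eq_intros continuous_intros simp: L_def)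
    also have "real (Suc i) / real n - mid = 1 / (2 * real n)" using n by (simp add: mid_def field_simps)
    also have "?c - mid = - (1 / (2 * real n))" by (simp add: mid_def)
    finally show ?thesis by simp
  qed
  have ALL: "?A (\<lambda>s. L s * L s) = 1 / (12 * real n ^ 3)"
  proof -
    have "?A (\<lambda>s. L s * L s) = (real (Suc i) / real n - mid) ^ 3 / 3 - (?c - mid) ^ 3 / 3"
      by (rule cell_int_FTC[OF i]) (auto intro!: derivative_eq_intros continuous_intros simp: L_def power2_eq_square)
    also have "real (Suc i) / real n - mid = 1 / (2 * real n)" using n by (simp add: mid_def field_simps)
    also have "?c - mid = - (1 / (2 * real n))" by (simp add: mid_def)
    finally show ?thesis using n by (simp add: power_divide power3_eq_cube)
  qed
  have Ah: "?A h = \<alpha>' / real n + (a * ?A L + ?A p)"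
  proof -
    have "?A h = ?A (\<lambda>s. \<alpha>' + (a * L s + p s))" by (simp add: hs[symmetric])
    also have "\<dots> = ?A (\<lambda>s. \<alpha>') + (?A (\<lambda>s. a * L s) + ?A p)"
      using ints by (simp add: cell_int_add)
    finally show ?thesis by (simp add: cell_int_const[OF i] cell_int_cmult)
  qed
  have Ak: "?A k = \<beta>' / real n + (b * ?A L + ?A q)"
  proof -
    have "?A k = ?A (\<lambda>s. \<beta>' + (b * L s + q s))" by (simp add: ks[symmetric])
    also have "\<dots> = ?A (\<lambda>s. \<beta>') + (?A (\<lambda>s. b * L s) + ?A q)"
      using ints by (simp add: cell_int_add)
    finally show ?thesis by (simp add: cell_int_const[OF i] cell_int_cmult)
  qed
  have Ahk: "?A (\<lambda>s. h s * k s) = \<alpha>' * \<beta>' / real n + (\<alpha>' * (b * ?A L + ?A q) + (\<beta>' * (a * ?A L + ?A p)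
      + (a * b * ?A (\<lambda>s. L s * L s) + (a * ?A (\<lambda>s. L s * q s) + (b * ?A (\<lambda>s. L s * p s) + ?A (\<lambda>s. p s * q s))))))"
  proof -
    have "?A (\<lambda>s. h s * k s) = ?A (\<lambda>s. \<alpha>' * \<beta>' + (\<alpha>' * (b * L s + q s) + (\<beta>' * (a * L s + p s)
      + (a * b * (L s * L s) + (a * (L s * q s) + (b * (L s * p s) + p s * q s))))))"
      by (rule arg_cong[where f="?A"]) (auto simp: hs ks algebra_simps)
    also have "\<dots> = ?A (\<lambda>s. \<alpha>' * \<beta>') + (?A (\<lambda>s. \<alpha>' * (b * L s + q s)) + (?A (\<lambda>s. \<beta>' * (a * L s + p s))
      + (?A (\<lambda>s. a * b * (L s * L s)) + (?A (\<lambda>s. a * (L s * q s)) + (?A (\<lambda>s. b * (L s * p s)) + ?A (\<lambda>s. p s * q s))))))"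
      using ints by (simp add: cell_int_add)
    also have "?A (\<lambda>s. \<alpha>' * (b * L s + q s)) = \<alpha>' * (b * ?A L + ?A q)"
      using ints by (simp add: cell_int_add cell_int_cmult)
    also have "?A (\<lambda>s. \<beta>' * (a * L s + p s)) = \<beta>' * (a * ?A L + ?A p)"
      using ints by (simp add: cell_int_add cell_int_cmult)
    finally show ?thesis unfolding cell_int_const[OF i] by (simp only: cell_int_cmult)
  qed
  \<comment> \<open>Constants and the product of the slopes have cancelled; each remaining term
    contains a remainder. Two are of order \<open>K * e\<close> and two of order
    \<open>e\<^sup>2\<close>, all divided by \<open>real n ^ 3\<close>.\<close>
  have cov: "?A (\<lambda>s. h s * k s) - real n * ?A h * ?A k - a * b / (12 * real n ^ 3) =
     a * ?A (\<lambda>s. L s * q s) + b * ?A (\<lambda>s. L s * p s) + ?A (\<lambda>s. p s * q s) - real n * ?A p * ?A q"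
    unfolding Ahk Ah Ak AL ALL using n by (simp add: field_simps)
  have Lb: "\<bar>L s\<bar> \<le> 1 / real n" if "s \<in> cell n i" for s
  proof -
    have "?c < s" "s \<le> ?c + 1 / real n" using that by (auto simp: add_divide_distrib)
    moreover have "1 / (2 * real n) \<le> 1 / real n" using n by (simp add: field_simps)
    moreover have "1 / real n = 1 / (2 * real n) + 1 / (2 * real n)" by simp
    ultimately show ?thesis unfolding L_def mid_def abs_le_iff by linarith
  qed
  have pb: "\<bar>p s\<bar> \<le> e / real n" and qb: "\<bar>q s\<bar> \<le> e / real n" if "s \<in> cell n i" for s
    using r that by (auto simp: p_def q_def)
  have b1: "\<bar>?A (\<lambda>s. L s * q s)\<bar> \<le> 1 / real n * (e / real n) / real n"
    by (rule cell_int_abs_le[OF ints(6) i]) (unfold abs_mult, intro mult_mono Lb qb, use n in auto)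
  have b2: "\<bar>?A (\<lambda>s. L s * p s)\<bar> \<le> 1 / real n * (e / real n) / real n"
    by (rule cell_int_abs_le[OF ints(5) i]) (unfold abs_mult, intro mult_mono Lb pb, use n in auto)
  have b3: "\<bar>?A (\<lambda>s. p s * q s)\<bar> \<le> e / real n * (e / real n) / real n"
    by (rule cell_int_abs_le[OF ints(7) i]) (unfold abs_mult, intro mult_mono pb qb, use n K in auto)
  have b4: "\<bar>real n * ?A p * ?A q\<bar> \<le> real n * (e / real n / real n) * (e / real n / real n)"
    unfolding abs_mult using K n
    by (intro mult_mono cell_int_abs_le[OF ints(2) i pb] cell_int_abs_le[OF ints(3) i qb]) auto
  have c1: "\<bar>a * ?A (\<lambda>s. L s * q s)\<bar> \<le> K * (1 / real n * (e / real n) / real n)"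
    unfolding abs_mult using K b1 by (intro mult_mono) auto
  have c2: "\<bar>b * ?A (\<lambda>s. L s * p s)\<bar> \<le> K * (1 / real n * (e / real n) / real n)"
    unfolding abs_mult using K b2 by (intro mult_mono) auto
  have "\<bar>a * ?A (\<lambda>s. L s * q s) + b * ?A (\<lambda>s. L s * p s) + ?A (\<lambda>s. p s * q s) - real n * ?A p * ?A q\<bar> \<le>
      K * (1 / real n * (e / real n) / real n) + K * (1 / real n * (e / real n) / real n)
      + e / real n * (e / real n) / real n + real n * (e / real n / real n) * (e / real n / real n)"
    using c1 c2 b3 b4 by linarith
  also have "\<dots> = (2 * K * e + 2 * e\<^sup>2) / real n ^ 3"
    using n by (simp add: field_simps power2_eq_square power3_eq_cube)
  finally show ?thesis unfolding cov .
qed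

text \<open>Summing the cell covariances yields a Riemann sum of \<open>h' k' / 12\<close>; uniform
  continuity of the derivatives controls both the affine approximation on cells and this Riemann
  sum.\<close>

lemma grid_projection_limit:
  assumes h: "\<And>y. y \<in> {0..1} \<Longrightarrow> (h has_real_derivative h' y) (at y within {0..1})" "continuous_on {0..1} h'"
    and k: "\<And>y. y \<in> {0..1} \<Longrightarrow> (k has_real_derivative k' y) (at y within {0..1})" "continuous_on {0..1} k'"
  shows "(\<lambda>n. (real n)\<^sup>2 * (inner01 h k - inner01 (step_fun (grid_step n h)) (step_fun (grid_step n k)))) \<longlonglongrightarrow> inner01 h' k' / 12"
proof (rule LIMSEQ_I)
  fix \<eta> :: real assume \<eta>: "\<eta> > 0"
  have ch: "continuous_on {0..1} h" by (rule DERIV_continuous_on[OF h(1)])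
  have ck: "continuous_on {0..1} k" by (rule DERIV_continuous_on[OF k(1)])
  note sq = continuous_square_integrable_leb01(1)[OF ch] continuous_square_integrable_leb01(1)[OF ck]
    continuous_square_integrable_leb01(1)[OF h(2)] continuous_square_integrable_leb01(1)[OF k(2)]
  obtain K1 where K1: "\<And>s. s \<in> {0..1} \<Longrightarrow> \<bar>h' s\<bar> \<le> K1" using continuous_square_integrable_leb01(2)[OF h(2)] by blast
  obtain K2 where K2: "\<And>s. s \<in> {0..1} \<Longrightarrow> \<bar>k' s\<bar> \<le> K2" using continuous_square_integrable_leb01(2)[OF k(2)] by blast
  define K where "K = max K1 K2"
  have K: "\<bar>h' s\<bar> \<le> K" "\<bar>k' s\<bar> \<le> K" if "s \<in> {0..1}" for s using K1[OF that] K2[OF that] by (auto simp: K_def)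
  have K0: "K \<ge> 0" using K(1)[of 0] by simp
  \<comment> \<open>The total error below is at most \<open>(4 * K + 2) * e\<close>, so this choice
    gives \<open>\<eta> / 2\<close>; the cap 1 serves to replace \<open>e\<^sup>2\<close> by
    \<open>e\<close>.\<close>
  define e where "e = min 1 (\<eta> / (2 * (4 * K + 2)))"
  have e: "e > 0" "e \<le> 1" using \<eta> K0 by (auto simp: e_def add_nonneg_pos)
  obtain d1 where d1: "d1 > 0" "\<And>x y. x \<in> {0..1} \<Longrightarrow> y \<in> {0..1} \<Longrightarrow> dist y x < d1 \<Longrightarrow> dist (h' y) (h' x) < e"
    using compact_uniformly_continuous[OF h(2)] e(1) unfolding uniformly_continuous_on_def by auto
  obtain d2 where d2: "d2 > 0" "\<And>x y. x \<in> {0..1} \<Longrightarrow> y \<in> {0..1} \<Longrightarrow> dist y x < d2 \<Longrightarrow> dist (k' y) (k' x) < e"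
    using compact_uniformly_continuous[OF k(2)] e(1) unfolding uniformly_continuous_on_def by auto
  obtain N :: nat where N: "N > 0" "1 / real N < min d1 d2"
    using d1(1) d2(1) by (metis min_less_iff_conj nat_approx_posE zero_less_Suc)
  show "\<exists>no. \<forall>n\<ge>no. norm ((real n)\<^sup>2 * (inner01 h k - inner01 (step_fun (grid_step n h)) (step_fun (grid_step n k))) - inner01 h' k' / 12) < \<eta>"
  proof (intro exI[of _ N] allI impI)
    fix n assume "n \<ge> N"
    then have n: "n > 0" and nd: "1 / real n < d1" "1 / real n < d2"
      using N by (auto intro: le_less_trans[of _ "1 / real N"] simp: frac_le)
    let ?c = "\<lambda>i. real i / real n"
    have cells: "s \<in> {0..1}" "?c i < s" "s \<le> ?c i + 1 / real n" "?c i \<in> {0..1}" if "s \<in> cell n i" "i < n" for s i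
    proof -
      have "real (Suc i) / real n \<le> 1" "0 \<le> ?c i" using that(2) by (auto simp: divide_simps)
      then show "s \<in> {0..1}" "?c i < s" "s \<le> ?c i + 1 / real n" "?c i \<in> {0..1}"
        using that(1) grid_point_less[of i n s] by (auto simp: add_divide_distrib)
    qed
    \<comment> \<open>The mean value theorem gives slope \<open>f' q\<close> at some
      \<open>q\<close> of the same cell, which is within \<open>e\<close> of the slope at the left
      end.\<close>
    have lin: "\<bar>f s - f (?c i) - f' (?c i) * (s - ?c i)\<bar> \<le> e / real n"
      if s: "s \<in> cell n i" "i < n" and f: "\<And>y. y \<in> {0..1} \<Longrightarrow> (f has_real_derivative f' y) (at y within {0..1})"
        and d: "\<And>x y. x \<in> {0..1} \<Longrightarrow> y \<in> {0..1} \<Longrightarrow> dist y x < d \<Longrightarrow> dist (f' y) (f' x) < e" "1 / real n < d" for f f' d s i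
    proof -
      note c = cells[OF s]
      obtain q where q: "?c i < q" "q < s" "f s - f (?c i) = f' q * (s - ?c i)"
        by (rule unit_interval_mvt[OF f, of "?c i" s]) (use c in auto)
      have "dist q (?c i) < d" using q c d(2) by (auto simp: dist_real_def)
      then have "dist (f' q) (f' (?c i)) < e" using q c grid_point_less[OF q(1)] by (intro d(1)) auto
      then have "\<bar>f' q - f' (?c i)\<bar> \<le> e" by (simp add: dist_real_def)
      then have "\<bar>f' q - f' (?c i)\<bar> * (s - ?c i) \<le> e * (1 / real n)"
        using c e by (intro mult_mono) auto
      moreover have "f s - f (?c i) - f' (?c i) * (s - ?c i) = (f' q - f' (?c i)) * (s - ?c i)"
        using q(3) by (simp add: algebra_simps)
      ultimately show ?thesis using c by (simp add: abs_mult)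
    qed
    have cov: "\<bar>cell_int n i (\<lambda>s. h s * k s) - real n * cell_int n i h * cell_int n i k - h' (?c i) * k' (?c i) / (12 * real n ^ 3)\<bar>
        \<le> (2 * K * e + 2 * e\<^sup>2) / real n ^ 3" if "i < n" for i
    proof (rule cell_covariance[OF sq(1,2) that])
      have c01: "?c i \<in> {0..1}" using that by (auto simp: divide_simps)
      show "\<bar>h' (?c i)\<bar> \<le> K" "\<bar>k' (?c i)\<bar> \<le> K" using K c01 by auto
    qed (use that e K0 lin[OF _ _ h(1) d1(2) nd(1)] lin[OF _ _ k(1) d2(2) nd(2)] in auto)
    \<comment> \<open>Error of the left-endpoint Riemann sum on one cell: changing either factor by
      \<open>e\<close> costs at most \<open>K * e\<close>.\<close>
    have riem: "\<bar>cell_int n i (\<lambda>s. h' s * k' s) - h' (?c i) * k' (?c i) / real n\<bar> \<le> 2 * K * e / real n" if i: "i < n" for i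
    proof -
      have int: "integrable leb01 (\<lambda>s. h' s * k' s)" by (intro square_integrable_mult sq)
      have "cell_int n i (\<lambda>s. h' s * k' s) - h' (?c i) * k' (?c i) / real n =
          cell_int n i (\<lambda>s. h' s * k' s + - (h' (?c i) * k' (?c i)))"
        using cell_int_add[OF int, of "\<lambda>s. - (h' (?c i) * k' (?c i))" n i] cell_int_const[OF i, of "- (h' (?c i) * k' (?c i))"]
        by simp
      also have "\<bar>\<dots>\<bar> \<le> 2 * K * e / real n"
      proof (rule cell_int_abs_le[OF _ i])
        show "integrable leb01 (\<lambda>s. h' s * k' s + - (h' (?c i) * k' (?c i)))" using int by simp
        fix s assume s: "s \<in> cell n i"
        note c = cells[OF s i]
        have "dist s (?c i) < d1" "dist s (?c i) < d2" using c nd by (auto simp: dist_real_def)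
        then have hk: "\<bar>h' s - h' (?c i)\<bar> \<le> e" "\<bar>k' s - k' (?c i)\<bar> \<le> e"
          using d1(2)[of "?c i" s] d2(2)[of "?c i" s] c by (auto simp: dist_real_def)
        have "h' s * k' s + - (h' (?c i) * k' (?c i)) = (h' s - h' (?c i)) * k' s + h' (?c i) * (k' s - k' (?c i))"
          by (simp add: algebra_simps)
        also have "\<bar>\<dots>\<bar> \<le> \<bar>h' s - h' (?c i)\<bar> * \<bar>k' s\<bar> + \<bar>h' (?c i)\<bar> * \<bar>k' s - k' (?c i)\<bar>"
          by (rule order_trans[OF abs_triangle_ineq]) (simp add: abs_mult)
        also have "\<dots> \<le> e * K + K * e" using hk K[OF c(1)] K[OF c(4)] K0 e by (intro add_mono mult_mono) auto
        finally show "\<bar>h' s * k' s + - (h' (?c i) * k' (?c i))\<bar> \<le> 2 * K * e" by simp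
      qed
      finally show ?thesis .
    qed
    have hk: "inner01 h k = (\<Sum>i<n. cell_int n i (\<lambda>s. h s * k s))" "inner01 h' k' = (\<Sum>i<n. cell_int n i (\<lambda>s. h' s * k' s))"
      by (intro integral_cells n square_integrable_mult sq)+
    have "norm ((real n)\<^sup>2 * (inner01 h k - inner01 (step_fun (grid_step n h)) (step_fun (grid_step n k))) - inner01 h' k' / 12) =
      \<bar>\<Sum>i<n. (real n)\<^sup>2 * (cell_int n i (\<lambda>s. h s * k s) - real n * cell_int n i h * cell_int n i k - h' (?c i) * k' (?c i) / (12 * real n ^ 3))
         - (cell_int n i (\<lambda>s. h' s * k' s) - h' (?c i) * k' (?c i) / real n) / 12\<bar>"
    proof -
      have t: "(real n)\<^sup>2 * (h' (?c i) * k' (?c i) / (12 * real n ^ 3)) = h' (?c i) * k' (?c i) / real n / 12" for i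
        using n by (simp add: power2_eq_square power3_eq_cube)
      have "(real n)\<^sup>2 * (cell_int n i (\<lambda>s. h s * k s) - real n * cell_int n i h * cell_int n i k - h' (?c i) * k' (?c i) / (12 * real n ^ 3))
         - (cell_int n i (\<lambda>s. h' s * k' s) - h' (?c i) * k' (?c i) / real n) / 12 =
         (real n)\<^sup>2 * (cell_int n i (\<lambda>s. h s * k s) - real n * cell_int n i h * cell_int n i k) - cell_int n i (\<lambda>s. h' s * k' s) / 12" for i
        unfolding right_diff_distrib t diff_divide_distrib by simp
      then show ?thesis
        unfolding hk inner01_grid_steps[OF sq(1,2) n] real_norm_def
        by (simp only: sum_subtractf sum_distrib_left[symmetric] sum_divide_distrib[symmetric])
    qed
    also have "\<dots> \<le> (\<Sum>i<n. (real n)\<^sup>2 * ((2 * K * e + 2 * e\<^sup>2) / real n ^ 3) + (2 * K * e / real n) / 12)"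
    proof (intro order_trans[OF sum_abs] sum_mono)
      fix i assume "i \<in> {..<n}"
      then have i: "i < n" by simp
      let ?X = "cell_int n i (\<lambda>s. h s * k s) - real n * cell_int n i h * cell_int n i k - h' (?c i) * k' (?c i) / (12 * real n ^ 3)"
      let ?Y = "cell_int n i (\<lambda>s. h' s * k' s) - h' (?c i) * k' (?c i) / real n"
      have "\<bar>(real n)\<^sup>2 * ?X - ?Y / 12\<bar> \<le> (real n)\<^sup>2 * \<bar>?X\<bar> + \<bar>?Y\<bar> / 12"
        by (rule order_trans[OF abs_triangle_ineq4]) (simp add: abs_mult)
      also have "\<dots> \<le> (real n)\<^sup>2 * ((2 * K * e + 2 * e\<^sup>2) / real n ^ 3) + (2 * K * e / real n) / 12"
        using cov[OF i] riem[OF i] by (intro add_mono mult_left_mono divide_right_mono) auto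
      finally show "\<bar>(real n)\<^sup>2 * ?X - ?Y / 12\<bar> \<le> (real n)\<^sup>2 * ((2 * K * e + 2 * e\<^sup>2) / real n ^ 3) + (2 * K * e / real n) / 12" .
    qed
    also have "\<dots> = 2 * K * e + 2 * e\<^sup>2 + 2 * K * e / 12"
    proof -
      have "r * (r\<^sup>2 * (C / r ^ 3) + D / r / 12) = C + D / 12" if "r > 0" for r C D :: real
        using that by (simp add: power2_eq_square power3_eq_cube distrib_left)
      from this[of "real n"] show ?thesis using n by (simp only: sum_constant card_lessThan of_nat_0_less_iff)
    qed
    also have "\<dots> \<le> (4 * K + 2) * e"
    proof -
      have "e\<^sup>2 \<le> e" using e by (simp add: power2_eq_square mult_left_le)
      moreover have "0 \<le> K * e" using K0 e by simp
      ultimately show ?thesis by (simp add: algebra_simps)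
    qed
    also have "\<dots> \<le> (4 * K + 2) * (\<eta> / (2 * (4 * K + 2)))"
      using K0 by (intro mult_left_mono) (auto simp: e_def)
    also have "\<dots> = \<eta> / 2" using K0 by (simp add: field_simps)
    also have "\<dots> < \<eta>" using \<eta> by simp
    finally show "norm ((real n)\<^sup>2 * (inner01 h k - inner01 (step_fun (grid_step n h)) (step_fun (grid_step n k))) - inner01 h' k' / 12) < \<eta>" .
  qed
qed

section \<open>The asymptotic error\<close>

lemma S_functional_cong:
  assumes "\<And>j. j \<in> {1..m} \<Longrightarrow> f j = f' j"
  shows "S_functional m f F g = S_functional m f' F g"
proof -
  have "S_array m f a g = S_array m f' a g" for a
    unfolding S_array_def by (rule prod.cong) (simp_all add: assms)
  then show ?thesis by (simp add: S_functional_def)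
qed

context brownian_space
begin

text \<open>The density of the directional derivative of the mixture carries the extra factor \<open>\<Sum>j. c j \<cdot> z j\<close>.\<close>

lemma wick_derivative_norm:
  fixes c :: "nat \<Rightarrow> real"
  assumes R: "R \<ge> 1" and F: "functional_growth R m F"
    and h: "\<And>j. j \<in> insert 0 {1..m} \<Longrightarrow> square_integrable leb01 (h j)"
  shows "complex_of_real (\<integral>\<omega>. (wick_product M W
          (\<lambda>\<omega>. (\<Sum>k\<in>{1..m}. c k * wick_eval M W m h (wick_partial k F) \<omega>) + c 0 * wick_eval M W m h F \<omega>)
          (wick_exp M W (h 0)) \<omega>)\<^sup>2 \<partial>M) =
    (\<Sum>j\<in>insert 0 {1..m}. \<Sum>k\<in>insert 0 {1..m}. of_real (c j * c k) *
      wick_mixture.moment (torus m) (insert 0 {1..m}) (torus_coord R) h (functional_density R m F) j k)"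
proof -
  let ?J = "insert 0 {1..m}"
  interpret C: wick_mixture M W "torus m" ?J "torus_coord R" R by (rule torus_mixture[OF R])
  let ?\<rho> = "functional_density R m F"
  have ok: "C.density_ok ?\<rho>" by (rule functional_mixture(1)[OF R F])
  have L2: "C.L2fam h" using h by blast
  define D where "D g = (\<Sum>k\<in>{1..m}. c k * S_functional m h (wick_partial k F) g) + c 0 * S_functional m h F g" for g
  have S: "C.S_mix h (\<lambda>\<theta>. ?\<rho> \<theta> * (\<Sum>j\<in>?J. torus_coord R \<theta> j * of_real (c j))) g = of_real (D g * exp (inner01 (h 0) g))" for g
  proof -
    \<comment> \<open>Coordinate 0 is constantly 1, so this partial derivative is the functional
      itself; it accounts for the term with \<open>c 0\<close>.\<close>
    have z: "C.S_mix h (\<lambda>\<theta>. ?\<rho> \<theta> * torus_coord R \<theta> 0) g = of_real (exp (inner01 (h 0) g) * S_functional m h F g)"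
      using functional_mixture(2)[OF R F, of h g] by (simp add: torus_coord_def)
    have "(\<Sum>j\<in>{1..m}. of_real (c j) * C.S_mix h (\<lambda>\<theta>. ?\<rho> \<theta> * torus_coord R \<theta> j) g) =
      (\<Sum>j\<in>{1..m}. complex_of_real (c j * (exp (inner01 (h 0) g) * S_functional m h (wick_partial j F) g)))"
      by (intro sum.cong refl) (simp only: functional_mixture(3)[OF R F] of_real_mult)
    also have "\<dots> = of_real ((\<Sum>k\<in>{1..m}. c k * S_functional m h (wick_partial k F) g) * exp (inner01 (h 0) g))"
      unfolding of_real_sum[symmetric] sum_distrib_right by (simp only: mult_ac)
    finally have s: "(\<Sum>j\<in>{1..m}. of_real (c j) * C.S_mix h (\<lambda>\<theta>. ?\<rho> \<theta> * torus_coord R \<theta> j) g) = \<dots>" .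
    have "C.S_mix h (\<lambda>\<theta>. ?\<rho> \<theta> * (\<Sum>j\<in>?J. torus_coord R \<theta> j * of_real (c j))) g =
       of_real (c 0) * C.S_mix h (\<lambda>\<theta>. ?\<rho> \<theta> * torus_coord R \<theta> 0) g +
       (\<Sum>j\<in>{1..m}. of_real (c j) * C.S_mix h (\<lambda>\<theta>. ?\<rho> \<theta> * torus_coord R \<theta> j) g)"
      unfolding C.S_mix_derivative[OF ok] by (rule sum.insert) auto
    then show ?thesis unfolding z s D_def by (simp add: algebra_simps)
  qed
  have "has_S M W (\<lambda>\<omega>. (\<Sum>k\<in>{1..m}. c k * wick_eval M W m h (wick_partial k F) \<omega>) + c 0 * wick_eval M W m h F \<omega>) D"
    unfolding D_def[abs_def]
    by (intro has_S_add has_S_sum has_S_cmult has_S_wick_eval[OF _ R] functional_growth_partial F) (use R h in auto)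
  moreover have "has_S M W (wick_exp M W (h 0)) (\<lambda>g. exp (inner01 (h 0) g))"
    by (rule has_S_wick_exp) (simp add: h)
  \<comment> \<open>Existence of the Wick product: its prospective S-transform is that of the
    mixture with the derivative density.\<close>
  moreover obtain Z where "has_S M W Z (\<lambda>g. D g * exp (inner01 (h 0) g))"
    using C.mix_real_exists[OF C.derivative_density_ok[OF ok] L2 S] unfolding has_S_def by metis
  ultimately have P: "has_S M W (wick_product M W
          (\<lambda>\<omega>. (\<Sum>k\<in>{1..m}. c k * wick_eval M W m h (wick_partial k F) \<omega>) + c 0 * wick_eval M W m h F \<omega>)
          (wick_exp M W (h 0))) (\<lambda>g. D g * exp (inner01 (h 0) g))"
    by (rule has_S_wick_product)
  have sq: "square_integrable M (wick_product M W
          (\<lambda>\<omega>. (\<Sum>k\<in>{1..m}. c k * wick_eval M W m h (wick_partial k F) \<omega>) + c 0 * wick_eval M W m h F \<omega>)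
          (wick_exp M W (h 0)))" by (rule has_SD(1)[OF P])
  show ?thesis
    by (rule C.derivative_mix_norm[OF ok L2 square_integrable_measurable[OF sq]
          C.mix_representation[OF C.derivative_density_ok[OF ok] L2 sq]])
       (simp only: S has_SD(2)[OF P])
qed

text \<open>Both sides are combinations of the same moments with weights
  \<open>inner01 (d j) (d k)\<close>. On the left these weights come from the Gram limit, on the
  right from integrating \<open>d j s * d k s\<close> over \<open>s\<close>. The scalar
  \<open>A\<close> is the deterministic factor of the solution.\<close>

lemma optimal_approx_limit:
  fixes h d :: "nat \<Rightarrow> real \<Rightarrow> real"
  assumes R: "R \<ge> 1" and F: "functional_growth R m F"
    and d: "\<And>j s. j \<in> insert 0 {1..m} \<Longrightarrow> s \<in> {0..1} \<Longrightarrow> (h j has_real_derivative d j s) (at s within {0..1})"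
    and cont: "\<And>j. j \<in> insert 0 {1..m} \<Longrightarrow> continuous_on {0..1} (d j)"
    and X: "has_S M W X (\<lambda>g. A * (S_functional m h F g * exp (inner01 (h 0) g)))"
  shows "(\<lambda>n. (real n)\<^sup>2 * (\<integral>\<omega>. (X \<omega> - optimal_approx M W n X \<omega>)\<^sup>2 \<partial>M)) \<longlonglongrightarrow>
    A\<^sup>2 / 12 * (\<integral>s. (\<integral>\<omega>. (wick_product M W
          (\<lambda>\<omega>. (\<Sum>k\<in>{1..m}. d k s * wick_eval M W m h (wick_partial k F) \<omega>) + d 0 s * wick_eval M W m h F \<omega>)
          (wick_exp M W (h 0)) \<omega>)\<^sup>2 \<partial>M) \<partial>leb01)" (is "(\<lambda>n. ?E n) \<longlonglongrightarrow> A\<^sup>2 / 12 * (\<integral>s. ?V s \<partial>leb01)")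
proof -
  let ?J = "insert 0 {1..m}"
  interpret C: wick_mixture M W "torus m" ?J "torus_coord R" R by (rule torus_mixture[OF R])
  let ?r = "functional_density R m F"
  \<comment> \<open>The scalar goes into the density; moments are quadratic in it, whence
    \<open>A\<^sup>2\<close>.\<close>
  define \<rho> where "\<rho> \<theta> = of_real A * ?r \<theta>" for \<theta>
  have okr: "C.density_ok ?r" by (rule functional_mixture(1)[OF R F])
  have ok: "C.density_ok \<rho>" unfolding \<rho>_def by (rule C.density_ok_cmult[OF okr])
  have S: "C.S_mix k \<rho> g = of_real (A * (S_functional m k F g * exp (inner01 (k 0) g)))" for k g
    unfolding \<rho>_def C.S_mix_cmult functional_mixture(2)[OF R F] by (simp add: mult.commute)
  have h: "square_integrable leb01 (h j)" if "j \<in> ?J" for j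
    using d[OF that] by (intro continuous_square_integrable_leb01 DERIV_continuous_on)
  have dsq: "square_integrable leb01 (d j)" if "j \<in> ?J" for j
    by (rule continuous_square_integrable_leb01[OF cont[OF that]])
  have L2: "C.L2fam h" using h by blast
  have sq: "square_integrable M X" by (rule has_SD(1)[OF X])
  have rep: "AE \<omega> in M. C.mix h \<rho> \<omega> = of_real (X \<omega>)"
    by (rule C.mix_representation[OF ok L2 sq]) (simp only: S has_SD(2)[OF X])
  define hn where "hn n j = step_fun (grid_step n (h j))" for n j
  have err: "complex_of_real (\<integral>\<omega>. (X \<omega> - optimal_approx M W n X \<omega>)\<^sup>2 \<partial>M) =
     C.pair_integral \<rho> (\<lambda>\<theta> \<theta>'. exp (C.gram h h \<theta> \<theta>')) - C.pair_integral \<rho> (\<lambda>\<theta> \<theta>'. exp (C.gram (hn n) (hn n) \<theta> \<theta>'))"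
    if n: "n > 0" for n
    unfolding optimal_approx_def
  proof (rule C.cond_exp_mix[OF _ ok L2 times_step_grid_step _ _ _ sq rep])
    show "grid_times n \<subseteq> {0..1}" using n by (auto simp: divide_simps)
    show "hn n j = step_fun (grid_step n (h j))" for j by (rule hn_def)
    show "inner01 (h j) (step_fun q) = inner01 (hn n j) (step_fun q)" if "j \<in> ?J" "times_step (grid_times n) q" for j q
      unfolding hn_def by (rule grid_step_projection[OF h[OF that(1)] n that(2)])
    show "C.S_mix (hn n) \<rho> g \<in> \<real>" for g unfolding S by (rule Reals_of_real)
  qed
  have "(\<lambda>n. of_real ((real n)\<^sup>2) * (C.pair_integral \<rho> (\<lambda>\<theta> \<theta>'. exp (C.gram h h \<theta> \<theta>')) -
      C.pair_integral \<rho> (\<lambda>\<theta> \<theta>'. exp (C.gram (hn n) (hn n) \<theta> \<theta>'))))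
    \<longlonglongrightarrow> (\<Sum>j\<in>?J. \<Sum>k\<in>?J. of_real (inner01 (d j) (d k) / 12) * C.moment h \<rho> j k)"
    unfolding hn_def[abs_def]
    by (rule C.pair_integral_gram_limit[OF ok]) (intro grid_projection_limit d cont)
  moreover have "eventually (\<lambda>n. of_real ((real n)\<^sup>2) * (C.pair_integral \<rho> (\<lambda>\<theta> \<theta>'. exp (C.gram h h \<theta> \<theta>')) -
      C.pair_integral \<rho> (\<lambda>\<theta> \<theta>'. exp (C.gram (hn n) (hn n) \<theta> \<theta>'))) = complex_of_real (?E n)) sequentially"
    using eventually_gt_at_top[of 0] by eventually_elim (simp only: err[symmetric] of_real_mult)
  ultimately have lim: "(\<lambda>n. complex_of_real (?E n)) \<longlonglongrightarrow> (\<Sum>j\<in>?J. \<Sum>k\<in>?J. of_real (inner01 (d j) (d k) / 12) * C.moment h \<rho> j k)"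
    by (rule Lim_transform_eventually)
  \<comment> \<open>For each fixed \<open>s\<close> the coefficients are the numbers
    \<open>d j s\<close>; the moments do not depend on \<open>s\<close>, so only the coefficients
    are integrated.\<close>
  have V: "complex_of_real (?V s) = (\<Sum>j\<in>?J. \<Sum>k\<in>?J. of_real (d j s * d k s) * C.moment h ?r j k)" for s
    by (rule wick_derivative_norm[OF R F h])
  have int: "integrable leb01 (\<lambda>s. complex_of_real (d j s * d k s) * C.moment h ?r j k)" if "j \<in> ?J" "k \<in> ?J" for j k
    by (intro integrable_mult_left integrable_of_real square_integrable_mult dsq that)
  have "complex_of_real (\<integral>s. ?V s \<partial>leb01) = (\<integral>s. (\<Sum>j\<in>?J. \<Sum>k\<in>?J. of_real (d j s * d k s) * C.moment h ?r j k) \<partial>leb01)"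
    unfolding V[symmetric] by (rule integral_complex_of_real[symmetric])
  also have "\<dots> = (\<Sum>j\<in>?J. (\<integral>s. (\<Sum>k\<in>?J. of_real (d j s * d k s) * C.moment h ?r j k) \<partial>leb01))"
    by (intro Bochner_Integration.integral_sum Bochner_Integration.integrable_sum int)
  also have "\<dots> = (\<Sum>j\<in>?J. \<Sum>k\<in>?J. (\<integral>s. of_real (d j s * d k s) * C.moment h ?r j k \<partial>leb01))"
    by (intro sum.cong refl Bochner_Integration.integral_sum int)
  also have "\<dots> = (\<Sum>j\<in>?J. \<Sum>k\<in>?J. of_real (inner01 (d j) (d k)) * C.moment h ?r j k)"
    by (simp only: integral_mult_left_zero integral_complex_of_real)
  finally have int_V: "complex_of_real (\<integral>s. ?V s \<partial>leb01) = \<dots>" .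
  have "(\<Sum>j\<in>?J. \<Sum>k\<in>?J. of_real (inner01 (d j) (d k) / 12) * C.moment h \<rho> j k) =
      (\<Sum>j\<in>?J. \<Sum>k\<in>?J. of_real (A\<^sup>2 / 12) * (of_real (inner01 (d j) (d k)) * C.moment h ?r j k))"
    unfolding \<rho>_def C.moment_cmult by (intro sum.cong refl) simp
  also have "\<dots> = complex_of_real (A\<^sup>2 / 12 * (\<integral>s. ?V s \<partial>leb01))"
    unfolding of_real_mult int_V by (simp only: sum_distrib_left)
  finally have "(\<Sum>j\<in>?J. \<Sum>k\<in>?J. of_real (inner01 (d j) (d k) / 12) * C.moment h \<rho> j k) = \<dots>" .
  with lim show ?thesis by (simp only: tendsto_of_real_iff)
qed

end

lemma wick_prod_upto_cong:
  "(\<And>i. i \<in> {1..m} \<Longrightarrow> Y i = Y' i) \<Longrightarrow> wick_prod_upto M W Y m = wick_prod_upto M W Y' m"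
  by (induction m) auto

text \<open>Allows overwriting index 0, reserved for the volatility, without changing the
  functional.\<close>

lemma wick_eval_cong:
  assumes "\<And>j. j \<in> {1..m} \<Longrightarrow> f j = f' j"
  shows "wick_eval M W m f F = wick_eval M W m f' F"
proof -
  have "wick_analytic M W m f a = wick_analytic M W m f' a" for a
    unfolding wick_analytic_def by (rule wick_prod_upto_cong) (simp add: assms)
  then show ?thesis by (simp add: wick_eval_def[abs_def])
qed

theorem theorem16:
  fixes M :: "'w measure" and W :: "real \<Rightarrow> 'w \<Rightarrow> real"
    and m :: nat
    and f f' :: "nat \<Rightarrow> real \<Rightarrow> real" and \<sigma> \<sigma>' a :: "real \<Rightarrow> real"
    and F :: wick_functional
    and X :: "real \<Rightarrow> 'w \<Rightarrow> real"
  assumes "brownian_space M W"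
    and "\<And>k. k \<in> {1..m} \<Longrightarrow> has_BV_derivative (f k) (f' k)"
    and "has_BV_derivative \<sigma> \<sigma>'"
    and "integrable lebesgue a"
    and "F \<in> lin_WA m"
    and "solves_skorohod_sde M W a \<sigma> (wick_eval M W m f F) X"
  shows "(\<lambda>n. (real n)\<^sup>2 * (\<integral>\<omega>. (X 1 \<omega> - optimal_approx M W n (X 1) \<omega>)\<^sup>2 \<partial>M))
    \<longlonglongrightarrow> exp (2 * (\<integral>s. a s \<partial>leb01)) / 12 *
      (\<integral>s. (\<integral>\<omega>. (wick_product M W
          (\<lambda>\<omega>. (\<Sum>k=1..m. f' k s * wick_eval M W m f (wick_partial k F) \<omega>)
                + \<sigma>' s * wick_eval M W m f F \<omega>)
          (wick_exp M W \<sigma>) \<omega>)\<^sup>2 \<partial>M) \<partial>leb01)"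
proof -
  interpret brownian_space M W by (rule assms(1))
  \<comment> \<open>The volatility is placed at index 0, so \<open>\<sigma>' F\<close> becomes the
    term of one more coordinate, with parameter constantly 1.\<close>
  define h d where "h = f(0 := \<sigma>)" and "d = f'(0 := \<sigma>')"
  have hf: "h j = f j" "d j = f' j" if "j \<in> {1..m}" for j using that by (auto simp: h_def d_def)
  have h0: "h 0 = \<sigma>" "d 0 = \<sigma>'" by (simp_all add: h_def d_def)
  have BV: "has_BV_derivative (h j) (d j)" if "j \<in> insert 0 {1..m}" for j
    using that assms(2,3) by (auto simp: h_def d_def)
  have der: "(h j has_real_derivative d j s) (at s within {0..1})" if "j \<in> insert 0 {1..m}" "s \<in> {0..1}" for j s
    using BV[OF that(1)] that(2) by (auto simp: has_BV_derivative_def)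
  \<comment> \<open>Here bounded variation of the derivatives is turned into continuity.\<close>
  have cont: "continuous_on {0..1} (d j)" if "j \<in> insert 0 {1..m}" for j
    using BV[OF that] by (intro bounded_variation_derivative_continuous[OF der[OF that]]) (auto simp: has_BV_derivative_def)
  obtain R where R: "R \<ge> 1" "functional_growth R m F" using lin_WA_growth[OF assms(5)] .
  have c\<sigma>: "continuous_on {0..1} \<sigma>" using DERIV_continuous_on[OF der[of 0]] by (simp add: h_def)
  obtain B where B: "\<And>s. s \<in> {0..1} \<Longrightarrow> \<bar>\<sigma> s\<bar> \<le> B"
    using continuous_square_integrable_leb01(2)[OF c\<sigma>] by blast
  have \<sigma>: "\<sigma> \<in> borel_measurable leb01"
    by (rule square_integrable_measurable[OF continuous_square_integrable_leb01(1)[OF c\<sigma>]])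
  have a: "integrable leb01 a" using integrable_mult_indicator[OF _ assms(4), of "{0..1}"] by (simp add: integrable_restrict_space)
  have "square_integrable leb01 (f j)" if "j \<in> {1..m}" for j
    using assms(2)[OF that] by (simp add: has_BV_derivative_def)
  then have "has_S M W (wick_eval M W m f F) (S_functional m f F)"
    by (rule has_S_wick_eval[OF _ R])
  note X1 = skorohod_sde_S_transform[OF assms(6) this a \<sigma> B]
  have "has_S M W (X 1) (\<lambda>g. exp (\<integral>s. a s \<partial>leb01) * (S_functional m h F g * exp (inner01 (h 0) g)))"
    using X1 by (simp only: S_functional_cong[of m h f, OF hf(1)] h0)
  note lim = optimal_approx_limit[OF R der cont this]
  have A: "(exp (\<integral>s. a s \<partial>leb01))\<^sup>2 = exp (2 * (\<integral>s. a s \<partial>leb01))"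
    by (simp add: exp_double)
  have "(\<Sum>k\<in>{1..m}. d k s * wick_eval M W m h (wick_partial k F) \<omega>) = (\<Sum>k\<in>{1..m}. f' k s * wick_eval M W m f (wick_partial k F) \<omega>)" for s \<omega>
    by (intro sum.cong refl) (simp only: hf wick_eval_cong[of m h f, OF hf(1)])
  with lim show ?thesis unfolding A by (simp only: h0 wick_eval_cong[of m h f, OF hf(1)])
qed

end
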